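(* Assume that $\mathbb M$ is positive semi-definite and that the operator $\mathscr D_M$ is $\mathbb C$-elliptic. Then for every bounded $C^2$ domain $\Omega\subset\mathbb R^n$ there is a constant $C$ such that $$\|u\|_{W^{1,2}(\Omega,F)}^2\le C\int_\Omega\big(|\mathscr Au(x)|^2+|\mathscr Bu(x)|^2+|u(x)|^2\big)\,dx$$ for all $u\in C^1(\overline\Omega,F)$ satisfying $\mathbb B(\nu(x))u(x)=0$ for all $x\in\partial\Omega$.
   Context: Let $E,F,G$ be finite-dimensional real or complex inner product spaces; in the complex case $\langle\cdot,\cdot\rangle$ denotes the real part of the complex inner product; on linear maps $\langle X,Y\rangle:=\mathrm{Re}\,\mathrm{tr}(X^*Y)$. Let $A_1,\dots,A_n\in\mathcal L(F,G)$, $B_1,\dots,B_n\in\mathcal L(F,E)$, $\mathscr A=\sum_jA_j\partial_j$, $\mathscr B=\sum_jB_j\partial_j$, with symbols $\mathbb A(\xi)=\sum_j\xi_jA_j$, $\mathbb B(\xi)=\sum_j\xi_jB_j$. Define $M_{ij}:=A_i^*A_j+B_j^*B_i$ and the self-adjoint map $\mathbb M$ on $\mathcal L(\mathbb R^n,F)$ by $(\mathbb MX)(e_i)=\sum_jM_{ij}X(e_j)$; positive semi-definite means $\langle X,\mathbb MX\rangle\ge0$ for all $X$. Then $\mathscr D_M u(x):=\sqrt{\mathbb M}(Du(x))$, where $Du(x)\in\mathcal L(\mathbb R^n,F)$ is the Jacobian; its symbol is $\mathbb D_M(\xi)u=\sqrt{\mathbb M}(u\otimes\xi)$ with $(u\otimes\xi)(e_j)=\xi_ju$.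 $\mathscr D_M$ is $\mathbb C$-elliptic if, after complexifying $F$ and extending $\sqrt{\mathbb M}$ complex-linearly, $\mathbb D_M(\zeta)$ is injective for every $\zeta\in\mathbb C^n\setminus\{0\}$. $\nu$ is the outward unit normal of $\Omega$. *)

theory Defs
  imports "HOL-Analysis.Analysis"
begin

text \<open>Euclidean space R^n is real^'n; a linear map X in L(R^n,F) is identified with
  the vector of its values (X(e_1),...,X(e_n)) :: 'f^'n. The Euclidean inner product on
  'f^'n is then exactly Re tr(X^* Y).\<close>

definition Mmap :: "('n::finite \<Rightarrow> 'f::euclidean_space \<Rightarrow> 'g::euclidean_space)
   \<Rightarrow> ('n \<Rightarrow> 'f \<Rightarrow> 'e::euclidean_space) \<Rightarrow> 'f^'n \<Rightarrow> 'f^'n" where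
  "Mmap A B X = (\<chi> i. \<Sum>j\<in>UNIV. adjoint (A i) (A j (X $ j)) + adjoint (B j) (B i (X $ j)))"

definition psd_map :: "('v::real_inner \<Rightarrow> 'v) \<Rightarrow> bool" where
  "psd_map T \<longleftrightarrow> (\<forall>X. X \<bullet> T X \<ge> 0)"

definition self_adjoint_map :: "('v::real_inner \<Rightarrow> 'v) \<Rightarrow> bool" where
  "self_adjoint_map T \<longleftrightarrow> (\<forall>X Y. T X \<bullet> Y = X \<bullet> T Y)"

definition psd_sqrt :: "('v::real_inner \<Rightarrow> 'v) \<Rightarrow> 'v \<Rightarrow> 'v" where
  "psd_sqrt T = (THE S. linear S \<and> self_adjoint_map S \<and> psd_map S \<and> S \<circ> S = T)"

definition tensor :: "'f::real_vector \<Rightarrow> real^'n \<Rightarrow> 'f^'n" where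
  "tensor u \<xi> = (\<chi> j. (\<xi> $ j) *\<^sub>R u)"

text \<open>C-ellipticity of D_M, with the complexification written out:
  u = v + i w in F_C, \<zeta> = \<xi> + i \<eta> in C^n, and
  u \<otimes> \<zeta> = (v\<otimes>\<xi> - w\<otimes>\<eta>) + i (v\<otimes>\<eta> + w\<otimes>\<xi>); sqrt M acts componentwise.\<close>
definition C_elliptic_DM :: "('n::finite \<Rightarrow> 'f::euclidean_space \<Rightarrow> 'g::euclidean_space)
   \<Rightarrow> ('n \<Rightarrow> 'f \<Rightarrow> 'e::euclidean_space) \<Rightarrow> bool" where
  "C_elliptic_DM A B \<longleftrightarrow>
     (\<forall>(\<xi>::real^'n) \<eta> (v::'f) w. (\<xi> \<noteq> 0 \<or> \<eta> \<noteq> 0) \<longrightarrow>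
        psd_sqrt (Mmap A B) (tensor v \<xi> - tensor w \<eta>) = 0 \<longrightarrow>
        psd_sqrt (Mmap A B) (tensor v \<eta> + tensor w \<xi>) = 0 \<longrightarrow>
        v = 0 \<and> w = 0)"

definition C2_on :: "(real^'n::finite) set \<Rightarrow> (real^'n \<Rightarrow> real)
   \<Rightarrow> (real^'n \<Rightarrow> ((real^'n) \<Rightarrow>\<^sub>L real)) \<Rightarrow> (real^'n \<Rightarrow> ((real^'n) \<Rightarrow>\<^sub>L ((real^'n) \<Rightarrow>\<^sub>L real))) \<Rightarrow> bool" where
  "C2_on U \<rho> \<rho>' \<rho>'' \<longleftrightarrow>
     (\<forall>y\<in>U. (\<rho> has_derivative blinfun_apply (\<rho>' y)) (at y)
           \<and> (\<rho>' has_derivative blinfun_apply (\<rho>'' y)) (at y))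
     \<and> continuous_on U \<rho>''"

definition grad :: "((real^'n::finite) \<Rightarrow>\<^sub>L real) \<Rightarrow> real^'n" where
  "grad L = (\<chi> j. L (axis j 1))"

definition local_defining_fun :: "(real^'n::finite) set \<Rightarrow> real^'n \<Rightarrow> (real^'n) set
   \<Rightarrow> (real^'n \<Rightarrow> real) \<Rightarrow> (real^'n \<Rightarrow> ((real^'n) \<Rightarrow>\<^sub>L real)) \<Rightarrow> bool" where
  "local_defining_fun \<Omega> p U \<rho> \<rho>' \<longleftrightarrow> open U \<and> p \<in> U \<and>
     (\<exists>\<rho>''. C2_on U \<rho> \<rho>' \<rho>'') \<and> (\<forall>y\<in>U. \<rho>' y \<noteq> 0) \<and>
     \<Omega> \<inter> U = {y\<in>U. \<rho> y < 0}"

definition C2_domain :: "(real^'n::finite) set \<Rightarrow> bool" where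
  "C2_domain \<Omega> \<longleftrightarrow> open \<Omega> \<and>
     (\<forall>p\<in>frontier \<Omega>. \<exists>U \<rho> \<rho>'. local_defining_fun \<Omega> p U \<rho> \<rho>')"

definition outward_normal :: "(real^'n::finite) set \<Rightarrow> real^'n \<Rightarrow> real^'n \<Rightarrow> bool" where
  "outward_normal \<Omega> p \<nu> \<longleftrightarrow> p \<in> frontier \<Omega> \<and>
     (\<exists>U \<rho> \<rho>'. local_defining_fun \<Omega> p U \<rho> \<rho>' \<and> \<nu> = grad (\<rho>' p) /\<^sub>R norm (grad (\<rho>' p)))"

definition C1_closure :: "(real^'n::finite) set \<Rightarrow> (real^'n \<Rightarrow> 'f::real_normed_vector)
   \<Rightarrow> (real^'n \<Rightarrow> ((real^'n) \<Rightarrow>\<^sub>L 'f)) \<Rightarrow> bool" where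
  "C1_closure \<Omega> u Du \<longleftrightarrow> continuous_on (closure \<Omega>) u \<and> continuous_on (closure \<Omega>) Du \<and>
     (\<forall>x\<in>\<Omega>. (u has_derivative blinfun_apply (Du x)) (at x))"

definition diffop :: "('n::finite \<Rightarrow> 'f \<Rightarrow> 'g::real_vector) \<Rightarrow> ((real^'n) \<Rightarrow>\<^sub>L 'f::real_normed_vector) \<Rightarrow> 'g" where
  "diffop A L = (\<Sum>j\<in>UNIV. A j (L (axis j 1)))"

definition symb :: "('n::finite \<Rightarrow> 'f \<Rightarrow> 'g::real_vector) \<Rightarrow> real^'n \<Rightarrow> 'f \<Rightarrow> 'g" where
  "symb A \<xi> u = (\<Sum>j\<in>UNIV. (\<xi> $ j) *\<^sub>R A j u)"

definition W12_norm_sq :: "(real^'n::finite) set \<Rightarrow> (real^'n \<Rightarrow> 'f::real_normed_vector)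
   \<Rightarrow> (real^'n \<Rightarrow> ((real^'n) \<Rightarrow>\<^sub>L 'f)) \<Rightarrow> real" where
  "W12_norm_sq \<Omega> u Du = integral \<Omega> (\<lambda>x. (norm (u x))\<^sup>2 + (\<Sum>j\<in>UNIV. (norm (Du x (axis j 1)))\<^sup>2))"

end

theory Submission
  imports Defs "HOL-Computational_Algebra.Fundamental_Theorem_Algebra"
begin

text \<open>
  Pointwise \<open>|D\<^sub>M u|\<^sup>2 = |A u|\<^sup>2 + |B u|\<^sup>2 + Q(Du)\<close>, where \<open>Q\<close> is a sum of null Lagrangians
  \<open>tr (DV)\<^sup>2 - (div V)\<^sup>2\<close> of the vector fields \<open>V\<^sub>j = \<langle>B\<^sub>j u, c\<rangle>\<close>, \<open>c\<close> running through a basis of \<open>E\<close>.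
  The boundary condition makes each \<open>V\<close> tangential, so \<open>\<integral> Q\<close> is a curvature integral over the
  boundary and is at most \<open>C \<integral> |u| |Du| + |u|\<^sup>2\<close>. It remains to prove the Korn inequality
  \<open>\<parallel>Du\<parallel> \<le> C \<parallel>D\<^sub>M u\<parallel>\<close> for \<open>u\<close> supported near a point. After flattening the boundary and freezing
  coefficients one is on a half-space. A discrete Fourier transform of tangential forward
  differences turns the operator into an ordinary differential expression \<open>L\<^sub>0 z' + N z\<close> in the
  normal variable, whose pencil is injective at every complex number by \<open>\<complex>\<close>-ellipticity. Such a
  pencil is observable, hence admits a quadratic form \<open>b \<ge> 0\<close> with
  \<open>|z|\<^sup>2 + |z'|\<^sup>2 + 2 b(z, z') \<le> C |L\<^sub>0 z' + N z|\<^sup>2\<close>; here \<open>2 b(z, z')\<close> is the normal derivative of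
  \<open>b(z, z)\<close>, so its integral over the half-space is nonnegative and can be dropped.
\<close>

section \<open>Square roots of positive semi-definite maps\<close>

text \<open>Regularity shapes the details. Fields are only C^1 up to the boundary, and no surface
  measure or trace is used: every integration by parts is a limit of integrals of difference
  quotients, and boundary integrals appear as volume integrals against derivatives of a cutoff in
  \<rho>. The cutoff depends on \<epsilon>/|\<rho>| alone, so the error terms stay bounded once the
  normal component is O(|\<rho>|). The discrete transform is chosen because its Parseval identity is
  finite algebra. The price is that a forward difference has the symbol (exp(i t) - 1)/h, which is
  not purely imaginary, so tangential covectors take general complex values; the ellipticity
  hypothesis covers all of these. Homogeneity and compactness make the constant uniform in the
  frequency, hence independent of the step h. The boundary condition enters only through the null
  Lagrangian; the Korn inequality holds for fields that jump to zero across the boundary. Interior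
  points are treated as boundary points with an artificial defining function, so one local estimate
  covers the whole closure.\<close>

lemma psd_form_null_vector:
  fixes S :: "'v::real_inner \<Rightarrow> 'v"
  assumes lin: "linear S" and V: "subspace V" and inv: "\<And>v. v \<in> V \<Longrightarrow> S v \<in> V"
    and sa: "\<And>u v. S u \<bullet> v = u \<bullet> S v" and pos: "\<And>v. v \<in> V \<Longrightarrow> 0 \<le> v \<bullet> S v"
    and x: "x \<in> V" "x \<bullet> S x = 0"
  shows "S x = 0"
proof -
  define a where "a = S x \<bullet> S x"
  define q where "q = S x \<bullet> S (S x)"
  have q0: "0 \<le> q" unfolding q_def using inv x(1) pos by blast
  have a0: "0 \<le> a" unfolding a_def by simp
  \<comment> \<open>Positivity of the form at x - t S x. As t tends to 0 the linear term dominates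
    and forces a = 0.\<close>
  have key: "2 * t * a \<le> t * t * q" for t
  proof -
    have "x - t *\<^sub>R S x \<in> V" using x inv V by (simp add: subspace_diff subspace_scale)
    from pos[OF this] have "0 \<le> (x - t *\<^sub>R S x) \<bullet> (S x - t *\<^sub>R S (S x))"
      by (simp add: linear_diff[OF lin] linear_scale[OF lin])
    also have "\<dots> = - 2 * t * a + t * t * q"
      using x(2) sa[of x "S x"] unfolding a_def q_def by (simp add: inner_diff_left inner_diff_right inner_commute algebra_simps)
    finally show ?thesis by simp
  qed
  have "a \<le> 0"
  proof (rule ccontr)
    assume "\<not> a \<le> 0" then have ap: "a > 0" by simp
    define t where "t = a / (q + 1)"
    have t: "t > 0" using ap q0 unfolding t_def by simp
    have "2 * a \<le> t * q" using key[of t] t by (simp add: mult.assoc)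
    also have "t * q \<le> a" using ap q0 unfolding t_def by (simp add: field_simps)
    finally show False using ap by simp
  qed
  then have "S x \<bullet> S x = 0" using a0 unfolding a_def by simp
  then show ?thesis by simp
qed

text \<open>A maximiser x of v . T v on the unit sphere of V works: with c the maximum, c - T is
  positive semi-definite on V and x is a null vector of its form. The invariant subspace V allows
  the lemma to be applied to orthogonal complements.\<close>

lemma self_adjoint_eigenvector:
  fixes T :: "'v::euclidean_space \<Rightarrow> 'v"
  assumes lin: "linear T" and V: "subspace V" and inv: "\<And>v. v \<in> V \<Longrightarrow> T v \<in> V"
    and sa: "\<And>u v. T u \<bullet> v = u \<bullet> T v" and ne: "z \<in> V" "z \<noteq> 0"
  shows "\<exists>x\<in>V. norm x = 1 \<and> (\<exists>c. T x = c *\<^sub>R x \<and> (\<forall>v\<in>V. v \<bullet> T v \<le> c * (v \<bullet> v)))"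
proof -
  define K where "K = V \<inter> sphere 0 1"
  have K: "compact K" unfolding K_def using closed_subspace[OF V] by (simp add: closed_Int_compact)
  have "z /\<^sub>R norm z \<in> K" using ne V unfolding K_def by (simp add: subspace_scale)
  then have K0: "K \<noteq> {}" by blast
  have "continuous_on K (\<lambda>v. v \<bullet> T v)"
    by (intro continuous_intros linear_continuous_on linear_conv_bounded_linear[THEN iffD1] lin)
  from continuous_attains_sup[OF K K0 this] obtain x where x: "x \<in> K" "\<And>y. y \<in> K \<Longrightarrow> y \<bullet> T y \<le> x \<bullet> T x" by blast
  define c where "c = x \<bullet> T x"
  have xV: "x \<in> V" and xn: "norm x = 1" using x(1) unfolding K_def by auto
  have bound: "v \<bullet> T v \<le> c * (v \<bullet> v)" if v: "v \<in> V" for v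
  proof (cases "v = 0")
    case True then show ?thesis by (simp add: linear_0[OF lin])
  next
    case False
    have "v /\<^sub>R norm v \<in> K" using False v V unfolding K_def by (simp add: subspace_scale)
    from x(2)[OF this] have "(v \<bullet> T v) / (norm v)\<^sup>2 \<le> c" unfolding c_def
      by (simp add: linear_scale[OF lin] power2_eq_square divide_inverse ac_simps)
    then show ?thesis using False by (simp add: divide_le_eq power2_norm_eq_inner)
  qed
  define S where "S = (\<lambda>v. c *\<^sub>R v - T v)"
  have "S x = 0"
  proof (rule psd_form_null_vector[of S V])
    show "linear S" unfolding S_def using lin
      by (intro linear_compose_sub linear_scale_self) auto
    show "S v \<in> V" if "v \<in> V" for v using that inv V unfolding S_def by (simp add: subspace_diff subspace_scale)
    show "S u \<bullet> v = u \<bullet> S v" for u v unfolding S_def by (simp add: inner_diff_left inner_diff_right sa)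
    show "0 \<le> v \<bullet> S v" if "v \<in> V" for v using bound[OF that] unfolding S_def by (simp add: inner_diff_right)
    show "x \<bullet> S x = 0" using xn unfolding S_def by (simp add: inner_diff_right c_def norm_eq_1)
  qed (use V xV in auto)
  then have "T x = c *\<^sub>R x" unfolding S_def by simp
  then show ?thesis using xV xn bound by blast
qed

text \<open>A maximal orthonormal set of eigenvectors spans: its orthogonal complement is invariant,
  so a nonzero vector there would yield one more eigenvector. Maximality is by cardinality, which
  the dimension bounds.\<close>

lemma self_adjoint_eigenbasis:
  fixes T :: "'v::euclidean_space \<Rightarrow> 'v"
  assumes lin: "linear T" and sa: "\<And>u v. T u \<bullet> v = u \<bullet> T v"
  obtains Q where "finite Q" "pairwise orthogonal Q" "\<And>b. b \<in> Q \<Longrightarrow> norm b = 1"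
    "\<And>b. b \<in> Q \<Longrightarrow> \<exists>c. T b = c *\<^sub>R b" "\<And>x. x = (\<Sum>b\<in>Q. (x \<bullet> b) *\<^sub>R b)"
proof -
  define P where "P Q \<longleftrightarrow> pairwise orthogonal Q \<and> (\<forall>b\<in>Q. norm b = 1 \<and> (\<exists>c. T b = c *\<^sub>R b))" for Q
  have fin: "finite Q \<and> card Q \<le> DIM('v)" if "P Q" for Q
  proof -
    have "independent Q" by (rule pairwise_orthogonal_independent) (use that in \<open>auto simp: P_def\<close>)
    then show ?thesis by (simp add: independent_bound)
  qed
  have "P {}" unfolding P_def by simp
  then obtain Q where Q: "P Q" and mx: "\<And>Q'. P Q' \<Longrightarrow> card Q' \<le> card Q"
    using ex_has_greatest_nat[of P "{}" card "DIM('v) + 1"] fin by (metis le_imp_less_Suc Suc_eq_plus1)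
  define V where "V = {v. \<forall>b\<in>Q. v \<bullet> b = 0}"
  have V: "subspace V" unfolding V_def by (auto simp: subspace_def inner_add_left)
  have inv: "T v \<in> V" if "v \<in> V" for v
  proof -
    have "T v \<bullet> b = 0" if b: "b \<in> Q" for b
    proof -
      obtain c where "T b = c *\<^sub>R b" using Q b unfolding P_def by blast
      then show ?thesis using \<open>v \<in> V\<close> b unfolding V_def by (simp add: sa)
    qed
    then show ?thesis unfolding V_def by simp
  qed
  have V0: "v = 0" if v: "v \<in> V" for v
  proof (rule ccontr)
    assume "v \<noteq> 0"
    from self_adjoint_eigenvector[OF lin V inv sa v this] obtain x c where x: "x \<in> V" "norm x = 1" "T x = c *\<^sub>R x" by blast
    have "x \<notin> Q" using x unfolding V_def by (auto simp: norm_eq_1)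
    moreover have "P (insert x Q)"
      using Q x unfolding P_def V_def pairwise_insert by (auto simp: orthogonal_def inner_commute)
    ultimately show False using mx[of "insert x Q"] fin[OF Q] by simp
  qed
  have exp: "x = (\<Sum>b\<in>Q. (x \<bullet> b) *\<^sub>R b)" for x
  proof -
    have "x - (\<Sum>b\<in>Q. (x \<bullet> b) *\<^sub>R b) \<in> V"
    proof -
      have "(\<Sum>b\<in>Q. (x \<bullet> b) *\<^sub>R b) \<bullet> d = x \<bullet> d" if d: "d \<in> Q" for d
      proof -
        have "(\<Sum>b\<in>Q. (x \<bullet> b) *\<^sub>R b) \<bullet> d = (\<Sum>b\<in>Q. if b = d then x \<bullet> d else 0)"
          unfolding inner_sum_left
        proof (rule sum.cong, simp)
          fix b assume b: "b \<in> Q"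
          show "(x \<bullet> b) *\<^sub>R b \<bullet> d = (if b = d then x \<bullet> d else 0)"
            using Q b d unfolding P_def pairwise_def orthogonal_def by (auto simp: norm_eq_1)
        qed
        also have "\<dots> = x \<bullet> d" using d fin[OF Q] by simp
        finally show ?thesis .
      qed
      then show ?thesis unfolding V_def by (simp add: inner_diff_left)
    qed
    from V0[OF this] show ?thesis by simp
  qed
  show ?thesis
    by (rule that[of Q]) (use Q fin exp in \<open>auto simp: P_def\<close>)
qed

lemma psd_sqrt_exists:
  fixes T :: "'v::euclidean_space \<Rightarrow> 'v"
  assumes lin: "linear T" and sa: "self_adjoint_map T" and psd: "psd_map T"
  shows "\<exists>S. linear S \<and> self_adjoint_map S \<and> psd_map S \<and> S \<circ> S = T"
proof -
  from self_adjoint_eigenbasis[OF lin] sa obtain Q where Q: "finite Q" "pairwise orthogonal Q" "\<And>b. b \<in> Q \<Longrightarrow> norm b = 1"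
    "\<And>b. b \<in> Q \<Longrightarrow> \<exists>c. T b = c *\<^sub>R b" and exp: "\<And>x. x = (\<Sum>b\<in>Q. (x \<bullet> b) *\<^sub>R b)"
    unfolding self_adjoint_map_def by metis
  obtain c where c: "\<And>b. b \<in> Q \<Longrightarrow> T b = c b *\<^sub>R b" using Q(4) by metis
  have c0: "0 \<le> c b" if "b \<in> Q" for b
    using psd c[OF that] Q(3)[OF that] unfolding psd_map_def by (metis inner_scaleR_right mult.right_neutral norm_eq_1)
  define S where "S = (\<lambda>x. \<Sum>b\<in>Q. (sqrt (c b) * (x \<bullet> b)) *\<^sub>R b)"
  have linS: "linear S" unfolding S_def
    by (rule linearI) (simp_all add: inner_add_left distrib_left scaleR_add_left sum.distrib scaleR_sum_right mult.left_commute)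
  have Sin: "S x \<bullet> y = (\<Sum>b\<in>Q. sqrt (c b) * (x \<bullet> b) * (y \<bullet> b))" for x y
    unfolding S_def inner_sum_left by (simp add: inner_commute)
  have Sb: "S b = sqrt (c b) *\<^sub>R b" if b: "b \<in> Q" for b
  proof -
    have "S b = (\<Sum>d\<in>Q. if d = b then sqrt (c b) *\<^sub>R b else 0)" unfolding S_def
      by (rule sum.cong) (use Q b in \<open>auto simp: pairwise_def orthogonal_def norm_eq_1\<close>)
    then show ?thesis using b Q(1) by simp
  qed
  have SS: "S (S x) = T x" for x
  proof -
    have "S (S x) = (\<Sum>b\<in>Q. (sqrt (c b) * (x \<bullet> b)) *\<^sub>R S b)"
      by (subst (2) S_def) (simp add: linear_sum[OF linS] linear_scale[OF linS])
    also have "\<dots> = (\<Sum>b\<in>Q. (x \<bullet> b) *\<^sub>R T b)"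
      by (rule sum.cong) (use c0 in \<open>auto simp: Sb c ac_simps\<close>)
    also have "\<dots> = T (\<Sum>b\<in>Q. (x \<bullet> b) *\<^sub>R b)" by (simp add: linear_sum[OF lin] linear_scale[OF lin])
    also have "\<dots> = T x" by (rule arg_cong[OF exp[of x], of T, symmetric])
    finally show ?thesis .
  qed
  have "self_adjoint_map S" unfolding self_adjoint_map_def
    by (simp add: Sin inner_commute[of _ "S _"] mult.commute mult.left_commute)
  moreover have "psd_map S" unfolding psd_map_def
    by (auto simp: inner_commute[of _ "S _"] Sin mult.assoc intro!: sum_nonneg mult_nonneg_nonneg[OF _ zero_le_square] c0)
  moreover have "S \<circ> S = T" using SS by auto
  ultimately show ?thesis using linS by blast
qed

text \<open>The difference D = S - R satisfies S D + D R = S S - R R = 0. Tested with an eigenvector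
  b of D with eigenvalue c this gives c (b . S b + b . R b) = 0, so either c = 0 or both nonnegative
  terms vanish; in both cases D b = 0.\<close>

lemma psd_sqrt_unique:
  fixes T :: "'v::euclidean_space \<Rightarrow> 'v"
  assumes 1: "linear S" "self_adjoint_map S" "psd_map S" "S \<circ> S = T"
    and 2: "linear R" "self_adjoint_map R" "psd_map R" "R \<circ> R = T"
  shows "S = R"
proof -
  define D where "D = (\<lambda>x. S x - R x)"
  have lin: "linear D" unfolding D_def using 1 2 by (intro linear_compose_sub)
  have sa: "D u \<bullet> v = u \<bullet> D v" for u v
    using 1 2 unfolding D_def self_adjoint_map_def by (simp add: inner_diff_left inner_diff_right)
  from self_adjoint_eigenbasis[OF lin sa] obtain Q where Q: "finite Q" "\<And>b. b \<in> Q \<Longrightarrow> norm b = 1"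
    "\<And>b. b \<in> Q \<Longrightarrow> \<exists>c. D b = c *\<^sub>R b" and exp: "\<And>x. x = (\<Sum>b\<in>Q. (x \<bullet> b) *\<^sub>R b)" by metis
  have Db: "D b = 0" if b: "b \<in> Q" for b
  proof -
    obtain c where c: "D b = c *\<^sub>R b" using Q(3)[OF b] by blast
    have "S (D b) + D (R b) = 0" unfolding D_def using 1(4) 2(4)
      by (simp add: linear_diff[OF 1(1)] fun_eq_iff)
    then have "0 = b \<bullet> S (D b) + b \<bullet> D (R b)" by (metis inner_add_right inner_zero_right)
    also have "\<dots> = c * (b \<bullet> S b) + c * (b \<bullet> R b)"
      using sa[of b "R b"] c by (simp add: linear_scale[OF 1(1)])
    finally have z: "c * (b \<bullet> S b + b \<bullet> R b) = 0" by (simp add: algebra_simps)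
    show ?thesis
    proof (cases "c = 0")
      case False
      then have "b \<bullet> S b + b \<bullet> R b = 0" using z by simp
      then have "b \<bullet> S b = 0" "b \<bullet> R b = 0" using 1(3) 2(3) unfolding psd_map_def by (metis add_nonneg_eq_0_iff)+
      then have "b \<bullet> D b = 0" unfolding D_def by (simp add: inner_diff_right)
      then show ?thesis using c Q(2)[OF b] by (simp add: norm_eq_1)
    qed (use c in simp)
  qed
  have "D x = 0" for x
  proof -
    have "D x = D (\<Sum>b\<in>Q. (x \<bullet> b) *\<^sub>R b)" by (rule arg_cong[OF exp[of x]])
    also have "\<dots> = 0" by (simp add: linear_sum[OF lin] linear_scale[OF lin] Db)
    finally show ?thesis .
  qed
  then show ?thesis unfolding D_def by (auto simp: fun_eq_iff)
qed

text \<open>Existence and uniqueness give the definite description in \<open>psd_sqrt\<close> a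
  meaning. These two facts are all that is used of the root later.\<close>

lemma psd_sqrt_properties:
  fixes T :: "'v::euclidean_space \<Rightarrow> 'v"
  assumes "linear T" "self_adjoint_map T" "psd_map T"
  shows "linear (psd_sqrt T)" and "(norm (psd_sqrt T x))\<^sup>2 = x \<bullet> T x"
proof -
  have "\<exists>!S. linear S \<and> self_adjoint_map S \<and> psd_map S \<and> S \<circ> S = T"
    using psd_sqrt_exists[OF assms] psd_sqrt_unique by blast
  from theI'[OF this] have *: "linear (psd_sqrt T)" "self_adjoint_map (psd_sqrt T)" "psd_sqrt T \<circ> psd_sqrt T = T"
    unfolding psd_sqrt_def by auto
  show "linear (psd_sqrt T)" by fact
  show "(norm (psd_sqrt T x))\<^sup>2 = x \<bullet> T x"
    using * unfolding self_adjoint_map_def by (metis comp_apply power2_norm_eq_inner)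
qed

section \<open>The quadratic form of \<open>Mmap\<close>\<close>

lemma inner_Mmap:
  fixes A :: "'n::finite \<Rightarrow> 'f::euclidean_space \<Rightarrow> 'g::euclidean_space" and B :: "'n \<Rightarrow> 'f \<Rightarrow> 'e::euclidean_space"
  assumes "\<And>j. linear (A j)" "\<And>j. linear (B j)"
  shows "X \<bullet> Mmap A B Y = (\<Sum>i\<in>UNIV. \<Sum>j\<in>UNIV. A i (X $ i) \<bullet> A j (Y $ j) + B j (X $ i) \<bullet> B i (Y $ j))"
  unfolding inner_vec_def Mmap_def
  by (simp add: inner_sum_right inner_add_right adjoint_works assms)

lemma linear_Mmap:
  fixes A :: "'n::finite \<Rightarrow> 'f::euclidean_space \<Rightarrow> 'g::euclidean_space" and B :: "'n \<Rightarrow> 'f \<Rightarrow> 'e::euclidean_space"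
  assumes "\<And>j. linear (A j)" "\<And>j. linear (B j)"
  shows "linear (Mmap A B)"
proof -
  have a: "linear (adjoint (A i))" "linear (adjoint (B i))" for i using assms by (simp_all add: adjoint_linear)
  show ?thesis
    by (rule linearI) (simp_all add: Mmap_def vec_eq_iff linear_add[OF assms(1)] linear_add[OF assms(2)] linear_add[OF a(1)] linear_add[OF a(2)]
        linear_scale[OF assms(1)] linear_scale[OF assms(2)] linear_scale[OF a(1)] linear_scale[OF a(2)] sum.distrib scaleR_sum_right scaleR_add_right)
qed

lemma self_adjoint_Mmap:
  fixes A :: "'n::finite \<Rightarrow> 'f::euclidean_space \<Rightarrow> 'g::euclidean_space" and B :: "'n \<Rightarrow> 'f \<Rightarrow> 'e::euclidean_space"
  assumes "\<And>j. linear (A j)" "\<And>j. linear (B j)"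
  shows "self_adjoint_map (Mmap A B)"
  unfolding self_adjoint_map_def
proof (intro allI)
  fix X Y
  have "Y \<bullet> Mmap A B X = (\<Sum>j\<in>UNIV. \<Sum>i\<in>UNIV. A i (Y $ i) \<bullet> A j (X $ j) + B j (Y $ i) \<bullet> B i (X $ j))"
    unfolding inner_Mmap[OF assms] by (rule sum.swap)
  also have "\<dots> = X \<bullet> Mmap A B Y" unfolding inner_Mmap[OF assms] by (simp add: inner_commute)
  finally show "Mmap A B X \<bullet> Y = X \<bullet> Mmap A B Y" by (simp add: inner_commute)
qed

section \<open>Eigenvectors of maps commuting with a complex structure\<close>

text \<open>More iterates than the dimension are linearly dependent. If two of them coincide,
  dependence of the set of iterates says nothing, and a relation is written down directly.\<close>

lemma real_relation_of_iterates:
  fixes E :: "'z::euclidean_space \<Rightarrow> 'z"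
  shows "\<exists>a::nat \<Rightarrow> real. (\<exists>i\<le>DIM('z). a i \<noteq> 0) \<and> (\<Sum>i\<le>DIM('z). a i *\<^sub>R (E ^^ i) z) = 0"
proof (cases "inj_on (\<lambda>i. (E ^^ i) z) {..DIM('z)}")
  case True
  define V where "V = (\<lambda>i. (E ^^ i) z) ` {..DIM('z)}"
  have "card V = DIM('z) + 1" unfolding V_def using True by (simp add: card_image)
  then have "dependent V" by (intro dependent_biggerset) simp
  moreover have "finite V" unfolding V_def by simp
  ultimately obtain u where u: "\<exists>v\<in>V. u v \<noteq> 0" "(\<Sum>v\<in>V. u v *\<^sub>R v) = 0"
    using dependent_finite by blast
  have "(\<Sum>i\<le>DIM('z). u ((E ^^ i) z) *\<^sub>R (E ^^ i) z) = 0"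
    using u(2) unfolding V_def by (subst (asm) sum.reindex[OF True]) simp
  then show ?thesis using u(1) unfolding V_def by (intro exI[of _ "\<lambda>i. u ((E ^^ i) z)"]) auto
next
  case False
  then obtain i j where ij: "i \<le> DIM('z)" "j \<le> DIM('z)" "i \<noteq> j" "(E ^^ i) z = (E ^^ j) z" unfolding inj_on_def by auto
  have "(\<Sum>l\<le>DIM('z). (if l = i then 1 else if l = j then -1 else 0) *\<^sub>R (E ^^ l) z)
     = (\<Sum>l\<le>DIM('z). (if l = i then (E ^^ i) z else 0) - (if l = j then (E ^^ j) z else 0))"
    by (rule sum.cong) (use ij in auto)
  also have "\<dots> = 0" using ij by (simp add: sum_subtractf)
  finally show ?thesis using ij
    by (intro exI[of _ "\<lambda>l. if l = i then 1 else if l = j then -1 else 0"]) auto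
qed

text \<open>J makes the space complex, with \<open>cs c z\<close> as multiplication by c, and E is
  complex linear. A polynomial in E that annihilates z0 splits into linear factors; applied one
  after the other they produce a last nonzero vector, which is an eigenvector and lies in W by
  invariance.\<close>

lemma complex_structure_eigenvector:
  fixes E J :: "'z::euclidean_space \<Rightarrow> 'z"
  assumes E: "linear E" and J: "linear J" and JJ: "\<And>z. J (J z) = - z" and EJ: "\<And>z. E (J z) = J (E z)"
    and W: "subspace W" and WE: "\<And>z. z \<in> W \<Longrightarrow> E z \<in> W" and WJ: "\<And>z. z \<in> W \<Longrightarrow> J z \<in> W"
    and z0: "z0 \<in> W" "z0 \<noteq> 0"
  shows "\<exists>z s t. z \<in> W \<and> z \<noteq> 0 \<and> E z = s *\<^sub>R z + t *\<^sub>R J z"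
proof -
  define N where "N = DIM('z)"
  define cs where "cs c z = Re c *\<^sub>R z + Im c *\<^sub>R J z" for c z
  have cs_cs: "cs a (cs b z) = cs (a * b) z" for a b z
    unfolding cs_def by (simp add: linear_add[OF J] linear_scale[OF J] JJ algebra_simps)
  have cs_add: "cs a (u + v) = cs a u + cs a v" for a u v
    unfolding cs_def by (simp add: linear_add[OF J] algebra_simps)
  have cs_add2: "cs (a + b) v = cs a v + cs b v" for a b v
    unfolding cs_def by (simp add: algebra_simps)
  have cs_diff: "cs a (u - v) = cs a u - cs a v" for a u v
    unfolding cs_def by (simp add: linear_diff[OF J] algebra_simps)
  have cs1: "cs 1 z = z" and cs0: "cs 0 z = 0" "cs a 0 = 0" for z a unfolding cs_def by (simp_all add: linear_0[OF J])
  have cs_sum: "cs a (sum f I) = (\<Sum>i\<in>I. cs a (f i))" for a I and f :: "nat \<Rightarrow> 'z"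
    by (induction I rule: infinite_finite_induct) (auto simp: cs0 cs_add)
  have Ecs: "E (cs a z) = cs a (E z)" for a z
    unfolding cs_def by (simp add: linear_add[OF E] linear_scale[OF E] EJ)
  have Eics: "(E ^^ i) (cs a z) = cs a ((E ^^ i) z)" for i a z
    by (induction i) (auto simp: Ecs)
  have Eidiff: "(E ^^ i) (u - v) = (E ^^ i) u - (E ^^ i) v" for i u v
    by (induction i) (auto simp: linear_diff[OF E])
  \<comment> \<open>The polynomial p evaluated at E. Cutting the sum at N loses nothing for
    polynomials of degree at most N, the only ones that occur.\<close>
  define act where "act p z = (\<Sum>i\<le>N. cs (coeff p i) ((E ^^ i) z))" for p z
  have act_cs: "act p (cs a z) = cs a (act p z)" for p a z
    unfolding act_def by (simp add: Eics cs_cs cs_sum mult.commute)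
  have act_diff: "act p (u - v) = act p u - act p v" for p u v
    unfolding act_def by (simp add: Eidiff cs_diff sum_subtractf)
  have act_factor: "act ([:-c, 1:] * q) z = act q (E z - cs c z)" if dq: "degree q < N" for c q z
  proof -
    obtain M where M: "N = Suc M" using dq by (cases N) auto
    have q0: "coeff q N = 0" using dq coeff_eq_0 by blast
    have "act ([:-c, 1:] * q) z = (\<Sum>i\<le>N. cs (- c * coeff q i) ((E ^^ i) z)) + (\<Sum>i\<le>N. cs (coeff (pCons 0 q) i) ((E ^^ i) z))"
      unfolding act_def sum.distrib[symmetric] cs_add2[symmetric] by simp
    also have "(\<Sum>i\<le>N. cs (- c * coeff q i) ((E ^^ i) z)) = cs (- c) (act q z)"
      unfolding act_def by (simp add: cs_sum cs_cs)
    also have "(\<Sum>i\<le>N. cs (coeff (pCons 0 q) i) ((E ^^ i) z)) = (\<Sum>i\<le>M. cs (coeff q i) ((E ^^ i) (E z)))"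
      unfolding M by (subst sum.atMost_Suc_shift) (simp add: cs0 funpow_swap1)
    also have "\<dots> = act q (E z)" unfolding act_def M using q0 M by (simp add: cs0)
    also have "cs (- c) (act q z) = - act q (cs c z)" unfolding act_cs by (simp add: cs_def)
    finally show ?thesis by (simp add: act_diff)
  qed
  \<comment> \<open>Peel off one root c: either (E - c) z = 0 and z is the eigenvector, or (E - c) z
    is a nonzero vector of W annihilated by the quotient polynomial.\<close>
  have main: "\<exists>z s t. z \<in> W \<and> z \<noteq> 0 \<and> E z = s *\<^sub>R z + t *\<^sub>R J z"
    if "degree p = n" "n \<le> N" "p \<noteq> 0" "z \<in> W" "z \<noteq> 0" "act p z = 0" for p n z
    using that
  proof (induction n arbitrary: p z)
    case 0
    then obtain a where a: "p = [:a:]" by (auto elim: degree_eq_zeroE)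
    have "coeff p i = (if i = 0 then a else 0)" for i unfolding a by (auto simp: coeff_pCons split: nat.split)
    then have "act p z = (\<Sum>i\<le>N. if i = 0 then cs a z else 0)" unfolding act_def
      by (intro sum.cong) (auto simp: cs0)
    then have "cs a z = 0" using "0.prems" by simp
    then have "cs (inverse a) (cs a z) = 0" by (simp add: cs0)
    moreover have "a \<noteq> 0" using "0.prems" a by auto
    ultimately have "z = 0" by (simp add: cs_cs cs1)
    then show ?case using "0.prems" by simp
  next
    case (Suc n)
    have "\<not> constant (poly p)" using Suc.prems(1) by (simp add: constant_degree)
    then obtain c where "poly p c = 0" using fundamental_theorem_of_algebra by blast
    then obtain q where q: "p = [:-c, 1:] * q" by (auto simp: poly_eq_0_iff_dvd)
    have qne: "q \<noteq> 0" using q Suc.prems by auto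
    have dq: "degree q = n" using Suc.prems(1) qne unfolding q by (subst (asm) degree_mult_eq) auto
    have z': "act q (E z - cs c z) = 0" using act_factor[of q c z] dq Suc.prems q by simp
    show ?case
    proof (cases "E z - cs c z = 0")
      case True
      then show ?thesis using Suc.prems unfolding cs_def by auto
    next
      case False
      have "E z - cs c z \<in> W" using Suc.prems W WE WJ unfolding cs_def
        by (intro subspace_diff subspace_add subspace_scale) auto
      then show ?thesis using Suc.IH[OF dq _ qne _ False z'] Suc.prems by simp
    qed
  qed
  obtain a :: "nat \<Rightarrow> real" where a: "\<exists>i\<le>N. a i \<noteq> 0" "(\<Sum>i\<le>N. a i *\<^sub>R (E ^^ i) z0) = 0"
    using real_relation_of_iterates[of E z0] unfolding N_def by blast
  define p where "p = (\<Sum>i\<le>N. monom (complex_of_real (a i)) i)"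
  have cp: "coeff p i = (if i \<le> N then complex_of_real (a i) else 0)" for i
    unfolding p_def by (simp add: coeff_sum)
  have "p \<noteq> 0" using a(1) cp by (metis coeff_0 of_real_eq_0_iff)
  moreover have "degree p \<le> N" using cp by (intro degree_le) auto
  moreover have "act p z0 = 0" unfolding act_def using a(2) by (simp add: cp cs_def)
  ultimately show ?thesis using main[of p "degree p" z0] z0 by simp
qed

section \<open>Dissipation inequalities for linear pencils\<close>

lemma bounded_linear_pos_bound:
  fixes f :: "'a::euclidean_space \<Rightarrow> 'b::real_normed_vector"
  assumes "linear f"
  obtains K where "K > 0" "\<And>x. norm (f x) \<le> K * norm x"
  using bounded_linear.pos_bounded[OF linear_conv_bounded_linear[THEN iffD1, OF assms]]
  by (metis mult.commute)

lemma bilinear_pos_bound: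
  fixes f :: "'a::euclidean_space \<Rightarrow> 'b::euclidean_space \<Rightarrow> 'c::real_normed_vector"
  assumes "bilinear f"
  obtains K where "K > 0" "\<And>x y. norm (f x y) \<le> K * norm x * norm y"
  using bounded_bilinear.pos_bounded[OF bilinear_conv_bounded_bilinear[THEN iffD1, OF assms]]
  by (metis mult.commute mult.left_commute)

lemma bilinear_cmult:
  fixes q :: "'a::real_vector \<Rightarrow> 'b::real_vector \<Rightarrow> real"
  assumes "bilinear q" shows "bilinear (\<lambda>z w. c * q z w)"
proof -
  have l: "linear (\<lambda>x. q x y)" "linear (q x)" for x y using assms unfolding bilinear_def by blast+
  show ?thesis unfolding bilinear_def
    by (auto intro!: linearI simp: linear_add[OF l(1)] linear_add[OF l(2)] linear_scale[OF l(1)] linear_scale[OF l(2)] distrib_left)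
qed

text \<open>Solutions of \<open>L\<^sub>0 z' + N z = 0\<close> satisfy \<open>z' = R z\<close> and \<open>S z = 0\<close>. The form is a Gramian
  of the resolvent \<open>E = (R + \<kappa>)\<^bsup>-1\<^esup>\<close>; the inequality \<open>b(z, z) \<le> |S E z|\<^sup>2 + \<mu> b(E z, E z)\<close> suffices,
  so that a finite sum serves and no convergence question arises.\<close>

lemma pencil_dissipation:
  fixes L0 N :: "'z::euclidean_space \<Rightarrow> 'y::euclidean_space" and G :: "'y \<Rightarrow> 'z" and J :: "'z \<Rightarrow> 'z"
  assumes L0: "linear L0" and N: "linear N" and G: "linear G" and J: "linear J" and JJ: "\<And>z. J (J z) = - z"
    and GL: "\<And>z. G (L0 z) = z" and NJ: "\<And>z. N (J z) = JY (N z)" and LJ: "\<And>z. L0 (J z) = JY (L0 z)"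
    and GJ: "\<And>y. G (JY y) = J (G y)"
    and inj: "\<And>s t z. L0 (s *\<^sub>R z + t *\<^sub>R J z) + N z = 0 \<Longrightarrow> z = 0"
  shows "\<exists>(b::'z \<Rightarrow> 'z \<Rightarrow> real) C. bilinear b \<and> (\<forall>z w. b z w = b w z) \<and> (\<forall>z. 0 \<le> b z z) \<and> 0 \<le> C \<and>
     (\<forall>z z'. (norm z)\<^sup>2 + (norm z')\<^sup>2 + 2 * b z z' \<le> C * (norm (L0 z' + N z))\<^sup>2)"
proof -
  define R where "R = (\<lambda>z. - G (N z))"
  define S where "S = (\<lambda>z. N z - L0 (G (N z)))"
  have R: "linear R" unfolding R_def using linear_compose[OF N G] by (simp add: o_def linear_compose_neg)
  have S: "linear S" unfolding S_def using linear_compose[OF linear_compose[OF N G] L0] N by (simp add: o_def linear_compose_sub)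
  obtain K where K: "K > 0" "\<And>z. norm (R z) \<le> K * norm z" using bounded_linear_pos_bound[OF R] by metis
  \<comment> \<open>\<kappa> exceeds the bound K of R, so R + \<kappa> is invertible.\<close>
  define \<kappa> where "\<kappa> = K + 1"
  have kp: "\<kappa> > 0" using K unfolding \<kappa>_def by simp
  define M where "M = (\<lambda>z. R z + \<kappa> *\<^sub>R z)"
  have M: "linear M" unfolding M_def using R by (intro linear_compose_add) auto
  have "inj M"
  proof (rule linear_injective_0[THEN iffD2, OF M], intro allI impI)
    fix z assume "M z = 0"
    then have "R z = - (\<kappa> *\<^sub>R z)" unfolding M_def by (simp add: eq_neg_iff_add_eq_0)
    then have "\<kappa> * norm z = norm (R z)" using kp by simp
    also have "\<dots> \<le> K * norm z" by (rule K)
    finally show "z = 0" unfolding \<kappa>_def by (simp add: algebra_simps)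
  qed
  then obtain E where E: "linear E" and EM: "\<And>x. E (M x) = x" and ME: "\<And>x. M (E x) = x"
    using linear_injective_isomorphism[OF M] by blast
  have RJ: "R (J z) = J (R z)" for z unfolding R_def by (simp add: NJ GJ linear_neg[OF J])
  have MJ: "M (J z) = J (M z)" for z unfolding M_def by (simp add: RJ linear_add[OF J] linear_scale[OF J])
  have EJ: "E (J z) = J (E z)" for z by (metis EM ME MJ)
  have SJ: "S (J e) = 0" if "S e = 0" for e
  proof -
    have "N e = L0 (G (N e))" using that unfolding S_def by simp
    then show ?thesis unfolding S_def by (metis GJ LJ NJ cancel_comm_monoid_add_class.diff_cancel)
  qed
  \<comment> \<open>The unobservable subspace, on which all outputs S E^(j+1) z vanish. It is
    invariant under E and J, so if it were nontrivial it would contain an eigenvector.\<close>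
  define W where "W = {z. \<forall>j. S ((E ^^ Suc j) z) = 0}"
  have linEi: "linear (E ^^ i)" for i
  proof (induction i)
    case (Suc i)
    then show ?case using linear_compose[OF Suc E] by (simp only: funpow.simps)
  qed (simp add: linear_id[unfolded id_def])
  have EiJ: "(E ^^ i) (J z) = J ((E ^^ i) z)" for i z by (induction i) (auto simp: EJ)
  have W0: "z = 0" if zW: "z \<in> W" for z
  proof (rule ccontr)
    assume z: "z \<noteq> 0"
    have "\<exists>z s t. z \<in> W \<and> z \<noteq> 0 \<and> E z = s *\<^sub>R z + t *\<^sub>R J z"
    proof (rule complex_structure_eigenvector[OF E J JJ EJ _ _ _ zW z])
      show "subspace W" unfolding W_def subspace_def
        by (auto simp: linear_0[OF linEi] linear_add[OF linEi] linear_scale[OF linEi]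
            linear_0[OF E] linear_add[OF E] linear_scale[OF E] linear_0[OF S] linear_add[OF S] linear_scale[OF S])
      show "E z \<in> W" if "z \<in> W" for z
        using that unfolding W_def by (auto simp: funpow_swap1[symmetric] simp del: funpow.simps(2)) (metis funpow.simps(2) funpow_swap1 o_apply)
      show "J z \<in> W" if "z \<in> W" for z
        using that SJ EiJ[of "Suc _" z] unfolding W_def by (auto simp del: funpow.simps(2))
    qed
    then obtain z s t where zz: "z \<in> W" "z \<noteq> 0" and Ez: "E z = s *\<^sub>R z + t *\<^sub>R J z" by blast
    define e where "e = E z"
    have e0: "e \<noteq> 0" using zz ME[of z] unfolding e_def by (auto simp: linear_0[OF M])
    have Se: "S e = 0" using zz unfolding W_def e_def by (auto dest!: spec[of _ 0])
    \<comment> \<open>The relation E z = s z + t J z is inverted by s e - t J e = D z. This turns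
      the eigenvector of E into one of R that still lies in the kernel of S, and L0 (R e) + N e = S
      e = 0 then contradicts \<open>inj\<close>.\<close>
    define D where "D = s\<^sup>2 + t\<^sup>2"
    have D0: "D \<noteq> 0" using Ez e0 unfolding e_def D_def by auto
    have "s *\<^sub>R e - t *\<^sub>R J e = D *\<^sub>R z"
      unfolding e_def Ez D_def by (simp add: linear_add[OF J] linear_scale[OF J] JJ algebra_simps power2_eq_square)
    then have "z = (1 / D) *\<^sub>R (s *\<^sub>R e - t *\<^sub>R J e)" using D0 by simp
    moreover have "z = R e + \<kappa> *\<^sub>R e" using ME[of z] unfolding M_def e_def by simp
    ultimately have Re: "R e = (s / D - \<kappa>) *\<^sub>R e + (- t / D) *\<^sub>R J e"
      by (simp add: algebra_simps)
    have "L0 (R e) + N e = 0" using Se unfolding S_def R_def by (simp add: linear_neg[OF L0])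
    then have "e = 0" using inj unfolding Re by blast
    then show False using e0 by simp
  qed
  \<comment> \<open>Since W is trivial, the open sets where some output is nonzero cover the unit
    sphere. Finitely many of them suffice, so a finite Gramian is positive definite.\<close>
  define O' where "O' j = {z. S ((E ^^ Suc j) z) \<noteq> 0}" for j
  have contSE: "continuous_on A (\<lambda>z. S ((E ^^ i) z))" for i A
    using linear_compose[OF linEi[of i] S] by (intro linear_continuous_on linear_conv_bounded_linear[THEN iffD1]) (simp add: o_def)
  have "open (O' j)" for j unfolding O'_def by (rule open_Collect_neq[OF contSE]) simp
  moreover have "sphere 0 1 \<subseteq> (\<Union>j. O' j)"
  proof
    fix z :: 'z assume "z \<in> sphere 0 1"
    then have "z \<notin> W" using W0[of z] by auto
    then show "z \<in> (\<Union>j. O' j)" unfolding W_def O'_def by blast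
  qed
  ultimately obtain Fs where Fs: "finite Fs" "sphere 0 1 \<subseteq> (\<Union>j\<in>Fs. O' j)"
    using compactE_image[OF compact_sphere, of UNIV O' 0 1] by auto
  obtain m where m: "\<And>j. j \<in> Fs \<Longrightarrow> j < m" using finite_nat_set_iff_bounded[THEN iffD1, OF Fs(1)] by blast
  \<comment> \<open>Any positive weight below \<kappa>^2 would do: the difference \<kappa>^2 - \<mu>
    is the decay that remains in \<open>bR\<close>.\<close>
  define \<mu> where "\<mu> = \<kappa>\<^sup>2 / 2"
  have mup: "\<mu> > 0" unfolding \<mu>_def using kp by simp
  define b where "b z w = (\<Sum>j<m. \<mu> ^ j * (S ((E ^^ Suc j) z) \<bullet> S ((E ^^ Suc j) w)))" for z w
  have bil: "bilinear b" unfolding bilinear_def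
    by (auto intro!: linearI simp del: funpow.simps(2) simp: b_def linear_add[OF linEi] linear_scale[OF linEi] linear_add[OF S] linear_scale[OF S]
        inner_add_left inner_add_right distrib_left sum.distrib sum_distrib_left mult.left_commute)
  have sym: "b z w = b w z" for z w unfolding b_def by (simp add: inner_commute)
  have psd: "0 \<le> b z z" for z unfolding b_def using mup by (intro sum_nonneg mult_nonneg_nonneg) auto
  have bpos: "b z z > 0" if z1: "z \<in> sphere 0 1" for z
  proof -
    obtain j where j: "j \<in> Fs" "S ((E ^^ Suc j) z) \<noteq> 0" using Fs(2) z1 unfolding O'_def by blast
    have "0 < \<mu> ^ j * (S ((E ^^ Suc j) z) \<bullet> S ((E ^^ Suc j) z))" using j mup by (intro mult_pos_pos) (auto simp del: funpow.simps(2))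
    then show ?thesis unfolding b_def using j m mup
      by (intro sum_pos2[of _ j]) (auto simp del: funpow.simps(2) intro!: mult_nonneg_nonneg)
  qed
  have "continuous_on (sphere 0 1) (\<lambda>z. b z z)" unfolding b_def by (intro continuous_intros contSE)
  then obtain z1 where z1: "z1 \<in> sphere 0 1" "\<And>z. z \<in> sphere 0 1 \<Longrightarrow> b z1 z1 \<le> b z z"
    using continuous_attains_inf[OF compact_sphere, of 0 1 "\<lambda>z. b z z"] by auto
  define c where "c = b z1 z1"
  have cp: "c > 0" unfolding c_def using bpos z1 by simp
  have bl: "linear (\<lambda>z. b z w)" "linear (\<lambda>w. b z w)" for z w using bil unfolding bilinear_def by auto
  have bc: "c * (norm z)\<^sup>2 \<le> b z z" for z
  proof (cases "z = 0")
    case True then show ?thesis using psd by simp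
  next
    case False
    define u where "u = z /\<^sub>R norm z"
    have "c \<le> b u u" unfolding c_def u_def using False by (intro z1) simp
    moreover have "b z z = (norm z)\<^sup>2 * b u u"
    proof -
      have zu: "z = norm z *\<^sub>R u" unfolding u_def using False by simp
      have "b z z = b (norm z *\<^sub>R u) (norm z *\<^sub>R u)" using zu by simp
      then show ?thesis by (simp only: linear_scale[OF bl(1)] linear_scale[OF bl(2)] power2_eq_square real_scaleR_def mult.assoc)
    qed
    ultimately show ?thesis using mult_right_mono[of c "b u u" "(norm z)\<^sup>2"] by (simp add: mult.commute)
  qed
  \<comment> \<open>Under E the outputs shift by one index, so the right side exceeds the left by
    the single term \<mu>^m |S E^(m+1) z|^2.\<close>
  have step: "b z z \<le> (norm (S (E z)))\<^sup>2 + \<mu> * b (E z) (E z)" for z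
  proof -
    define s where "s j = S ((E ^^ Suc j) z) \<bullet> S ((E ^^ Suc j) z)" for j
    have "(E ^^ Suc j) (E z) = (E ^^ Suc (Suc j)) z" for j by (simp add: funpow_swap1)
    then have "\<mu> * b (E z) (E z) = (\<Sum>j<m. \<mu> ^ Suc j * s (Suc j))"
      unfolding b_def s_def by (simp add: sum_distrib_left mult.assoc del: funpow.simps(2))
    moreover have "(norm (S (E z)))\<^sup>2 = \<mu> ^ 0 * s 0" unfolding s_def by (simp add: power2_norm_eq_inner)
    ultimately have "(norm (S (E z)))\<^sup>2 + \<mu> * b (E z) (E z) = (\<Sum>j<Suc m. \<mu> ^ j * s j)"
      by (simp only: sum.lessThan_Suc_shift)
    also have "\<dots> = b z z + \<mu> ^ m * s m" unfolding b_def s_def by (simp del: funpow.simps(2))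
    finally show ?thesis using mup unfolding s_def by simp
  qed
  \<comment> \<open>Apply \<open>step\<close> to M e = R e + \<kappa> e, expand the form, and drop
    the nonnegative b(R e, R e).\<close>
  have bR: "2 * \<kappa> * b e (R e) \<le> (norm (S e))\<^sup>2 - (\<kappa>\<^sup>2 / 2) * c * (norm e)\<^sup>2" for e
  proof -
    have "b (M e) (M e) \<le> (norm (S e))\<^sup>2 + \<mu> * b e e" using step[of "M e"] by (simp add: EM)
    moreover have "b (M e) (M e) = b (R e) (R e) + 2 * \<kappa> * b e (R e) + \<kappa>\<^sup>2 * b e e"
      unfolding M_def using sym[of "R e" e]
      by (simp add: linear_add[OF bl(1)] linear_add[OF bl(2)] linear_scale[OF bl(1)] linear_scale[OF bl(2)] power2_eq_square algebra_simps)
    moreover have "0 \<le> b (R e) (R e)" by (rule psd)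
    moreover have "(\<kappa>\<^sup>2 / 2) * (c * (norm e)\<^sup>2) \<le> (\<kappa>\<^sup>2 / 2) * b e e" using bc by (intro mult_left_mono) auto
    ultimately show ?thesis unfolding \<mu>_def by (simp add: algebra_simps)
  qed
  obtain K2 where K2: "K2 > 0" "\<And>y. norm (G y) \<le> K2 * norm y" using bounded_linear_pos_bound[OF G] by metis
  obtain K3 where K3: "K3 > 0" "\<And>z w. norm (b z w) \<le> K3 * norm z * norm w" using bilinear_pos_bound[OF bil] by metis
  obtain K4 where K4: "K4 > 0" "\<And>y. norm (L0 y) \<le> K4 * norm y" using bounded_linear_pos_bound[OF L0] by metis
  define K1 where "K1 = 1 + K4 * K2"
  define d where "d = \<kappa> * c / 2"
  have dp: "d > 0" unfolding d_def using kp cp by simp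
  \<comment> \<open>After the error is absorbed a decay of d/2 |z|^2 is left; \<Lambda> scales it to
    (1 + 2 K^2) |z|^2, which pays for |z|^2 and for the part of |z'|^2 that comes from R z.\<close>
  define \<Lambda> where "\<Lambda> = 2 / d * (1 + 2 * K\<^sup>2)"
  have Lp: "\<Lambda> > 0" unfolding \<Lambda>_def using dp by (simp add: add_pos_nonneg)
  define C0 where "C0 = K1\<^sup>2 / \<kappa> + 2 * (K3 * K2)\<^sup>2 / d"
  define C where "C = \<Lambda> * C0 + 2 * K2\<^sup>2"
  have C0p: "C0 \<ge> 0" unfolding C0_def using kp dp by simp
  have main: "(norm z)\<^sup>2 + (norm z')\<^sup>2 + 2 * (\<Lambda> * b z z') \<le> C * (norm (L0 z' + N z))\<^sup>2" for z z'
  proof -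
    \<comment> \<open>Here z' = R z + G y and S z = y - L0 (G y), so y alone measures how far the
      pair is from a solution of the homogeneous equation.\<close>
    define y where "y = L0 z' + N z"
    define Y where "Y = norm y"
    define Z where "Z = norm z"
    have Gy: "G y = z' - R z" unfolding y_def R_def by (simp add: linear_add[OF G] GL)
    then have z': "z' = R z + G y" by simp
    have Sz: "S z = y - L0 (G y)" unfolding Gy unfolding y_def S_def R_def by (simp add: linear_add[OF L0])
    have nS: "norm (S z) \<le> K1 * Y"
    proof -
      have "norm (S z) \<le> norm y + norm (L0 (G y))" unfolding Sz by (rule norm_triangle_ineq4)
      also have "norm (L0 (G y)) \<le> K4 * (K2 * norm y)" using K4 K2 by (meson mult_left_mono order.trans less_imp_le)
      finally show ?thesis unfolding K1_def Y_def by (simp add: algebra_simps)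
    qed
    have nS2: "(norm (S z))\<^sup>2 \<le> K1\<^sup>2 * Y\<^sup>2" using power_mono[OF nS norm_ge_zero, of 2] by (simp add: power_mult_distrib)
    have 1: "2 * b z (R z) \<le> K1\<^sup>2 / \<kappa> * Y\<^sup>2 - d * Z\<^sup>2"
    proof -
      have "\<kappa> * (2 * b z (R z)) \<le> \<kappa> * (K1\<^sup>2 / \<kappa> * Y\<^sup>2 - d * Z\<^sup>2)"
        using bR[of z] nS2 kp unfolding d_def Z_def by (simp add: algebra_simps power2_eq_square)
      then show ?thesis using kp by (simp only: mult_le_cancel_left_pos)
    qed
    have 2: "2 * b z (G y) \<le> d / 2 * Z\<^sup>2 + 2 * (K3 * K2)\<^sup>2 / d * Y\<^sup>2"
    proof -
      have "b z (G y) \<le> K3 * Z * norm (G y)" using K3(2)[of z "G y"] unfolding Z_def by simp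
      also have "\<dots> \<le> K3 * Z * (K2 * Y)" using K2(2)[of y] K3(1) unfolding Y_def Z_def by (intro mult_left_mono) auto
      finally have "2 * b z (G y) \<le> 2 * (K3 * K2 * Y) * Z" by (simp add: algebra_simps)
      also have "\<dots> \<le> d / 2 * Z\<^sup>2 + 2 * (K3 * K2)\<^sup>2 / d * Y\<^sup>2"
      proof -
        have "0 \<le> (d * Z - 2 * (K3 * K2 * Y))\<^sup>2 / (2 * d)" using dp by simp
        also have "\<dots> = d / 2 * Z\<^sup>2 + 2 * (K3 * K2)\<^sup>2 / d * Y\<^sup>2 - 2 * (K3 * K2 * Y) * Z"
          using dp by (simp add: field_simps power2_eq_square)
        finally show ?thesis by simp
      qed
      finally show ?thesis .
    qed
    have "2 * b z z' = 2 * b z (R z) + 2 * b z (G y)" unfolding z' by (simp add: linear_add[OF bl(2)])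
    also have "\<dots> \<le> C0 * Y\<^sup>2 - d / 2 * Z\<^sup>2" using 1 2 unfolding C0_def by (simp add: algebra_simps)
    finally have "\<Lambda> * (2 * b z z') \<le> \<Lambda> * (C0 * Y\<^sup>2 - d / 2 * Z\<^sup>2)" using Lp by (intro mult_left_mono) auto
    also have "\<dots> = \<Lambda> * C0 * Y\<^sup>2 - (1 + 2 * K\<^sup>2) * Z\<^sup>2" unfolding \<Lambda>_def using dp by (simp add: field_simps)
    finally have 3: "2 * (\<Lambda> * b z z') \<le> \<Lambda> * C0 * Y\<^sup>2 - (1 + 2 * K\<^sup>2) * Z\<^sup>2" by simp
    have "norm z' \<le> K * Z + K2 * Y" unfolding z' using K(2)[of z] K2(2)[of y] norm_triangle_ineq[of "R z" "G y"] unfolding Z_def Y_def by simp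
    then have "(norm z')\<^sup>2 \<le> (K * Z + K2 * Y)\<^sup>2" by (intro power_mono) auto
    also have "\<dots> \<le> 2 * K\<^sup>2 * Z\<^sup>2 + 2 * K2\<^sup>2 * Y\<^sup>2"
      using sum_squares_bound[of "K * Z" "K2 * Y"] by (simp add: power2_sum power_mult_distrib)
    finally show ?thesis using 3 unfolding C_def Y_def Z_def y_def by (simp add: algebra_simps)
  qed
  have "bilinear (\<lambda>z w. \<Lambda> * b z w)" by (rule bilinear_cmult[OF bil])
  moreover have "0 \<le> C" unfolding C_def using Lp C0p by simp
  ultimately show ?thesis using main sym psd Lp
    by (intro exI[of _ "\<lambda>z w. \<Lambda> * b z w"] exI[of _ C]) auto
qed

section \<open>Ellipticity and dissipation for complex covectors\<close>

definition C_elliptic_map :: "('f::real_vector^'n \<Rightarrow> 'k::real_vector) \<Rightarrow> bool" where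
  "C_elliptic_map P \<longleftrightarrow> (\<forall>(\<xi>::real^'n) \<eta> v w. (\<xi> \<noteq> 0 \<or> \<eta> \<noteq> 0) \<longrightarrow>
     P (tensor v \<xi> - tensor w \<eta>) = 0 \<longrightarrow> P (tensor v \<eta> + tensor w \<xi>) = 0 \<longrightarrow> v = 0 \<and> w = 0)"

lemma tensor_simps:
  "tensor (u + v) \<xi> = tensor u \<xi> + tensor v \<xi>" "tensor u (\<xi> + \<eta>) = tensor u \<xi> + tensor u \<eta>"
  "tensor (u - v) \<xi> = tensor u \<xi> - tensor v \<xi>" "tensor u (\<xi> - \<eta>) = tensor u \<xi> - tensor u \<eta>"
  "tensor (r *\<^sub>R u) \<xi> = r *\<^sub>R tensor u \<xi>" "tensor u (r *\<^sub>R \<xi>) = r *\<^sub>R tensor u \<xi>"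
  "tensor 0 \<xi> = 0" "tensor u 0 = 0" "tensor (- u) \<xi> = - tensor u \<xi>"
  by (simp_all add: tensor_def vec_eq_iff algebra_simps)

lemma inner_tensor: "tensor u \<xi> \<bullet> tensor v \<eta> = (u \<bullet> v) * (\<xi> \<bullet> \<eta>)"
  for u v :: "'f::real_inner" and \<xi> \<eta> :: "real^'n::finite"
  by (simp add: tensor_def inner_vec_def sum_distrib_left ac_simps)

text \<open>The arguments of \<open>P\<close> are the real and imaginary parts of (a + i b)
  \<otimes> (\<alpha> + i \<beta>) + (a' + i b') \<otimes> e_k. Derivatives would only lead to
  imaginary tangential covectors; the real part \<alpha> comes from forward differences. One
  constant C serves all covectors, while the form q may depend on them.\<close>

definition tangentially_dissipative :: "('f::euclidean_space^'n::finite \<Rightarrow> 'k::euclidean_space) \<Rightarrow> 'n \<Rightarrow> real \<Rightarrow> bool" where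
  "tangentially_dissipative P k C \<longleftrightarrow> (\<forall>(\<alpha>::real^'n) \<beta>. \<alpha> $ k = 0 \<longrightarrow> \<beta> $ k = 0 \<longrightarrow>
     (\<exists>q::('f \<times> 'f) \<Rightarrow> ('f \<times> 'f) \<Rightarrow> real. bilinear q \<and> (\<forall>z w. q z w = q w z) \<and> (\<forall>z. 0 \<le> q z z) \<and>
       (\<forall>a b a' b'. (norm (tensor a \<alpha> - tensor b \<beta> + tensor a' (axis k 1)))\<^sup>2
           + (norm (tensor b \<alpha> + tensor a \<beta> + tensor b' (axis k 1)))\<^sup>2 + 2 * q (a, b) (a', b')
         \<le> C * ((norm (P (tensor a \<alpha> - tensor b \<beta> + tensor a' (axis k 1))))\<^sup>2
           + (norm (P (tensor b \<alpha> + tensor a \<beta> + tensor b' (axis k 1))))\<^sup>2))))"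

text \<open>For a unit pair (\<alpha>, \<beta>) the pencil inequality applies, because adding a
  complex multiple of e_k to the tangential covector \<alpha> + i \<beta> never gives 0. Its
  constant is locally uniform by perturbation, hence uniform on the compact sphere, and homogeneity
  carries it to all lengths.\<close>

lemma tangential_dissipation:
  fixes P :: "'f::euclidean_space^'n::finite \<Rightarrow> 'k::euclidean_space" and k :: 'n
  assumes P: "linear P" and ell: "C_elliptic_map P"
  shows "\<exists>C\<ge>0. tangentially_dissipative P k C"
proof -
  let ?e = "axis k 1 :: real^'n"
  have ee: "?e \<bullet> ?e = 1" by (simp add: inner_axis_axis)
  have linT: "linear (\<lambda>a. P (tensor a \<xi>))" for \<xi>
    by (rule linearI) (simp_all add: tensor_simps linear_add[OF P] linear_scale[OF P])
  have "inj (\<lambda>a. P (tensor a ?e))"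
  proof (rule linear_injective_0[THEN iffD2, OF linT], intro allI impI)
    fix a assume a: "P (tensor a ?e) = 0"
    have "?e \<noteq> 0" by (simp add: axis_eq_0_iff)
    then show "a = 0" using ell[unfolded C_elliptic_map_def, rule_format, of ?e 0 a 0] a
      by (simp add: tensor_simps linear_0[OF P])
  qed
  then obtain g where g: "linear g" and gT: "\<And>a. g (P (tensor a ?e)) = a"
    using linear_injective_left_inverse[OF linT] by (metis comp_apply id_apply)
  define L0 where "L0 = (\<lambda>z::'f \<times> 'f. (P (tensor (fst z) ?e), P (tensor (snd z) ?e)))"
  define Nf where "Nf = (\<lambda>(p::(real^'n) \<times> (real^'n)) (z::'f \<times> 'f).
     (P (tensor (fst z) (fst p) - tensor (snd z) (snd p)), P (tensor (snd z) (fst p) + tensor (fst z) (snd p))))"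
  define G where "G = (\<lambda>y::'k \<times> 'k. (g (fst y), g (snd y)))"
  define J where "J = (\<lambda>z::'f \<times> 'f. (- snd z, fst z))"
  define JY where "JY = (\<lambda>z::'k \<times> 'k. (- snd z, fst z))"
  have L0: "linear L0" unfolding L0_def
    by (rule linearI) (simp_all add: tensor_simps linear_add[OF P] linear_scale[OF P])
  have bilN: "bilinear Nf" unfolding bilinear_def Nf_def
    by (auto intro!: linearI simp: tensor_simps linear_add[OF P] linear_diff[OF P] linear_scale[OF P] algebra_simps)
  have linN: "linear (Nf p)" "linear (\<lambda>p. Nf p z)" for p z using bilN unfolding bilinear_def by blast+
  have G: "linear G" unfolding G_def by (rule linearI) (simp_all add: linear_add[OF g] linear_scale[OF g])
  have J: "linear J" unfolding J_def by (rule linearI) simp_all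
  define W where "W = {p::(real^'n) \<times> (real^'n). fst p $ k = 0 \<and> snd p $ k = 0}"
  define K where "K = sphere 0 1 \<inter> W"
  have "closed W" unfolding W_def by (intro closed_Collect_conj closed_Collect_eq continuous_intros)
  then have K: "compact K" unfolding K_def by (simp add: compact_Int_closed)
  define good where "good p q C \<longleftrightarrow> bilinear q \<and> (\<forall>z w. q z w = q w z) \<and> (\<forall>z. 0 \<le> q z z) \<and> 0 \<le> C \<and>
     (\<forall>z z'. (norm z)\<^sup>2 + (norm z')\<^sup>2 + 2 * q z z' \<le> C * (norm (L0 z' + Nf p z))\<^sup>2)"
    for p and q :: "('f \<times> 'f) \<Rightarrow> ('f \<times> 'f) \<Rightarrow> real" and C
  have fixed: "\<exists>q C. good p q C" if p: "p \<in> K" for p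
    unfolding good_def
  proof (rule pencil_dissipation[OF L0 linN(1) G J])
    show "J (J z) = - z" for z unfolding J_def by (simp add: prod_eq_iff)
    show "G (L0 z) = z" for z unfolding G_def L0_def by (simp add: gT)
    show "Nf p (J z) = JY (Nf p z)" for z unfolding Nf_def J_def JY_def
      by (simp add: tensor_simps linear_diff[OF P] linear_add[OF P] linear_neg[OF P])
    show "L0 (J z) = JY (L0 z)" for z unfolding L0_def J_def JY_def by (simp add: tensor_simps linear_neg[OF P])
    show "G (JY y) = J (G y)" for y unfolding G_def J_def JY_def by (simp add: linear_neg[OF g])
    fix s t z assume eq: "L0 (s *\<^sub>R z + t *\<^sub>R J z) + Nf p z = 0"
    obtain a b where z: "z = (a, b)" by (cases z)
    obtain \<alpha> \<beta> where pe: "p = (\<alpha>, \<beta>)" by (cases p)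
    have pk: "\<alpha> $ k = 0" "\<beta> $ k = 0" and p0: "norm p = 1" using p unfolding K_def W_def pe by auto
    have "P (tensor a (\<alpha> + s *\<^sub>R ?e) - tensor b (\<beta> + t *\<^sub>R ?e)) = 0"
      "P (tensor a (\<beta> + t *\<^sub>R ?e) + tensor b (\<alpha> + s *\<^sub>R ?e)) = 0"
      using eq unfolding z pe L0_def Nf_def J_def
      by (simp_all add: prod_eq_iff tensor_simps linear_add[OF P] linear_diff[OF P] linear_scale[OF P] linear_neg[OF P] algebra_simps)
    moreover have "\<alpha> + s *\<^sub>R ?e \<noteq> 0 \<or> \<beta> + t *\<^sub>R ?e \<noteq> 0"
    proof (rule ccontr)
      assume "\<not> ?thesis"
      then have 1: "\<alpha> = - (s *\<^sub>R ?e)" "\<beta> = - (t *\<^sub>R ?e)" by (simp_all add: eq_neg_iff_add_eq_0)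
      then have "s = 0" "t = 0" using pk by (simp_all add: axis_def)
      then show False using 1 p0 pe by (simp add: norm_Pair)
    qed
    ultimately have "a = 0 \<and> b = 0" using ell unfolding C_elliptic_map_def by blast
    then show "z = 0" unfolding z by (simp add: zero_prod_def)
  qed
  obtain q0 C0 where qC: "\<And>p. p \<in> K \<Longrightarrow> good p (q0 p) (C0 p)" using fixed by metis
  obtain KN where KN: "KN > 0" "\<And>p z. norm (Nf p z) \<le> KN * norm p * norm z" using bilinear_pos_bound[OF bilN] by metis
  \<comment> \<open>Within this distance the error 2 C0 |N_(p - p') z|^2 is at most |z|^2 / 2.
    Doubling the inequality then restores the coefficient of |z|^2, which is where 4 C0 comes
    from.\<close>
  define \<delta> where "\<delta> p = 1 / (2 * KN * (1 + C0 p))" for p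
  have near: "(norm z)\<^sup>2 + (norm z')\<^sup>2 + 2 * (2 * q0 p z z') \<le> 4 * C0 p * (norm (L0 z' + Nf p' z))\<^sup>2"
    if p: "p \<in> K" and p': "p' \<in> ball p (\<delta> p)" for p p' z z'
  proof -
    have C0p: "0 \<le> C0 p" using qC[OF p] unfolding good_def by simp
    define cc where "cc = 1 / (2 * (1 + C0 p))"
    have "norm (p - p') \<le> \<delta> p" using p' by (simp add: dist_norm)
    then have "KN * norm (p - p') * norm z \<le> KN * \<delta> p * norm z" using KN(1) by (intro mult_right_mono mult_left_mono) auto
    then have "norm (Nf (p - p') z) \<le> KN * \<delta> p * norm z" using KN(2)[of "p - p'" z] by linarith
    also have "KN * \<delta> p = cc" unfolding \<delta>_def cc_def using KN(1) by simp
    finally have "norm (Nf (p - p') z) \<le> cc * norm z" .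
    then have "(norm (Nf (p - p') z))\<^sup>2 \<le> (cc * norm z)\<^sup>2" by (rule power_mono) simp
    then have "(norm (Nf (p - p') z))\<^sup>2 \<le> cc\<^sup>2 * (norm z)\<^sup>2" by (simp only: power_mult_distrib)
    from mult_left_mono[OF this, of "2 * C0 p"]
    have "2 * C0 p * (norm (Nf (p - p') z))\<^sup>2 \<le> 2 * C0 p * cc\<^sup>2 * (norm z)\<^sup>2"
      using C0p by (simp add: mult.assoc)
    also have "2 * C0 p * cc\<^sup>2 \<le> 1 / 2"
    proof -
      have "C0 p * 4 \<le> (2 * (1 + C0 p))\<^sup>2" using C0p by (simp add: power2_eq_square algebra_simps)
      moreover have "(2 * (1 + C0 p))\<^sup>2 > 0" using C0p by simp
      ultimately show ?thesis unfolding cc_def by (simp add: power_divide divide_le_eq)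
    qed
    finally have 1: "2 * C0 p * (norm (Nf (p - p') z))\<^sup>2 \<le> 1 / 2 * (norm z)\<^sup>2" by (simp add: mult_right_mono)
    have "L0 z' + Nf p z = (L0 z' + Nf p' z) + Nf (p - p') z" by (simp add: linear_diff[OF linN(2)])
    then have "norm (L0 z' + Nf p z) \<le> norm (L0 z' + Nf p' z) + norm (Nf (p - p') z)" by (metis norm_triangle_ineq)
    then have "(norm (L0 z' + Nf p z))\<^sup>2 \<le> (norm (L0 z' + Nf p' z) + norm (Nf (p - p') z))\<^sup>2" by (intro power_mono) auto
    also have "\<dots> \<le> 2 * (norm (L0 z' + Nf p' z))\<^sup>2 + 2 * (norm (Nf (p - p') z))\<^sup>2"
      using sum_squares_bound[of "norm (L0 z' + Nf p' z)" "norm (Nf (p - p') z)"] by (simp add: power2_sum)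
    finally have "C0 p * (norm (L0 z' + Nf p z))\<^sup>2 \<le> C0 p * (2 * (norm (L0 z' + Nf p' z))\<^sup>2 + 2 * (norm (Nf (p - p') z))\<^sup>2)"
      using C0p by (intro mult_left_mono)
    then have A: "C0 p * (norm (L0 z' + Nf p z))\<^sup>2 \<le> 2 * (C0 p * (norm (L0 z' + Nf p' z))\<^sup>2) + 2 * (C0 p * (norm (Nf (p - p') z))\<^sup>2)"
      by (simp add: algebra_simps)
    have B: "(norm z)\<^sup>2 + (norm z')\<^sup>2 + 2 * q0 p z z' \<le> C0 p * (norm (L0 z' + Nf p z))\<^sup>2"
      using qC[OF p] unfolding good_def by blast
    show ?thesis using A B 1 zero_le_power2[of "norm z'"] unfolding mult.assoc by linarith
  qed
  have "K \<subseteq> (\<Union>p\<in>K. ball p (\<delta> p))"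
  proof
    fix p assume p: "p \<in> K"
    then have "0 \<le> C0 p" using qC unfolding good_def by blast
    then have "\<delta> p > 0" unfolding \<delta>_def using KN(1) by (simp add: add_pos_nonneg)
    then show "p \<in> (\<Union>p\<in>K. ball p (\<delta> p))" using p by (intro UN_I[of p]) auto
  qed
  then obtain F where F: "F \<subseteq> K" "finite F" "K \<subseteq> (\<Union>p\<in>F. ball p (\<delta> p))"
    using compactE_image[OF K, of K "\<lambda>p. ball p (\<delta> p)"] by blast
  have C0F: "0 \<le> C0 p" if "p \<in> F" for p using qC F that unfolding good_def by blast
  obtain KG where KG: "KG > 0" "\<And>y. norm (G y) \<le> KG * norm y" using bounded_linear_pos_bound[OF G] by metis
  \<comment> \<open>The sum dominates the constants of all centres of the cover. The summand with
    \<open>KG\<close> serves the zero frequency, where the left inverse G bounds z'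
    directly.\<close>
  define C where "C = (\<Sum>p\<in>F. 4 * C0 p) + KG\<^sup>2"
  have C0: "0 \<le> C" unfolding C_def using C0F by (simp add: sum_nonneg)
  have main: "\<exists>q. bilinear q \<and> (\<forall>z w. q z w = q w z) \<and> (\<forall>z. 0 \<le> q z z) \<and>
      (\<forall>z z'. (norm p)\<^sup>2 * (norm z)\<^sup>2 + (norm z')\<^sup>2 + 2 * q z z' \<le> C * (norm (L0 z' + Nf p z))\<^sup>2)" if p: "p \<in> W" for p
  proof (cases "p = 0")
    case True
    have "(norm z')\<^sup>2 \<le> C * (norm (L0 z' + Nf p z))\<^sup>2" for z z'
    proof -
      have "Nf p z = 0" unfolding True by (rule linear_0[OF linN(2)])
      then have "norm z' \<le> KG * norm (L0 z' + Nf p z)" using KG(2)[of "L0 z'"] unfolding G_def L0_def by (simp add: gT)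
      then have "(norm z')\<^sup>2 \<le> (KG * norm (L0 z' + Nf p z))\<^sup>2" by (intro power_mono) auto
      also have "\<dots> = KG\<^sup>2 * (norm (L0 z' + Nf p z))\<^sup>2" by (simp add: power_mult_distrib)
      also have "\<dots> \<le> C * (norm (L0 z' + Nf p z))\<^sup>2" unfolding C_def using C0F by (intro mult_right_mono) (auto simp: sum_nonneg)
      finally show ?thesis .
    qed
    then show ?thesis using True by (intro exI[of _ "\<lambda>z w. 0"]) (auto simp: bilinear_def intro!: linearI)
  next
    case False
    define r where "r = norm p"
    have r: "r > 0" unfolding r_def using False by simp
    define u where "u = p /\<^sub>R r"
    have "u \<in> K" using p r unfolding K_def W_def u_def r_def by simp
    then obtain p1 where p1: "p1 \<in> F" "u \<in> ball p1 (\<delta> p1)" using F by blast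
    have p1K: "p1 \<in> K" using p1 F by blast
    have g: "good p1 (q0 p1) (C0 p1)" by (rule qC[OF p1K])
    then have "bilinear (q0 p1)" unfolding good_def by simp
    then have bl: "linear (\<lambda>z. q0 p1 z w)" "linear (\<lambda>w. q0 p1 z w)" for z w unfolding bilinear_def by blast+
    have "4 * C0 p1 \<le> (\<Sum>p\<in>F. 4 * C0 p)" using p1 F C0F by (intro member_le_sum) auto
    then have C4: "4 * C0 p1 \<le> C" unfolding C_def by (simp add: add_increasing2)
    \<comment> \<open>Apply the unit case to z' / r and multiply by r^2: the form picks up one
      factor r.\<close>
    have ineq: "r\<^sup>2 * (norm z)\<^sup>2 + (norm z')\<^sup>2 + 2 * (2 * r * q0 p1 z z') \<le> C * (norm (L0 z' + Nf p z))\<^sup>2" for z z'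
    proof -
      have "(norm z)\<^sup>2 + (norm (z' /\<^sub>R r))\<^sup>2 + 2 * (2 * q0 p1 z (z' /\<^sub>R r)) \<le> 4 * C0 p1 * (norm (L0 (z' /\<^sub>R r) + Nf u z))\<^sup>2"
        by (rule near[OF p1K p1(2)])
      also have "L0 (z' /\<^sub>R r) + Nf u z = (L0 z' + Nf p z) /\<^sub>R r" unfolding u_def
        by (simp add: linear_scale[OF L0] linear_scale[OF linN(2)] algebra_simps)
      also have "4 * C0 p1 * (norm ((L0 z' + Nf p z) /\<^sub>R r))\<^sup>2 \<le> C * (norm ((L0 z' + Nf p z) /\<^sub>R r))\<^sup>2"
        using C4 by (intro mult_right_mono) auto
      finally have "r\<^sup>2 * ((norm z)\<^sup>2 + (norm (z' /\<^sub>R r))\<^sup>2 + 2 * (2 * q0 p1 z (z' /\<^sub>R r))) \<le> r\<^sup>2 * (C * (norm ((L0 z' + Nf p z) /\<^sub>R r))\<^sup>2)"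
        by (intro mult_left_mono) auto
      moreover have "r\<^sup>2 * (norm (z' /\<^sub>R r))\<^sup>2 = (norm z')\<^sup>2" using r by (simp add: power_mult_distrib power_inverse)
      moreover have "r\<^sup>2 * (norm ((L0 z' + Nf p z) /\<^sub>R r))\<^sup>2 = (norm (L0 z' + Nf p z))\<^sup>2"
        using r by (simp add: power_mult_distrib power_inverse del: scaleR_add_right)
      moreover have "r\<^sup>2 * q0 p1 z (z' /\<^sub>R r) = r * q0 p1 z z'" using r by (simp add: linear_scale[OF bl(2)] power2_eq_square)
      moreover have "a * (b + c + 2 * (2 * d)) \<le> a * (C * e) \<longleftrightarrow> a * b + a * c + 4 * (a * d) \<le> C * (a * e)" for a b c d e :: real
        by (simp add: algebra_simps)
      ultimately show ?thesis by simp
    qed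
    have "bilinear (\<lambda>z w. 2 * r * q0 p1 z w)" using g unfolding good_def by (intro bilinear_cmult) simp
    then show ?thesis using ineq g r unfolding good_def r_def
      by (intro exI[of _ "\<lambda>z w. 2 * r * q0 p1 z w"]) (auto simp: r_def)
  qed
  show ?thesis unfolding tangentially_dissipative_def
  proof (intro exI[of _ C] conjI C0 allI impI)
    fix \<alpha> \<beta> :: "real^'n" assume ab: "\<alpha> $ k = 0" "\<beta> $ k = 0"
    then have "(\<alpha>, \<beta>) \<in> W" unfolding W_def by simp
    from main[OF this] obtain q where q: "bilinear q" "\<forall>z w. q z w = q w z" "\<forall>z. 0 \<le> q z z" and
      ineq: "\<And>z z'. (norm (\<alpha>, \<beta>))\<^sup>2 * (norm z)\<^sup>2 + (norm z')\<^sup>2 + 2 * q z z' \<le> C * (norm (L0 z' + Nf (\<alpha>, \<beta>) z))\<^sup>2" by blast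
    have "(norm (tensor a \<alpha> - tensor b \<beta> + tensor a' ?e))\<^sup>2 + (norm (tensor b \<alpha> + tensor a \<beta> + tensor b' ?e))\<^sup>2 + 2 * q (a, b) (a', b')
        \<le> C * ((norm (P (tensor a \<alpha> - tensor b \<beta> + tensor a' ?e)))\<^sup>2 + (norm (P (tensor b \<alpha> + tensor a \<beta> + tensor b' ?e)))\<^sup>2)" for a b a' b'
    proof -
      have e: "\<alpha> \<bullet> ?e = 0" "\<beta> \<bullet> ?e = 0" "?e \<bullet> \<alpha> = 0" "?e \<bullet> \<beta> = 0" using ab by (simp_all add: inner_axis inner_axis')
      \<comment> \<open>\<alpha> and \<beta> are orthogonal to e_k, and the mixed terms 2 (a . b)
        (\<alpha> . \<beta>) of the two squares cancel.\<close>
      have "(norm (tensor a \<alpha> - tensor b \<beta> + tensor a' ?e))\<^sup>2 + (norm (tensor b \<alpha> + tensor a \<beta> + tensor b' ?e))\<^sup>2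
         = (norm (\<alpha>, \<beta>))\<^sup>2 * (norm (a, b))\<^sup>2 + (norm (a', b'))\<^sup>2"
        unfolding power2_norm_eq_inner inner_Pair
        by (simp add: inner_add_left inner_add_right inner_diff_left inner_diff_right inner_tensor e ee inner_commute[of b a] inner_commute[of \<beta> \<alpha>] algebra_simps)
      moreover have "(norm (L0 (a', b') + Nf (\<alpha>, \<beta>) (a, b)))\<^sup>2 = (norm (P (tensor a \<alpha> - tensor b \<beta> + tensor a' ?e)))\<^sup>2 + (norm (P (tensor b \<alpha> + tensor a \<beta> + tensor b' ?e)))\<^sup>2"
        unfolding L0_def Nf_def by (simp add: norm_Pair linear_add[OF P] linear_diff[OF P] algebra_simps)
      ultimately show ?thesis using ineq[of "(a, b)" "(a', b')"] by simp
    qed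
    then show "\<exists>q. bilinear q \<and> (\<forall>z w. q z w = q w z) \<and> (\<forall>z. 0 \<le> q z z) \<and>
       (\<forall>a b a' b'. (norm (tensor a \<alpha> - tensor b \<beta> + tensor a' (axis k 1)))\<^sup>2
           + (norm (tensor b \<alpha> + tensor a \<beta> + tensor b' (axis k 1)))\<^sup>2 + 2 * q (a, b) (a', b')
         \<le> C * ((norm (P (tensor a \<alpha> - tensor b \<beta> + tensor a' (axis k 1))))\<^sup>2
           + (norm (P (tensor b \<alpha> + tensor a \<beta> + tensor b' (axis k 1))))\<^sup>2))" using q by blast
  qed
qed

section \<open>Directional derivatives and integrals of boundedly supported functions\<close>

abbreviation lint :: "('a::euclidean_space \<Rightarrow> 'b::euclidean_space) \<Rightarrow> 'b" where
  "lint f \<equiv> integral\<^sup>L lborel f"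

text \<open>Only the behaviour along one line matters. Functions cut off by an indicator that is
  constant along the direction e still have this derivative where no full derivative exists.\<close>

definition dir_deriv :: "('a::real_normed_vector \<Rightarrow> 'b::real_normed_vector) \<Rightarrow> 'a \<Rightarrow> 'a \<Rightarrow> 'b \<Rightarrow> bool" where
  "dir_deriv f e x d \<longleftrightarrow> ((\<lambda>t. f (x + t *\<^sub>R e)) has_vector_derivative d) (at 0)"

lemma dir_deriv_real: "dir_deriv f e x d \<longleftrightarrow> ((\<lambda>t. f (x + t *\<^sub>R e)) has_real_derivative d) (at 0)"
  unfolding dir_deriv_def by (simp add: has_real_derivative_iff_has_vector_derivative)

lemma dir_deriv_at: "dir_deriv f e (x + s *\<^sub>R e) d \<longleftrightarrow> ((\<lambda>t. f (x + t *\<^sub>R e)) has_vector_derivative d) (at s)"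
  unfolding dir_deriv_def has_vector_derivative_def has_derivative_at by (simp add: algebra_simps)

lemma has_derivative_imp_dir_deriv:
  assumes "(f has_derivative D) (at x)" shows "dir_deriv f e x (D e)"
proof -
  interpret bounded_linear D by (rule has_derivative_bounded_linear[OF assms])
  have "((\<lambda>t. x + t *\<^sub>R e) has_derivative (\<lambda>t. t *\<^sub>R e)) (at 0)" by (auto intro!: derivative_eq_intros)
  moreover have "(f has_derivative D) (at (x + 0 *\<^sub>R e))" using assms by simp
  ultimately have "((\<lambda>t. f (x + t *\<^sub>R e)) has_derivative (\<lambda>t. D (t *\<^sub>R e))) (at 0)"
    by (rule has_derivative_compose)
  then show ?thesis unfolding dir_deriv_def has_vector_derivative_def by (simp add: scaleR)
qed

lemma dir_deriv_local:
  assumes "dir_deriv f e x d" "open S" "x \<in> S" "\<And>y. y \<in> S \<Longrightarrow> f y = g y"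
  shows "dir_deriv g e x d"
  unfolding dir_deriv_def
proof (rule has_vector_derivative_transform_within_open[of "\<lambda>t. f (x + t *\<^sub>R e)" d 0 "(\<lambda>t. x + t *\<^sub>R e) -` S"])
  show "open ((\<lambda>t::real. x + t *\<^sub>R e) -` S)"
    by (intro continuous_open_vimage assms continuous_intros)
qed (use assms in \<open>auto simp: dir_deriv_def\<close>)

lemma dir_deriv_const: "dir_deriv (\<lambda>x. c) e x 0"
  unfolding dir_deriv_def by simp

lemma dir_deriv_diff: "dir_deriv f e x d \<Longrightarrow> dir_deriv g e x d' \<Longrightarrow> dir_deriv (\<lambda>x. f x - g x) e x (d - d')"
  unfolding dir_deriv_def by (rule has_vector_derivative_diff)

lemma dir_deriv_bilinear:
  assumes "bounded_bilinear h" "dir_deriv f e x d" "dir_deriv g e x d'"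
  shows "dir_deriv (\<lambda>x. h (f x) (g x)) e x (h (f x) d' + h d (g x))"
  using bounded_bilinear.has_vector_derivative[OF assms(1), of "\<lambda>t. f (x + t *\<^sub>R e)" d 0 UNIV "\<lambda>t. g (x + t *\<^sub>R e)" d'] assms(2,3)
  unfolding dir_deriv_def by simp

lemmas dir_deriv_mult = dir_deriv_bilinear[OF bounded_bilinear_mult]
lemmas dir_deriv_inner = dir_deriv_bilinear[OF bounded_bilinear_inner]

lemma dir_deriv_linear:
  assumes "bounded_linear h" "dir_deriv f e x d" shows "dir_deriv (\<lambda>x. h (f x)) e x (h d)"
  using bounded_linear.has_vector_derivative[OF assms(1)] assms(2) unfolding dir_deriv_def by blast

lemma dir_deriv_sum: "(\<And>i. i \<in> I \<Longrightarrow> dir_deriv (f i) e x (d i)) \<Longrightarrow> dir_deriv (\<lambda>x. \<Sum>i\<in>I. f i x) e x (\<Sum>i\<in>I. d i)"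
  unfolding dir_deriv_def by (rule has_vector_derivative_sum)

lemma dir_deriv_Pair: "dir_deriv f e x d \<Longrightarrow> dir_deriv g e x d' \<Longrightarrow> dir_deriv (\<lambda>x. (f x, g x)) e x (d, d')"
  unfolding dir_deriv_def by (rule has_vector_derivative_Pair)

lemma dir_deriv_chain:
  assumes "(h has_real_derivative h') (at (f x))" "dir_deriv f e x d"
  shows "dir_deriv (\<lambda>x. h (f x)) e x (h' * d)"
  using DERIV_chain2[of h h' "\<lambda>t. f (x + t *\<^sub>R e)" 0 d UNIV] assms unfolding dir_deriv_real by simp

lemma dir_deriv_translate: "dir_deriv f e (x + c) d \<Longrightarrow> dir_deriv (\<lambda>x. f (x + c)) e x d"
  unfolding dir_deriv_def by (simp add: ac_simps)

lemma dir_deriv_quotient_tendsto: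
  assumes f: "dir_deriv f e x d" and h: "h \<longlonglongrightarrow> 0" "\<And>n. h n \<noteq> 0"
  shows "(\<lambda>n. (f (x + h n *\<^sub>R e) - f x) /\<^sub>R h n) \<longlonglongrightarrow> d"
proof -
  have "((\<lambda>s. norm (f (x + s *\<^sub>R e) - f x - s *\<^sub>R d) / norm s) \<longlongrightarrow> 0) (at 0)"
    using f unfolding dir_deriv_def has_vector_derivative_def has_derivative_at by simp
  moreover have "filterlim h (at 0) sequentially" using h by (simp add: filterlim_at)
  ultimately have "(\<lambda>n. norm (f (x + h n *\<^sub>R e) - f x - h n *\<^sub>R d) / norm (h n)) \<longlonglongrightarrow> 0"
    by (rule filterlim_compose)
  moreover have "norm (f (x + h n *\<^sub>R e) - f x - h n *\<^sub>R d) / norm (h n) = norm ((f (x + h n *\<^sub>R e) - f x) /\<^sub>R h n - d)" for n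
  proof -
    have "(f (x + h n *\<^sub>R e) - f x) /\<^sub>R h n - d = (f (x + h n *\<^sub>R e) - f x - h n *\<^sub>R d) /\<^sub>R h n"
      using h(2)[of n] by (simp add: scaleR_diff_right)
    then show ?thesis by (simp add: divide_inverse mult.commute)
  qed
  ultimately have "(\<lambda>n. (f (x + h n *\<^sub>R e) - f x) /\<^sub>R h n - d) \<longlonglongrightarrow> 0" by (simp add: tendsto_norm_zero_iff)
  then show ?thesis by (simp add: LIM_zero_iff)
qed

text \<open>Supplies the uniform bound for dominated convergence of difference quotients.\<close>

lemma dir_deriv_quotient_bound:
  assumes "h > 0" and d: "\<And>t. 0 \<le> t \<Longrightarrow> t \<le> h \<Longrightarrow> dir_deriv f e (x + t *\<^sub>R e) (g t)"
    and B: "\<And>t. 0 \<le> t \<Longrightarrow> t \<le> h \<Longrightarrow> norm (g t) \<le> B"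
  shows "norm ((f (x + h *\<^sub>R e) - f x) /\<^sub>R h) \<le> B"
proof -
  have "norm (f (x + h *\<^sub>R e) - f (x + 0 *\<^sub>R e)) \<le> B * norm (h - 0)"
  proof (rule differentiable_bound[where S = "{0..h}" and f = "\<lambda>t. f (x + t *\<^sub>R e)" and f' = "\<lambda>t s. s *\<^sub>R g t"])
    show "((\<lambda>t. f (x + t *\<^sub>R e)) has_derivative (\<lambda>s. s *\<^sub>R g t)) (at t within {0..h})" if "t \<in> {0..h}" for t
      using d[of t] that unfolding dir_deriv_at has_vector_derivative_def by (auto intro: has_derivative_at_withinI)
    show "onorm (\<lambda>s. s *\<^sub>R g t) \<le> B" if "t \<in> {0..h}" for t
    proof (rule onorm_le)
      fix s show "norm (s *\<^sub>R g t) \<le> B * norm s" using mult_right_mono[OF B[of t], of "\<bar>s\<bar>"] that by (simp add: mult.commute)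
    qed
  qed (use assms in auto)
  then have "norm (f (x + h *\<^sub>R e) - f x) / h \<le> B" using assms(1) by (simp add: divide_le_eq)
  then show ?thesis using assms(1) by (simp add: divide_inverse mult.commute)
qed

text \<open>Continuity is not asked for, since the functions jump at the boundary. The class
  consists of integrable functions and is closed under translations, products, linear images and
  cutting by Borel sets, so integrability is settled by closure rules throughout.\<close>

definition bdd_supp :: "('a::euclidean_space \<Rightarrow> 'b::euclidean_space) \<Rightarrow> bool" where
  "bdd_supp f \<longleftrightarrow> f \<in> borel_measurable borel \<and> (\<exists>R B. \<forall>x. norm (f x) \<le> B \<and> (R \<le> norm x \<longrightarrow> f x = 0))"

lemma bdd_suppE:
  assumes "bdd_supp f"
  obtains R B where "R > 0" "B > 0" "\<And>x. norm (f x) \<le> B" "\<And>x. R \<le> norm x \<Longrightarrow> f x = 0"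
proof -
  obtain R B where RB: "\<And>x. norm (f x) \<le> B \<and> (R \<le> norm x \<longrightarrow> f x = 0)" using assms unfolding bdd_supp_def by blast
  show thesis by (rule that[of "max R 1" "max B 1"]) (use RB in \<open>auto simp: le_max_iff_disj\<close>)
qed

lemma bdd_supp_measurable: "bdd_supp f \<Longrightarrow> f \<in> borel_measurable borel"
  unfolding bdd_supp_def by simp

lemma bdd_supp_integrable: assumes "bdd_supp f" shows "integrable lborel f"
proof -
  obtain R B where RB: "R > 0" "\<And>x. norm (f x) \<le> B" "\<And>x. R \<le> norm x \<Longrightarrow> f x = 0" using bdd_suppE[OF assms] by metis
  show ?thesis
    by (rule integrableI_bounded_set[of "cball 0 R" _ _ B])
      (use RB bdd_supp_measurable[OF assms] emeasure_lborel_cball_finite[of 0 R] in auto)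
qed

lemma bdd_supp_comp:
  assumes "bdd_supp f" "continuous_on UNIV h" "h 0 = 0" shows "bdd_supp (\<lambda>x. h (f x))"
proof -
  obtain R B where RB: "R > 0" "\<And>x. norm (f x) \<le> B" "\<And>x. R \<le> norm x \<Longrightarrow> f x = 0" using bdd_suppE[OF assms(1)] by metis
  have "compact (h ` cball 0 B)" using assms(2) by (intro compact_continuous_image) (auto intro: continuous_on_subset)
  then have "bounded (h ` cball 0 B)" by (rule compact_imp_bounded)
  then obtain B' where "\<forall>y\<in>h ` cball 0 B. norm y \<le> B'" unfolding bounded_iff by blast
  then have B': "norm (h y) \<le> B'" if "y \<in> cball 0 B" for y using that by blast
  have "(\<lambda>x. h (f x)) \<in> borel_measurable borel"
    using borel_measurable_continuous_onI[OF assms(2)] bdd_supp_measurable[OF assms(1)] by measurable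
  then show ?thesis unfolding bdd_supp_def using RB B' assms(3) by (intro conjI exI[of _ R] exI[of _ B']) auto
qed

lemma bdd_supp_Pair:
  assumes "bdd_supp f" "bdd_supp g" shows "bdd_supp (\<lambda>x. (f x, g x))"
proof -
  obtain R B where RB: "R > 0" "\<And>x. norm (f x) \<le> B" "\<And>x. R \<le> norm x \<Longrightarrow> f x = 0" using bdd_suppE[OF assms(1)] by metis
  obtain R' B' where RB': "R' > 0" "\<And>x. norm (g x) \<le> B'" "\<And>x. R' \<le> norm x \<Longrightarrow> g x = 0" using bdd_suppE[OF assms(2)] by metis
  have "norm (f x, g x) \<le> B + B'" for x using norm_Pair_le[of "f x" "g x"] RB(2)[of x] RB'(2)[of x] by linarith
  then show ?thesis unfolding bdd_supp_def using bdd_supp_measurable[OF assms(1)] bdd_supp_measurable[OF assms(2)] RB RB'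
    by (intro conjI exI[of _ "max R R'"] exI[of _ "B + B'"]) (auto simp: zero_prod_def)
qed

lemma bdd_supp_linear: assumes "bdd_supp f" "linear h" shows "bdd_supp (\<lambda>x. h (f x))"
proof (rule bdd_supp_comp[OF assms(1)])
  show "continuous_on UNIV h" using assms(2) by (simp add: linear_continuous_on linear_conv_bounded_linear)
qed (rule linear_0[OF assms(2)])

lemma bdd_supp_bilinear:
  assumes h: "bounded_bilinear h" and "bdd_supp f" "bdd_supp g" shows "bdd_supp (\<lambda>x. h (f x) (g x))"
  using bdd_supp_comp[OF bdd_supp_Pair[OF assms(2,3)], of "\<lambda>p. h (fst p) (snd p)"]
    bounded_bilinear.continuous_on[OF h continuous_on_fst[OF continuous_on_id] continuous_on_snd[OF continuous_on_id], of UNIV]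
    bounded_bilinear.zero_left[OF h] by simp

lemmas bdd_supp_mult = bdd_supp_bilinear[OF bounded_bilinear_mult]
lemmas bdd_supp_inner = bdd_supp_bilinear[OF bounded_bilinear_inner]

lemma bdd_supp_zero: "bdd_supp (\<lambda>x. 0)" unfolding bdd_supp_def by auto

lemma bdd_supp_add: assumes "bdd_supp f" "bdd_supp g" shows "bdd_supp (\<lambda>x. f x + g x)"
proof -
  have "continuous_on UNIV (\<lambda>p::'b \<times> 'b. fst p + snd p)" by (intro continuous_intros)
  from bdd_supp_comp[OF bdd_supp_Pair[OF assms] this] show ?thesis by simp
qed

lemma bdd_supp_cscale: assumes "bdd_supp f" shows "bdd_supp (\<lambda>x. c *\<^sub>R f x)"
  by (rule bdd_supp_linear[OF assms]) simp

lemma bdd_supp_minus: "bdd_supp f \<Longrightarrow> bdd_supp (\<lambda>x. - f x)"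
  using bdd_supp_cscale[of f "-1"] by simp

lemma bdd_supp_diff: "bdd_supp f \<Longrightarrow> bdd_supp g \<Longrightarrow> bdd_supp (\<lambda>x. f x - g x)"
  using bdd_supp_add[OF _ bdd_supp_minus, of f g] by simp

lemma bdd_supp_cmult: "bdd_supp f \<Longrightarrow> bdd_supp (\<lambda>x. c * f x :: real)"
  using bdd_supp_cscale[of f c] by simp

lemma bdd_supp_norm2: "bdd_supp f \<Longrightarrow> bdd_supp (\<lambda>x. (norm (f x))\<^sup>2)"
  unfolding power2_norm_eq_inner by (rule bdd_supp_inner)

lemma bdd_supp_sum: "(\<And>i. i \<in> I \<Longrightarrow> bdd_supp (f i)) \<Longrightarrow> bdd_supp (\<lambda>x. \<Sum>i\<in>I. f i x)"
  by (induction I rule: infinite_finite_induct) (auto simp: bdd_supp_zero bdd_supp_add)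

lemma bdd_supp_vec:
  fixes f :: "'n::finite \<Rightarrow> 'a::euclidean_space \<Rightarrow> 'b::euclidean_space"
  assumes "\<And>j. bdd_supp (f j)" shows "bdd_supp (\<lambda>x. \<chi> j. f j x)"
proof -
  have "linear (axis j :: 'b \<Rightarrow> 'b^'n)" for j
    by (rule linearI) (auto simp: axis_def vec_eq_iff)
  then have "bdd_supp (\<lambda>x. axis j (f j x) :: 'b^'n)" for j by (rule bdd_supp_linear[OF assms])
  then have "bdd_supp (\<lambda>x. \<Sum>j\<in>UNIV. axis j (f j x) :: 'b^'n)" by (rule bdd_supp_sum)
  moreover have "(\<Sum>j\<in>UNIV. axis j (f j x)) = (\<chi> j. f j x)" for x
    by (simp add: vec_eq_iff axis_def sum.If_cases)
  ultimately show ?thesis by simp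
qed

lemma bdd_supp_nth: "bdd_supp f \<Longrightarrow> bdd_supp (\<lambda>x. f x $ j)"
  by (rule bdd_supp_linear[of f "\<lambda>v. v $ j"]) (auto intro: linearI)

lemma bdd_supp_indicator: assumes "bdd_supp f" "A \<in> sets borel" shows "bdd_supp (\<lambda>x. indicator A x *\<^sub>R f x)"
proof -
  obtain R B where RB: "R > 0" "\<And>x. norm (f x) \<le> B" "\<And>x. R \<le> norm x \<Longrightarrow> f x = 0" using bdd_suppE[OF assms(1)] by metis
  have "norm (indicator A x *\<^sub>R f x) \<le> B" for x
    using RB(2)[of x] order_trans[OF norm_ge_zero RB(2)[of x]] by (simp add: indicator_def)
  moreover have "(\<lambda>x. indicator A x *\<^sub>R f x) \<in> borel_measurable borel"
    using bdd_supp_measurable[OF assms(1)] assms(2) by measurable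
  ultimately show ?thesis unfolding bdd_supp_def using RB by (intro conjI exI[of _ R] exI[of _ B]) auto
qed

lemma bdd_supp_translate: assumes "bdd_supp f" shows "bdd_supp (\<lambda>x. f (x + c))"
proof -
  obtain R B where RB: "R > 0" "\<And>x. norm (f x) \<le> B" "\<And>x. R \<le> norm x \<Longrightarrow> f x = 0" using bdd_suppE[OF assms] by metis
  have "f (x + c) = 0" if "R + norm c \<le> norm x" for x
    using norm_triangle_ineq4[of "x + c" c] that by (intro RB) simp
  moreover have "(\<lambda>x. f (x + c)) \<in> borel_measurable borel" using bdd_supp_measurable[OF assms] by measurable
  ultimately show ?thesis unfolding bdd_supp_def using RB by (intro conjI exI[of _ "R + norm c"] exI[of _ B]) auto
qed

lemma lborel_integral_translate:
  fixes f :: "'a::euclidean_space \<Rightarrow> 'b::euclidean_space"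
  assumes "f \<in> borel_measurable borel"
  shows "lint (\<lambda>x. f (x + c)) = lint f"
proof -
  have "lint f = integral\<^sup>L (distr lborel borel ((+) c)) f" by (simp add: lborel_distr_plus)
  also have "\<dots> = lint (\<lambda>x. f (c + x))" using assms by (subst integral_distr) auto
  finally show ?thesis by (simp add: add.commute)
qed

section \<open>Integration by parts as a limit of difference quotients\<close>

lemma integral_limit_bounded_support:
  fixes f :: "'a::euclidean_space \<Rightarrow> 'b::euclidean_space"
  assumes "\<And>n. s n \<in> borel_measurable borel" "\<And>x. (\<lambda>n. s n x) \<longlonglongrightarrow> f x"
    and "\<And>n x. norm (s n x) \<le> B" "\<And>n x. R \<le> norm x \<Longrightarrow> s n x = 0"
  shows "(\<lambda>n. lint (s n)) \<longlonglongrightarrow> lint f"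
proof (rule integral_dominated_convergence[where w = "\<lambda>x. \<bar>B\<bar> * indicator (cball 0 R) x"])
  show "f \<in> borel_measurable lborel" using borel_measurable_LIMSEQ_metric[OF assms(1,2)] by simp
  show "integrable lborel (\<lambda>x. \<bar>B\<bar> * indicator (cball 0 R :: 'a set) x :: real)"
    using emeasure_lborel_cball_finite[of "0::'a" R] by (intro integrable_mult_right integrable_real_indicator) auto
  show "AE x in lborel. norm (s n x) \<le> \<bar>B\<bar> * indicator (cball 0 R) x" for n
  proof (rule AE_I2)
    fix x show "norm (s n x) \<le> \<bar>B\<bar> * indicator (cball 0 R) x"
      using assms(3)[of n x] assms(4)[of x n] by (cases "x \<in> cball 0 R") (auto simp: indicator_def)
  qed
qed (use assms in auto)

text \<open>Each difference quotient has integral zero by translation invariance, and dominated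
  convergence passes to the derivative.\<close>

lemma integral_dir_deriv_zero:
  fixes q :: "'a::euclidean_space \<Rightarrow> real"
  assumes q: "bdd_supp q" and q': "bdd_supp q'" and d: "\<And>x. dir_deriv q e x (q' x)"
  shows "lint q' = 0"
proof -
  obtain R B where RB: "R > 0" "\<And>x. norm (q x) \<le> B" "\<And>x. R \<le> norm x \<Longrightarrow> q x = 0" using bdd_suppE[OF q] by metis
  obtain B' where B': "\<And>x. norm (q' x) \<le> B'" using bdd_suppE[OF q'] by metis
  define h where "h n = 1 / real (Suc n)" for n
  have h: "h \<longlonglongrightarrow> 0" "\<And>n. h n > 0" "\<And>n. h n \<le> 1" unfolding h_def using LIMSEQ_inverse_real_of_nat by (auto simp: inverse_eq_divide)
  define s where "s n x = (q (x + h n *\<^sub>R e) - q x) /\<^sub>R h n" for n x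
  have sb: "bdd_supp (s n)" for n unfolding s_def by (intro bdd_supp_cscale bdd_supp_diff bdd_supp_translate q)
  have "(\<lambda>n. lint (s n)) \<longlonglongrightarrow> lint q'"
  proof (rule integral_limit_bounded_support)
    show "(\<lambda>n. s n x) \<longlonglongrightarrow> q' x" for x unfolding s_def using h(2) by (intro dir_deriv_quotient_tendsto[OF d h(1)]) (metis less_irrefl)
    show "norm (s n x) \<le> B'" for n x unfolding s_def by (rule dir_deriv_quotient_bound[OF h(2) d]) (rule B')
    show "s n x = 0" if "R + norm e \<le> norm x" for n x
    proof -
      have "norm (h n *\<^sub>R e) \<le> norm e" using h(2)[of n] h(3)[of n] by (simp add: mult_left_le_one_le)
      moreover have "norm x \<le> norm (x + h n *\<^sub>R e) + norm (h n *\<^sub>R e)" using norm_triangle_ineq4[of "x + h n *\<^sub>R e" "h n *\<^sub>R e"] by simp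
      ultimately have "R \<le> norm (x + h n *\<^sub>R e)" "R \<le> norm x" using that norm_ge_zero[of e] by linarith+
      then show ?thesis unfolding s_def by (simp add: RB(3))
    qed
  qed (use sb bdd_supp_measurable in auto)
  moreover have "lint (s n) = 0" for n
    unfolding s_def using q by (simp add: bdd_supp_integrable bdd_supp_translate lborel_integral_translate bdd_supp_measurable)
  ultimately show ?thesis by (simp add: LIMSEQ_const_iff)
qed

text \<open>Morally the integral equals that of q over the hyperplane x_k = 0, approached from
  inside. Without a trace: the difference quotients restricted to x_k < -h have as integral 1/h
  times the integral of q over the strip x_k \<ge> -h, which is nonnegative.\<close>

lemma integral_dir_deriv_halfspace_nonneg:
  fixes q :: "real^'n::finite \<Rightarrow> real" and k :: 'n
  assumes q: "bdd_supp q" and q': "bdd_supp q'" and d: "\<And>x. x $ k < 0 \<Longrightarrow> dir_deriv q (axis k 1) x (q' x)"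
    and pos: "\<And>x. 0 \<le> q x" and z: "\<And>x. 0 \<le> x $ k \<Longrightarrow> q x = 0" "\<And>x. 0 \<le> x $ k \<Longrightarrow> q' x = 0"
  shows "0 \<le> lint q'"
proof -
  let ?e = "axis k 1 :: real^'n"
  obtain R B where RB: "R > 0" "\<And>x. norm (q x) \<le> B" "\<And>x. R \<le> norm x \<Longrightarrow> q x = 0" using bdd_suppE[OF q] by metis
  obtain B' where B': "\<And>x. norm (q' x) \<le> B'" using bdd_suppE[OF q'] by metis
  define h where "h n = 1 / real (Suc n)" for n
  have h: "h \<longlonglongrightarrow> 0" "\<And>n. h n > 0" "\<And>n. h n \<le> 1" unfolding h_def using LIMSEQ_inverse_real_of_nat by (auto simp: inverse_eq_divide)
  \<comment> \<open>For x_k < -h the segment from x to x + h e_k stays where q is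
    differentiable.\<close>
  define A where "A n = {x::real^'n. x $ k < - h n}" for n
  have A: "A n \<in> sets borel" for n unfolding A_def by measurable
  define s where "s n x = indicator (A n) x *\<^sub>R ((q (x + h n *\<^sub>R ?e) - q x) /\<^sub>R h n)" for n x
  have sb: "bdd_supp (s n)" for n unfolding s_def by (intro bdd_supp_indicator bdd_supp_cscale bdd_supp_diff bdd_supp_translate q A)
  have "(\<lambda>n. lint (s n)) \<longlonglongrightarrow> lint q'"
  proof (rule integral_limit_bounded_support)
    show "(\<lambda>n. s n x) \<longlonglongrightarrow> q' x" for x
    proof (cases "x $ k < 0")
      case True
      have "(\<lambda>n. (q (x + h n *\<^sub>R ?e) - q x) /\<^sub>R h n) \<longlonglongrightarrow> q' x"
        using h(2) by (intro dir_deriv_quotient_tendsto[OF d[OF True] h(1)]) (metis less_irrefl)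
      moreover have "eventually (\<lambda>n. (q (x + h n *\<^sub>R ?e) - q x) /\<^sub>R h n = s n x) sequentially"
      proof -
        have "eventually (\<lambda>n. h n < - x $ k) sequentially" using h(1) True by (intro order_tendstoD) auto
        then show ?thesis by eventually_elim (auto simp: s_def A_def)
      qed
      ultimately show ?thesis by (rule Lim_transform_eventually)
    next
      case False
      have "s n x = 0" for n using False h(2)[of n] unfolding s_def A_def by (auto simp: indicator_def)
      then show ?thesis using z(2)[of x] False by simp
    qed
    show "norm (s n x) \<le> B'" for n x
    proof (cases "x \<in> A n")
      case True
      have "norm ((q (x + h n *\<^sub>R ?e) - q x) /\<^sub>R h n) \<le> B'"
      proof (rule dir_deriv_quotient_bound[OF h(2)])
        fix t assume "0 \<le> t" "t \<le> h n"
        then show "dir_deriv q ?e (x + t *\<^sub>R ?e) (q' (x + t *\<^sub>R ?e))" using True unfolding A_def by (intro d) (simp add: axis_def)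
      qed (rule B')
      then show ?thesis using True unfolding s_def by simp
    next
      case False
      then show ?thesis unfolding s_def using order_trans[OF norm_ge_zero B'[of x]] by simp
    qed
    show "s n x = 0" if "R + 1 \<le> norm x" for n x
    proof -
      have "norm (h n *\<^sub>R ?e) \<le> 1" using h(2)[of n] h(3)[of n] by simp
      moreover have "norm x \<le> norm (x + h n *\<^sub>R ?e) + norm (h n *\<^sub>R ?e)" using norm_triangle_ineq4[of "x + h n *\<^sub>R ?e" "h n *\<^sub>R ?e"] by simp
      ultimately have "R \<le> norm (x + h n *\<^sub>R ?e)" "R \<le> norm x" using that by linarith+
      then show ?thesis unfolding s_def by (simp add: RB(3))
    qed
  qed (use sb bdd_supp_measurable in auto)
  moreover have "0 \<le> lint (s n)" for n
  proof -
    \<comment> \<open>The indicator may be removed from the shifted term, because for x_k \<ge> -h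
      the point x + h e_k lies where q vanishes.\<close>
    have "s n x = (q (x + h n *\<^sub>R ?e) - indicator (A n) x *\<^sub>R q x) /\<^sub>R h n" for x
      using z(1)[of "x + h n *\<^sub>R ?e"] unfolding s_def A_def by (auto simp: indicator_def axis_def)
    then have sn: "s n = (\<lambda>x. (q (x + h n *\<^sub>R ?e) - indicator (A n) x *\<^sub>R q x) /\<^sub>R h n)" by (rule ext)
    have "lint (s n) = (lint q - lint (\<lambda>x. indicator (A n) x *\<^sub>R q x)) /\<^sub>R h n"
      unfolding sn using bdd_supp_integrable[OF bdd_supp_translate[OF q]] bdd_supp_integrable[OF bdd_supp_indicator[OF q A]]
      by (simp add: lborel_integral_translate bdd_supp_measurable[OF q])
    moreover have "lint (\<lambda>x. indicator (A n) x *\<^sub>R q x) \<le> lint q"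
      using pos by (intro integral_mono bdd_supp_integrable bdd_supp_indicator q A) (auto simp: indicator_def)
    ultimately show ?thesis using h(2)[of n] by simp
  qed
  ultimately show ?thesis by (intro LIMSEQ_le_const) auto
qed

lemma integral_mixed_dir_deriv_swap:
  fixes f g :: "'a::euclidean_space \<Rightarrow> real"
  assumes b: "bdd_supp f" "bdd_supp g" "bdd_supp fi" "bdd_supp fj" "bdd_supp gi" "bdd_supp gj"
    and d: "\<And>x. dir_deriv f e x (fi x)" "\<And>x. dir_deriv f e' x (fj x)" "\<And>x. dir_deriv g e x (gi x)" "\<And>x. dir_deriv g e' x (gj x)"
  shows "lint (\<lambda>x. fi x * gj x) = lint (\<lambda>x. fj x * gi x)"
proof -
  define h where "h n = 1 / real (Suc n)" for n
  have h: "h \<longlonglongrightarrow> 0" "\<And>n. h n > 0" "\<And>n. h n \<noteq> 0" unfolding h_def using LIMSEQ_inverse_real_of_nat by (auto simp: inverse_eq_divide)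
  obtain Rf where Rf: "\<And>x. Rf \<le> norm x \<Longrightarrow> fi x = 0" using bdd_suppE[OF b(3)] by metis
  obtain Bf where Bf: "Bf > 0" "\<And>x. norm (fi x) \<le> Bf" using bdd_suppE[OF b(3)] by metis
  obtain Bj where Bj: "Bj > 0" "\<And>x. norm (fj x) \<le> Bj" using bdd_suppE[OF b(4)] by metis
  obtain Rg where Rg: "\<And>x. Rg \<le> norm x \<Longrightarrow> gi x = 0" using bdd_suppE[OF b(5)] by metis
  obtain Bi where Bi: "Bi > 0" "\<And>x. norm (gi x) \<le> Bi" using bdd_suppE[OF b(5)] by metis
  obtain Bg where Bg: "Bg > 0" "\<And>x. norm (gj x) \<le> Bg" using bdd_suppE[OF b(6)] by metis
  define s where "s n x = fi x * ((g (x + h n *\<^sub>R e') - g x) /\<^sub>R h n)" for n x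
  define r where "r n x = ((f (x + h n *\<^sub>R (- e')) - f x) /\<^sub>R h n) * gi x" for n x
  have sb: "bdd_supp (s n)" for n unfolding s_def by (intro bdd_supp_mult bdd_supp_cscale bdd_supp_diff bdd_supp_translate b)
  have rb: "bdd_supp (r n)" for n unfolding r_def by (intro bdd_supp_mult bdd_supp_cscale bdd_supp_diff bdd_supp_translate b)
  have d2: "dir_deriv f (- e') x (- fj x)" for x
  proof -
    have "((\<lambda>t. f (x + (- t) *\<^sub>R e')) has_vector_derivative (-1) *\<^sub>R fj x) (at 0)"
    proof -
      have "(uminus has_vector_derivative (-1::real)) (at 0)" by (auto intro!: derivative_eq_intros)
      from vector_diff_chain_at[OF this, of "\<lambda>t. f (x + t *\<^sub>R e')" "fj x"] d(2)[of x]
      show ?thesis unfolding dir_deriv_def by (simp add: o_def)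
    qed
    then show ?thesis unfolding dir_deriv_def by simp
  qed
  have 1: "(\<lambda>n. lint (s n)) \<longlonglongrightarrow> lint (\<lambda>x. fi x * gj x)"
  proof (rule integral_limit_bounded_support)
    show "(\<lambda>n. s n x) \<longlonglongrightarrow> fi x * gj x" for x unfolding s_def by (intro tendsto_mult tendsto_const dir_deriv_quotient_tendsto[OF d(4) h(1) h(3)])
    show "norm (s n x) \<le> Bf * Bg" for n x unfolding s_def norm_mult
      by (intro mult_mono Bf dir_deriv_quotient_bound[OF h(2) d(4)] Bg) (use Bf in auto)
    show "s n x = 0" if "Rf \<le> norm x" for n x unfolding s_def by (simp add: Rf that)
  qed (use sb bdd_supp_measurable in auto)
  have 2: "(\<lambda>n. lint (r n)) \<longlonglongrightarrow> lint (\<lambda>x. - fj x * gi x)"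
  proof (rule integral_limit_bounded_support)
    show "(\<lambda>n. r n x) \<longlonglongrightarrow> - fj x * gi x" for x unfolding r_def by (intro tendsto_mult tendsto_const dir_deriv_quotient_tendsto[OF d2 h(1) h(3)])
    show "norm (r n x) \<le> Bj * Bi" for n x unfolding r_def norm_mult
      by (intro mult_mono Bi dir_deriv_quotient_bound[OF h(2) d2]) (use Bj in auto)
    show "r n x = 0" if "Rg \<le> norm x" for n x unfolding r_def by (simp add: Rg that)
  qed (use rb bdd_supp_measurable in auto)
  \<comment> \<open>The derivative along e of f times the difference quotient of g integrates to
    zero; a translation then turns the forward difference of gi into a backward difference of
    f.\<close>
  have eq: "lint (s n) = - lint (r n)" for n
  proof -
    define c where "c = h n *\<^sub>R e'"
    define p where "p x = f x * ((g (x + c) - g x) /\<^sub>R h n)" for x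
    define p' where "p' x = f x * ((gi (x + c) - gi x) /\<^sub>R h n) + fi x * ((g (x + c) - g x) /\<^sub>R h n)" for x
    have "dir_deriv p e x (p' x)" for x unfolding p_def p'_def
      by (intro dir_deriv_mult d dir_deriv_linear[OF bounded_linear_scaleR_right] dir_deriv_diff dir_deriv_translate)
    moreover have "bdd_supp p" "bdd_supp p'" unfolding p_def p'_def by (intro bdd_supp_add bdd_supp_mult bdd_supp_cscale bdd_supp_diff bdd_supp_translate b)+
    ultimately have "lint p' = 0" by (intro integral_dir_deriv_zero)
    moreover have i1: "integrable lborel (\<lambda>x. f x * ((gi (x + c) - gi x) /\<^sub>R h n))"
      by (rule bdd_supp_integrable) (intro bdd_supp_mult bdd_supp_cscale bdd_supp_diff bdd_supp_translate b)
    moreover have i2: "integrable lborel (\<lambda>x. fi x * ((g (x + c) - g x) /\<^sub>R h n))"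
      by (rule bdd_supp_integrable) (intro bdd_supp_mult bdd_supp_cscale bdd_supp_diff bdd_supp_translate b)
    ultimately have "lint (s n) = - lint (\<lambda>x. f x * ((gi (x + c) - gi x) /\<^sub>R h n))"
      using Bochner_Integration.integral_add[OF i1 i2] unfolding p'_def s_def c_def by linarith
    also have "lint (\<lambda>x. f x * ((gi (x + c) - gi x) /\<^sub>R h n)) = lint (r n)"
    proof -
      have i: "integrable lborel (\<lambda>x. f x * gi (x + c))" "integrable lborel (\<lambda>x. f x * gi x)" "integrable lborel (\<lambda>x. f (x - c) * gi x)"
        using bdd_supp_mult[OF b(1) bdd_supp_translate[OF b(5)]] bdd_supp_mult[OF b(1) b(5)] bdd_supp_mult[OF bdd_supp_translate[OF b(1), of "- c"] b(5)]
        by (simp_all add: bdd_supp_integrable)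
      have "(\<lambda>x. f (x - c) * gi x) \<in> borel_measurable borel" using i(3) by (simp add: borel_measurable_integrable)
      from lborel_integral_translate[OF this, of c]
      have t: "lint (\<lambda>x. f x * gi (x + c)) = lint (\<lambda>x. f (x - c) * gi x)" by simp
      have "lint (\<lambda>x. f x * ((gi (x + c) - gi x) /\<^sub>R h n)) = lint (\<lambda>x. (f x * gi (x + c) - f x * gi x) /\<^sub>R h n)"
        by (intro Bochner_Integration.integral_cong) (auto simp: algebra_simps)
      also have "\<dots> = lint (\<lambda>x. (f (x - c) * gi x - f x * gi x) /\<^sub>R h n)" using i t by simp
      also have "\<dots> = lint (r n)" unfolding r_def c_def
        by (intro Bochner_Integration.integral_cong) (auto simp: algebra_simps)
      finally show ?thesis .
    qed
    finally show ?thesis .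
  qed
  have "(\<lambda>n. lint (s n)) \<longlonglongrightarrow> - lint (\<lambda>x. - fj x * gi x)"
    unfolding eq by (intro tendsto_minus 2)
  then show ?thesis using LIMSEQ_unique[OF 1] by simp
qed

section \<open>The discrete Fourier transform on a finite grid\<close>

text \<open>The number of points depends on the direction; a direction with a single point is left
  untransformed.\<close>

definition dft_grid :: "('n::finite \<Rightarrow> nat) \<Rightarrow> ('n \<Rightarrow> nat) set" where
  "dft_grid m = {x. \<forall>j. x j < m j}"

definition dft_phase :: "('n::finite \<Rightarrow> nat) \<Rightarrow> ('n \<Rightarrow> nat) \<Rightarrow> ('n \<Rightarrow> nat) \<Rightarrow> real" where
  "dft_phase m \<xi> x = 2 * pi * (\<Sum>j\<in>UNIV. real (\<xi> j) * real (x j) / real (m j))"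

text \<open>With the sign chosen in \<open>dft_sin\<close>, the pair is the real and imaginary part
  of the sum of exp(-i phase) f(x). Keeping the two parts apart lets f take values in a real vector
  space.\<close>

definition dft_cos :: "('n::finite \<Rightarrow> nat) \<Rightarrow> ('n \<Rightarrow> nat) \<Rightarrow> (('n \<Rightarrow> nat) \<Rightarrow> 'v::real_vector) \<Rightarrow> 'v" where
  "dft_cos m \<xi> f = (\<Sum>x\<in>dft_grid m. cos (dft_phase m \<xi> x) *\<^sub>R f x)"

definition dft_sin :: "('n::finite \<Rightarrow> nat) \<Rightarrow> ('n \<Rightarrow> nat) \<Rightarrow> (('n \<Rightarrow> nat) \<Rightarrow> 'v::real_vector) \<Rightarrow> 'v" where
  "dft_sin m \<xi> f = - (\<Sum>x\<in>dft_grid m. sin (dft_phase m \<xi> x) *\<^sub>R f x)"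

definition dft_shift :: "('n::finite \<Rightarrow> nat) \<Rightarrow> 'n \<Rightarrow> ('n \<Rightarrow> nat) \<Rightarrow> ('n \<Rightarrow> nat)" where
  "dft_shift m j x = x(j := (if Suc (x j) = m j then 0 else Suc (x j)))"

lemma dft_grid_PiE: "dft_grid m = PiE UNIV (\<lambda>j. {..<m j})"
  by (auto simp: dft_grid_def PiE_def Pi_def extensional_def)

lemma finite_dft_grid: "finite (dft_grid (m :: 'n::finite \<Rightarrow> nat))"
  unfolding dft_grid_PiE by (intro finite_PiE) auto

lemma card_dft_grid: "card (dft_grid (m :: 'n::finite \<Rightarrow> nat)) = (\<Prod>j\<in>UNIV. m j)"
  unfolding dft_grid_PiE by (simp add: card_PiE)

lemma cis_sum: "finite I \<Longrightarrow> cis (\<Sum>i\<in>I. f i) = (\<Prod>i\<in>I. cis (f i))"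
  by (induction I rule: finite_induct) (auto simp: cis_mult[symmetric])

text \<open>A geometric series in w = exp(2 pi i d / n), which differs from 1 because n does not
  divide d.\<close>

lemma sum_cis_roots_of_unity:
  fixes d :: int
  assumes "n > 0" "d \<noteq> 0" "\<bar>d\<bar> < int n"
  shows "(\<Sum>i<n. cis (2 * pi * (real i * of_int d / real n))) = 0"
proof -
  define w where "w = cis (2 * pi * of_int d / real n)"
  have "(\<Sum>i<n. cis (2 * pi * (real i * of_int d / real n))) = (\<Sum>i<n. w ^ i)"
    unfolding w_def Complex.DeMoivre by (rule sum.cong) (auto simp: ac_simps)
  moreover have "w ^ n = 1"
  proof -
    have "w ^ n = cis (2 * pi * of_int d)" unfolding w_def Complex.DeMoivre using assms by simp
    then show ?thesis by (simp add: cis_multiple_2pi)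
  qed
  moreover have "w \<noteq> 1"
  proof
    assume "w = 1"
    then have "cos (2 * pi * of_int d / real n) = 1" unfolding w_def by (metis cis.simps(1) one_complex.simps(1))
    then obtain l :: int where "2 * pi * of_int d / real n = of_int l * 2 * pi" using cos_one_2pi_int by blast
    then have "(of_int d :: real) = of_int l * of_int (int n)" using assms by (simp add: field_simps)
    then have dl: "d = l * int n" by (metis of_int_eq_iff of_int_mult)
    then have "l \<noteq> 0" using assms by auto
    then have "int n \<le> \<bar>d\<bar>" unfolding dl abs_mult using assms(1) by (simp add: mult_le_cancel_right1)
    then show False using assms(3) by simp
  qed
  ultimately show ?thesis by (simp add: sum_gp_strict)
qed

text \<open>The exponential sum factors over the directions, and a factor with x_j \<noteq> y_j is a
  full sum over powers of a nontrivial root of unity.\<close>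

lemma dft_orthogonality:
  fixes m :: "'n::finite \<Rightarrow> nat"
  assumes "x \<in> dft_grid m" "y \<in> dft_grid m"
  shows "(\<Sum>\<xi>\<in>dft_grid m. cos (dft_phase m \<xi> x - dft_phase m \<xi> y)) = (if x = y then real (card (dft_grid m)) else 0)"
proof -
  define d where "d j = int (x j) - int (y j)" for j
  have mp: "m j > 0" for j using assms(1) unfolding dft_grid_def by (metis (mono_tags) mem_Collect_eq less_nat_zero_code gr0I)
  have eq: "cis (dft_phase m \<xi> x - dft_phase m \<xi> y) = (\<Prod>j\<in>UNIV. cis (2 * pi * (real (\<xi> j) * of_int (d j) / real (m j))))" for \<xi>
    unfolding cis_sum[OF finite, symmetric] dft_phase_def d_def
    by (simp add: sum_distrib_left sum_subtractf[symmetric] algebra_simps diff_divide_distrib)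
  have "(\<Sum>\<xi>\<in>dft_grid m. cis (dft_phase m \<xi> x - dft_phase m \<xi> y)) = (\<Prod>j\<in>UNIV. \<Sum>i<m j. cis (2 * pi * (real i * of_int (d j) / real (m j))))"
    unfolding eq dft_grid_PiE by (subst prod_sum_PiE) auto
  also have "\<dots> = (if x = y then of_nat (card (dft_grid m)) else 0)"
  proof (cases "x = y")
    case True
    then show ?thesis unfolding d_def by (simp add: card_dft_grid)
  next
    case False
    then obtain j where j: "x j \<noteq> y j" by auto
    have "x j < m j" "y j < m j" using assms unfolding dft_grid_def by auto
    then have "(\<Sum>i<m j. cis (2 * pi * (real i * of_int (d j) / real (m j)))) = 0"
      using j mp[of j] unfolding d_def by (intro sum_cis_roots_of_unity) auto
    then show ?thesis using False by (auto simp: prod_zero_iff)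
  qed
  finally have "Re (\<Sum>\<xi>\<in>dft_grid m. cis (dft_phase m \<xi> x - dft_phase m \<xi> y)) = Re (if x = y then of_nat (card (dft_grid m)) else 0)" by simp
  then show ?thesis by (simp split: if_splits)
qed

lemma dft_parseval:
  fixes m :: "'n::finite \<Rightarrow> nat" and f :: "('n \<Rightarrow> nat) \<Rightarrow> 'v::real_inner"
  shows "(\<Sum>\<xi>\<in>dft_grid m. (norm (dft_cos m \<xi> f))\<^sup>2 + (norm (dft_sin m \<xi> f))\<^sup>2)
    = real (card (dft_grid m)) * (\<Sum>x\<in>dft_grid m. (norm (f x))\<^sup>2)"
proof -
  let ?G = "dft_grid m"
  have 1: "(norm (dft_cos m \<xi> f))\<^sup>2 + (norm (dft_sin m \<xi> f))\<^sup>2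
      = (\<Sum>x\<in>?G. \<Sum>y\<in>?G. cos (dft_phase m \<xi> x - dft_phase m \<xi> y) * (f x \<bullet> f y))" for \<xi>
  proof -
    have eq: "(\<Sum>x\<in>?G. a x *\<^sub>R f x) \<bullet> (\<Sum>y\<in>?G. a y *\<^sub>R f y) = (\<Sum>x\<in>?G. \<Sum>y\<in>?G. a x * a y * (f x \<bullet> f y))" for a
      unfolding inner_sum_left unfolding inner_sum_right by (simp add: ac_simps)
    show ?thesis unfolding power2_norm_eq_inner dft_cos_def dft_sin_def
      by (simp add: eq cos_diff distrib_right sum.distrib)
  qed
  have "(\<Sum>\<xi>\<in>?G. (norm (dft_cos m \<xi> f))\<^sup>2 + (norm (dft_sin m \<xi> f))\<^sup>2)
      = (\<Sum>x\<in>?G. \<Sum>y\<in>?G. \<Sum>\<xi>\<in>?G. cos (dft_phase m \<xi> x - dft_phase m \<xi> y) * (f x \<bullet> f y))"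
    unfolding 1 by (subst sum.swap, rule sum.cong[OF refl], rule sum.swap)
  also have "\<dots> = (\<Sum>x\<in>?G. \<Sum>y\<in>?G. if x = y then real (card ?G) * (f x \<bullet> f x) else 0)"
    unfolding sum_distrib_right[symmetric]
    by (intro sum.cong refl) (auto simp: dft_orthogonality)
  also have "\<dots> = (\<Sum>x\<in>?G. real (card ?G) * (f x \<bullet> f x))"
    by (intro sum.cong refl) (simp add: finite_dft_grid)
  finally show ?thesis by (simp add: power2_norm_eq_inner sum_distrib_left)
qed

lemma dft_shift_bij: "bij_betw (dft_shift m j) (dft_grid m) (dft_grid m)" for m :: "'n::finite \<Rightarrow> nat"
proof -
  have "inj_on (dft_shift m j) (dft_grid m)"
  proof (rule inj_onI)
    fix x y assume x: "x \<in> dft_grid m" and y: "y \<in> dft_grid m" and eq: "dft_shift m j x = dft_shift m j y"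
    have "x i = y i" for i
      using fun_cong[OF eq, of i] x y unfolding dft_shift_def dft_grid_def by (auto split: if_splits)
    then show "x = y" by auto
  qed
  moreover have "dft_shift m j ` dft_grid m \<subseteq> dft_grid m"
    unfolding dft_shift_def dft_grid_def by (auto simp: Suc_lessI)
  ultimately show ?thesis by (simp add: bij_betw_def endo_inj_surj finite_dft_grid)
qed

lemma dft_phase_shift:
  fixes m \<xi> :: "'n::finite \<Rightarrow> nat" and j :: 'n
  assumes x: "x \<in> dft_grid m"
  defines "t \<equiv> 2 * pi * real (\<xi> j) / real (m j)"
  shows "cos (dft_phase m \<xi> (dft_shift m j x)) = cos (dft_phase m \<xi> x + t)"
    and "sin (dft_phase m \<xi> (dft_shift m j x)) = sin (dft_phase m \<xi> x + t)"
proof -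
  have mj: "real (m j) > 0" using x unfolding dft_grid_def by (metis (mono_tags) mem_Collect_eq less_nat_zero_code gr0I of_nat_0_less_iff)
  \<comment> \<open>Records the wrap-around, which changes the phase by a multiple of 2 pi.\<close>
  define c where "c = (if Suc (x j) = m j then 1 else 0 :: nat)"
  have "dft_phase m \<xi> (dft_shift m j x) - dft_phase m \<xi> x
      = 2 * pi * (\<Sum>i\<in>UNIV. if i = j then real (\<xi> j) * (real (dft_shift m j x j) - real (x j)) / real (m j) else 0)"
    unfolding dft_phase_def right_diff_distrib[symmetric] sum_subtractf[symmetric]
    by (intro arg_cong[where f = "\<lambda>z. 2 * pi * z"] sum.cong) (auto simp: dft_shift_def algebra_simps diff_divide_distrib)
  also have "\<dots> = 2 * pi * (real (\<xi> j) * (1 - real c * real (m j)) / real (m j))"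
    by (auto simp: dft_shift_def c_def)
  also have "\<dots> = t - 2 * pi * real (c * \<xi> j)" unfolding t_def using mj by (simp add: field_simps)
  finally have eq: "dft_phase m \<xi> (dft_shift m j x) = dft_phase m \<xi> x + t - 2 * pi * real (c * \<xi> j)" by simp
  show "cos (dft_phase m \<xi> (dft_shift m j x)) = cos (dft_phase m \<xi> x + t)"
    unfolding eq cos_diff using cos_2npi[of "c * \<xi> j"] sin_2npi[of "c * \<xi> j"] by (simp add: mult.commute mult.left_commute)
  show "sin (dft_phase m \<xi> (dft_shift m j x)) = sin (dft_phase m \<xi> x + t)"
    unfolding eq sin_diff using cos_2npi[of "c * \<xi> j"] sin_2npi[of "c * \<xi> j"] by (simp add: mult.commute mult.left_commute)
qed

text \<open>A cyclic shift multiplies the transform by exp(i t); these are the real and imaginary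
  parts.\<close>

lemma dft_of_shift:
  fixes m :: "'n::finite \<Rightarrow> nat" and j :: 'n and f :: "('n \<Rightarrow> nat) \<Rightarrow> 'v::real_vector"
  defines "t \<equiv> \<lambda>\<xi>. 2 * pi * real (\<xi> j) / real (m j)"
  shows "dft_cos m \<xi> (\<lambda>x. f (dft_shift m j x)) = cos (t \<xi>) *\<^sub>R dft_cos m \<xi> f - sin (t \<xi>) *\<^sub>R dft_sin m \<xi> f"
    and "dft_sin m \<xi> (\<lambda>x. f (dft_shift m j x)) = cos (t \<xi>) *\<^sub>R dft_sin m \<xi> f + sin (t \<xi>) *\<^sub>R dft_cos m \<xi> f"
proof -
  let ?G = "dft_grid m" and ?s = "dft_shift m j" and ?p = "dft_phase m \<xi>"
  have c: "cos (?p x) = cos (?p (?s x)) * cos (t \<xi>) + sin (?p (?s x)) * sin (t \<xi>)"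
    and s: "sin (?p x) = sin (?p (?s x)) * cos (t \<xi>) - cos (?p (?s x)) * sin (t \<xi>)" if "x \<in> ?G" for x
    using cos_diff[of "?p x + t \<xi>" "t \<xi>"] sin_diff[of "?p x + t \<xi>" "t \<xi>"] dft_phase_shift[OF that, of \<xi> j]
    unfolding t_def by simp_all
  have "dft_cos m \<xi> (\<lambda>x. f (?s x)) = (\<Sum>x\<in>?G. (cos (?p (?s x)) * cos (t \<xi>) + sin (?p (?s x)) * sin (t \<xi>)) *\<^sub>R f (?s x))"
    unfolding dft_cos_def by (rule sum.cong) (auto simp: c)
  also have "\<dots> = (\<Sum>x\<in>?G. (cos (?p x) * cos (t \<xi>) + sin (?p x) * sin (t \<xi>)) *\<^sub>R f x)"
    by (rule sum.reindex_bij_betw[OF dft_shift_bij])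
  finally show "dft_cos m \<xi> (\<lambda>x. f (?s x)) = cos (t \<xi>) *\<^sub>R dft_cos m \<xi> f - sin (t \<xi>) *\<^sub>R dft_sin m \<xi> f"
    unfolding dft_cos_def dft_sin_def by (simp add: scaleR_sum_right sum.distrib scaleR_add_left mult.commute)
  have "dft_sin m \<xi> (\<lambda>x. f (?s x)) = - (\<Sum>x\<in>?G. (sin (?p (?s x)) * cos (t \<xi>) - cos (?p (?s x)) * sin (t \<xi>)) *\<^sub>R f (?s x))"
    unfolding dft_sin_def by (intro arg_cong[where f = uminus] sum.cong) (auto simp: s)
  also have "\<dots> = - (\<Sum>x\<in>?G. (sin (?p x) * cos (t \<xi>) - cos (?p x) * sin (t \<xi>)) *\<^sub>R f x)"
    by (rule arg_cong[where f = uminus], rule sum.reindex_bij_betw[OF dft_shift_bij])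
  finally show "dft_sin m \<xi> (\<lambda>x. f (?s x)) = cos (t \<xi>) *\<^sub>R dft_sin m \<xi> f + sin (t \<xi>) *\<^sub>R dft_cos m \<xi> f"
    unfolding dft_cos_def dft_sin_def by (simp add: scaleR_sum_right sum_subtractf scaleR_diff_left mult.commute)
qed

section \<open>Coercivity on a half-space\<close>

lemma dft_cos_cong: "(\<And>x. x \<in> dft_grid m \<Longrightarrow> f x = g x) \<Longrightarrow> dft_cos m \<xi> f = dft_cos m \<xi> g"
  and dft_sin_cong: "(\<And>x. x \<in> dft_grid m \<Longrightarrow> f x = g x) \<Longrightarrow> dft_sin m \<xi> f = dft_sin m \<xi> g"
  unfolding dft_cos_def dft_sin_def by (simp_all cong: sum.cong)

lemma dft_linear:
  assumes "linear L"
  shows "L (dft_cos m \<xi> f) = dft_cos m \<xi> (\<lambda>x. L (f x))" "L (dft_sin m \<xi> f) = dft_sin m \<xi> (\<lambda>x. L (f x))"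
  unfolding dft_cos_def dft_sin_def by (simp_all add: linear_sum[OF assms] linear_scale[OF assms] linear_neg[OF assms])

lemma dft_diff_scale:
  "dft_cos m \<xi> (\<lambda>x. (f x - g x) /\<^sub>R c) = (dft_cos m \<xi> f - dft_cos m \<xi> g) /\<^sub>R c"
  "dft_sin m \<xi> (\<lambda>x. (f x - g x) /\<^sub>R c) = (dft_sin m \<xi> f - dft_sin m \<xi> g) /\<^sub>R c"
  unfolding dft_cos_def dft_sin_def
  by (simp_all add: scaleR_sum_right sum_subtractf scaleR_diff_right mult.commute)

definition tile_pos :: "'n \<Rightarrow> real \<Rightarrow> ('n::finite \<Rightarrow> nat) \<Rightarrow> real^'n" where
  "tile_pos k h x = (\<chi> j. if j = k then 0 else h * real (x j))"

text \<open>A cell in the tangential directions times the whole line in direction k, so its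
  indicator is constant along e_k and does not disturb normal derivatives.\<close>

definition tile :: "'n \<Rightarrow> real \<Rightarrow> real \<Rightarrow> (real^'n::finite) set" where
  "tile k h a = {y. \<forall>j. j \<noteq> k \<longrightarrow> a \<le> y $ j \<and> y $ j < a + h}"

lemma tile_borel: "tile k h a \<in> sets borel"
  unfolding tile_def by measurable

text \<open>On the support of \<phi> every point is y + \<open>tile_pos k h x\<close> for exactly
  one y in the tile and one grid point x, found by rounding (z_j - a) / h down.\<close>

lemma integral_over_tiles:
  fixes \<phi> :: "real^'n::finite \<Rightarrow> real"
  assumes "h > 0" and \<phi>: "bdd_supp \<phi>"
    and z: "\<And>z. \<phi> z \<noteq> 0 \<Longrightarrow> (\<forall>j. j \<noteq> k \<longrightarrow> a \<le> z $ j \<and> z $ j < a + h * real N)"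
  shows "lint (\<lambda>y. indicator (tile k h a) y * (\<Sum>x\<in>dft_grid (\<lambda>j. if j = k then 1 else N). \<phi> (y + tile_pos k h x)))
    = lint \<phi>"
proof -
  let ?G = "dft_grid (\<lambda>j. if j = k then 1 else N)" and ?Q = "tile k h a"
  have b1: "bdd_supp (\<lambda>y. indicator ?Q y * \<phi> (y + c))" for c
    using bdd_supp_indicator[OF bdd_supp_translate[OF \<phi>] tile_borel] by simp
  have b2: "bdd_supp (\<lambda>z. indicator ?Q (z - c) * \<phi> z)" for c
    using bdd_supp_translate[OF b1[of c], of "- c"] by simp
  have t: "lint (\<lambda>y. indicator ?Q y * \<phi> (y + c)) = lint (\<lambda>z. indicator ?Q (z - c) * \<phi> z)" for c
    using lborel_integral_translate[OF bdd_supp_measurable[OF b1[of c]], of "- c"] by simp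
  have "lint (\<lambda>y. indicator ?Q y * (\<Sum>x\<in>?G. \<phi> (y + tile_pos k h x)))
     = (\<Sum>x\<in>?G. lint (\<lambda>y. indicator ?Q y * \<phi> (y + tile_pos k h x)))"
    unfolding sum_distrib_left by (rule Bochner_Integration.integral_sum) (rule bdd_supp_integrable[OF b1])
  also have "\<dots> = lint (\<lambda>z. \<Sum>x\<in>?G. indicator ?Q (z - tile_pos k h x) * \<phi> z)"
    unfolding t by (rule Bochner_Integration.integral_sum[symmetric]) (rule bdd_supp_integrable[OF b2])
  also have "\<dots> = lint \<phi>"
  proof (rule Bochner_Integration.integral_cong[OF refl])
    fix z
    show "(\<Sum>x\<in>?G. indicator ?Q (z - tile_pos k h x) * \<phi> z) = \<phi> z"
    proof (cases "\<phi> z = 0")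
      case False
      define x0 where "x0 = (\<lambda>j. if j = k then 0 else nat \<lfloor>(z $ j - a) / h\<rfloor>)"
      have zj: "a \<le> z $ j" "z $ j < a + h * real N" if "j \<noteq> k" for j using z[OF False] that by auto
      have fl: "0 \<le> \<lfloor>(z $ j - a) / h\<rfloor>" if "j \<noteq> k" for j using zj[OF that] assms(1) by simp
      have "x0 \<in> ?G" unfolding dft_grid_def
      proof (clarify)
        fix j
        show "x0 j < (if j = k then 1 else N)"
        proof (cases "j = k")
          case False
          have "(z $ j - a) / h < real N" using zj(2)[OF False] assms(1) by (simp add: divide_less_eq mult.commute)
          then have "\<lfloor>(z $ j - a) / h\<rfloor> < int N" by (simp add: floor_less_iff)
          then have "nat \<lfloor>(z $ j - a) / h\<rfloor> < N" using nat_less_iff[OF fl[OF False]] by blast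
          then show ?thesis using False unfolding x0_def by simp
        qed (simp add: x0_def)
      qed
      moreover have "indicator ?Q (z - tile_pos k h x) = (if x = x0 then 1 else 0 :: real)" if x: "x \<in> ?G" for x
      proof -
        have iff: "a \<le> z $ j - h * real (x j) \<and> z $ j - h * real (x j) < a + h \<longleftrightarrow> x j = x0 j" if j: "j \<noteq> k" for j
        proof -
          have "a \<le> z $ j - h * real (x j) \<and> z $ j - h * real (x j) < a + h \<longleftrightarrow> real (x j) \<le> (z $ j - a) / h \<and> (z $ j - a) / h < real (x j) + 1"
            using assms(1) by (auto simp: field_simps)
          also have "\<dots> \<longleftrightarrow> \<lfloor>(z $ j - a) / h\<rfloor> = int (x j)" by (auto simp: floor_eq_iff)
          also have "\<dots> \<longleftrightarrow> x j = x0 j" using fl[OF j] j unfolding x0_def by auto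
          finally show ?thesis .
        qed
        have "x k < 1" using x unfolding dft_grid_def by (auto dest: spec[of _ k])
        then have xk: "x k = x0 k" unfolding x0_def by simp
        have "z - tile_pos k h x \<in> ?Q \<longleftrightarrow> (\<forall>j. j \<noteq> k \<longrightarrow> x j = x0 j)"
          unfolding tile_def tile_pos_def using iff by simp
        also have "\<dots> \<longleftrightarrow> x = x0" using xk by (auto simp: fun_eq_iff)
        finally show ?thesis by (simp add: indicator_def)
      qed
      ultimately show ?thesis by (simp add: finite_dft_grid if_distrib[of "\<lambda>u. u * \<phi> z"] cong: sum.cong if_cong)
    qed simp
  qed
  finally show ?thesis .
qed

text \<open>\<open>Xh\<close> keeps the exact normal derivative and replaces the tangential ones by
  forward differences. For fixed y in the tile, the transform over the grid through y turns
  \<open>P (Xh y)\<close> into the pencil with covector \<alpha> + i \<beta>, and Parseval sums the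
  dissipation inequality over the frequencies. The terms with q form the normal derivative of a
  nonnegative function of y and drop out after integration.\<close>

lemma halfspace_korn_discrete:
  fixes P :: "'f::euclidean_space^'n::finite \<Rightarrow> 'k::euclidean_space" and k :: 'n
    and v :: "real^'n \<Rightarrow> 'f" and X :: "real^'n \<Rightarrow> 'f^'n"
  assumes P: "linear P"
    and diss: "tangentially_dissipative P k C"
    and v: "bdd_supp v" and X: "bdd_supp X" and out: "\<And>x. 0 \<le> x $ k \<Longrightarrow> v x = 0" "\<And>x. 0 \<le> x $ k \<Longrightarrow> X x = 0"
    and d: "\<And>x. x $ k < 0 \<Longrightarrow> dir_deriv v (axis k 1) x (X x $ k)"
    and h: "h > 0"
  defines "Xh \<equiv> \<lambda>y. \<chi> j. if j = k then X y $ k else (v (y + h *\<^sub>R axis j 1) - v y) /\<^sub>R h"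
  shows "lint (\<lambda>y. (norm (Xh y))\<^sup>2) \<le> C * lint (\<lambda>y. (norm (P (Xh y)))\<^sup>2)"
proof -
  let ?e = "axis k 1 :: real^'n"
  obtain R where R: "R > 0" "\<And>x. R \<le> norm x \<Longrightarrow> v x = 0" "\<And>x. R \<le> norm x \<Longrightarrow> X x = 0"
  proof -
    obtain R1 where R1: "R1 > 0" "\<And>x. R1 \<le> norm x \<Longrightarrow> v x = 0" using bdd_suppE[OF v] by metis
    obtain R2 where R2: "R2 > 0" "\<And>x. R2 \<le> norm x \<Longrightarrow> X x = 0" using bdd_suppE[OF X] by metis
    show thesis by (rule that[of "max R1 R2"]) (use R1 R2 in auto)
  qed
  have far: "v x = 0" "X x = 0" if "R \<le> \<bar>x $ j\<bar>" for x j
    using R that component_le_norm_cart[of x j] by (meson order_trans)+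
  \<comment> \<open>In each tangential direction the support of \<open>Xh\<close> lies between -R -
    h and R, since a forward difference looks one step ahead. N steps of length h cover it with the
    margin that makes the cyclic shift agree with the true one.\<close>
  define N where "N = nat \<lceil>(2 * R + h) / h\<rceil>"
  have N: "2 * R + h \<le> h * real N"
  proof -
    have "(2 * R + h) / h \<le> real N" unfolding N_def by linarith
    then show ?thesis using h by (simp add: divide_le_eq mult.commute)
  qed
  define m where "m = (\<lambda>j::'n. if j = k then 1 else N)"
  define G where "G = dft_grid m"
  define a0 where "a0 = - R - h"
  let ?Q = "tile k h a0" and ?pos = "tile_pos k h"
  have Xh: "bdd_supp Xh" unfolding Xh_def
  proof (rule bdd_supp_vec)
    fix j show "bdd_supp (\<lambda>x. if j = k then X x $ k else (v (x + h *\<^sub>R axis j 1) - v x) /\<^sub>R h)"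
      by (cases "j = k") (auto intro!: bdd_supp_nth X bdd_supp_cscale bdd_supp_diff bdd_supp_translate v)
  qed
  have supp: "a0 \<le> z $ i \<and> z $ i < a0 + h * real N" if "Xh z \<noteq> 0" "i \<noteq> k" for z i
  proof (rule ccontr)
    assume nr: "\<not> ?thesis"
    then have out1: "z $ i < - R - h \<or> R \<le> z $ i" using N unfolding a0_def by linarith
    have "Xh z $ j = 0" for j
    proof -
      have "R \<le> \<bar>z $ i\<bar>" using out1 h by linarith
      moreover have "R \<le> \<bar>(z + h *\<^sub>R axis j 1) $ i\<bar>" using out1 h by (auto simp: axis_def)
      ultimately show ?thesis unfolding Xh_def using far by simp
    qed
    then show False using that(1) by (simp add: vec_eq_iff)
  qed
  \<comment> \<open>\<alpha> and \<beta> are the real and imaginary part of (exp(i t_j) - 1) / h,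
    the symbol of the forward difference in direction j, with t_j = 2 pi \<xi>_j / m_j.\<close>
  define \<alpha> where "\<alpha> \<xi> = (\<chi> j. if j = k then 0 else (cos (2 * pi * real (\<xi> j) / real (m j)) - 1) / h)" for \<xi> :: "'n \<Rightarrow> nat"
  define \<beta> where "\<beta> \<xi> = (\<chi> j. if j = k then 0 else sin (2 * pi * real (\<xi> j) / real (m j)) / h)" for \<xi> :: "'n \<Rightarrow> nat"
  have "\<exists>q::('f \<times> 'f) \<Rightarrow> ('f \<times> 'f) \<Rightarrow> real. bilinear q \<and> (\<forall>z w. q z w = q w z) \<and> (\<forall>z. 0 \<le> q z z) \<and>
       (\<forall>a b a' b'. (norm (tensor a (\<alpha> \<xi>) - tensor b (\<beta> \<xi>) + tensor a' ?e))\<^sup>2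
           + (norm (tensor b (\<alpha> \<xi>) + tensor a (\<beta> \<xi>) + tensor b' ?e))\<^sup>2 + 2 * q (a, b) (a', b')
         \<le> C * ((norm (P (tensor a (\<alpha> \<xi>) - tensor b (\<beta> \<xi>) + tensor a' ?e)))\<^sup>2
           + (norm (P (tensor b (\<alpha> \<xi>) + tensor a (\<beta> \<xi>) + tensor b' ?e)))\<^sup>2))" for \<xi>
    by (rule diss[unfolded tangentially_dissipative_def, rule_format]) (simp_all add: \<alpha>_def \<beta>_def)
  then obtain q :: "('n \<Rightarrow> nat) \<Rightarrow> ('f \<times> 'f) \<Rightarrow> ('f \<times> 'f) \<Rightarrow> real" where
    qb: "\<And>\<xi>. bilinear (q \<xi>)" and qs: "\<And>\<xi> z w. q \<xi> z w = q \<xi> w z" and qp: "\<And>\<xi> z. 0 \<le> q \<xi> z z" and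
    qi: "\<And>\<xi> a b a' b'. (norm (tensor a (\<alpha> \<xi>) - tensor b (\<beta> \<xi>) + tensor a' ?e))\<^sup>2
           + (norm (tensor b (\<alpha> \<xi>) + tensor a (\<beta> \<xi>) + tensor b' ?e))\<^sup>2 + 2 * q \<xi> (a, b) (a', b')
         \<le> C * ((norm (P (tensor a (\<alpha> \<xi>) - tensor b (\<beta> \<xi>) + tensor a' ?e)))\<^sup>2
           + (norm (P (tensor b (\<alpha> \<xi>) + tensor a (\<beta> \<xi>) + tensor b' ?e)))\<^sup>2)" by metis
  define Z where "Z \<xi> y = (dft_cos m \<xi> (\<lambda>x. v (y + ?pos x)), dft_sin m \<xi> (\<lambda>x. v (y + ?pos x)))" for \<xi> y
  define Z' where "Z' \<xi> y = (dft_cos m \<xi> (\<lambda>x. X (y + ?pos x) $ k), dft_sin m \<xi> (\<lambda>x. X (y + ?pos x) $ k))" for \<xi> y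
  define S1 where "S1 y = (\<Sum>x\<in>G. (norm (Xh (y + ?pos x)))\<^sup>2)" for y
  define S2 where "S2 y = (\<Sum>x\<in>G. (norm (P (Xh (y + ?pos x))))\<^sup>2)" for y
  have pw: "real (card G) * S1 y + (\<Sum>\<xi>\<in>G. 2 * q \<xi> (Z \<xi> y) (Z' \<xi> y)) \<le> C * (real (card G) * S2 y)" if y: "y \<in> ?Q" for y
  proof -
    define V where "V x = v (y + ?pos x)" for x
    define K where "K x = X (y + ?pos x) $ k" for x
    define F where "F x = Xh (y + ?pos x)" for x
    have Fk: "F x $ k = K x" for x unfolding F_def K_def Xh_def by simp
    have Fj: "F x $ j = (V (dft_shift m j x) - V x) /\<^sub>R h" if x: "x \<in> G" and j: "j \<noteq> k" for x j
    proof -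
      \<comment> \<open>At the wrap-around both points lie outside the support, so the cyclic and
        the true neighbour carry the same value 0.\<close>
      have "v (y + ?pos (dft_shift m j x)) = v (y + ?pos x + h *\<^sub>R axis j 1)"
      proof (cases "Suc (x j) = m j")
        case True
        have "m j = N" using j unfolding m_def by simp
        then have Nx: "real N = real (x j) + 1" using True by simp
        have "(y + ?pos (dft_shift m j x)) $ j = y $ j" using True j unfolding tile_pos_def dft_shift_def by simp
        then have A1: "R \<le> \<bar>(y + ?pos (dft_shift m j x)) $ j\<bar>" using y j unfolding tile_def a0_def by auto
        have "(y + ?pos x + h *\<^sub>R axis j 1) $ j = y $ j + h * real N" using j unfolding tile_pos_def Nx by (simp add: algebra_simps)
        then have A2: "R \<le> \<bar>(y + ?pos x + h *\<^sub>R axis j 1) $ j\<bar>" using y j N unfolding tile_def a0_def by auto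
        show ?thesis using far(1)[OF A1] far(1)[OF A2] by simp
      next
        case False
        then have "?pos (dft_shift m j x) = ?pos x + h *\<^sub>R axis j 1"
          using j unfolding tile_pos_def dft_shift_def by (auto simp: vec_eq_iff axis_def algebra_simps)
        then show ?thesis by (simp add: add.assoc)
      qed
      then show ?thesis unfolding F_def V_def Xh_def using j by simp
    qed
    have comp: "linear (\<lambda>w::'f^'n. w $ j)" for j by (auto intro: linearI)
    have cF: "dft_cos m \<xi> F = tensor (dft_cos m \<xi> V) (\<alpha> \<xi>) - tensor (dft_sin m \<xi> V) (\<beta> \<xi>) + tensor (dft_cos m \<xi> K) ?e" for \<xi>
    proof (rule vec_eq_iff[THEN iffD2], rule allI)
      fix j
      show "dft_cos m \<xi> F $ j = (tensor (dft_cos m \<xi> V) (\<alpha> \<xi>) - tensor (dft_sin m \<xi> V) (\<beta> \<xi>) + tensor (dft_cos m \<xi> K) ?e) $ j"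
      proof (cases "j = k")
        case True
        then show ?thesis unfolding dft_linear(1)[OF comp] by (simp add: Fk tensor_def \<alpha>_def \<beta>_def)
      next
        case False
        have "dft_cos m \<xi> F $ j = dft_cos m \<xi> (\<lambda>x. (V (dft_shift m j x) - V x) /\<^sub>R h)"
          unfolding dft_linear(1)[OF comp] by (rule dft_cos_cong) (use Fj False in \<open>simp add: G_def\<close>)
        also have "\<dots> = (cos (2 * pi * real (\<xi> j) / real (m j)) *\<^sub>R dft_cos m \<xi> V - sin (2 * pi * real (\<xi> j) / real (m j)) *\<^sub>R dft_sin m \<xi> V - dft_cos m \<xi> V) /\<^sub>R h"
          unfolding dft_diff_scale dft_of_shift ..
        also have "\<dots> = (tensor (dft_cos m \<xi> V) (\<alpha> \<xi>) - tensor (dft_sin m \<xi> V) (\<beta> \<xi>) + tensor (dft_cos m \<xi> K) ?e) $ j"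
          using False by (simp add: tensor_def \<alpha>_def \<beta>_def axis_def algebra_simps diff_divide_distrib divide_inverse)
        finally show ?thesis .
      qed
    qed
    have sF: "dft_sin m \<xi> F = tensor (dft_sin m \<xi> V) (\<alpha> \<xi>) + tensor (dft_cos m \<xi> V) (\<beta> \<xi>) + tensor (dft_sin m \<xi> K) ?e" for \<xi>
    proof (rule vec_eq_iff[THEN iffD2], rule allI)
      fix j
      show "dft_sin m \<xi> F $ j = (tensor (dft_sin m \<xi> V) (\<alpha> \<xi>) + tensor (dft_cos m \<xi> V) (\<beta> \<xi>) + tensor (dft_sin m \<xi> K) ?e) $ j"
      proof (cases "j = k")
        case True
        then show ?thesis unfolding dft_linear(2)[OF comp] by (simp add: Fk tensor_def \<alpha>_def \<beta>_def)
      next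
        case False
        have "dft_sin m \<xi> F $ j = dft_sin m \<xi> (\<lambda>x. (V (dft_shift m j x) - V x) /\<^sub>R h)"
          unfolding dft_linear(2)[OF comp] by (rule dft_sin_cong) (use Fj False in \<open>simp add: G_def\<close>)
        also have "\<dots> = (cos (2 * pi * real (\<xi> j) / real (m j)) *\<^sub>R dft_sin m \<xi> V + sin (2 * pi * real (\<xi> j) / real (m j)) *\<^sub>R dft_cos m \<xi> V - dft_sin m \<xi> V) /\<^sub>R h"
          unfolding dft_diff_scale dft_of_shift ..
        also have "\<dots> = (tensor (dft_sin m \<xi> V) (\<alpha> \<xi>) + tensor (dft_cos m \<xi> V) (\<beta> \<xi>) + tensor (dft_sin m \<xi> K) ?e) $ j"
          using False by (simp add: tensor_def \<alpha>_def \<beta>_def axis_def algebra_simps diff_divide_distrib divide_inverse)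
        finally show ?thesis .
      qed
    qed
    have Zy: "Z \<xi> y = (dft_cos m \<xi> V, dft_sin m \<xi> V)" "Z' \<xi> y = (dft_cos m \<xi> K, dft_sin m \<xi> K)" for \<xi>
      unfolding Z_def Z'_def V_def K_def by simp_all
    have "(norm (dft_cos m \<xi> F))\<^sup>2 + (norm (dft_sin m \<xi> F))\<^sup>2 + 2 * q \<xi> (Z \<xi> y) (Z' \<xi> y)
        \<le> C * ((norm (dft_cos m \<xi> (\<lambda>x. P (F x))))\<^sup>2 + (norm (dft_sin m \<xi> (\<lambda>x. P (F x))))\<^sup>2)" for \<xi>
      unfolding dft_linear[OF P, symmetric] cF sF Zy by (rule qi)
    then have "(\<Sum>\<xi>\<in>G. (norm (dft_cos m \<xi> F))\<^sup>2 + (norm (dft_sin m \<xi> F))\<^sup>2 + 2 * q \<xi> (Z \<xi> y) (Z' \<xi> y))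
        \<le> (\<Sum>\<xi>\<in>G. C * ((norm (dft_cos m \<xi> (\<lambda>x. P (F x))))\<^sup>2 + (norm (dft_sin m \<xi> (\<lambda>x. P (F x))))\<^sup>2))"
      by (rule sum_mono)
    then have "(\<Sum>\<xi>\<in>G. (norm (dft_cos m \<xi> F))\<^sup>2 + (norm (dft_sin m \<xi> F))\<^sup>2) + (\<Sum>\<xi>\<in>G. 2 * q \<xi> (Z \<xi> y) (Z' \<xi> y))
        \<le> C * (\<Sum>\<xi>\<in>G. (norm (dft_cos m \<xi> (\<lambda>x. P (F x))))\<^sup>2 + (norm (dft_sin m \<xi> (\<lambda>x. P (F x))))\<^sup>2)"
      by (simp add: sum.distrib sum_distrib_left distrib_left)
    then show ?thesis unfolding G_def dft_parseval unfolding S1_def S2_def F_def G_def by simp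
  qed
  \<comment> \<open>By symmetry of the forms, g' is the derivative of the nonnegative g along e_k in
    the half-space.\<close>
  define g where "g y = (\<Sum>\<xi>\<in>G. indicator ?Q y * q \<xi> (Z \<xi> y) (Z \<xi> y))" for y
  define g' where "g' y = (\<Sum>\<xi>\<in>G. indicator ?Q y * (2 * q \<xi> (Z \<xi> y) (Z' \<xi> y)))" for y
  have qbb: "bounded_bilinear (q \<xi>)" for \<xi> using qb by (simp add: bilinear_conv_bounded_bilinear)
  have Zb: "bdd_supp (Z \<xi>)" for \<xi> unfolding Z_def dft_cos_def dft_sin_def
    by (intro bdd_supp_Pair bdd_supp_minus bdd_supp_sum bdd_supp_cscale bdd_supp_translate v)
  have Zb': "bdd_supp (Z' \<xi>)" for \<xi> unfolding Z'_def dft_cos_def dft_sin_def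
    by (intro bdd_supp_Pair bdd_supp_minus bdd_supp_sum bdd_supp_cscale bdd_supp_nth bdd_supp_translate X)
  have gb: "bdd_supp g" unfolding g_def
    using bdd_supp_indicator[OF bdd_supp_bilinear[OF qbb Zb Zb] tile_borel] by (intro bdd_supp_sum) simp
  have gb': "bdd_supp g'" unfolding g'_def
    using bdd_supp_indicator[OF bdd_supp_cmult[OF bdd_supp_bilinear[OF qbb Zb Zb']] tile_borel] by (intro bdd_supp_sum) simp
  have z0: "v (y + ?pos x) = 0" "X (y + ?pos x) = 0" if "0 \<le> y $ k" for y x
    using that by (auto intro!: out simp: tile_pos_def)
  have "0 \<le> lint g'"
  proof (rule integral_dir_deriv_halfspace_nonneg[OF gb gb', of k])
    show "0 \<le> g y" for y unfolding g_def by (intro sum_nonneg mult_nonneg_nonneg qp) simp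
    show "g y = 0" "g' y = 0" if "0 \<le> y $ k" for y
    proof -
      have "Z \<xi> y = 0" for \<xi> unfolding Z_def dft_cos_def dft_sin_def by (simp add: z0[OF that] zero_prod_def)
      then show "g y = 0" "g' y = 0" unfolding g_def g'_def by (simp_all add: bounded_bilinear.zero_left[OF qbb])
    qed
    fix y :: "real^'n" assume y: "y $ k < 0"
    have dv: "dir_deriv (\<lambda>y. v (y + ?pos x)) ?e y (X (y + ?pos x) $ k)" for x
      using y by (intro dir_deriv_translate d) (simp add: tile_pos_def)
    have bl: "bounded_linear (\<lambda>w. c *\<^sub>R w :: 'f)" for c by (rule bounded_linear_scaleR_right)
    have dZ: "dir_deriv (Z \<xi>) ?e y (Z' \<xi> y)" for \<xi> unfolding Z_def Z'_def dft_cos_def dft_sin_def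
      by (intro dir_deriv_Pair dir_deriv_linear[OF bounded_linear_minus[OF bounded_linear_ident]] dir_deriv_sum dir_deriv_linear[OF bl] dv)
    have dI: "dir_deriv (indicator ?Q :: _ \<Rightarrow> real) ?e y 0"
    proof -
      have "(indicator ?Q (y + t *\<^sub>R ?e) :: real) = indicator ?Q y" for t
        unfolding tile_def by (auto simp: indicator_def axis_def)
      then show ?thesis unfolding dir_deriv_def by simp
    qed
    have "dir_deriv g ?e y (\<Sum>\<xi>\<in>G. indicator ?Q y * (q \<xi> (Z \<xi> y) (Z' \<xi> y) + q \<xi> (Z' \<xi> y) (Z \<xi> y)) + 0 * q \<xi> (Z \<xi> y) (Z \<xi> y))"
      unfolding g_def by (intro dir_deriv_sum dir_deriv_mult dI dir_deriv_bilinear[OF qbb] dZ)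
    then show "dir_deriv g ?e y (g' y)" unfolding g'_def using qs[of _ "Z' _ y" "Z _ y"] by simp
  qed
  moreover have pwi: "real (card G) * (indicator ?Q y * S1 y) + g' y \<le> C * (real (card G) * (indicator ?Q y * S2 y))" for y
    using pw[of y] unfolding g'_def by (cases "y \<in> ?Q") auto
  moreover have Gt: "(\<lambda>j. if j = k then 1 else N) = m" unfolding m_def ..
  have PX: "bdd_supp (\<lambda>y. P (Xh y))" by (rule bdd_supp_linear[OF Xh P])
  have b1: "bdd_supp (\<lambda>y. indicator ?Q y * S1 y)" "bdd_supp (\<lambda>y. indicator ?Q y * S2 y)" unfolding S1_def S2_def
    using bdd_supp_indicator[OF bdd_supp_sum[OF bdd_supp_translate[OF bdd_supp_norm2[OF Xh]]] tile_borel]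
      bdd_supp_indicator[OF bdd_supp_sum[OF bdd_supp_translate[OF bdd_supp_norm2[OF PX]]] tile_borel] by simp_all
  have i1: "lint (\<lambda>y. indicator ?Q y * S1 y) = lint (\<lambda>y. (norm (Xh y))\<^sup>2)"
    unfolding S1_def G_def Gt[symmetric]
    by (rule integral_over_tiles[OF h bdd_supp_norm2[OF Xh]]) (use supp in auto)
  have i2: "lint (\<lambda>y. indicator ?Q y * S2 y) = lint (\<lambda>y. (norm (P (Xh y)))\<^sup>2)"
    unfolding S2_def G_def Gt[symmetric]
  proof (rule integral_over_tiles[OF h bdd_supp_norm2[OF PX]])
    fix z assume "(norm (P (Xh z)))\<^sup>2 \<noteq> 0"
    then have "Xh z \<noteq> 0" using linear_0[OF P] by auto
    then show "\<forall>j. j \<noteq> k \<longrightarrow> a0 \<le> z $ j \<and> z $ j < a0 + h * real N" using supp by blast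
  qed
  have "lint (\<lambda>y. real (card G) * (indicator ?Q y * S1 y) + g' y) \<le> lint (\<lambda>y. C * (real (card G) * (indicator ?Q y * S2 y)))"
    by (intro integral_mono bdd_supp_integrable bdd_supp_add bdd_supp_cmult b1 gb' pwi)
  ultimately have "real (card G) * lint (\<lambda>y. indicator ?Q y * S1 y) \<le> C * (real (card G) * lint (\<lambda>y. indicator ?Q y * S2 y))"
    using bdd_supp_integrable[OF b1(1)] bdd_supp_integrable[OF gb'] by simp
  moreover have "card G > 0"
  proof -
    have "N > 0" using N R(1) h by (cases N) auto
    then show ?thesis unfolding G_def m_def card_dft_grid by (simp add: prod_pos)
  qed
  ultimately show ?thesis unfolding i1 i2 by (simp add: mult.left_commute[of C])
qed

text \<open>The constant of the discrete inequality does not depend on h, so h may tend to 0.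
  Tangential steps stay inside the half-space, where X bounds the difference quotients and gives
  dominated convergence.\<close>

lemma halfspace_korn:
  fixes P :: "'f::euclidean_space^'n::finite \<Rightarrow> 'k::euclidean_space" and k :: 'n
  assumes P: "linear P" and ell: "C_elliptic_map P"
  obtains C where "C \<ge> 0" "\<And>(v :: real^'n \<Rightarrow> 'f) X. bdd_supp v \<Longrightarrow> bdd_supp X \<Longrightarrow> (\<And>x. 0 \<le> x $ k \<Longrightarrow> v x = 0) \<Longrightarrow> (\<And>x. 0 \<le> x $ k \<Longrightarrow> X x = 0) \<Longrightarrow>
     (\<And>x j. x $ k < 0 \<Longrightarrow> dir_deriv v (axis j 1) x (X x $ j)) \<Longrightarrow>
     lint (\<lambda>y. (norm (X y))\<^sup>2) \<le> C * lint (\<lambda>y. (norm (P (X y)))\<^sup>2)"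
proof -
  from tangential_dissipation[OF P ell, of k] obtain C where C: "C \<ge> 0" and diss: "tangentially_dissipative P k C" by blast
  show thesis
  proof (rule that[OF C])
    fix v :: "real^'n \<Rightarrow> 'f" and X :: "real^'n \<Rightarrow> 'f^'n"
    assume v: "bdd_supp v" and X: "bdd_supp X" and out: "\<And>x. 0 \<le> x $ k \<Longrightarrow> v x = 0" "\<And>x. 0 \<le> x $ k \<Longrightarrow> X x = 0"
      and d: "\<And>x j. x $ k < 0 \<Longrightarrow> dir_deriv v (axis j 1) x (X x $ j)"
    define h where "h n = 1 / real (Suc n)" for n
    have h: "h \<longlonglongrightarrow> 0" "\<And>n. h n > 0" "\<And>n. h n \<le> 1" "\<And>n. h n \<noteq> 0" unfolding h_def using LIMSEQ_inverse_real_of_nat by (auto simp: inverse_eq_divide)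
    define Xh where "Xh n = (\<lambda>y. \<chi> j. if j = k then X y $ k else (v (y + h n *\<^sub>R axis j 1) - v y) /\<^sub>R h n)" for n
    have le: "lint (\<lambda>y. (norm (Xh n y))\<^sup>2) \<le> C * lint (\<lambda>y. (norm (P (Xh n y)))\<^sup>2)" for n
      unfolding Xh_def using h(2) by (intro halfspace_korn_discrete[OF P diss v X out d]) auto
    obtain R1 where R1: "R1 > 0" "\<And>x. R1 \<le> norm x \<Longrightarrow> v x = 0" using bdd_suppE[OF v] by metis
    obtain R2 where R2: "R2 > 0" "\<And>x. R2 \<le> norm x \<Longrightarrow> X x = 0" using bdd_suppE[OF X] by metis
    obtain B where B: "B > 0" "\<And>x. norm (X x) \<le> B" using bdd_suppE[OF X] by metis
    define R where "R = max R1 R2 + 1"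
    have Xj: "norm (X y $ j) \<le> B" for y j using B(2)[of y] Finite_Cartesian_Product.norm_nth_le[of "X y" j] by linarith
    have comp: "norm (Xh n y $ j) \<le> B" for n y j
    proof (cases "j = k \<or> 0 \<le> y $ k")
      case True
      then show ?thesis unfolding Xh_def using Xj B(1) out(1) by (auto simp: axis_def)
    next
      case False
      have "norm ((v (y + h n *\<^sub>R axis j 1) - v y) /\<^sub>R h n) \<le> B"
        by (rule dir_deriv_quotient_bound[OF h(2) d Xj]) (use False in \<open>auto simp: axis_def\<close>)
      then show ?thesis using False unfolding Xh_def by simp
    qed
    have bnd: "norm (Xh n y) \<le> real CARD('n) * B" for n y
    proof -
      have "norm (Xh n y) \<le> (\<Sum>j\<in>UNIV. norm (Xh n y $ j))" by (simp add: norm_vec_def L2_set_le_sum)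
      also have "\<dots> \<le> (\<Sum>j\<in>(UNIV::'n set). B)" by (intro sum_mono comp)
      finally show ?thesis by simp
    qed
    have van: "Xh n y = 0" if "R \<le> norm y" for n y
    proof -
      have "v (y + h n *\<^sub>R axis j 1) = 0" for j
      proof (rule R1(2))
        have "norm (h n *\<^sub>R axis j 1 :: real^'n) \<le> 1" using h(2)[of n] h(3)[of n] by simp
        then show "R1 \<le> norm (y + h n *\<^sub>R axis j 1)"
          using that norm_triangle_ineq4[of "y + h n *\<^sub>R axis j 1" "h n *\<^sub>R axis j 1"] unfolding R_def by simp
      qed
      then show ?thesis unfolding Xh_def using R1(2)[of y] R2(2)[of y] that unfolding R_def by (simp add: vec_eq_iff)
    qed
    have lim: "(\<lambda>n. Xh n y) \<longlonglongrightarrow> X y" for y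
    proof (rule vec_tendstoI)
      fix j
      show "(\<lambda>n. Xh n y $ j) \<longlonglongrightarrow> X y $ j"
      proof (cases "j = k \<or> 0 \<le> y $ k")
        case True
        then have "Xh n y $ j = X y $ j" for n unfolding Xh_def using out by (auto simp: axis_def)
        then show ?thesis by simp
      next
        case False
        then show ?thesis unfolding Xh_def using dir_deriv_quotient_tendsto[OF d h(1,4)] by simp
      qed
    qed
    have Xhb: "bdd_supp (Xh n)" for n unfolding Xh_def
    proof (rule bdd_supp_vec)
      fix j show "bdd_supp (\<lambda>x. if j = k then X x $ k else (v (x + h n *\<^sub>R axis j 1) - v x) /\<^sub>R h n)"
        by (cases "j = k") (auto intro!: bdd_supp_nth X bdd_supp_cscale bdd_supp_diff bdd_supp_translate v)
    qed
    have PXb: "bdd_supp (\<lambda>y. P (Xh n y))" for n by (rule bdd_supp_linear[OF Xhb P])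
    obtain KP where KP: "KP > 0" "\<And>x. norm (P x) \<le> KP * norm x" using bounded_linear_pos_bound[OF P] by metis
    have "(\<lambda>n. lint (\<lambda>y. (norm (Xh n y))\<^sup>2)) \<longlonglongrightarrow> lint (\<lambda>y. (norm (X y))\<^sup>2)"
    proof (rule integral_limit_bounded_support[where B = "(real CARD('n) * B)\<^sup>2" and R = R])
      show "(\<lambda>n. (norm (Xh n y))\<^sup>2) \<longlonglongrightarrow> (norm (X y))\<^sup>2" for y by (intro tendsto_intros lim)
      show "norm ((norm (Xh n y))\<^sup>2) \<le> (real CARD('n) * B)\<^sup>2" for n y using power_mono[OF bnd, of n y 2] by simp
    qed (use van bdd_supp_measurable[OF bdd_supp_norm2[OF Xhb]] in auto)
    moreover have "(\<lambda>n. lint (\<lambda>y. (norm (P (Xh n y)))\<^sup>2)) \<longlonglongrightarrow> lint (\<lambda>y. (norm (P (X y)))\<^sup>2)"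
    proof (rule integral_limit_bounded_support[where B = "(KP * (real CARD('n) * B))\<^sup>2" and R = R])
      show "(\<lambda>n. (norm (P (Xh n y)))\<^sup>2) \<longlonglongrightarrow> (norm (P (X y)))\<^sup>2" for y
        by (intro tendsto_intros bounded_linear.tendsto[OF linear_conv_bounded_linear[THEN iffD1, OF P]] lim)
      have "norm (P (Xh n y)) \<le> KP * (real CARD('n) * B)" for n y
        using KP(2)[of "Xh n y"] mult_left_mono[OF bnd[of n y], of KP] KP(1) by linarith
      then show "norm ((norm (P (Xh n y)))\<^sup>2) \<le> (KP * (real CARD('n) * B))\<^sup>2" for n y using power_mono[of "norm (P (Xh n y))" _ 2] by simp
    qed (use van bdd_supp_measurable[OF bdd_supp_norm2[OF PXb]] linear_0[OF P] in auto)
    ultimately show "lint (\<lambda>y. (norm (X y))\<^sup>2) \<le> C * lint (\<lambda>y. (norm (P (X y)))\<^sup>2)"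
      using le by (intro LIMSEQ_le[OF _ tendsto_mult_left]) auto
  qed
qed

section \<open>The null Lagrangian near the boundary\<close>

text \<open>An exponent of at least 2 makes the positive part continuously differentiable; at t = 0
  the difference quotient is itself a power that tends to 0.\<close>

lemma DERIV_pos_part_power:
  "((\<lambda>t::real. max 0 t ^ Suc (Suc n)) has_real_derivative real (Suc (Suc n)) * max 0 t ^ Suc n) (at t)"
proof (cases "t = 0")
  case True
  have "((\<lambda>h::real. max 0 h ^ Suc n) \<longlongrightarrow> max 0 0 ^ Suc n) (at 0)" by (intro tendsto_intros)
  then have "(\<lambda>h::real. (max 0 (0 + h) ^ Suc (Suc n) - max 0 0 ^ Suc (Suc n)) / h) \<midarrow>0\<rightarrow> max 0 0 ^ Suc n"
    by (rule LIM_equal[THEN iffD2, rotated]) (auto simp: max_def)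
  then show ?thesis unfolding True DERIV_def by simp
next
  case False
  show ?thesis
  proof (cases "t > 0")
    case True
    have "((\<lambda>t::real. t ^ Suc (Suc n)) has_real_derivative real (Suc (Suc n)) * t ^ Suc n) (at t)"
      using DERIV_pow[of "Suc (Suc n)" t] by simp
    then have "((\<lambda>t::real. max 0 t ^ Suc (Suc n)) has_real_derivative real (Suc (Suc n)) * t ^ Suc n) (at t)"
      by (rule has_field_derivative_transform_within_open[where S = "{0<..}"]) (use True in auto)
    then show ?thesis using True by simp
  next
    case nt: False
    have "((\<lambda>t::real. 0) has_real_derivative 0) (at t)" by simp
    then have "((\<lambda>t::real. max 0 t ^ Suc (Suc n)) has_real_derivative 0) (at t)"
      by (rule has_field_derivative_transform_within_open[where S = "{..<0}"]) (use False nt in auto)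
    then show ?thesis using False nt by simp
  qed
qed

lemma continuous_on_blinfun_eval:
  "continuous_on S f \<Longrightarrow> continuous_on S (\<lambda>x. blinfun_apply (f x) a)"
  by (rule bounded_linear.continuous_on[OF blinfun.bounded_linear_left])

lemma continuous_on_vec_nth: "continuous_on S f \<Longrightarrow> continuous_on S (\<lambda>x. f x $ i)"
  by (intro continuous_intros)

lemma compact_bound:
  fixes f :: "'a::topological_space \<Rightarrow> 'b::real_normed_vector"
  assumes "compact K" "continuous_on K f"
  obtains B where "B > 0" "\<And>x. x \<in> K \<Longrightarrow> norm (f x) \<le> B"
proof -
  have "bounded (f ` K)" by (intro compact_imp_bounded compact_continuous_image assms)
  then obtain B where "B > 0" "\<forall>y\<in>f ` K. norm y \<le> B" unfolding bounded_pos by blast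
  then show thesis using that by blast
qed

lemma bdd_supp_cut:
  fixes f :: "'a::euclidean_space \<Rightarrow> 'b::euclidean_space"
  assumes "open D" "continuous_on D f" "compact K" "K \<subseteq> D" "\<And>x. x \<in> D \<Longrightarrow> x \<notin> K \<Longrightarrow> f x = 0"
  shows "bdd_supp (\<lambda>x. indicator D x *\<^sub>R f x)"
proof -
  obtain B where B: "B > 0" "\<And>x. x \<in> K \<Longrightarrow> norm (f x) \<le> B"
    using compact_bound[OF assms(3) continuous_on_subset[OF assms(2,4)]] by blast
  obtain R where R: "\<And>x. x \<in> K \<Longrightarrow> norm x \<le> R" using compact_imp_bounded[OF assms(3)] unfolding bounded_iff by blast
  have "(\<lambda>x. indicator D x *\<^sub>R f x) \<in> borel_measurable borel"
    by (rule borel_measurable_continuous_on_indicator) (use assms in auto)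
  moreover have "norm (indicator D x *\<^sub>R f x) \<le> B \<and> (R + 1 \<le> norm x \<longrightarrow> indicator D x *\<^sub>R f x = 0)" for x
  proof (cases "x \<in> K")
    case True
    then show ?thesis using B(2)[OF True] R[OF True] B(1) by (auto simp: indicator_def)
  next
    case False
    then have "indicator D x *\<^sub>R f x = 0" using assms(5) by (auto simp: indicator_def)
    then show ?thesis using B(1) by (metis norm_zero less_imp_le)
  qed
  ultimately show ?thesis unfolding bdd_supp_def by blast
qed

text \<open>This set carries the cut-off functions. Being compact inside \<Omega> \<inter> U, it
  keeps extension by zero from creating a jump.\<close>

lemma sublevel_compact:
  fixes \<rho> :: "'a::euclidean_space \<Rightarrow> real"
  assumes eq: "\<Omega> \<inter> U = {y\<in>U. \<rho> y < 0}" and c\<rho>: "continuous_on U \<rho>"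
    and K: "compact K" "K \<subseteq> U" and \<epsilon>: "\<epsilon> > 0"
  shows "compact {x\<in>K. \<rho> x \<le> - \<epsilon>}" "{x\<in>K. \<rho> x \<le> - \<epsilon>} \<subseteq> \<Omega> \<inter> U"
proof -
  have cK: "continuous_on K \<rho>" using c\<rho> K(2) by (rule continuous_on_subset)
  have "closedin (top_of_set K) (K \<inter> \<rho> -` {..- \<epsilon>})" by (rule continuous_closedin_preimage[OF cK]) simp
  then have "closed (K \<inter> \<rho> -` {..- \<epsilon>})" using K(1) compact_imp_closed closedin_closed_eq by blast
  moreover have "{x\<in>K. \<rho> x \<le> - \<epsilon>} = K \<inter> (K \<inter> \<rho> -` {..- \<epsilon>})" by auto
  ultimately show "compact {x\<in>K. \<rho> x \<le> - \<epsilon>}" using K(1) by (metis compact_Int_closed)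
  show "{x\<in>K. \<rho> x \<le> - \<epsilon>} \<subseteq> \<Omega> \<inter> U" unfolding eq using K(2) \<epsilon> by auto
qed

lemma cutoff_bdd_supp:
  fixes f :: "'a::euclidean_space \<Rightarrow> 'b::euclidean_space" and \<rho> :: "'a \<Rightarrow> real"
  assumes U: "open U" and Om: "open \<Omega>" and eq: "\<Omega> \<inter> U = {y\<in>U. \<rho> y < 0}" and c\<rho>: "continuous_on U \<rho>"
    and K: "compact K" "K \<subseteq> U" and \<epsilon>: "\<epsilon> > 0"
    and cf: "continuous_on (\<Omega> \<inter> U) f" and z: "\<And>x. x \<in> \<Omega> \<inter> U \<Longrightarrow> x \<notin> K \<or> - \<epsilon> < \<rho> x \<Longrightarrow> f x = 0"
  shows "bdd_supp (\<lambda>x. indicator (\<Omega> \<inter> U) x *\<^sub>R f x)"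
  using U Om z by (intro bdd_supp_cut[OF _ cf sublevel_compact[OF eq c\<rho> K \<epsilon>]]) auto

text \<open>A point outside \<Omega> \<inter> U has a neighbourhood that misses the closed support,
  so the extension has derivative 0 there.\<close>

lemma cutoff_dir_deriv:
  fixes f :: "'a::euclidean_space \<Rightarrow> real" and \<rho> :: "'a \<Rightarrow> real"
  assumes U: "open U" and Om: "open \<Omega>" and eq: "\<Omega> \<inter> U = {y\<in>U. \<rho> y < 0}" and c\<rho>: "continuous_on U \<rho>"
    and K: "compact K" "K \<subseteq> U" and \<epsilon>: "\<epsilon> > 0"
    and z: "\<And>x. x \<in> \<Omega> \<inter> U \<Longrightarrow> x \<notin> K \<or> - \<epsilon> < \<rho> x \<Longrightarrow> f x = 0"
    and d: "\<And>x. x \<in> \<Omega> \<inter> U \<Longrightarrow> dir_deriv f e x (f' x)"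
  shows "dir_deriv (\<lambda>x. indicator (\<Omega> \<inter> U) x *\<^sub>R f x) e x (indicator (\<Omega> \<inter> U) x *\<^sub>R f' x)"
proof (cases "x \<in> \<Omega> \<inter> U")
  case True
  have "dir_deriv (\<lambda>x. indicator (\<Omega> \<inter> U) x *\<^sub>R f x) e x (f' x)"
    by (rule dir_deriv_local[OF d[OF True] _ True]) (use U Om in auto)
  then show ?thesis using True by simp
next
  case False
  let ?K' = "{x\<in>K. \<rho> x \<le> - \<epsilon>}"
  note K' = sublevel_compact[OF eq c\<rho> K \<epsilon>]
  have "closed ?K'" using K'(1) by (rule compact_imp_closed)
  moreover have "x \<notin> ?K'" using False K'(2) by blast
  moreover have "0 = indicator (\<Omega> \<inter> U) y *\<^sub>R f y" if "y \<in> - ?K'" for y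
    using z[of y] that by (cases "y \<in> \<Omega> \<inter> U") auto
  ultimately have "dir_deriv (\<lambda>x. indicator (\<Omega> \<inter> U) x *\<^sub>R f x) e x 0"
    by (intro dir_deriv_local[OF dir_deriv_const[of 0 e x], of "- ?K'"]) auto
  then show ?thesis using False by simp
qed

text \<open>Move in the direction \<open>a\<close>, along which \<open>\<rho>\<close> increases at rate at least \<open>c\<close>, until the
  boundary is met.\<close>

lemma boundary_vanishing_bound:
  fixes \<sigma> :: "real^'n::finite \<Rightarrow> real"
  assumes Om: "open \<Omega>" and U: "open U" and eq: "\<Omega> \<inter> U = {y\<in>U. \<rho> y < 0}" and r: "r > 0" "cball p (2 * r) \<subseteq> U"
    and a: "norm a = 1" and c: "c > 0"
    and d\<rho>: "\<And>y. y \<in> cball p (2 * r) \<Longrightarrow> dir_deriv \<rho> a y (\<rho>a y)" "\<And>y. y \<in> cball p (2 * r) \<Longrightarrow> c \<le> \<rho>a y"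
    and c\<rho>: "continuous_on U \<rho>"
    and c\<sigma>: "continuous_on (closure \<Omega> \<inter> cball p (2 * r)) \<sigma>"
    and d\<sigma>: "\<And>y. y \<in> \<Omega> \<inter> cball p (2 * r) \<Longrightarrow> dir_deriv \<sigma> a y (\<sigma>a y)" "\<And>y. y \<in> \<Omega> \<inter> cball p (2 * r) \<Longrightarrow> \<bar>\<sigma>a y\<bar> \<le> B"
    and B: "\<And>y. y \<in> \<Omega> \<inter> cball p (2 * r) \<Longrightarrow> \<bar>\<sigma> y\<bar> \<le> B"
    and zero: "\<And>y. y \<in> frontier \<Omega> \<inter> cball p (2 * r) \<Longrightarrow> \<sigma> y = 0"
    and x: "x \<in> \<Omega> \<inter> cball p r"
  shows "\<bar>\<sigma> x\<bar> \<le> B * (1 / c + 1 / (c * r)) * \<bar>\<rho> x\<bar>"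
proof -
  have x2: "x \<in> \<Omega> \<inter> cball p (2 * r)" using x r(1) by auto
  have B0: "B \<ge> 0" using B[OF x2] by linarith
  have \<rho>x: "\<rho> x < 0" using x2 r(2) eq by auto
  \<comment> \<open>Since \<rho> grows at rate c along a, the boundary is reached within time
    \<tau>. If \<tau> exceeds r the segment may leave the ball, but then |\<sigma>| \<le> B \<le> B
    \<tau> / r. The two cases give the two terms of the constant.\<close>
  define \<tau> where "\<tau> = - \<rho> x / c"
  have \<tau>: "\<tau> > 0" unfolding \<tau>_def using divide_neg_pos[OF \<rho>x c] by simp
  have split: "B * (1 / c + 1 / (c * r)) * \<bar>\<rho> x\<bar> = B * \<tau> + B * (\<tau> / r)"
    unfolding \<tau>_def using \<rho>x c r(1) by (simp add: field_simps)
  show ?thesis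
  proof (cases "\<tau> \<le> r")
    case False
    have "\<bar>\<sigma> x\<bar> \<le> B * 1" using B[OF x2] by simp
    also have "\<dots> \<le> B * (\<tau> / r)" using False r(1) B0 by (intro mult_left_mono) (auto simp: le_divide_eq)
    finally show ?thesis unfolding split using B0 \<tau> by (simp add: add_increasing)
  next
    case True
    have seg: "x + t *\<^sub>R a \<in> cball p (2 * r)" if "0 \<le> t" "t \<le> \<tau>" for t
    proof -
      have "dist p (x + t *\<^sub>R a) \<le> dist p x + dist x (x + t *\<^sub>R a)" by (rule dist_triangle)
      also have "dist x (x + t *\<^sub>R a) = t" using a that by (simp add: dist_norm)
      finally show ?thesis using x that True by auto
    qed
    have segU: "x + t *\<^sub>R a \<in> U" if "0 \<le> t" "t \<le> \<tau>" for t using seg[OF that] r(2) by blast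
    define \<phi> where "\<phi> t = \<rho> (x + t *\<^sub>R a)" for t
    have c\<phi>: "continuous_on {0..\<tau>} \<phi>" unfolding \<phi>_def
      by (rule continuous_on_compose2[OF c\<rho>]) (auto intro!: continuous_intros segU)
    have d\<phi>: "DERIV \<phi> t :> \<rho>a (x + t *\<^sub>R a)" if "0 \<le> t" "t \<le> \<tau>" for t
      using d\<rho>(1)[OF seg[OF that]] unfolding \<phi>_def dir_deriv_at has_real_derivative_iff_has_vector_derivative .
    have grow: "c * (t - s) \<le> \<phi> t - \<phi> s" if st: "0 \<le> s" "s < t" "t \<le> \<tau>" for s t
    proof -
      have "\<exists>l z. z > s \<and> z < t \<and> DERIV \<phi> z :> l \<and> \<phi> t - \<phi> s = (t - s) * l"
      proof (rule MVT[OF st(2)])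
        show "continuous_on {s..t} \<phi>" using c\<phi> by (rule continuous_on_subset) (use st in auto)
        show "\<phi> differentiable (at z)" if "s < z" "z < t" for z
          using d\<phi>[of z] that st by (auto simp: real_differentiable_def)
      qed
      then obtain l z where lz: "s < z" "z < t" "DERIV \<phi> z :> l" "\<phi> t - \<phi> s = (t - s) * l" by blast
      have "l = \<rho>a (x + z *\<^sub>R a)" using DERIV_unique[OF lz(3) d\<phi>[of z]] lz st by simp
      then have "c \<le> l" using d\<rho>(2)[OF seg[of z]] lz st by simp
      then show ?thesis using lz(4) st by (simp add: mult.commute mult_left_mono)
    qed
    have "0 \<le> \<phi> \<tau>" using grow[of 0 \<tau>] \<tau> c \<rho>x unfolding \<tau>_def \<phi>_def by (simp add: field_simps)
    moreover have "\<phi> 0 < 0" unfolding \<phi>_def using \<rho>x by simp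
    ultimately obtain t1 where t1: "0 \<le> t1" "t1 \<le> \<tau>" "\<phi> t1 = 0" using IVT'[of \<phi> 0 0 \<tau>] c\<phi> \<tau> by auto
    have t10: "t1 > 0" using t1 \<open>\<phi> 0 < 0\<close> by (cases "t1 = 0") auto
    \<comment> \<open>Strict growth of \<phi> keeps the segment inside \<Omega> before the zero t1,
      where it meets the frontier.\<close>
    have inside: "x + t *\<^sub>R a \<in> \<Omega> \<inter> cball p (2 * r)" if t: "0 \<le> t" "t < t1" for t
    proof -
      have "\<phi> t < 0" using grow[of t t1] t t1 mult_pos_pos[OF c, of "t1 - t"] by linarith
      then show ?thesis using segU[of t] seg[of t] t t1 eq unfolding \<phi>_def by auto
    qed
    have cl: "x + t *\<^sub>R a \<in> closure \<Omega>" if t: "0 \<le> t" "t \<le> t1" for t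
    proof -
      have "continuous_on {0..t1} (\<lambda>t. x + t *\<^sub>R a)" by (intro continuous_intros)
      then have "(\<lambda>t. x + t *\<^sub>R a) ` closure {0..<t1} \<subseteq> closure \<Omega>"
        using t10 by (intro image_closure_subset) (use inside in \<open>auto simp: closure_atLeastLessThan intro!: closure_subset[THEN subsetD]\<close>)
      then show ?thesis using t t10 by (auto simp: closure_atLeastLessThan image_subset_iff)
    qed
    have "x + t1 *\<^sub>R a \<notin> \<Omega>"
    proof
      assume "x + t1 *\<^sub>R a \<in> \<Omega>"
      then have "x + t1 *\<^sub>R a \<in> {y\<in>U. \<rho> y < 0}" using segU[OF t1(1,2)] unfolding eq[symmetric] by blast
      then show False using t1(3) unfolding \<phi>_def by simp
    qed
    then have "x + t1 *\<^sub>R a \<in> frontier \<Omega>" using cl[of t1] t10 Om by (simp add: frontier_def interior_open)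
    then have z1: "\<sigma> (x + t1 *\<^sub>R a) = 0" using zero seg t1 by simp
    define \<omega> where "\<omega> t = \<sigma> (x + t *\<^sub>R a)" for t
    have "\<exists>l z. z > 0 \<and> z < t1 \<and> DERIV \<omega> z :> l \<and> \<omega> t1 - \<omega> 0 = (t1 - 0) * l"
    proof (rule MVT[OF t10])
      show "continuous_on {0..t1} \<omega>" unfolding \<omega>_def
        by (rule continuous_on_compose2[OF c\<sigma>]) (use t1 in \<open>auto intro!: continuous_intros cl seg[unfolded mem_cball]\<close>)
      show "\<omega> differentiable (at z)" if "0 < z" "z < t1" for z
        using d\<sigma>(1)[OF inside[of z]] that unfolding dir_deriv_at \<omega>_def has_real_derivative_iff_has_vector_derivative[symmetric]
        by (auto simp: real_differentiable_def)
    qed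
    then obtain l z where lz: "0 < z" "z < t1" "DERIV \<omega> z :> l" "\<omega> t1 - \<omega> 0 = (t1 - 0) * l" by blast
    have "DERIV \<omega> z :> \<sigma>a (x + z *\<^sub>R a)"
      using d\<sigma>(1)[OF inside[of z]] lz unfolding dir_deriv_at \<omega>_def has_real_derivative_iff_has_vector_derivative by simp
    then have "\<bar>l\<bar> \<le> B" using DERIV_unique[OF lz(3)] d\<sigma>(2)[OF inside[of z]] lz by simp
    moreover have "\<bar>\<sigma> x\<bar> = t1 * \<bar>l\<bar>" using lz(4) z1 t10 abs_mult[of t1 l] unfolding \<omega>_def by simp
    ultimately have "\<bar>\<sigma> x\<bar> \<le> \<tau> * B" using t1 t10 B0 by (simp add: mult_mono)
    moreover have "0 \<le> B * (\<tau> / r)" using B0 \<tau> r(1) by simp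
    ultimately show ?thesis unfolding split by (simp add: mult.commute)
  qed
qed

text \<open>Pointwise limits, at a fixed value s of \<rho>, of the cutoff and of the factors in its
  derivatives.\<close>

lemma tendsto_cutoff_terms:
  fixes s :: real and \<epsilon> :: "nat \<Rightarrow> real"
  assumes "\<epsilon> \<longlonglongrightarrow> 0" "s \<noteq> 0"
  shows "(\<lambda>n. max 0 (1 + \<epsilon> n / s) ^ m) \<longlonglongrightarrow> 1" "(\<lambda>n. \<epsilon> n / s ^ m) \<longlonglongrightarrow> 0"
proof -
  have "(\<lambda>n. max 0 (1 + \<epsilon> n / s) ^ m) \<longlonglongrightarrow> max 0 (1 + 0 / s) ^ m" using assms by (intro tendsto_intros) auto
  then show "(\<lambda>n. max 0 (1 + \<epsilon> n / s) ^ m) \<longlonglongrightarrow> 1" by simp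
  have "(\<lambda>n. \<epsilon> n / s ^ m) \<longlonglongrightarrow> 0 / s ^ m" using assms by (intro tendsto_intros) auto
  then show "(\<lambda>n. \<epsilon> n / s ^ m) \<longlonglongrightarrow> 0" by simp
qed

definition null_lagrangian :: "((real^'n::finite) \<Rightarrow>\<^sub>L (real^'n)) \<Rightarrow> real" where
  "null_lagrangian L = (\<Sum>i\<in>UNIV. \<Sum>j\<in>UNIV. L (axis i 1) $ j * L (axis j 1) $ i) - (\<Sum>i\<in>UNIV. L (axis i 1) $ i)\<^sup>2"

text \<open>With \<open>\<theta> = \<psi>\<^sup>2\<close> and \<open>\<sigma> = V \<bullet> grad \<rho>\<close>, the first identity combines \<open>\<integral> null_lagrangian (D(\<psi>V)) = 0\<close>
  with the divergence of \<open>\<theta>' \<sigma> V\<close>; the second one, a trace inequality in disguise, is the divergence of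
  \<open>\<theta> |V|\<^sup>2 grad \<rho>\<close>. Here \<open>\<theta>1\<close> and \<open>\<theta>2\<close> are the derivatives of \<open>\<theta>\<close> as a function of \<open>\<rho>\<close>.\<close>

lemma null_lagrangian_cutoff_identity:
  fixes V :: "real^'n::finite \<Rightarrow> real^'n" and DV :: "real^'n \<Rightarrow> ((real^'n) \<Rightarrow>\<^sub>L (real^'n))"
    and \<rho> :: "real^'n \<Rightarrow> real"
  assumes U: "open U" and Om: "open \<Omega>" and eq: "\<Omega> \<inter> U = {y\<in>U. \<rho> y < 0}"
    and C2: "C2_on U \<rho> \<rho>' \<rho>''"
    and K: "compact K" "K \<subseteq> U" and \<epsilon>: "\<epsilon> > 0"
    and V: "\<And>x. x \<in> \<Omega> \<inter> U \<Longrightarrow> (V has_derivative blinfun_apply (DV x)) (at x)" "continuous_on (\<Omega> \<inter> U) DV"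
    and supp: "\<And>x. x \<in> \<Omega> \<inter> U \<Longrightarrow> x \<notin> K \<Longrightarrow> V x = 0 \<and> DV x = 0"
  defines "\<sigma> \<equiv> \<lambda>x. \<Sum>j\<in>UNIV. V x $ j * \<rho>' x (axis j 1)"
    and "\<theta> \<equiv> \<lambda>x. max 0 (1 + \<epsilon> / \<rho> x) ^ 4"
    and "\<theta>1 \<equiv> \<lambda>x. 4 * max 0 (1 + \<epsilon> / \<rho> x) ^ 3 * (- (\<epsilon> / (\<rho> x)\<^sup>2))"
    and "\<theta>2 \<equiv> \<lambda>x. 12 * max 0 (1 + \<epsilon> / \<rho> x) ^ 2 * (\<epsilon> / (\<rho> x)\<^sup>2)\<^sup>2 + 4 * max 0 (1 + \<epsilon> / \<rho> x) ^ 3 * (2 * (\<epsilon> / (\<rho> x) ^ 3))"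
    and "H \<equiv> \<lambda>x. \<Sum>i\<in>UNIV. \<Sum>j\<in>UNIV. V x $ j * V x $ i * \<rho>'' x (axis j 1) (axis i 1)"
    and "dv \<equiv> \<lambda>x. \<Sum>i\<in>UNIV. DV x (axis i 1) $ i"
    and "G2 \<equiv> \<lambda>x. \<Sum>i\<in>UNIV. (\<rho>' x (axis i 1))\<^sup>2"
    and "T3 \<equiv> \<lambda>x. \<Sum>i\<in>UNIV. 2 * (V x \<bullet> DV x (axis i 1)) * \<rho>' x (axis i 1) + (V x \<bullet> V x) * \<rho>'' x (axis i 1) (axis i 1)"
  shows "bdd_supp (\<lambda>x. indicator (\<Omega> \<inter> U) x * (\<theta> x * null_lagrangian (DV x)))"
    and "bdd_supp (\<lambda>x. indicator (\<Omega> \<inter> U) x * (\<theta>1 x * H x))"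
    and "bdd_supp (\<lambda>x. indicator (\<Omega> \<inter> U) x * (\<theta>2 x * (\<sigma> x)\<^sup>2 + 2 * \<theta>1 x * \<sigma> x * dv x))"
    and "bdd_supp (\<lambda>x. indicator (\<Omega> \<inter> U) x * (- \<theta>1 x * G2 x * (V x \<bullet> V x)))"
    and "bdd_supp (\<lambda>x. indicator (\<Omega> \<inter> U) x * (\<theta> x * T3 x))"
    and "lint (\<lambda>x. indicator (\<Omega> \<inter> U) x * (\<theta> x * null_lagrangian (DV x)))
      = lint (\<lambda>x. indicator (\<Omega> \<inter> U) x * (\<theta>1 x * H x))
       + lint (\<lambda>x. indicator (\<Omega> \<inter> U) x * (\<theta>2 x * (\<sigma> x)\<^sup>2 + 2 * \<theta>1 x * \<sigma> x * dv x))"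
    and "lint (\<lambda>x. indicator (\<Omega> \<inter> U) x * (- \<theta>1 x * G2 x * (V x \<bullet> V x)))
      = lint (\<lambda>x. indicator (\<Omega> \<inter> U) x * (\<theta> x * T3 x))"
proof -
  define D where "D = \<Omega> \<inter> U"
  have D: "open D" unfolding D_def using U Om by blast
  have \<rho>neg: "\<rho> x < 0" if "x \<in> D" for x using that eq unfolding D_def by blast
  have DU: "x \<in> U" if "x \<in> D" for x using that unfolding D_def by blast
  have d\<rho>: "(\<rho> has_derivative blinfun_apply (\<rho>' y)) (at y)" "(\<rho>' has_derivative blinfun_apply (\<rho>'' y)) (at y)" if "y \<in> U" for y
    using C2 that unfolding C2_on_def by auto
  have c\<rho>'': "continuous_on U \<rho>''" using C2 unfolding C2_on_def by auto
  have c\<rho>: "continuous_on U \<rho>" "continuous_on U \<rho>'"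
    by (rule has_derivative_continuous_on[OF has_derivative_at_withinI[OF d\<rho>(1)]] has_derivative_continuous_on[OF has_derivative_at_withinI[OF d\<rho>(2)]], assumption)+
  have cV: "continuous_on D V"
    by (rule has_derivative_continuous_on[OF has_derivative_at_withinI[OF V(1)]]) (simp add: D_def)
  have cD: "continuous_on D \<rho>" "continuous_on D \<rho>'" "continuous_on D \<rho>''" "continuous_on D V" "continuous_on D DV"
    using continuous_on_subset[OF c\<rho>(1), of D] continuous_on_subset[OF c\<rho>(2), of D] continuous_on_subset[OF c\<rho>'', of D]
      cV V(2) unfolding D_def by simp_all
  define R where "R i x = \<rho>' x (axis i 1)" for i x
  define R2 where "R2 i j x = \<rho>'' x (axis j 1) (axis i 1)" for i j x
  define W where "W i j x = DV x (axis i 1) $ j" for i j x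
  have cR: "continuous_on D (R i)" for i unfolding R_def by (intro continuous_on_blinfun_eval cD)
  have cR2: "continuous_on D (R2 i j)" for i j unfolding R2_def by (intro continuous_on_blinfun_eval cD)
  have cW: "continuous_on D (W i j)" for i j unfolding W_def by (intro continuous_on_vec_nth continuous_on_blinfun_eval cD)
  have cVj: "continuous_on D (\<lambda>x. V x $ j)" for j by (intro continuous_on_vec_nth cD)
  have dV: "dir_deriv (\<lambda>x. V x $ j) (axis i 1) x (W i j x)" if "x \<in> D" for i j x
  proof -
    have "dir_deriv V (axis i 1) x (DV x (axis i 1))" using V(1) that unfolding D_def by (intro has_derivative_imp_dir_deriv) auto
    from dir_deriv_linear[OF bounded_linear_vec_nth this] show ?thesis unfolding W_def .
  qed
  have dR: "dir_deriv (R i) (axis j 1) x (R2 i j x)" if "x \<in> D" for i j x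
    using dir_deriv_linear[OF blinfun.bounded_linear_left has_derivative_imp_dir_deriv[OF d\<rho>(2)[OF DU[OF that]]], of "axis i 1" "axis j 1"]
    unfolding R_def R2_def .
  have d\<rho>x: "dir_deriv \<rho> (axis i 1) x (R i x)" if "x \<in> D" for i x
    unfolding R_def by (intro has_derivative_imp_dir_deriv d\<rho>(1) DU that)
  have dinner: "DERIV (\<lambda>s. 1 + \<epsilon> / s) s :> - (\<epsilon> / s\<^sup>2)" if "s \<noteq> 0" for s :: real
    using that by (auto intro!: derivative_eq_intros simp: power2_eq_square)
  have dpow: "DERIV (\<lambda>s. max 0 (1 + \<epsilon> / s) ^ Suc (Suc n)) s :> real (Suc (Suc n)) * max 0 (1 + \<epsilon> / s) ^ Suc n * (- (\<epsilon> / s\<^sup>2))" if "s \<noteq> 0" for s :: real and n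
    by (rule DERIV_chain2[OF DERIV_pos_part_power dinner[OF that]])
  \<comment> \<open>The argument 1 + \<epsilon>/\<rho> is negative for \<rho> between -\<epsilon>
    and 0 and tends to 1 as \<epsilon> tends to 0. Exponent 2 makes \<psi> continuously
    differentiable, and exponent 4 gives \<theta> = \<psi>^2 the two derivatives that the divergence
    of \<theta>' \<sigma> V consumes.\<close>
  define \<psi> where "\<psi> x = max 0 (1 + \<epsilon> / \<rho> x) ^ 2" for x
  define \<psi>1 where "\<psi>1 x = 2 * max 0 (1 + \<epsilon> / \<rho> x) * (- (\<epsilon> / (\<rho> x)\<^sup>2))" for x
  have d\<psi>: "dir_deriv \<psi> (axis i 1) x (\<psi>1 x * R i x)" if x: "x \<in> D" for i x
    unfolding \<psi>_def using dir_deriv_chain[OF dpow[of "\<rho> x" 0] d\<rho>x[OF x]] \<rho>neg[OF x] unfolding \<psi>1_def by (simp add: numeral_2_eq_2)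
  have d\<theta>: "dir_deriv \<theta> (axis i 1) x (\<theta>1 x * R i x)" if x: "x \<in> D" for i x
    unfolding \<theta>_def using dir_deriv_chain[OF dpow[of "\<rho> x" 2] d\<rho>x[OF x]] \<rho>neg[OF x] unfolding \<theta>1_def by (simp add: eval_nat_numeral)
  have d\<theta>1: "dir_deriv \<theta>1 (axis i 1) x (\<theta>2 x * R i x)" if x: "x \<in> D" for i x
  proof -
    have d3: "DERIV (\<lambda>s. - (\<epsilon> / s\<^sup>2)) s :> 2 * (\<epsilon> / s ^ 3)" if "s \<noteq> 0" for s :: real
      using that by (auto intro!: derivative_eq_intros simp: power2_eq_square power3_eq_cube mult.commute mult.left_commute)
    note dd = dir_deriv_chain[OF DERIV_mult[OF DERIV_cmult[OF dpow[of _ 1], of _ 4] d3] d\<rho>x[OF x]]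
    from dd[of i] \<rho>neg[OF x]
    show ?thesis unfolding \<theta>1_def \<theta>2_def by (simp add: eval_nat_numeral algebra_simps)
  qed
  have c\<psi>: "continuous_on D \<psi>" "continuous_on D \<psi>1" "continuous_on D \<theta>" "continuous_on D \<theta>1" "continuous_on D \<theta>2"
    unfolding \<psi>_def \<psi>1_def \<theta>_def \<theta>1_def \<theta>2_def using \<rho>neg by (auto intro!: continuous_intros cD simp: less_imp_neq)
  have zero: "\<psi> x = 0" "\<psi>1 x = 0" "\<theta> x = 0" "\<theta>1 x = 0" "\<theta>2 x = 0" if "x \<in> D" "- \<epsilon> < \<rho> x" for x
  proof -
    have "1 + \<epsilon> / \<rho> x \<le> 0" using that \<rho>neg[OF that(1)] \<epsilon> by (simp add: field_simps)
    then have "max 0 (1 + \<epsilon> / \<rho> x) = 0" by simp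
    then show "\<psi> x = 0" "\<psi>1 x = 0" "\<theta> x = 0" "\<theta>1 x = 0" "\<theta>2 x = 0" unfolding \<psi>_def \<psi>1_def \<theta>_def \<theta>1_def \<theta>2_def by simp_all
  qed
  have VW0: "V x = 0" "W i j x = 0" "DV x = 0" if "x \<in> D" "x \<notin> K" for x i j
    using supp[of x] that unfolding D_def W_def by auto
  note cutb = cutoff_bdd_supp[OF U Om eq c\<rho>(1) K \<epsilon>, folded D_def]
  note cutd = cutoff_dir_deriv[OF U Om eq c\<rho>(1) K \<epsilon>, folded D_def]
  define u where "u j x = \<psi> x * V x $ j" for j x
  define u' where "u' i j x = \<psi> x * W i j x + \<psi>1 x * R i x * V x $ j" for i j x
  have du: "dir_deriv (u j) (axis i 1) x (u' i j x)" if "x \<in> D" for i j x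
    unfolding u_def u'_def by (intro dir_deriv_mult d\<psi> dV that)
  have cu: "continuous_on D (u j)" "continuous_on D (u' i j)" for i j
    unfolding u_def u'_def by (intro continuous_intros c\<psi> cVj cW cR)+
  have zu: "u j x = 0 \<and> u' i j x = 0" if "x \<in> D" "x \<notin> K \<or> - \<epsilon> < \<rho> x" for i j x
    using that zero VW0 unfolding u_def u'_def by auto
  have bu: "bdd_supp (\<lambda>x. indicator D x *\<^sub>R u j x)" "bdd_supp (\<lambda>x. indicator D x *\<^sub>R u' i j x)" for i j
    using zu by (intro cutb cu; blast)+
  have deu: "dir_deriv (\<lambda>x. indicator D x *\<^sub>R u j x) (axis i 1) x (indicator D x *\<^sub>R u' i j x)" for i j x
    using zu du by (intro cutd) blast+
  \<comment> \<open>Mixed derivatives of the components of \<psi> V commute under the integral,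
    although the field is only C^1.\<close>
  have swap: "lint (\<lambda>x. (indicator D x *\<^sub>R u' i j x) * (indicator D x *\<^sub>R u' j i x)) = lint (\<lambda>x. (indicator D x *\<^sub>R u' j j x) * (indicator D x *\<^sub>R u' i i x))" for i j
    by (rule integral_mixed_dir_deriv_swap[OF bu(1) bu(1) bu(2) bu(2) bu(2) bu(2) deu deu deu deu])
  \<comment> \<open>T is the inner product of grad \<rho> with the derivative of V along V. It
    occurs in both divergence identities and is eliminated between them.\<close>
  define T where "T x = (\<Sum>i\<in>UNIV. \<Sum>j\<in>UNIV. V x $ i * W i j x * R j x)" for x
  have ibu: "integrable lborel (\<lambda>x. (indicator D x *\<^sub>R u' i j x) * (indicator D x *\<^sub>R u' k l x))" for i j k l
    by (intro bdd_supp_integrable bdd_supp_mult bu)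
  have b1: "bdd_supp (\<lambda>x. (\<Sum>i\<in>UNIV. \<Sum>j\<in>UNIV. (indicator D x *\<^sub>R u' i j x) * (indicator D x *\<^sub>R u' j i x)) - (\<Sum>i\<in>UNIV. \<Sum>j\<in>UNIV. (indicator D x *\<^sub>R u' j j x) * (indicator D x *\<^sub>R u' i i x)))"
    by (intro bdd_supp_diff bdd_supp_sum bdd_supp_mult bu)
  have "lint (\<lambda>x. (\<Sum>i\<in>UNIV. \<Sum>j\<in>UNIV. (indicator D x *\<^sub>R u' i j x) * (indicator D x *\<^sub>R u' j i x)) - (\<Sum>i\<in>UNIV. \<Sum>j\<in>UNIV. (indicator D x *\<^sub>R u' j j x) * (indicator D x *\<^sub>R u' i i x))) = 0"
    (is "lint ?f = 0")
  proof -
    have "lint ?f = (\<Sum>i\<in>UNIV. \<Sum>j\<in>UNIV. lint (\<lambda>x. (indicator D x *\<^sub>R u' i j x) * (indicator D x *\<^sub>R u' j i x)))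
       - (\<Sum>i\<in>UNIV. \<Sum>j\<in>UNIV. lint (\<lambda>x. (indicator D x *\<^sub>R u' j j x) * (indicator D x *\<^sub>R u' i i x)))"
      using ibu by (simp add: Bochner_Integration.integral_diff Bochner_Integration.integral_sum)
    moreover have "(\<Sum>i\<in>UNIV. \<Sum>j\<in>UNIV. lint (\<lambda>x. (indicator D x *\<^sub>R u' i j x) * (indicator D x *\<^sub>R u' j i x)))
       = (\<Sum>i\<in>UNIV. \<Sum>j\<in>UNIV. lint (\<lambda>x. (indicator D x *\<^sub>R u' j j x) * (indicator D x *\<^sub>R u' i i x)))"
      by (intro sum.cong refl swap)
    ultimately show ?thesis by linarith
  qed
  \<comment> \<open>In both double sums the coefficient of \<open>\<psi>1\<close> squared is
    \<sigma>^2, so this most singular term cancels.\<close>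
  moreover have pE1: "(\<Sum>i\<in>UNIV. \<Sum>j\<in>UNIV. (indicator D x *\<^sub>R u' i j x) * (indicator D x *\<^sub>R u' j i x)) - (\<Sum>i\<in>UNIV. \<Sum>j\<in>UNIV. (indicator D x *\<^sub>R u' j j x) * (indicator D x *\<^sub>R u' i i x))
     = indicator D x * (\<theta> x * null_lagrangian (DV x) + \<theta>1 x * (T x - \<sigma> x * dv x))" for x
  proof (cases "x \<in> D")
    case True
    have psq: "\<psi> x * \<psi> x = \<theta> x" "2 * (\<psi> x * \<psi>1 x) = \<theta>1 x" unfolding \<psi>_def \<psi>1_def \<theta>_def \<theta>1_def by (simp_all add: eval_nat_numeral)
    have sw: "(\<Sum>i\<in>UNIV. \<Sum>j\<in>UNIV. W j i x * (R i x * V x $ j)) = (\<Sum>i\<in>UNIV. \<Sum>j\<in>UNIV. W i j x * (R j x * V x $ i))"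
      by (rule sum.swap)
    have "(\<Sum>i\<in>UNIV. \<Sum>j\<in>UNIV. u' i j x * u' j i x) =
       \<psi> x * \<psi> x * (\<Sum>i\<in>UNIV. \<Sum>j\<in>UNIV. W i j x * W j i x) + \<psi> x * \<psi>1 x * (\<Sum>i\<in>UNIV. \<Sum>j\<in>UNIV. W i j x * (R j x * V x $ i))
       + \<psi> x * \<psi>1 x * (\<Sum>i\<in>UNIV. \<Sum>j\<in>UNIV. W j i x * (R i x * V x $ j)) + \<psi>1 x * \<psi>1 x * (\<Sum>i\<in>UNIV. \<Sum>j\<in>UNIV. (R i x * V x $ i) * (R j x * V x $ j))"
      unfolding u'_def sum_distrib_left sum.distrib[symmetric] by (intro sum.cong refl) (simp add: algebra_simps)
    also have "\<dots> = \<theta> x * (\<Sum>i\<in>UNIV. \<Sum>j\<in>UNIV. W i j x * W j i x) + \<theta>1 x * T x + \<psi>1 x * \<psi>1 x * (\<sigma> x * \<sigma> x)"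
      unfolding sw psq(1) psq(2)[symmetric] T_def \<sigma>_def R_def[symmetric] sum_product by (simp add: ac_simps)
    finally have 1: "(\<Sum>i\<in>UNIV. \<Sum>j\<in>UNIV. u' i j x * u' j i x) = \<dots>" .
    have "(\<Sum>i\<in>UNIV. u' i i x) = \<psi> x * dv x + \<psi>1 x * \<sigma> x"
      unfolding u'_def dv_def \<sigma>_def W_def[symmetric] R_def[symmetric] sum_distrib_left sum.distrib[symmetric]
      by (intro sum.cong refl) (simp add: algebra_simps)
    then have "(\<Sum>i\<in>UNIV. \<Sum>j\<in>UNIV. u' j j x * u' i i x) = (\<psi> x * dv x + \<psi>1 x * \<sigma> x) * (\<psi> x * dv x + \<psi>1 x * \<sigma> x)"
    proof -
      assume eq: "(\<Sum>i\<in>UNIV. u' i i x) = \<psi> x * dv x + \<psi>1 x * \<sigma> x"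
      have "(\<Sum>i\<in>UNIV. \<Sum>j\<in>UNIV. u' j j x * u' i i x) = (\<Sum>i\<in>UNIV. u' i i x) * (\<Sum>i\<in>UNIV. u' i i x)"
        unfolding sum_product by (intro sum.cong refl mult.commute)
      then show ?thesis unfolding eq .
    qed
    also have "\<dots> = \<psi> x * \<psi> x * (dv x)\<^sup>2 + 2 * (\<psi> x * \<psi>1 x) * \<sigma> x * dv x + \<psi>1 x * \<psi>1 x * (\<sigma> x * \<sigma> x)"
      by (simp add: power2_eq_square algebra_simps)
    finally have 2: "(\<Sum>i\<in>UNIV. \<Sum>j\<in>UNIV. u' j j x * u' i i x) = \<theta> x * (dv x)\<^sup>2 + \<theta>1 x * \<sigma> x * dv x + \<psi>1 x * \<psi>1 x * (\<sigma> x * \<sigma> x)"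
      unfolding psq .
    show ?thesis using True 1 2 unfolding null_lagrangian_def dv_def[symmetric] W_def[symmetric]
      by (simp add: algebra_simps dv_def W_def)
  qed (simp add: indicator_def)
  ultimately have E1: "lint (\<lambda>x. indicator D x * (\<theta> x * null_lagrangian (DV x) + \<theta>1 x * (T x - \<sigma> x * dv x))) = 0"
    and bE1: "bdd_supp (\<lambda>x. indicator D x * (\<theta> x * null_lagrangian (DV x) + \<theta>1 x * (T x - \<sigma> x * dv x)))"
    using b1 by simp_all
  have c\<sigma>: "continuous_on D \<sigma>" unfolding \<sigma>_def R_def[symmetric] by (intro continuous_intros cVj cR)
  define \<sigma>' where "\<sigma>' j x = (\<Sum>i\<in>UNIV. V x $ i * R2 i j x + W j i x * R i x)" for j x
  have c\<sigma>': "continuous_on D (\<sigma>' j)" for j unfolding \<sigma>'_def by (intro continuous_intros cVj cR cR2 cW)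
  have d\<sigma>: "dir_deriv \<sigma> (axis j 1) x (\<sigma>' j x)" if "x \<in> D" for j x
    unfolding \<sigma>_def R_def[symmetric] \<sigma>'_def by (intro dir_deriv_sum dir_deriv_mult dV dR that)
  define g where "g j x = \<theta>1 x * \<sigma> x * V x $ j" for j x
  define g' where "g' j x = \<theta>1 x * \<sigma> x * W j j x + (\<theta>1 x * \<sigma>' j x + \<theta>2 x * R j x * \<sigma> x) * V x $ j" for j x
  have dg: "dir_deriv (g j) (axis j 1) x (g' j x)" if "x \<in> D" for j x
    unfolding g_def g'_def by (intro dir_deriv_mult d\<theta>1 d\<sigma> dV that)
  have cg: "continuous_on D (g j)" "continuous_on D (g' j)" for j
    unfolding g_def g'_def by (intro continuous_intros c\<psi> cVj cW cR c\<sigma> c\<sigma>')+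
  have zg: "g j x = 0 \<and> g' j x = 0" if "x \<in> D" "x \<notin> K \<or> - \<epsilon> < \<rho> x" for j x
    using that zero VW0 unfolding g_def g'_def by auto
  have eg: "bdd_supp (\<lambda>x. indicator D x *\<^sub>R g j x)" "bdd_supp (\<lambda>x. indicator D x *\<^sub>R g' j x)" for j
    using zg by (intro cutb cg; blast)+
  have eg3: "dir_deriv (\<lambda>x. indicator D x *\<^sub>R g j x) (axis j 1) x (indicator D x *\<^sub>R g' j x)" for j x
    using zg dg by (intro cutd) blast+
  have ig: "lint (\<lambda>x. indicator D x *\<^sub>R g' j x) = 0" for j
    by (rule integral_dir_deriv_zero[OF eg(1) eg(2) eg3])
  have "lint (\<lambda>x. \<Sum>j\<in>UNIV. indicator D x *\<^sub>R g' j x) = 0"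
    by (subst Bochner_Integration.integral_sum) (rule bdd_supp_integrable[OF eg(2)], simp only: ig sum.neutral_const)
  moreover have "(\<Sum>j\<in>UNIV. indicator D x *\<^sub>R g' j x) = indicator D x * (\<theta>2 x * (\<sigma> x)\<^sup>2 + \<theta>1 x * (T x + H x + \<sigma> x * dv x))" for x
  proof -
    have s1: "(\<Sum>j\<in>UNIV. \<sigma>' j x * V x $ j) = T x + H x"
    proof -
      have "H x = (\<Sum>j\<in>UNIV. \<Sum>i\<in>UNIV. V x $ j * V x $ i * R2 i j x)" unfolding H_def R2_def by (rule sum.swap)
      then show ?thesis unfolding \<sigma>'_def T_def sum_distrib_right sum.distrib[symmetric]
        by (simp add: sum.distrib[symmetric] algebra_simps)
    qed
    have "(\<Sum>j\<in>UNIV. g' j x) = \<theta>1 x * \<sigma> x * dv x + \<theta>1 x * (\<Sum>j\<in>UNIV. \<sigma>' j x * V x $ j) + \<theta>2 x * \<sigma> x * \<sigma> x"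
      unfolding g'_def dv_def W_def[symmetric]
      by (subst (5) \<sigma>_def) (simp add: R_def[symmetric] sum_distrib_left sum.distrib[symmetric] algebra_simps)
    then show ?thesis unfolding s1 by (simp add: sum_distrib_left[symmetric] power2_eq_square algebra_simps)
  qed
  moreover have "bdd_supp (\<lambda>x. \<Sum>j\<in>UNIV. indicator D x *\<^sub>R g' j x)" by (intro bdd_supp_sum eg(2))
  ultimately have E2: "lint (\<lambda>x. indicator D x * (\<theta>2 x * (\<sigma> x)\<^sup>2 + \<theta>1 x * (T x + H x + \<sigma> x * dv x))) = 0"
    and bE2: "bdd_supp (\<lambda>x. indicator D x * (\<theta>2 x * (\<sigma> x)\<^sup>2 + \<theta>1 x * (T x + H x + \<sigma> x * dv x)))" by simp_all
  define k where "k i x = \<theta> x * (V x \<bullet> V x) * R i x" for i x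
  define k' where "k' i x = \<theta> x * (V x \<bullet> V x) * R2 i i x + (\<theta> x * (V x \<bullet> DV x (axis i 1) + DV x (axis i 1) \<bullet> V x) + \<theta>1 x * R i x * (V x \<bullet> V x)) * R i x" for i x
  have dVv: "dir_deriv V (axis i 1) x (DV x (axis i 1))" if "x \<in> D" for i x
    using V(1) that unfolding D_def by (intro has_derivative_imp_dir_deriv) auto
  have dk: "dir_deriv (k i) (axis i 1) x (k' i x)" if "x \<in> D" for i x
    unfolding k_def k'_def by (intro dir_deriv_mult dir_deriv_inner d\<theta> dR dVv that)
  have ck: "continuous_on D (k i)" "continuous_on D (k' i)" for i
    unfolding k_def k'_def by (intro continuous_intros continuous_on_blinfun_eval c\<psi> cD cR cR2)+
  have zk: "k i x = 0 \<and> k' i x = 0" if "x \<in> D" "x \<notin> K \<or> - \<epsilon> < \<rho> x" for i x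
    using that zero VW0 unfolding k_def k'_def by auto
  have ek: "bdd_supp (\<lambda>x. indicator D x *\<^sub>R k i x)" "bdd_supp (\<lambda>x. indicator D x *\<^sub>R k' i x)" for i
    using zk by (intro cutb ck; blast)+
  have ek3: "dir_deriv (\<lambda>x. indicator D x *\<^sub>R k i x) (axis i 1) x (indicator D x *\<^sub>R k' i x)" for i x
    using zk dk by (intro cutd) blast+
  have ik: "lint (\<lambda>x. indicator D x *\<^sub>R k' i x) = 0" for i
    by (rule integral_dir_deriv_zero[OF ek(1) ek(2) ek3])
  have "lint (\<lambda>x. \<Sum>i\<in>UNIV. indicator D x *\<^sub>R k' i x) = 0"
    by (subst Bochner_Integration.integral_sum) (rule bdd_supp_integrable[OF ek(2)], simp only: ik sum.neutral_const)
  moreover have pk: "(\<Sum>i\<in>UNIV. indicator D x *\<^sub>R k' i x) = indicator D x * (\<theta> x * T3 x) - indicator D x * (- \<theta>1 x * G2 x * (V x \<bullet> V x))" for x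
  proof -
    have "(\<Sum>i\<in>UNIV. k' i x) = \<theta> x * T3 x + \<theta>1 x * G2 x * (V x \<bullet> V x)"
      unfolding k'_def T3_def G2_def R_def[symmetric] R2_def sum_distrib_left sum_distrib_right sum.distrib[symmetric]
      by (intro sum.cong refl) (simp add: inner_commute power2_eq_square algebra_simps)
    then show ?thesis by (simp add: sum_distrib_left[symmetric] algebra_simps)
  qed
  ultimately have E3: "lint (\<lambda>x. indicator D x * (\<theta> x * T3 x) - indicator D x * (- \<theta>1 x * G2 x * (V x \<bullet> V x))) = 0" by simp
  have cutr: "bdd_supp (\<lambda>x. indicator D x * f x)" if "continuous_on D f" "\<And>x. x \<in> D \<Longrightarrow> x \<notin> K \<or> - \<epsilon> < \<rho> x \<Longrightarrow> f x = 0" for f :: "_ \<Rightarrow> real"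
    using cutb[OF that] by simp
  have cn: "continuous_on D (\<lambda>x. null_lagrangian (DV x))"
    unfolding null_lagrangian_def by (intro continuous_intros continuous_on_vec_nth continuous_on_blinfun_eval cD)
  have cH: "continuous_on D H" unfolding H_def R2_def[symmetric] by (intro continuous_intros cVj cR2)
  have cdv: "continuous_on D dv" unfolding dv_def W_def[symmetric] by (intro continuous_intros cW)
  have cG2: "continuous_on D G2" unfolding G2_def R_def[symmetric] by (intro continuous_intros cR)
  have cT3: "continuous_on D T3" unfolding T3_def R_def[symmetric] R2_def[symmetric]
    by (intro continuous_intros continuous_on_blinfun_eval cD cR cR2)
  have z3: "null_lagrangian (DV x) = 0" "H x = 0" "\<sigma> x = 0" "T3 x = 0" if "x \<in> D" "x \<notin> K" for x
    using VW0[OF that] unfolding null_lagrangian_def H_def \<sigma>_def T3_def by simp_all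
  show b1: "bdd_supp (\<lambda>x. indicator (\<Omega> \<inter> U) x * (\<theta> x * null_lagrangian (DV x)))"
    unfolding D_def[symmetric] by (rule cutr) (auto intro!: continuous_intros c\<psi> cn simp: zero z3)
  show b2: "bdd_supp (\<lambda>x. indicator (\<Omega> \<inter> U) x * (\<theta>1 x * H x))"
    unfolding D_def[symmetric] by (rule cutr) (auto intro!: continuous_intros c\<psi> cH simp: zero z3)
  show b3: "bdd_supp (\<lambda>x. indicator (\<Omega> \<inter> U) x * (\<theta>2 x * (\<sigma> x)\<^sup>2 + 2 * \<theta>1 x * \<sigma> x * dv x))"
    unfolding D_def[symmetric] by (rule cutr) (auto intro!: continuous_intros c\<psi> c\<sigma> cdv simp: zero z3)
  show b4: "bdd_supp (\<lambda>x. indicator (\<Omega> \<inter> U) x * (- \<theta>1 x * G2 x * (V x \<bullet> V x)))"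
    unfolding D_def[symmetric] by (rule cutr) (auto intro!: continuous_intros c\<psi> cG2 cD simp: zero VW0)
  show b5: "bdd_supp (\<lambda>x. indicator (\<Omega> \<inter> U) x * (\<theta> x * T3 x))"
    unfolding D_def[symmetric] by (rule cutr) (auto intro!: continuous_intros c\<psi> cT3 simp: zero z3)
  \<comment> \<open>Subtracting the two vanishing integrals eliminates \<theta>1 T.\<close>
  have "lint (\<lambda>x. indicator D x * (\<theta> x * null_lagrangian (DV x)))
     = lint (\<lambda>x. (indicator D x * (\<theta> x * null_lagrangian (DV x) + \<theta>1 x * (T x - \<sigma> x * dv x)) - indicator D x * (\<theta>2 x * (\<sigma> x)\<^sup>2 + \<theta>1 x * (T x + H x + \<sigma> x * dv x)))
         + (indicator D x * (\<theta>1 x * H x) + indicator D x * (\<theta>2 x * (\<sigma> x)\<^sup>2 + 2 * \<theta>1 x * \<sigma> x * dv x)))"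
    by (rule Bochner_Integration.integral_cong) (simp_all add: algebra_simps)
  also have "\<dots> = lint (\<lambda>x. indicator D x * (\<theta>1 x * H x))
       + lint (\<lambda>x. indicator D x * (\<theta>2 x * (\<sigma> x)\<^sup>2 + 2 * \<theta>1 x * \<sigma> x * dv x))"
    using bdd_supp_integrable[OF bE1] bdd_supp_integrable[OF bE2] bdd_supp_integrable[OF b2] bdd_supp_integrable[OF b3] E1 E2
    unfolding D_def[symmetric] by (simp add: Bochner_Integration.integral_diff Bochner_Integration.integral_add del: ring_distribs)
  finally show "lint (\<lambda>x. indicator (\<Omega> \<inter> U) x * (\<theta> x * null_lagrangian (DV x)))
      = lint (\<lambda>x. indicator (\<Omega> \<inter> U) x * (\<theta>1 x * H x))
       + lint (\<lambda>x. indicator (\<Omega> \<inter> U) x * (\<theta>2 x * (\<sigma> x)\<^sup>2 + 2 * \<theta>1 x * \<sigma> x * dv x))"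
    unfolding D_def .
  show "lint (\<lambda>x. indicator (\<Omega> \<inter> U) x * (- \<theta>1 x * G2 x * (V x \<bullet> V x)))
      = lint (\<lambda>x. indicator (\<Omega> \<inter> U) x * (\<theta> x * T3 x))"
    using E3 bdd_supp_integrable[OF b4] bdd_supp_integrable[OF b5] unfolding D_def[symmetric]
    by (simp add: Bochner_Integration.integral_diff)
qed

text \<open>The counterpart for functions that do not vanish near the boundary: continuity on the
  compact set \<open>closure \<Omega> \<inter> K\<close> provides the bound.\<close>

lemma bdd_supp_closure_cut:
  fixes f :: "'a::euclidean_space \<Rightarrow> 'b::euclidean_space"
  assumes "open \<Omega>" "continuous_on (closure \<Omega>) f" "compact K" "\<And>x. x \<in> closure \<Omega> \<Longrightarrow> x \<notin> K \<Longrightarrow> f x = 0"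
  shows "bdd_supp (\<lambda>x. indicator \<Omega> x *\<^sub>R f x)"
proof -
  have "compact (closure \<Omega> \<inter> K)" using assms(3) by (simp add: closed_Int_compact)
  then obtain B where B: "B > 0" "\<And>x. x \<in> closure \<Omega> \<inter> K \<Longrightarrow> norm (f x) \<le> B"
    using compact_bound[of "closure \<Omega> \<inter> K" f] continuous_on_subset[OF assms(2), of "closure \<Omega> \<inter> K"] by blast
  obtain R where R: "\<And>x. x \<in> K \<Longrightarrow> norm x \<le> R" using compact_imp_bounded[OF assms(3)] unfolding bounded_iff by blast
  have "(\<lambda>x. indicator \<Omega> x *\<^sub>R f x) \<in> borel_measurable borel"
    using assms(1) continuous_on_subset[OF assms(2) closure_subset] by (intro borel_measurable_continuous_on_indicator) auto
  moreover have "norm (indicator \<Omega> x *\<^sub>R f x) \<le> B \<and> (R + 1 \<le> norm x \<longrightarrow> indicator \<Omega> x *\<^sub>R f x = 0)" for x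
  proof (cases "x \<in> \<Omega> \<inter> K")
    case True
    then have "x \<in> closure \<Omega> \<inter> K" using closure_subset[of \<Omega>] by blast
    then show ?thesis using B R[of x] True by auto
  next
    case False
    then have "indicator \<Omega> x *\<^sub>R f x = 0" using assms(4)[of x] closure_subset[of \<Omega>] by (cases "x \<in> \<Omega>") auto
    then show ?thesis using B(1) by (metis norm_zero less_imp_le)
  qed
  ultimately show ?thesis unfolding bdd_supp_def by blast
qed

text \<open>With t = \<epsilon>/|s| and m the positive part of 1 - t, each term is a product m^i t^j
  with i \<ge> 1 times a power of L. Such products are at most 1, because m vanishes for t > 1. This
  gives 12 + 8 = 20 and 4, uniformly in \<epsilon>.\<close>

lemma cutoff_term_bounds:
  fixes \<epsilon> s \<sigma> L :: real
  assumes "\<epsilon> > 0" "s < 0" "\<bar>\<sigma>\<bar> \<le> L * \<bar>s\<bar>" "L \<ge> 0"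
  shows "\<bar>(12 * max 0 (1 + \<epsilon> / s) ^ 2 * (\<epsilon> / s\<^sup>2)\<^sup>2 + 4 * max 0 (1 + \<epsilon> / s) ^ 3 * (2 * (\<epsilon> / s ^ 3))) * \<sigma>\<^sup>2\<bar> \<le> 20 * L\<^sup>2"
    "\<bar>4 * max 0 (1 + \<epsilon> / s) ^ 3 * (- (\<epsilon> / s\<^sup>2)) * \<sigma>\<bar> \<le> 4 * L"
proof -
  define t where "t = \<epsilon> / \<bar>s\<bar>"
  define m where "m = max 0 (1 + \<epsilon> / s)"
  have t0: "t > 0" unfolding t_def using divide_pos_neg[OF assms(1,2)] assms(2) by simp
  have mt: "m = max 0 (1 - t)" unfolding m_def t_def using assms by simp
  have m01: "0 \<le> m" "m \<le> 1" unfolding mt using t0 by auto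
  have mp: "0 \<le> m ^ i" "m ^ i \<le> 1" for i using m01 by (auto intro: power_le_one)
  have key: "m ^ Suc i * t ^ j \<le> 1" for i j
  proof (cases "t \<le> 1")
    case True
    then show ?thesis using mp[of "Suc i"] t0 by (intro mult_le_one) (auto intro: power_le_one)
  next
    case False
    then show ?thesis unfolding mt by simp
  qed
  have ss: "\<bar>s\<bar> > 0" using assms by simp
  have \<sigma>2: "\<sigma>\<^sup>2 \<le> L\<^sup>2 * s\<^sup>2" using power_mono[OF assms(3), of 2] by (simp add: power_mult_distrib)
  have e1: "(\<epsilon> / s\<^sup>2)\<^sup>2 * s\<^sup>2 = t ^ 2" unfolding t_def using ss by (simp add: field_simps power2_eq_square)
  have e2: "\<bar>\<epsilon> / s ^ 3\<bar> * s\<^sup>2 = t ^ 1" unfolding t_def using ss assms(1) by (simp add: abs_mult power3_eq_cube power2_eq_square)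
  have e3: "\<bar>\<epsilon> / s\<^sup>2\<bar> * \<bar>s\<bar> = t ^ 1" unfolding t_def using ss assms(1) by (simp add: field_simps abs_mult power2_eq_square)
  have "\<bar>(12 * m ^ 2 * (\<epsilon> / s\<^sup>2)\<^sup>2 + 4 * m ^ 3 * (2 * (\<epsilon> / s ^ 3))) * \<sigma>\<^sup>2\<bar>
      \<le> (12 * m ^ 2 * (\<epsilon> / s\<^sup>2)\<^sup>2 + 8 * m ^ 3 * \<bar>\<epsilon> / s ^ 3\<bar>) * \<sigma>\<^sup>2"
  proof -
    have "\<bar>12 * m ^ 2 * (\<epsilon> / s\<^sup>2)\<^sup>2 + 4 * m ^ 3 * (2 * (\<epsilon> / s ^ 3))\<bar> \<le> \<bar>12 * m ^ 2 * (\<epsilon> / s\<^sup>2)\<^sup>2\<bar> + \<bar>4 * m ^ 3 * (2 * (\<epsilon> / s ^ 3))\<bar>"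
      by (rule abs_triangle_ineq)
    also have "\<dots> = 12 * m ^ 2 * (\<epsilon> / s\<^sup>2)\<^sup>2 + 8 * m ^ 3 * \<bar>\<epsilon> / s ^ 3\<bar>"
      using mp(1)[of 3] mp(1)[of 2] by (simp only: abs_mult abs_of_nonneg[OF mp(1)] abs_power2 abs_numeral)
    finally show ?thesis by (simp only: abs_mult abs_power2 mult_right_mono zero_le_power2)
  qed
  also have "\<dots> \<le> (12 * m ^ 2 * (\<epsilon> / s\<^sup>2)\<^sup>2 + 8 * m ^ 3 * \<bar>\<epsilon> / s ^ 3\<bar>) * (L\<^sup>2 * s\<^sup>2)"
    using \<sigma>2 mp m01(1) by (intro mult_left_mono add_nonneg_nonneg mult_nonneg_nonneg) auto
  also have "\<dots> = (12 * m ^ 2 * ((\<epsilon> / s\<^sup>2)\<^sup>2 * s\<^sup>2) + 8 * m ^ 3 * (\<bar>\<epsilon> / s ^ 3\<bar> * s\<^sup>2)) * L\<^sup>2"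
    by (simp only: distrib_right mult.assoc mult.commute[of "s\<^sup>2" "L\<^sup>2"])
  also have "\<dots> = (12 * (m ^ 2 * t ^ 2) + 8 * (m ^ 3 * t ^ 1)) * L\<^sup>2" unfolding e1 e2 by (simp only: mult.assoc)
  also have "\<dots> \<le> (12 * 1 + 8 * 1) * L\<^sup>2"
    using key[of 1 2] key[of 2 1] by (intro mult_right_mono add_mono mult_left_mono) (simp_all add: eval_nat_numeral)
  finally show "\<bar>(12 * max 0 (1 + \<epsilon> / s) ^ 2 * (\<epsilon> / s\<^sup>2)\<^sup>2 + 4 * max 0 (1 + \<epsilon> / s) ^ 3 * (2 * (\<epsilon> / s ^ 3))) * \<sigma>\<^sup>2\<bar> \<le> 20 * L\<^sup>2"
    unfolding m_def by simp
  have "\<bar>4 * m ^ 3 * (- (\<epsilon> / s\<^sup>2)) * \<sigma>\<bar> = 4 * m ^ 3 * \<bar>\<epsilon> / s\<^sup>2\<bar> * \<bar>\<sigma>\<bar>"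
    by (simp only: abs_mult abs_minus_cancel abs_of_nonneg[OF mp(1)] abs_numeral)
  also have "\<dots> \<le> 4 * m ^ 3 * \<bar>\<epsilon> / s\<^sup>2\<bar> * (L * \<bar>s\<bar>)"
    using assms(3) mp m01(1) by (intro mult_left_mono mult_nonneg_nonneg) auto
  also have "\<dots> = 4 * (m ^ 3 * (\<bar>\<epsilon> / s\<^sup>2\<bar> * \<bar>s\<bar>)) * L" by (simp only: ac_simps)
  also have "\<dots> \<le> 4 * 1 * L" unfolding e3 using key[of 2 1] assms(4)
    by (intro mult_right_mono mult_left_mono) (simp_all add: eval_nat_numeral)
  finally show "\<bar>4 * max 0 (1 + \<epsilon> / s) ^ 3 * (- (\<epsilon> / s\<^sup>2)) * \<sigma>\<bar> \<le> 4 * L" unfolding m_def by simp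
qed

text \<open>A coordinate direction replaces the normal: it is constant on a whole ball, gives
  straight segments to the boundary, and its coordinate can be exchanged for \<rho> when the
  boundary is flattened.\<close>

lemma defining_gradient_direction:
  fixes \<rho>' :: "real^'n::finite \<Rightarrow> ((real^'n) \<Rightarrow>\<^sub>L real)"
  assumes "open U" "p \<in> U" "continuous_on U \<rho>'" "\<rho>' p \<noteq> 0"
  obtains k s c \<delta> where "\<bar>s\<bar> = 1" "c > 0" "\<delta> > 0" "cball p \<delta> \<subseteq> U" "\<And>x. x \<in> cball p \<delta> \<Longrightarrow> c \<le> s * \<rho>' x (axis k 1)"
proof -
  obtain k where k: "\<rho>' p (axis k 1) \<noteq> 0"
  proof (rule ccontr)
    assume "\<not> thesis"
    then have "\<rho>' p (axis k 1) = 0" for k using that by blast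
    then have "\<rho>' p = 0" by (intro blinfun_euclidean_eqI) (auto simp: Basis_vec_def)
    then show False using assms(4) by simp
  qed
  define s where "s = sgn (\<rho>' p (axis k 1))"
  define c where "c = \<bar>\<rho>' p (axis k 1)\<bar> / 2"
  have c: "c > 0" unfolding c_def using k by simp
  have "s * \<rho>' p (axis k 1) = 2 * c" unfolding s_def c_def by (simp add: mult.commute abs_sgn)
  moreover have "continuous_on U (\<lambda>x. s * \<rho>' x (axis k 1))" by (intro continuous_intros continuous_on_blinfun_eval assms)
  ultimately have "open (U \<inter> (\<lambda>x. s * \<rho>' x (axis k 1)) -` {c<..})" "p \<in> U \<inter> (\<lambda>x. s * \<rho>' x (axis k 1)) -` {c<..}"
    using assms(1,2) c by (auto intro: continuous_open_preimage)
  then obtain \<delta> where \<delta>: "\<delta> > 0" "cball p \<delta> \<subseteq> U \<inter> (\<lambda>x. s * \<rho>' x (axis k 1)) -` {c<..}" by (meson open_contains_cball)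
  show thesis
  proof (rule that[of s c \<delta> k])
    show "\<bar>s\<bar> = 1" unfolding s_def using k by (simp add: abs_sgn_eq)
    show "c \<le> s * \<rho>' x (axis k 1)" if "x \<in> cball p \<delta>" for x using \<delta>(2) that by (auto intro: less_imp_le)
  qed (use c \<delta> in auto)
qed

text \<open>In the cutoff identity the term with H is a smeared curvature integral. Since -\<theta>1
  is nonnegative and |grad \<rho>| \<ge> c, it is controlled by the left side of the second
  identity, whose right side is a volume integral with the bounded weight \<theta>. The terms with
  \<sigma> disappear in the limit because tangency makes \<sigma> = O(|\<rho>|).\<close>

lemma null_lagrangian_boundary_bound:
  fixes \<Omega> :: "(real^'n::finite) set"
  assumes Om: "open \<Omega>" and ldf: "local_defining_fun \<Omega> p U \<rho> \<rho>'"
  obtains r C where "r > 0" "C \<ge> 0" "cball p r \<subseteq> U"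
    "\<And>V DV. C1_closure \<Omega> V DV \<Longrightarrow> (\<And>x. x \<in> closure \<Omega> \<Longrightarrow> x \<notin> cball p r \<Longrightarrow> V x = 0 \<and> DV x = 0) \<Longrightarrow>
      (\<And>q. q \<in> frontier \<Omega> \<inter> U \<Longrightarrow> V q \<bullet> grad (\<rho>' q) = 0) \<Longrightarrow>
      lint (\<lambda>x. indicator \<Omega> x * null_lagrangian (DV x))
       \<le> C * lint (\<lambda>x. indicator \<Omega> x * (norm (V x) * norm (DV x) + (norm (V x))\<^sup>2))"
proof -
  obtain \<rho>'' where U: "open U" "p \<in> U" and C2: "C2_on U \<rho> \<rho>' \<rho>''" and nz: "\<And>y. y \<in> U \<Longrightarrow> \<rho>' y \<noteq> 0" and eq: "\<Omega> \<inter> U = {y\<in>U. \<rho> y < 0}"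
    using ldf unfolding local_defining_fun_def by blast
  have d\<rho>: "(\<rho> has_derivative blinfun_apply (\<rho>' y)) (at y)" "(\<rho>' has_derivative blinfun_apply (\<rho>'' y)) (at y)" if "y \<in> U" for y
    using C2 that unfolding C2_on_def by auto
  have c\<rho>'': "continuous_on U \<rho>''" using C2 unfolding C2_on_def by auto
  have c\<rho>: "continuous_on U \<rho>" "continuous_on U \<rho>'"
    by (rule has_derivative_continuous_on[OF has_derivative_at_withinI[OF d\<rho>(1)]] has_derivative_continuous_on[OF has_derivative_at_withinI[OF d\<rho>(2)]], assumption)+
  obtain k s c \<delta> where s: "\<bar>s\<bar> = 1" and c: "c > 0" and \<delta>: "\<delta> > 0" "cball p \<delta> \<subseteq> U"
    and grow: "\<And>x. x \<in> cball p \<delta> \<Longrightarrow> c \<le> s * \<rho>' x (axis k 1)"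
    using defining_gradient_direction[OF U c\<rho>(2) nz[OF U(2)]] by metis
  \<comment> \<open>Half the radius, so that the segments of length at most r that bound \<sigma>
    stay in \<open>cball p \<delta>\<close>.\<close>
  define r where "r = \<delta> / 2"
  have r: "r > 0" "cball p (2 * r) = cball p \<delta>" "cball p r \<subseteq> cball p \<delta>" unfolding r_def using \<delta>(1) by auto
  define a where "a = s *\<^sub>R axis k (1::real)"
  have na: "norm a = 1" unfolding a_def using s by simp
  let ?n = "real CARD('n)"
  obtain M1 where M1: "M1 > 0" "\<And>x. x \<in> cball p \<delta> \<Longrightarrow> norm (\<rho>' x) \<le> M1"
    using compact_bound[OF compact_cball continuous_on_subset[OF c\<rho>(2) \<delta>(2)]] by blast
  obtain M2 where M2: "M2 > 0" "\<And>x. x \<in> cball p \<delta> \<Longrightarrow> norm (\<rho>'' x) \<le> M2"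
    using compact_bound[OF compact_cball continuous_on_subset[OF c\<rho>'' \<delta>(2)]] by blast
  define M where "M = max M1 M2"
  have M: "M > 0" unfolding M_def using M1 by simp
  have bR: "\<bar>\<rho>' x v\<bar> \<le> M * norm v" if "x \<in> cball p \<delta>" for x v
  proof -
    have "\<bar>\<rho>' x v\<bar> \<le> norm (\<rho>' x) * norm v" using norm_blinfun[of "\<rho>' x" v] by simp
    also have "\<dots> \<le> M * norm v" using M1(2)[OF that] unfolding M_def by (intro mult_right_mono) auto
    finally show ?thesis .
  qed
  have bR2: "\<bar>\<rho>'' x v w\<bar> \<le> M * norm v * norm w" if "x \<in> cball p \<delta>" for x v w
  proof -
    have "\<bar>\<rho>'' x v w\<bar> \<le> norm (\<rho>'' x v) * norm w" using norm_blinfun[of "\<rho>'' x v" w] by simp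
    also have "\<dots> \<le> (norm (\<rho>'' x) * norm v) * norm w" by (intro mult_right_mono norm_blinfun) auto
    also have "\<dots> \<le> (M * norm v) * norm w" using M2(2)[OF that] unfolding M_def by (intro mult_right_mono) auto
    finally show ?thesis .
  qed
  \<comment> \<open>The first factor compares H with G2 |V|^2, the second bounds T3.\<close>
  define C where "C = ?n\<^sup>2 * M / c\<^sup>2 * (?n * (2 * M))"
  have C0: "C \<ge> 0" unfolding C_def using M c by simp
  show thesis
  proof (rule that[of r C])
    show "r > 0" "C \<ge> 0" "cball p r \<subseteq> U" using r C0 \<delta> by auto
    fix V :: "real^'n \<Rightarrow> real^'n" and DV
    assume C1: "C1_closure \<Omega> V DV" and supp: "\<And>x. x \<in> closure \<Omega> \<Longrightarrow> x \<notin> cball p r \<Longrightarrow> V x = 0 \<and> DV x = 0"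
      and bc: "\<And>q. q \<in> frontier \<Omega> \<inter> U \<Longrightarrow> V q \<bullet> grad (\<rho>' q) = 0"
    have cV: "continuous_on (closure \<Omega>) V" "continuous_on (closure \<Omega>) DV"
      and dV: "\<And>x. x \<in> \<Omega> \<Longrightarrow> (V has_derivative blinfun_apply (DV x)) (at x)" using C1 unfolding C1_closure_def by auto
    define K where "K = cball p r"
    have K: "compact K" "K \<subseteq> U" "K \<subseteq> cball p \<delta>" unfolding K_def using r \<delta> by auto
    have incl: "\<Omega> \<subseteq> closure \<Omega>" by (rule closure_subset)
    have supp': "V x = 0 \<and> DV x = 0" if "x \<in> \<Omega> \<inter> U" "x \<notin> K" for x using supp[of x] that incl unfolding K_def by blast
    have cVD: "continuous_on (\<Omega> \<inter> U) DV" using cV(2) incl by (auto intro: continuous_on_subset)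
    have comK: "compact (closure \<Omega> \<inter> cball p \<delta>)" by (simp add: closed_Int_compact)
    obtain B1 where B1: "B1 > 0" "\<And>x. x \<in> closure \<Omega> \<inter> cball p \<delta> \<Longrightarrow> norm (V x) \<le> B1"
      using compact_bound[OF comK, of V] continuous_on_subset[OF cV(1)] by blast
    obtain B2 where B2: "B2 > 0" "\<And>x. x \<in> closure \<Omega> \<inter> cball p \<delta> \<Longrightarrow> norm (DV x) \<le> B2"
      using compact_bound[OF comK, of DV] continuous_on_subset[OF cV(2)] by blast
    have Vj: "\<bar>V x $ j\<bar> \<le> norm (V x)" for x j by (rule component_le_norm_cart)
    have DVi: "norm (DV x e) \<le> norm (DV x) * norm e" for x e by (rule norm_blinfun)
    have DVij: "\<bar>DV x e $ j\<bar> \<le> norm (DV x) * norm e" for x e j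
      using component_le_norm_cart[of "DV x e" j] DVi[of x e] by linarith
    define \<sigma> where "\<sigma> x = (\<Sum>j\<in>UNIV. V x $ j * \<rho>' x (axis j 1))" for x
    define \<sigma>a where "\<sigma>a x = (\<Sum>j\<in>UNIV. V x $ j * \<rho>'' x a (axis j 1) + DV x a $ j * \<rho>' x (axis j 1))" for x
    define B where "B = ?n * (B1 * M + B2 * M)"
    have \<sigma>B: "\<bar>\<sigma> x\<bar> \<le> B" "\<bar>\<sigma>a x\<bar> \<le> B" if x: "x \<in> \<Omega> \<inter> cball p \<delta>" for x
    proof -
      have x': "x \<in> closure \<Omega> \<inter> cball p \<delta>" "x \<in> cball p \<delta>" using x incl by auto
      have v: "\<bar>V x $ j\<bar> \<le> B1" for j using Vj[of x j] B1(2)[OF x'(1)] by linarith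
      have d: "\<bar>DV x a $ j\<bar> \<le> B2" for j using DVij[of x a j] B2(2)[OF x'(1)] na by simp
      have 1: "\<bar>V x $ j * \<rho>' x (axis j 1)\<bar> \<le> B1 * M" for j
        unfolding abs_mult using v bR[OF x'(2), of "axis j 1"] B1(1) by (intro mult_mono) auto
      have 2: "\<bar>V x $ j * \<rho>'' x a (axis j 1)\<bar> \<le> B1 * M" for j
        unfolding abs_mult using v bR2[OF x'(2), of a "axis j 1"] na B1(1) by (intro mult_mono) auto
      have 3: "\<bar>DV x a $ j * \<rho>' x (axis j 1)\<bar> \<le> B2 * M" for j
        unfolding abs_mult using d bR[OF x'(2), of "axis j 1"] B2(1) by (intro mult_mono) auto
      have "\<bar>\<sigma> x\<bar> \<le> (\<Sum>j\<in>(UNIV::'n set). B1 * M)" unfolding \<sigma>_def by (rule sum_abs[THEN order_trans]) (intro sum_mono 1)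
      also have "\<dots> \<le> B" unfolding B_def using B2(1) M by (simp add: distrib_left)
      finally show "\<bar>\<sigma> x\<bar> \<le> B" .
      have "\<bar>\<sigma>a x\<bar> \<le> (\<Sum>j\<in>(UNIV::'n set). B1 * M + B2 * M)" unfolding \<sigma>a_def
        by (rule sum_abs[THEN order_trans]) (intro sum_mono abs_triangle_ineq[THEN order_trans] add_mono 2 3)
      then show "\<bar>\<sigma>a x\<bar> \<le> B" unfolding B_def by simp
    qed
    define L where "L = B * (1 / c + 1 / (c * r))"
    have B0: "B \<ge> 0" unfolding B_def using B1(1) B2(1) M by simp
    have L0: "L \<ge> 0" unfolding L_def using B0 c r(1) by simp
    have \<sigma>L: "\<bar>\<sigma> x\<bar> \<le> L * \<bar>\<rho> x\<bar>" if x: "x \<in> \<Omega> \<inter> U" for x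
    proof (cases "x \<in> K")
      case False
      then show ?thesis using supp'[OF x False] L0 unfolding \<sigma>_def by simp
    next
      case True
      show ?thesis unfolding L_def
      proof (rule boundary_vanishing_bound[OF Om U(1) eq r(1)])
        show "cball p (2 * r) \<subseteq> U" unfolding r(2) by (rule \<delta>(2))
        show "norm a = 1" by (rule na)
        show "0 < c" by (rule c)
        fix y
        show "dir_deriv \<rho> a y (\<rho>' y a)" if "y \<in> cball p (2 * r)" using that \<delta>(2) unfolding r(2) by (intro has_derivative_imp_dir_deriv d\<rho>) auto
        show "c \<le> \<rho>' y a" if "y \<in> cball p (2 * r)" using grow[of y] that unfolding a_def r(2) by (simp add: blinfun.scaleR_right)
        show "dir_deriv \<sigma> a y (\<sigma>a y)" if y: "y \<in> \<Omega> \<inter> cball p (2 * r)"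
        proof -
          have yU: "y \<in> U" using y \<delta>(2) unfolding r(2) by blast
          have "dir_deriv (\<lambda>x. V x $ j) a y (DV y a $ j)" for j
            using dir_deriv_linear[OF bounded_linear_vec_nth has_derivative_imp_dir_deriv[OF dV]] y by blast
          moreover have "dir_deriv (\<lambda>x. \<rho>' x (axis j 1)) a y (\<rho>'' y a (axis j 1))" for j
            using dir_deriv_linear[OF blinfun.bounded_linear_left has_derivative_imp_dir_deriv[OF d\<rho>(2)[OF yU]]] .
          ultimately show ?thesis unfolding \<sigma>_def \<sigma>a_def by (intro dir_deriv_sum dir_deriv_mult)
        qed
        show "\<sigma> y = 0" if y: "y \<in> frontier \<Omega> \<inter> cball p (2 * r)"
          using bc[of y] y \<delta>(2) unfolding r(2) \<sigma>_def inner_vec_def grad_def by auto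
        show "\<bar>\<sigma> y\<bar> \<le> B" "\<bar>\<sigma>a y\<bar> \<le> B" if "y \<in> \<Omega> \<inter> cball p (2 * r)" using that \<sigma>B unfolding r(2) by auto
      next
        show "continuous_on U \<rho>" by (rule c\<rho>)
        show "continuous_on (closure \<Omega> \<inter> cball p (2 * r)) \<sigma>" unfolding \<sigma>_def r(2)
          by (intro continuous_intros continuous_on_vec_nth continuous_on_blinfun_eval)
            (use cV(1) c\<rho>(2) \<delta>(2) in \<open>auto intro: continuous_on_subset\<close>)
        show "x \<in> \<Omega> \<inter> cball p r" using x True unfolding K_def by simp
      qed
    qed
    define H where "H x = (\<Sum>i\<in>UNIV. \<Sum>j\<in>UNIV. V x $ j * V x $ i * \<rho>'' x (axis j 1) (axis i 1))" for x
    define dv where "dv x = (\<Sum>i\<in>UNIV. DV x (axis i 1) $ i)" for x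
    define G2 where "G2 x = (\<Sum>i\<in>UNIV. (\<rho>' x (axis i 1))\<^sup>2)" for x
    define T3 where "T3 x = (\<Sum>i\<in>UNIV. 2 * (V x \<bullet> DV x (axis i 1)) * \<rho>' x (axis i 1) + (V x \<bullet> V x) * \<rho>'' x (axis i 1) (axis i 1))" for x
    define \<epsilon> where "\<epsilon> n = 1 / real (Suc n)" for n
    have \<epsilon>: "\<epsilon> \<longlonglongrightarrow> 0" "\<And>n. \<epsilon> n > 0" unfolding \<epsilon>_def using LIMSEQ_inverse_real_of_nat by (auto simp: inverse_eq_divide)
    define t0 where "t0 n x = max 0 (1 + \<epsilon> n / \<rho> x) ^ 4" for n x
    define t1 where "t1 n x = 4 * max 0 (1 + \<epsilon> n / \<rho> x) ^ 3 * (- (\<epsilon> n / (\<rho> x)\<^sup>2))" for n x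
    define t2 where "t2 n x = 12 * max 0 (1 + \<epsilon> n / \<rho> x) ^ 2 * (\<epsilon> n / (\<rho> x)\<^sup>2)\<^sup>2 + 4 * max 0 (1 + \<epsilon> n / \<rho> x) ^ 3 * (2 * (\<epsilon> n / (\<rho> x) ^ 3))" for n x
    define D where "D = \<Omega> \<inter> U"
    define I where "I x = norm (V x) * norm (DV x) + (norm (V x))\<^sup>2" for x
    have dV': "(V has_derivative blinfun_apply (DV x)) (at x)" if "x \<in> \<Omega> \<inter> U" for x using dV that by blast
    note id = null_lagrangian_cutoff_identity[OF U(1) Om eq C2 K(1,2) \<epsilon>(2) dV' cVD supp', folded \<sigma>_def H_def dv_def G2_def T3_def t0_def t1_def t2_def D_def]
    have \<rho>neg: "\<rho> x < 0" if "x \<in> D" for x using that eq unfolding D_def by blast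
    have cI: "continuous_on (closure \<Omega>) I" unfolding I_def by (intro continuous_intros cV)
    have "bdd_supp (\<lambda>x. indicator \<Omega> x *\<^sub>R I x)"
      by (rule bdd_supp_closure_cut[OF Om cI K(1)]) (use supp in \<open>simp add: I_def K_def\<close>)
    then have bI: "bdd_supp (\<lambda>x. indicator \<Omega> x * I x)" by simp
    have I0: "0 \<le> I x" for x unfolding I_def by simp
    have HT: "\<bar>H x\<bar> \<le> ?n\<^sup>2 * M * (norm (V x))\<^sup>2" "T3 x \<le> ?n * (2 * M) * I x" "c\<^sup>2 \<le> G2 x" if x: "x \<in> D" "x \<in> K" for x
    proof -
      have xd: "x \<in> cball p \<delta>" using x K by blast
      have 1: "\<bar>V x $ j * V x $ i * \<rho>'' x (axis j 1) (axis i 1)\<bar> \<le> norm (V x) * norm (V x) * M" for i j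
        unfolding abs_mult using Vj bR2[OF xd, of "axis j 1" "axis i 1"] by (intro mult_mono) auto
      have "\<bar>H x\<bar> \<le> (\<Sum>i\<in>(UNIV::'n set). \<Sum>j\<in>(UNIV::'n set). norm (V x) * norm (V x) * M)" unfolding H_def
        by (intro sum_abs[THEN order_trans] sum_mono 1)
      also have "\<dots> = ?n\<^sup>2 * M * (norm (V x))\<^sup>2" by (simp add: power2_eq_square ac_simps)
      finally show "\<bar>H x\<bar> \<le> ?n\<^sup>2 * M * (norm (V x))\<^sup>2" .
      have 2: "2 * (V x \<bullet> DV x (axis i 1)) * \<rho>' x (axis i 1) + (V x \<bullet> V x) * \<rho>'' x (axis i 1) (axis i 1) \<le> (2 * M) * I x" for i
      proof -
        have "\<bar>V x \<bullet> DV x (axis i 1)\<bar> \<le> norm (V x) * norm (DV x)"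
          using Cauchy_Schwarz_ineq2[of "V x" "DV x (axis i 1)"] mult_left_mono[OF DVi[of x "axis i 1"], of "norm (V x)"] by simp
        then have a: "\<bar>2 * (V x \<bullet> DV x (axis i 1)) * \<rho>' x (axis i 1)\<bar> \<le> 2 * (norm (V x) * norm (DV x)) * M"
          unfolding abs_mult using bR[OF xd, of "axis i 1"] by (intro mult_mono) auto
        have b: "\<bar>(V x \<bullet> V x) * \<rho>'' x (axis i 1) (axis i 1)\<bar> \<le> (norm (V x))\<^sup>2 * M"
          unfolding abs_mult using bR2[OF xd, of "axis i 1" "axis i 1"] by (intro mult_mono) (auto simp: power2_norm_eq_inner)
        have "(norm (V x))\<^sup>2 * M \<le> (norm (V x))\<^sup>2 * (2 * M)" using M by (intro mult_left_mono) auto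
        then show ?thesis using a b unfolding I_def by (simp add: algebra_simps)
      qed
      show "T3 x \<le> ?n * (2 * M) * I x" unfolding T3_def using sum_bounded_above[of UNIV, OF 2] by (simp add: ac_simps)
      have "c \<le> \<bar>\<rho>' x (axis k 1)\<bar>" using grow[OF xd] s abs_ge_self[of "s * \<rho>' x (axis k 1)"] by (simp add: abs_mult)
      then have "c\<^sup>2 \<le> (\<rho>' x (axis k 1))\<^sup>2" using power_mono[of c "\<bar>\<rho>' x (axis k 1)\<bar>" 2] c by simp
      also have "\<dots> \<le> G2 x" unfolding G2_def by (rule member_le_sum) auto
      finally show "c\<^sup>2 \<le> G2 x" .
    qed
    have tb: "0 \<le> t0 n x" "t0 n x \<le> 1" "t1 n x \<le> 0" if "x \<in> D" for n x
    proof -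
      have "\<epsilon> n / \<rho> x \<le> 0" using \<epsilon>(2)[of n] \<rho>neg[OF that] by (simp add: divide_nonneg_neg)
      then have "0 \<le> max 0 (1 + \<epsilon> n / \<rho> x)" "max 0 (1 + \<epsilon> n / \<rho> x) \<le> 1" by auto
      then show "0 \<le> t0 n x" "t0 n x \<le> 1" "t1 n x \<le> 0"
        unfolding t0_def t1_def using \<epsilon>(2)[of n] by (auto intro: power_le_one mult_nonneg_nonneg simp: mult_nonneg_nonpos)
    qed
    have est: "lint (\<lambda>x. indicator D x * (t0 n x * null_lagrangian (DV x)))
       \<le> C * lint (\<lambda>x. indicator \<Omega> x * I x) + lint (\<lambda>x. indicator D x * (t2 n x * (\<sigma> x)\<^sup>2 + 2 * t1 n x * \<sigma> x * dv x))" for n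
    proof -
      have bb: "bdd_supp (\<lambda>x. indicator D x * (- t1 n x * G2 x * (V x \<bullet> V x)))" "bdd_supp (\<lambda>x. indicator D x * (t0 n x * T3 x))"
        "bdd_supp (\<lambda>x. indicator D x * (t1 n x * H x))"
        using id by auto
      have "lint (\<lambda>x. indicator D x * (t1 n x * H x))
          \<le> lint (\<lambda>x. ?n\<^sup>2 * M / c\<^sup>2 * (indicator D x * (- t1 n x * G2 x * (V x \<bullet> V x))))"
      proof (intro integral_mono bdd_supp_integrable bdd_supp_cmult bb)
        fix x
        show "indicator D x * (t1 n x * H x) \<le> ?n\<^sup>2 * M / c\<^sup>2 * (indicator D x * (- t1 n x * G2 x * (V x \<bullet> V x)))"
        proof (cases "x \<in> D \<and> x \<in> K")
          case True
          then have h: "\<bar>H x\<bar> \<le> ?n\<^sup>2 * M * (norm (V x))\<^sup>2" "c\<^sup>2 \<le> G2 x" and t: "t1 n x \<le> 0" using HT tb by auto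
          have "t1 n x * H x \<le> (- t1 n x) * \<bar>H x\<bar>" using t by (metis abs_ge_minus_self minus_mult_minus mult_left_mono neg_0_le_iff_le mult_minus_left)
          also have "\<dots> \<le> (- t1 n x) * (?n\<^sup>2 * M * (norm (V x))\<^sup>2)" using h(1) t by (intro mult_left_mono) auto
          also have "\<dots> = ?n\<^sup>2 * M / c\<^sup>2 * (- t1 n x * c\<^sup>2 * (V x \<bullet> V x))" using c by (simp add: power2_norm_eq_inner)
          also have "\<dots> \<le> ?n\<^sup>2 * M / c\<^sup>2 * (- t1 n x * G2 x * (V x \<bullet> V x))"
            using h(2) t M c by (intro mult_left_mono mult_right_mono) auto
          finally show ?thesis using True by simp
        next
          case False
          then show ?thesis using supp'[of x] unfolding D_def H_def by (cases "x \<in> \<Omega> \<inter> U") auto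
        qed
      qed
      \<comment> \<open>The trace identity trades the weight -\<theta>1, which concentrates at the
        boundary, for the bounded weight \<theta>.\<close>
      also have "\<dots> = ?n\<^sup>2 * M / c\<^sup>2 * lint (\<lambda>x. indicator D x * (t0 n x * T3 x))"
      proof -
        have "lint (\<lambda>x. indicator D x * (- t1 n x * G2 x * (V x \<bullet> V x))) = lint (\<lambda>x. indicator D x * (t0 n x * T3 x))"
          using id by simp
        then show ?thesis by (simp only: integral_mult_right_zero)
      qed
      also have "\<dots> \<le> ?n\<^sup>2 * M / c\<^sup>2 * lint (\<lambda>x. ?n * (2 * M) * (indicator \<Omega> x * I x))"
      proof (intro mult_left_mono integral_mono bdd_supp_integrable bdd_supp_cmult bb bI)
        fix x
        show "indicator D x * (t0 n x * T3 x) \<le> ?n * (2 * M) * (indicator \<Omega> x * I x)"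
        proof (cases "x \<in> D \<and> x \<in> K")
          case True
          have "t0 n x * T3 x \<le> t0 n x * (?n * (2 * M) * I x)" using True HT tb by (intro mult_left_mono) auto
          also have "\<dots> \<le> 1 * (?n * (2 * M) * I x)" using True tb I0 M by (intro mult_right_mono mult_nonneg_nonneg) auto
          finally show ?thesis using True unfolding D_def by simp
        next
          case False
          then have "indicator D x * (t0 n x * T3 x) = 0" using supp'[of x] unfolding D_def T3_def by (cases "x \<in> \<Omega> \<inter> U") auto
          moreover have "0 \<le> ?n * (2 * M) * (indicator \<Omega> x * I x)" using I0 M by (intro mult_nonneg_nonneg) auto
          ultimately show ?thesis by linarith
        qed
      qed (use M c in auto)
      also have "\<dots> = C * lint (\<lambda>x. indicator \<Omega> x * I x)" unfolding C_def by simp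
      finally show ?thesis using id by simp
    qed
    obtain RK where RK: "\<And>x. x \<in> K \<Longrightarrow> norm x \<le> RK" using compact_imp_bounded[OF K(1)] unfolding bounded_iff by blast
    have out: "indicator D x * f x = 0" if "RK + 1 \<le> norm x" "\<And>x. x \<in> D \<Longrightarrow> x \<notin> K \<Longrightarrow> f x = 0" for x and f :: "_ \<Rightarrow> real"
      using that RK[of x] by (cases "x \<in> D") force+
    have comK2: "compact (closure \<Omega> \<inter> K)" using K(1) by (simp add: closed_Int_compact)
    have "continuous_on (closure \<Omega> \<inter> K) (\<lambda>x. null_lagrangian (DV x))"
      unfolding null_lagrangian_def by (intro continuous_intros continuous_on_vec_nth continuous_on_blinfun_eval) (use cV(2) in \<open>auto intro: continuous_on_subset\<close>)
    then obtain BN where BN: "BN > 0" "\<And>x. x \<in> closure \<Omega> \<inter> K \<Longrightarrow> \<bar>null_lagrangian (DV x)\<bar> \<le> BN"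
      using compact_bound[OF comK2] by (metis real_norm_def)
    have nl0: "null_lagrangian (DV x) = 0" "\<sigma> x = 0" if "x \<in> D" "x \<notin> K" for x
      using supp'[of x] that unfolding D_def null_lagrangian_def \<sigma>_def by auto
    have lim1: "(\<lambda>n. lint (\<lambda>x. indicator D x * (t0 n x * null_lagrangian (DV x)))) \<longlonglongrightarrow> lint (\<lambda>x. indicator D x * null_lagrangian (DV x))"
    proof (rule integral_limit_bounded_support[where B = BN and R = "RK + 1"])
      show "(\<lambda>x. indicator D x * (t0 n x * null_lagrangian (DV x))) \<in> borel_measurable borel" for n using id(1) by (rule bdd_supp_measurable)
      show "(\<lambda>n. indicator D x * (t0 n x * null_lagrangian (DV x))) \<longlonglongrightarrow> indicator D x * null_lagrangian (DV x)" for x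
      proof (cases "x \<in> D")
        case True
        have "(\<lambda>n. t0 n x) \<longlonglongrightarrow> 1" unfolding t0_def using \<rho>neg[OF True] by (intro tendsto_cutoff_terms \<epsilon>) auto
        from tendsto_mult[OF this tendsto_const, of "null_lagrangian (DV x)"] show ?thesis using True by simp
      qed simp
      show "norm (indicator D x * (t0 n x * null_lagrangian (DV x))) \<le> BN" for n x
      proof (cases "x \<in> D \<and> x \<in> K")
        case True
        then have "\<bar>t0 n x\<bar> * \<bar>null_lagrangian (DV x)\<bar> \<le> 1 * BN"
          using tb[of x n] BN incl unfolding D_def by (intro mult_mono) auto
        then show ?thesis using True by (simp add: abs_mult)
      next
        case False
        then show ?thesis using nl0[of x] BN(1) by (cases "x \<in> D") auto
      qed
      show "indicator D x * (t0 n x * null_lagrangian (DV x)) = 0" if "RK + 1 \<le> norm x" for n x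
        by (rule out[OF that]) (simp add: nl0)
    qed
    define BE where "BE = 20 * L\<^sup>2 + 2 * (4 * L) * (?n * B2)"
    have dvB: "\<bar>dv x\<bar> \<le> ?n * B2" if "x \<in> D" "x \<in> K" for x
    proof -
      have "x \<in> closure \<Omega> \<inter> cball p \<delta>" using that incl K unfolding D_def by blast
      then have "\<bar>DV x (axis i 1) $ i\<bar> \<le> B2" for i using DVij[of x "axis i 1" i] B2(2)[of x] by simp
      then have "\<bar>dv x\<bar> \<le> (\<Sum>i\<in>(UNIV::'n set). B2)" unfolding dv_def by (intro sum_abs[THEN order_trans] sum_mono)
      then show ?thesis by simp
    qed
    \<comment> \<open>For fixed x in D the derivatives of the cutoff tend to 0, while |\<sigma>|
      \<le> L |\<rho>| gives a bound that is uniform in n and up to the boundary; dominated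
      convergence applies.\<close>
    have lim2: "(\<lambda>n. lint (\<lambda>x. indicator D x * (t2 n x * (\<sigma> x)\<^sup>2 + 2 * t1 n x * \<sigma> x * dv x))) \<longlonglongrightarrow> lint (\<lambda>x::real^'n. 0 :: real)"
    proof (rule integral_limit_bounded_support[where B = BE and R = "RK + 1"])
      show "(\<lambda>x. indicator D x * (t2 n x * (\<sigma> x)\<^sup>2 + 2 * t1 n x * \<sigma> x * dv x)) \<in> borel_measurable borel" for n
        by (rule bdd_supp_measurable) (use id in auto)
      show "(\<lambda>n. indicator D x * (t2 n x * (\<sigma> x)\<^sup>2 + 2 * t1 n x * \<sigma> x * dv x)) \<longlonglongrightarrow> 0" for x
      proof (cases "x \<in> D")
        case True
        have "\<rho> x \<noteq> 0" using \<rho>neg[OF True] by simp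
        note tc = tendsto_cutoff_terms[OF \<epsilon>(1) this]
        have "(\<lambda>n. t1 n x) \<longlonglongrightarrow> 4 * 1 * (- 0)" unfolding t1_def by (intro tendsto_intros tc)
        moreover have "(\<lambda>n. t2 n x) \<longlonglongrightarrow> 12 * 1 * 0\<^sup>2 + 4 * 1 * (2 * 0)" unfolding t2_def by (intro tendsto_intros tc)
        ultimately have "(\<lambda>n. t2 n x * (\<sigma> x)\<^sup>2 + 2 * t1 n x * \<sigma> x * dv x) \<longlonglongrightarrow> 0 * (\<sigma> x)\<^sup>2 + 2 * 0 * \<sigma> x * dv x"
          by (intro tendsto_intros) simp_all
        then show ?thesis using True by simp
      qed simp
      show "norm (indicator D x * (t2 n x * (\<sigma> x)\<^sup>2 + 2 * t1 n x * \<sigma> x * dv x)) \<le> BE" for n x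
      proof (cases "x \<in> D \<and> x \<in> K")
        case True
        have b: "\<bar>t2 n x * (\<sigma> x)\<^sup>2\<bar> \<le> 20 * L\<^sup>2" "\<bar>t1 n x * \<sigma> x\<bar> \<le> 4 * L"
          unfolding t1_def t2_def using cutoff_term_bounds[OF \<epsilon>(2) \<rho>neg \<sigma>L L0] True unfolding D_def by auto
        have "\<bar>2 * t1 n x * \<sigma> x * dv x\<bar> = 2 * \<bar>t1 n x * \<sigma> x\<bar> * \<bar>dv x\<bar>" by (simp add: abs_mult)
        also have "\<dots> \<le> 2 * (4 * L) * (?n * B2)" using b(2) dvB[of x] True L0 by (intro mult_mono) auto
        finally have "\<bar>t2 n x * (\<sigma> x)\<^sup>2 + 2 * t1 n x * \<sigma> x * dv x\<bar> \<le> BE" unfolding BE_def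
          using b(1) abs_triangle_ineq[of "t2 n x * (\<sigma> x)\<^sup>2" "2 * t1 n x * \<sigma> x * dv x"] by linarith
        then show ?thesis using True by simp
      next
        case False
        have "BE \<ge> 0" unfolding BE_def using L0 B2(1) by simp
        then show ?thesis using False nl0[of x] by (cases "x \<in> D") auto
      qed
      show "indicator D x * (t2 n x * (\<sigma> x)\<^sup>2 + 2 * t1 n x * \<sigma> x * dv x) = 0" if "RK + 1 \<le> norm x" for n x
        by (rule out[OF that]) (simp add: nl0)
    qed
    have "lint (\<lambda>x. indicator D x * null_lagrangian (DV x)) \<le> C * lint (\<lambda>x. indicator \<Omega> x * I x) + lint (\<lambda>x::real^'n. 0 :: real)"
      by (rule LIMSEQ_le[OF lim1 tendsto_add[OF tendsto_const lim2]]) (use est in auto)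
    moreover have "indicator D x * null_lagrangian (DV x) = indicator \<Omega> x * null_lagrangian (DV x)" for x
    proof (cases "x \<in> \<Omega> \<and> x \<notin> U")
      case True
      then have "DV x = 0" using supp[of x] incl K(2) unfolding K_def by blast
      then show ?thesis by (simp add: null_lagrangian_def)
    qed (auto simp: D_def indicator_def)
    ultimately show "lint (\<lambda>x. indicator \<Omega> x * null_lagrangian (DV x))
       \<le> C * lint (\<lambda>x. indicator \<Omega> x * (norm (V x) * norm (DV x) + (norm (V x))\<^sup>2))"
      unfolding I_def by simp
  qed
qed

section \<open>Change of variables\<close>

text \<open>The change of variables theorem of the library requires a well-ordered index type.\<close>

datatype 'a wo = Wo (unwo: 'a)

lemma Wo_image: "range Wo = UNIV"
  by (metis surjI wo.collapse)

instance wo :: (finite) finite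
  by standard (metis Wo_image finite finite_imageI)

text \<open>An arbitrary injection, which only serves to transport the order of the natural
  numbers.\<close>

definition wo_rank :: "'a::finite wo \<Rightarrow> nat" where
  "wo_rank = (SOME f. inj f)"

lemma inj_wo_rank: "inj (wo_rank :: 'a::finite wo \<Rightarrow> nat)"
proof -
  have "\<exists>f::'a wo \<Rightarrow> nat. inj f" using finite_imp_inj_to_nat_seg[OF finite[of "UNIV :: 'a wo set"]] by blast
  then show ?thesis unfolding wo_rank_def by (rule someI_ex)
qed

instantiation wo :: (finite) wellorder
begin

definition "x \<le> y \<longleftrightarrow> wo_rank x \<le> wo_rank y"
definition "x < y \<longleftrightarrow> wo_rank x < wo_rank y"

instance
proof
  fix x y z :: "'a wo"
  show "x \<le> y \<Longrightarrow> y \<le> x \<Longrightarrow> x = y" using inj_wo_rank by (auto simp: less_eq_wo_def inj_def)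
  fix P :: "'a wo \<Rightarrow> bool" and a
  assume step: "\<And>x. (\<And>y. y < x \<Longrightarrow> P y) \<Longrightarrow> P x"
  show "P a" by (induction a rule: measure_induct_rule[of wo_rank]) (auto intro: step simp: less_wo_def)
qed (auto simp: less_eq_wo_def less_wo_def)

end

definition to_wo :: "real^'n::finite \<Rightarrow> real^('n wo)" where "to_wo x = (\<chi> i. x $ unwo i)"
definition of_wo :: "real^('n::finite wo) \<Rightarrow> real^'n" where "of_wo x = (\<chi> i. x $ Wo i)"

lemma of_to_wo [simp]: "of_wo (to_wo x) = x" "to_wo (of_wo y) = y"
  by (simp_all add: to_wo_def of_wo_def vec_eq_iff)

lemma linear_to_wo: "linear to_wo" and linear_of_wo: "linear of_wo"
  by (auto intro!: linearI simp: to_wo_def of_wo_def vec_eq_iff)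

lemma bounded_linear_wo: "bounded_linear to_wo" "bounded_linear of_wo"
  using linear_to_wo linear_of_wo by (simp_all add: linear_conv_bounded_linear)

lemma prod_Basis_cart: "(\<Prod>b\<in>Basis. (u::real^'n::finite) \<bullet> b) = (\<Prod>i\<in>UNIV. u $ i)"
proof -
  have B: "(Basis :: (real^'n) set) = range (\<lambda>i. axis i 1)" by (auto simp: Basis_vec_def)
  have "inj (\<lambda>i::'n. axis i (1::real))" by (auto simp: inj_def axis_eq_axis)
  then show ?thesis unfolding B by (simp add: prod.reindex inner_axis)
qed

text \<open>Reindexing the coordinates maps boxes to boxes with the same side lengths, and Lebesgue
  measure is determined by its values on boxes.\<close>

lemma distr_of_wo: "distr lborel borel (of_wo :: _ \<Rightarrow> real^'n::finite) = lborel"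
proof (rule lborel_eqI[symmetric])
  have m: "(of_wo :: _ \<Rightarrow> real^'n) \<in> borel_measurable borel"
    by (intro borel_measurable_continuous_onI linear_continuous_on bounded_linear_wo)
  fix l u :: "real^'n" assume lu: "\<And>b. b \<in> Basis \<Longrightarrow> l \<bullet> b \<le> u \<bullet> b"
  have "axis i 1 \<in> (Basis :: (real^'n) set)" for i by (auto simp: Basis_vec_def)
  from lu[OF this] have lui: "l $ i \<le> u $ i" for i by (simp add: inner_axis)
  have "of_wo -` box l u = box (to_wo l) (to_wo u)"
  proof -
    have "(\<forall>i. l $ i < x $ Wo i \<and> x $ Wo i < u $ i) \<longleftrightarrow> (\<forall>i. l $ unwo i < x $ i \<and> x $ i < u $ unwo i)" for x :: "real^('n wo)"
      by (metis wo.collapse wo.sel)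
    then show ?thesis by (auto simp: mem_box_cart of_wo_def to_wo_def)
  qed
  then have "emeasure (distr lborel borel of_wo) (box l u) = emeasure lborel (box (to_wo l) (to_wo u))"
    using m by (simp add: emeasure_distr)
  also have "\<dots> = ennreal (\<Prod>b\<in>Basis. (to_wo u - to_wo l) \<bullet> b)"
    using lui by (intro emeasure_lborel_box) (auto simp: Basis_vec_def inner_axis to_wo_def)
  also have "(\<Prod>b\<in>Basis. (to_wo u - to_wo l) \<bullet> b) = (\<Prod>i\<in>(UNIV::'n wo set). (u - l) $ unwo i)"
    unfolding prod_Basis_cart by (simp add: to_wo_def)
  also have "\<dots> = (\<Prod>i\<in>UNIV. (u - l) $ i)"
    by (rule prod.reindex_bij_betw) (metis bij_betwI' UNIV_I wo.expand wo.sel)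
  also have "\<dots> = (\<Prod>b\<in>Basis. (u - l) \<bullet> b)" unfolding prod_Basis_cart ..
  finally show "emeasure (distr lborel borel of_wo) (box l u) = (\<Prod>b\<in>Basis. (u - l) \<bullet> b)" .
qed simp

lemma integral_of_wo:
  fixes f :: "real^'n::finite \<Rightarrow> real"
  assumes "f \<in> borel_measurable borel"
  shows "lint (\<lambda>y. f (of_wo y)) = lint f"
proof -
  have m: "(of_wo :: _ \<Rightarrow> real^'n) \<in> borel_measurable borel"
    by (intro borel_measurable_continuous_onI linear_continuous_on bounded_linear_wo)
  have "lint f = integral\<^sup>L (distr lborel borel of_wo) f" by (simp add: distr_of_wo)
  also have "\<dots> = lint (\<lambda>y. f (of_wo y))" using m assms by (subst integral_distr) auto
  finally show ?thesis by simp
qed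

lemma integrable_of_wo:
  fixes f :: "real^'n::finite \<Rightarrow> real"
  assumes "integrable lborel f" shows "integrable lborel (\<lambda>y. f (of_wo y))"
proof -
  have m: "(of_wo :: _ \<Rightarrow> real^'n) \<in> measurable lborel borel"
    by simp (intro borel_measurable_continuous_onI linear_continuous_on bounded_linear_wo)
  have "integrable (distr lborel borel of_wo) f" using assms by (simp add: distr_of_wo)
  then show ?thesis by (rule integrable_distr[OF m])
qed

definition wo_jac :: "((real^'n::finite) \<Rightarrow>\<^sub>L (real^'n)) \<Rightarrow> real" where
  "wo_jac L = \<bar>det (matrix (\<lambda>z. to_wo (L (of_wo z))))\<bar>"

lemma continuous_on_wo_jac:
  assumes "continuous_on S f" shows "continuous_on S (\<lambda>x. wo_jac (f x))"
  unfolding wo_jac_def det_def matrix_def to_wo_def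
  by (auto intro!: continuous_intros continuous_on_blinfun_eval assms)

lemma wo_jac_pos:
  assumes "inj (blinfun_apply L)" shows "wo_jac L > 0"
proof -
  let ?f = "\<lambda>z. to_wo (blinfun_apply L (of_wo z))"
  have lin: "linear ?f"
    using linear_compose[OF linear_compose[OF linear_of_wo bounded_linear.linear[OF blinfun.bounded_linear_right[of L]]] linear_to_wo] by (simp add: o_def)
  have "inj ?f" using assms by (metis (no_types, lifting) injD injI of_to_wo)
  then have "det (matrix ?f) \<noteq> 0" using det_nz_iff_inj[OF lin] by simp
  then show ?thesis unfolding wo_jac_def by simp
qed

text \<open>The integrand is moved to the well-ordered index type and to values in
  \<open>real^1\<close>, where the change of variables for absolutely integrable functions applies.
  As f vanishes off the image of E, the integral over that image is the integral over the whole
  space.\<close>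

lemma integral_change_of_variables_lborel:
  fixes f :: "real^'n::finite \<Rightarrow> real" and \<Phi> :: "real^'n \<Rightarrow> real^'n"
  assumes E: "open E" and d: "\<And>x. x \<in> E \<Longrightarrow> (\<Phi> has_derivative blinfun_apply (\<Phi>' x)) (at x)" and inj: "inj_on \<Phi> E"
    and f: "integrable lborel f" and z: "\<And>y. y \<notin> \<Phi> ` E \<Longrightarrow> f y = 0"
    and i: "integrable lborel (\<lambda>x. indicator E x * (wo_jac (\<Phi>' x) * f (\<Phi> x)))"
  shows "lint f = lint (\<lambda>x. indicator E x * (wo_jac (\<Phi>' x) * f (\<Phi> x)))"
proof -
  define S where "S = to_wo ` E"
  define g where "g = (\<lambda>y. to_wo (\<Phi> (of_wo y)))"
  define g' where "g' = (\<lambda>y z. to_wo (blinfun_apply (\<Phi>' (of_wo y)) (of_wo z)))"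
  have Seq: "S = of_wo -` E" unfolding S_def by force
  have "open S" unfolding Seq by (intro open_vimage E linear_continuous_on bounded_linear_wo)
  then have Sl: "S \<in> sets lebesgue" by (simp add: sets_completionI_sets borel_open)
  have gS: "g ` S = to_wo ` \<Phi> ` E" unfolding g_def S_def by (force simp: image_image)
  have dg: "(g has_derivative g' y) (at y within S)" if "y \<in> S" for y
  proof -
    have "of_wo y \<in> E" using that unfolding Seq by simp
    from d[OF this] have "((\<lambda>y. \<Phi> (of_wo y)) has_derivative (\<lambda>z. \<Phi>' (of_wo y) (of_wo z))) (at y)"
      by (rule has_derivative_compose[OF bounded_linear_imp_has_derivative[OF bounded_linear_wo(2)]])
    then show ?thesis unfolding g_def g'_def
      by (rule bounded_linear.has_derivative[OF bounded_linear_wo(1), THEN has_derivative_at_withinI])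
  qed
  have ig: "inj_on g S"
  proof (rule inj_onI)
    fix y y' assume y: "y \<in> S" "y' \<in> S" and eq: "g y = g y'"
    from arg_cong[OF eq, of of_wo] have "\<Phi> (of_wo y) = \<Phi> (of_wo y')" unfolding g_def by simp
    then have "of_wo y = of_wo y'" using inj y unfolding Seq by (auto dest: inj_onD)
    from arg_cong[OF this, of to_wo] show "y = y'" by simp
  qed
  define F where "F y = (\<chi> i. f (of_wo y) :: real^1)" for y
  have fw: "integrable lborel (\<lambda>y. f (of_wo y))" by (rule integrable_of_wo[OF f])
  have out: "f (of_wo y) = 0" if "y \<notin> g ` S" for y
  proof (rule z)
    show "of_wo y \<notin> \<Phi> ` E" using that unfolding gS by (metis imageI of_to_wo(2))
  qed
  have ind: "indicator (g ` S) y *\<^sub>R f (of_wo y) = f (of_wo y)" for y using out[of y] by (auto simp: indicator_def)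
  have "integrable lebesgue (\<lambda>y. f (of_wo y))" using fw by (simp add: integrable_completion borel_measurable_integrable)
  then have fa: "(\<lambda>y. f (of_wo y)) absolutely_integrable_on (g ` S)"
    unfolding set_integrable_def ind .
  then have Fa: "F absolutely_integrable_on (g ` S)"
    unfolding F_def by (subst absolutely_integrable_componentwise_iff) (auto simp: Basis_vec_def inner_axis)
  have cov: "(\<lambda>y. \<bar>det (matrix (g' y))\<bar> *\<^sub>R F (g y)) absolutely_integrable_on S"
    "integral S (\<lambda>y. \<bar>det (matrix (g' y))\<bar> *\<^sub>R F (g y)) = integral (g ` S) F"
    using has_absolute_integral_change_of_variables[OF Sl dg ig, of F "integral (g ` S) F"] Fa by auto
  have "lint f = lint (\<lambda>y. f (of_wo y))"
    using f by (simp add: integral_of_wo borel_measurable_integrable)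
  also have "\<dots> = integral (g ` S) (\<lambda>y. f (of_wo y))"
  proof -
    have "set_integrable lborel (g ` S) (\<lambda>y. f (of_wo y))" unfolding set_integrable_def ind by (rule fw)
    from set_borel_integral_eq_integral(2)[OF this] show ?thesis unfolding set_lebesgue_integral_def ind .
  qed
  also have "\<dots> = integral (g ` S) F $ 1"
    using integral_component_eq_cart[of F "g ` S" 1] Fa unfolding F_def by (simp add: absolutely_integrable_on_def)
  also have "\<dots> = integral S (\<lambda>y. \<bar>det (matrix (g' y))\<bar> *\<^sub>R F (g y)) $ 1" unfolding cov(2) ..
  also have "\<dots> = integral S (\<lambda>y. wo_jac (\<Phi>' (of_wo y)) * f (\<Phi> (of_wo y)))"
    using integral_component_eq_cart[of "\<lambda>y. \<bar>det (matrix (g' y))\<bar> *\<^sub>R F (g y)" S 1] cov(1)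
    unfolding absolutely_integrable_on_def by (simp add: F_def g_def g'_def wo_jac_def)
  also have "\<dots> = lint (\<lambda>y. indicator E (of_wo y) * (wo_jac (\<Phi>' (of_wo y)) * f (\<Phi> (of_wo y))))"
  proof -
    have e: "indicator S y *\<^sub>R c = indicator E (of_wo y) * (c::real)" for y c unfolding Seq by (simp add: indicator_def)
    have "set_integrable lborel S (\<lambda>y. wo_jac (\<Phi>' (of_wo y)) * f (\<Phi> (of_wo y)))"
      unfolding set_integrable_def e using integrable_of_wo[OF i] .
    from set_borel_integral_eq_integral(2)[OF this] show ?thesis unfolding set_lebesgue_integral_def e ..
  qed
  also have "\<dots> = lint (\<lambda>x. indicator E x * (wo_jac (\<Phi>' x) * f (\<Phi> x)))"
    using i by (intro integral_of_wo borel_measurable_integrable[of lborel, simplified])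
  finally show ?thesis .
qed

section \<open>Flattening the boundary\<close>

definition jac_vec :: "((real^'n::finite) \<Rightarrow>\<^sub>L 'f::real_normed_vector) \<Rightarrow> 'f^'n" where
  "jac_vec L = (\<chi> j. L (axis j 1))"

lemma bdd_supp_open_cut:
  fixes f :: "'a::euclidean_space \<Rightarrow> 'b::euclidean_space"
  assumes "open D" "continuous_on D f" "\<And>x. x \<in> D \<Longrightarrow> norm (f x) \<le> B" "\<And>x. x \<in> D \<Longrightarrow> R \<le> norm x \<Longrightarrow> f x = 0"
  shows "bdd_supp (\<lambda>x. indicator D x *\<^sub>R f x)"
proof -
  have "(\<lambda>x. indicator D x *\<^sub>R f x) \<in> borel_measurable borel"
    by (rule borel_measurable_continuous_on_indicator) (use assms in auto)
  moreover have "norm (indicator D x *\<^sub>R f x) \<le> \<bar>B\<bar> \<and> (R \<le> norm x \<longrightarrow> indicator D x *\<^sub>R f x = 0)" for x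
    using assms(3,4)[of x] by (cases "x \<in> D") auto
  ultimately show ?thesis unfolding bdd_supp_def by blast
qed

lemma norm_vec_le_sum: "norm (Z :: 'f::real_normed_vector^'n::finite) \<le> (\<Sum>j\<in>UNIV. norm (Z $ j))"
  by (simp add: norm_vec_def L2_set_le_sum)

text \<open>Z, read as a linear map on R^n, composed with L: the chain rule for Jacobians.\<close>

definition pull :: "((real^'n::finite) \<Rightarrow>\<^sub>L (real^'n)) \<Rightarrow> 'f::real_normed_vector^'n \<Rightarrow> 'f^'n" where
  "pull L Z = (\<chi> j. \<Sum>i\<in>UNIV. (L (axis j 1) $ i) *\<^sub>R Z $ i)"

lemma norm_pull: "norm (pull L Z) \<le> (real CARD('n))\<^sup>2 * norm L * norm Z"
  for L :: "(real^'n::finite) \<Rightarrow>\<^sub>L (real^'n)"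
proof -
  have 1: "norm ((L (axis j 1) $ i) *\<^sub>R Z $ i) \<le> norm L * norm Z" for i j
  proof -
    have "\<bar>L (axis j 1) $ i\<bar> \<le> norm L"
      using component_le_norm_cart[of "L (axis j 1)" i] norm_blinfun[of L "axis j 1"] by simp
    then show ?thesis by (simp add: mult_mono Finite_Cartesian_Product.norm_nth_le)
  qed
  have "norm (pull L Z) \<le> (\<Sum>j\<in>(UNIV::'n set). norm (pull L Z $ j))" by (rule norm_vec_le_sum)
  also have "\<dots> \<le> (\<Sum>j\<in>(UNIV::'n set). \<Sum>i\<in>(UNIV::'n set). norm L * norm Z)"
    unfolding pull_def by (intro sum_mono) (simp only: vec_lambda_beta, intro sum_norm_le 1)
  also have "\<dots> = (real CARD('n))\<^sup>2 * norm L * norm Z" by (simp add: power2_eq_square)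
  finally show ?thesis .
qed

lemma pull_diff: "pull (L - M) Z = pull L Z - pull M Z"
  by (simp add: pull_def vec_eq_iff blinfun.diff_left scaleR_diff_left sum_subtractf)

lemma linear_pull: "linear (pull L)"
  by (rule linearI) (simp_all add: pull_def vec_eq_iff scaleR_add_right sum.distrib scaleR_sum_right mult.commute)

lemma linear_in_axes:
  fixes x :: "real^'n::finite"
  assumes "linear f" shows "f x = (\<Sum>i\<in>UNIV. (x $ i) *\<^sub>R f (axis i 1))"
proof -
  have "x = (\<Sum>i\<in>UNIV. (x $ i) *\<^sub>R axis i 1)" by (rule basis_expansion[of x, unfolded scalar_mult_eq_scaleR, symmetric])
  from arg_cong[OF this, of f] show ?thesis by (simp only: linear_sum[OF assms] linear_scale[OF assms])
qed

text \<open>\<open>pull L\<close> sends v \<otimes> \<xi> to v \<otimes> (L^T \<xi>), and the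
  transpose L^T is injective because L is surjective.\<close>

lemma C_elliptic_pull:
  fixes P :: "'f::euclidean_space^'n::finite \<Rightarrow> 'k::euclidean_space"
  assumes ell: "C_elliptic_map P" and surj: "surj (blinfun_apply L)"
  shows "C_elliptic_map (\<lambda>Z. P (pull L Z))"
proof -
  define A where "A \<xi> = (\<chi> j. L (axis j 1) \<bullet> \<xi>)" for \<xi> :: "real^'n"
  have t: "pull L (tensor v \<xi>) = tensor v (A \<xi>)" for v :: 'f and \<xi>
    by (simp add: pull_def tensor_def A_def vec_eq_iff inner_vec_def scaleR_sum_left)
  have A0: "\<xi> = 0" if "A \<xi> = 0" for \<xi>
  proof -
    have lin: "linear (\<lambda>h. L h \<bullet> \<xi>)" by (intro linearI) (simp_all add: blinfun.add_right blinfun.scaleR_right inner_add_left)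
    have "L (axis i 1) \<bullet> \<xi> = 0" for i using that unfolding A_def by (simp add: vec_eq_iff)
    then have "L h \<bullet> \<xi> = 0" for h using linear_in_axes[OF lin, of h] by simp
    moreover obtain h where "L h = \<xi>" using surj by (metis surjD)
    ultimately show ?thesis by (metis inner_eq_zero_iff)
  qed
  show ?thesis unfolding C_elliptic_map_def linear_diff[OF linear_pull] linear_add[OF linear_pull] t
  proof (intro allI impI)
    fix \<xi> \<eta> v w
    assume "\<xi> \<noteq> 0 \<or> \<eta> \<noteq> 0" and 1: "P (tensor v (A \<xi>) - tensor w (A \<eta>)) = 0" "P (tensor v (A \<eta>) + tensor w (A \<xi>)) = 0"
    then have "A \<xi> \<noteq> 0 \<or> A \<eta> \<noteq> 0" using A0 by blast
    then show "v = 0 \<and> w = 0" using ell 1 unfolding C_elliptic_map_def by blast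
  qed
qed

text \<open>Replaces the coordinate x_k by \<rho>, so that locally the domain becomes the half-space
  y_k < 0.\<close>

definition flat_map :: "'n \<Rightarrow> (real^'n::finite \<Rightarrow> real) \<Rightarrow> real^'n \<Rightarrow> real^'n" where
  "flat_map k \<rho> x = x + (\<rho> x - x $ k) *\<^sub>R axis k 1"

definition flat_deriv :: "'n \<Rightarrow> ((real^'n::finite) \<Rightarrow>\<^sub>L real) \<Rightarrow> (real^'n) \<Rightarrow>\<^sub>L (real^'n)" where
  "flat_deriv k L = id_blinfun + ((Blinfun (\<lambda>t. t *\<^sub>R axis k 1)) o\<^sub>L (L - Blinfun (\<lambda>h. h $ k)))"

text \<open>Solves \<open>flat_deriv k L h = e\<close> for h. The closed form makes it evident that
  the derivative of the inverse map depends continuously on L.\<close>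

definition flat_inv :: "'n \<Rightarrow> ((real^'n::finite) \<Rightarrow>\<^sub>L real) \<Rightarrow> real^'n \<Rightarrow> real^'n" where
  "flat_inv k L e = e + ((e $ k - L e) / L (axis k 1)) *\<^sub>R axis k 1"

lemma flat_deriv_apply: "flat_deriv k L h = h + (L h - h $ k) *\<^sub>R axis k 1"
  for L :: "(real^'n::finite) \<Rightarrow>\<^sub>L real"
proof -
  have "bounded_linear (\<lambda>t. t *\<^sub>R axis k (1::real))" by (rule bounded_linear_scaleR_left)
  moreover have "bounded_linear (\<lambda>h::real^'n. h $ k)" by (rule bounded_linear_vec_nth)
  ultimately show ?thesis unfolding flat_deriv_def
    by (simp add: blinfun.add_left blinfun.diff_left bounded_linear_Blinfun_apply)
qed

lemma flat_inv_left: "L (axis k 1) \<noteq> 0 \<Longrightarrow> flat_inv k L (flat_deriv k L h) = h"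
  and flat_inv_right: "L (axis k 1) \<noteq> 0 \<Longrightarrow> flat_deriv k L (flat_inv k L e) = e"
  for L :: "(real^'n::finite) \<Rightarrow>\<^sub>L real"
proof -
  assume n: "L (axis k 1) \<noteq> 0"
  have 1: "flat_deriv k L h $ k = L h" unfolding flat_deriv_apply by simp
  have 2: "L (flat_deriv k L h) = L h + (L h - h $ k) * L (axis k 1)"
    unfolding flat_deriv_apply by (simp add: blinfun.add_right blinfun.scaleR_right)
  have "(flat_deriv k L h $ k - L (flat_deriv k L h)) / L (axis k 1) = h $ k - L h"
    unfolding 1 2 using n by (simp add: field_simps)
  then show "flat_inv k L (flat_deriv k L h) = h" unfolding flat_inv_def
    by (simp add: flat_deriv_apply) (simp flip: scaleR_add_left)
  define \<tau> where "\<tau> = (e $ k - L e) / L (axis k 1)"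
  have i: "flat_inv k L e = e + \<tau> *\<^sub>R axis k 1" unfolding flat_inv_def \<tau>_def ..
  have "L (flat_inv k L e) = L e + \<tau> * L (axis k 1)" unfolding i by (simp add: blinfun.add_right blinfun.scaleR_right)
  also have "\<dots> = e $ k" unfolding \<tau>_def using n by simp
  finally show "flat_deriv k L (flat_inv k L e) = e" unfolding flat_deriv_apply unfolding i
    by (simp flip: scaleR_add_left)
qed

lemma flat_map_deriv:
  fixes L :: "(real^'n::finite) \<Rightarrow>\<^sub>L real"
  assumes "(\<rho> has_derivative blinfun_apply L) (at x)"
  shows "(flat_map k \<rho> has_derivative blinfun_apply (flat_deriv k L)) (at x)"
  unfolding flat_map_def flat_deriv_apply[abs_def]
  by (auto intro!: derivative_eq_intros assms bounded_linear.has_derivative[OF bounded_linear_vec_nth])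

lemma continuous_on_flat_deriv: "continuous_on S L \<Longrightarrow> continuous_on S (\<lambda>x. flat_deriv k (L x))"
  unfolding flat_deriv_def by (intro continuous_intros)

lemma pull_flat_deriv:
  fixes Dw :: "(real^'n::finite) \<Rightarrow>\<^sub>L 'f::real_normed_vector" and L :: "(real^'n) \<Rightarrow>\<^sub>L real"
  assumes "L (axis k 1) \<noteq> 0"
  shows "jac_vec Dw = pull (flat_deriv k L) (\<chi> i. Dw (flat_inv k L (axis i 1)))"
proof -
  have lin: "linear (flat_inv k L)"
    by (rule linearI) (simp_all add: flat_inv_def blinfun.add_right blinfun.scaleR_right add_divide_distrib diff_divide_distrib algebra_simps)
  have lin2: "linear (\<lambda>h. Dw (flat_inv k L h))"
    by (rule linearI) (simp_all add: linear_add[OF lin] linear_scale[OF lin] blinfun.add_right blinfun.scaleR_right)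
  have "Dw (axis j 1) = Dw (flat_inv k L (flat_deriv k L (axis j 1)))" for j by (simp add: flat_inv_left[OF assms])
  then have "Dw (axis j 1) = (\<Sum>i\<in>UNIV. (flat_deriv k L (axis j 1) $ i) *\<^sub>R Dw (flat_inv k L (axis i 1)))" for j
    using linear_in_axes[OF lin2] by metis
  then show ?thesis unfolding jac_vec_def pull_def by (simp add: vec_eq_iff)
qed

text \<open>In the coordinates y = \<Phi>(x) the Jacobian of w is the pullback of the Jacobian of
  the transported field. Freezing \<open>\<Phi>'\<close> at p gives a map P' with constant
  coefficients, to which the half-space inequality applies; on a small ball the coefficient error is
  absorbed. The transported field may jump to zero at y_k = 0, which that inequality allows.\<close>

lemma local_korn:
  fixes P :: "'f::euclidean_space^'n::finite \<Rightarrow> 'k::euclidean_space" and \<Omega> :: "(real^'n) set"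
  assumes P: "linear P" and ell: "C_elliptic_map P" and Om: "open \<Omega>" and ldf: "local_defining_fun \<Omega> p U \<rho> \<rho>'"
  obtains r C where "r > 0" "C \<ge> 0"
    "\<And>(w :: real^'n \<Rightarrow> 'f) Dw. C1_closure \<Omega> w Dw \<Longrightarrow> (\<And>x. x \<in> closure \<Omega> \<Longrightarrow> x \<notin> cball p r \<Longrightarrow> w x = 0 \<and> Dw x = 0) \<Longrightarrow>
      lint (\<lambda>x. indicator \<Omega> x * (norm (jac_vec (Dw x)))\<^sup>2)
       \<le> C * lint (\<lambda>x. indicator \<Omega> x * (norm (P (jac_vec (Dw x))))\<^sup>2)"
proof -
  obtain \<rho>'' where U: "open U" "p \<in> U" and C2: "C2_on U \<rho> \<rho>' \<rho>''" and nz: "\<And>y. y \<in> U \<Longrightarrow> \<rho>' y \<noteq> 0" and eq: "\<Omega> \<inter> U = {y\<in>U. \<rho> y < 0}"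
    using ldf unfolding local_defining_fun_def by blast
  have d\<rho>: "(\<rho> has_derivative blinfun_apply (\<rho>' y)) (at y)" "(\<rho>' has_derivative blinfun_apply (\<rho>'' y)) (at y)" if "y \<in> U" for y
    using C2 that unfolding C2_on_def by auto
  have c\<rho>': "continuous_on U \<rho>'"
    by (rule has_derivative_continuous_on[OF has_derivative_at_withinI[OF d\<rho>(2)]])
  obtain k s c \<delta> where s: "\<bar>s\<bar> = 1" and c: "c > 0" and \<delta>: "\<delta> > 0" "cball p \<delta> \<subseteq> U"
    and grow: "\<And>x. x \<in> cball p \<delta> \<Longrightarrow> c \<le> s * \<rho>' x (axis k 1)"
    using defining_gradient_direction[OF U c\<rho>' nz[OF U(2)]] by metis
  have Rk: "\<rho>' x (axis k 1) \<noteq> 0" if "x \<in> cball p \<delta>" for x using grow[OF that] c by auto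
  have pc: "p \<in> cball p \<delta>" using \<delta> by simp
  define U0 where "U0 = ball p \<delta>"
  have U0: "open U0" "p \<in> U0" "U0 \<subseteq> cball p \<delta>" "U0 \<subseteq> U" unfolding U0_def using \<delta> ball_subset_cball[of p \<delta>] by auto
  define \<Phi> where "\<Phi> = flat_map k \<rho>"
  define \<Phi>' where "\<Phi>' x = flat_deriv k (\<rho>' x)" for x
  have d\<Phi>: "(\<Phi> has_derivative blinfun_apply (\<Phi>' x)) (at x)" if "x \<in> U0" for x
    unfolding \<Phi>_def \<Phi>'_def using that U0 by (intro flat_map_deriv d\<rho>) auto
  have c\<Phi>'c: "continuous_on (cball p \<delta>) \<Phi>'" unfolding \<Phi>'_def
    by (intro continuous_on_flat_deriv continuous_on_subset[OF c\<rho>' \<delta>(2)])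
  have c\<Phi>': "continuous_on U0 \<Phi>'" using c\<Phi>'c U0(3) by (rule continuous_on_subset)
  have \<Phi>k: "\<Phi> x $ k = \<rho> x" for x unfolding \<Phi>_def flat_map_def by simp
  have linI: "linear (flat_inv k L)" for L :: "(real^'n) \<Rightarrow>\<^sub>L real"
    by (rule linearI) (simp_all add: flat_inv_def blinfun.add_right blinfun.scaleR_right add_divide_distrib diff_divide_distrib algebra_simps)
  define invf where "invf = Blinfun (flat_inv k (\<rho>' p))"
  have invf: "invf o\<^sub>L \<Phi>' p = id_blinfun"
    by (rule blinfun_eqI) (simp add: invf_def \<Phi>'_def bounded_linear_Blinfun_apply linear_conv_bounded_linear[THEN iffD1, OF linI] flat_inv_left Rk[OF pc])
  obtain U' V g g' where U': "open U'" "U' \<subseteq> U0" "p \<in> U'" and V: "open V" "\<Phi> p \<in> V" and hom: "homeomorphism U' V \<Phi> g"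
    and dg: "\<And>y. y \<in> V \<Longrightarrow> (g has_derivative (g' y)) (at y)" and g': "\<And>y. y \<in> V \<Longrightarrow> g' y = inv (blinfun_apply (\<Phi>' (g y)))"
    using inverse_function_theorem[OF U0(1) d\<Phi> c\<Phi>' U0(2) invf] by metis
  have gV: "g y \<in> U'" "\<Phi> (g y) = y" if "y \<in> V" for y using hom that unfolding homeomorphism_def by auto
  have \<Phi>U: "\<Phi> x \<in> V" "g (\<Phi> x) = x" if "x \<in> U'" for x using hom that unfolding homeomorphism_def by auto
  have U'sub: "x \<in> cball p \<delta>" "x \<in> U" if "x \<in> U'" for x using that U' U0 by auto
  have g'eq: "g' y = flat_inv k (\<rho>' (g y))" if "y \<in> V" for y
  proof -
    have n: "\<rho>' (g y) (axis k 1) \<noteq> 0" by (intro Rk U'sub gV that)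
    show ?thesis unfolding g'[OF that] \<Phi>'_def
      by (rule inv_unique_comp) (auto simp: flat_inv_left[OF n] flat_inv_right[OF n])
  qed
  let ?n = "real CARD('n)"
  obtain KP where KP: "KP > 0" "\<And>x. norm (P x) \<le> KP * norm x" using bounded_linear_pos_bound[OF P] by metis
  define P' where "P' = (\<lambda>Z. P (pull (\<Phi>' p) Z))"
  have P': "linear P'" unfolding P'_def using linear_compose[OF linear_pull P] by (simp add: o_def)
  have "surj (blinfun_apply (\<Phi>' p))" unfolding \<Phi>'_def by (rule surjI[of _ "flat_inv k (\<rho>' p)"]) (simp add: flat_inv_right Rk[OF pc])
  then have ell': "C_elliptic_map P'" unfolding P'_def by (rule C_elliptic_pull[OF ell])
  obtain C1 where C1: "C1 \<ge> 0" and korn: "\<And>(v :: real^'n \<Rightarrow> 'f) X. bdd_supp v \<Longrightarrow> bdd_supp X \<Longrightarrow> (\<And>x. 0 \<le> x $ k \<Longrightarrow> v x = 0) \<Longrightarrow> (\<And>x. 0 \<le> x $ k \<Longrightarrow> X x = 0) \<Longrightarrow>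
     (\<And>x j. x $ k < 0 \<Longrightarrow> dir_deriv v (axis j 1) x (X x $ j)) \<Longrightarrow>
     lint (\<lambda>y. (norm (X y))\<^sup>2) \<le> C1 * lint (\<lambda>y. (norm (P' (X y)))\<^sup>2)"
    by (fact halfspace_korn[OF P' ell', of k])
  \<comment> \<open>Chosen so that 2 C1 \<eta>^2 \<le> 1/2: the error of freezing coefficients then
    costs at most half of the left side.\<close>
  define \<eta> where "\<eta> = 1 / (2 * (1 + C1))"
  have \<eta>: "\<eta> > 0" unfolding \<eta>_def using C1 by simp
  have C\<eta>: "C1 * (2 * \<eta>\<^sup>2) \<le> 1 / 2"
  proof -
    have "C1 * 4 \<le> (2 * (1 + C1))\<^sup>2" using C1 by (simp add: power2_eq_square algebra_simps)
    moreover have "(2 * (1 + C1))\<^sup>2 > 0" using C1 by simp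
    ultimately show ?thesis unfolding \<eta>_def by (simp add: power_divide divide_le_eq)
  qed
  \<comment> \<open>The tolerance for \<open>\<Phi>'\<close> itself, which the bounds of P and of
    \<open>pull\<close> turn into \<eta>.\<close>
  define \<eta>0 where "\<eta>0 = \<eta> / (KP * ?n\<^sup>2)"
  have \<eta>0: "\<eta>0 > 0" unfolding \<eta>0_def using \<eta> KP by simp
  have "isCont \<Phi>' p" using c\<Phi>' U0 by (simp add: continuous_on_eq_continuous_at)
  then obtain r1 where r1: "r1 > 0" "\<And>x. dist x p < r1 \<Longrightarrow> norm (\<Phi>' x - \<Phi>' p) < \<eta>0"
    using \<eta>0 unfolding continuous_at_eps_delta dist_norm by metis
  obtain r2 where r2: "r2 > 0" "cball p r2 \<subseteq> U'" using U' open_contains_cball by metis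
  define r where "r = min (r1 / 2) r2"
  have r: "r > 0" "cball p r \<subseteq> U'" unfolding r_def using r1 r2 subset_cball[of "min (r1 / 2) r2" r2 p] by auto
  have near: "norm (\<Phi>' x - \<Phi>' p) \<le> \<eta>0" if "x \<in> cball p r" for x
  proof -
    have "dist x p < r1" using that r1(1) unfolding r_def by (simp add: dist_commute)
    then show ?thesis using r1(2) by (simp add: less_imp_le)
  qed
  define K where "K = cball p r"
  have K: "compact K" "K \<subseteq> U'" unfolding K_def using r by auto
  have Kd: "K \<subseteq> cball p \<delta>" using K U'sub by blast
  have pullerr: "norm (P' Z) \<le> norm (P (pull (\<Phi>' x) Z)) + \<eta> * norm Z" if x: "x \<in> K" for x Z
  proof -
    have "P' Z = P (pull (\<Phi>' x) Z) - P (pull (\<Phi>' x - \<Phi>' p) Z)" unfolding P'_def pull_diff by (simp add: linear_diff[OF P])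
    then have "norm (P' Z) \<le> norm (P (pull (\<Phi>' x) Z)) + norm (P (pull (\<Phi>' x - \<Phi>' p) Z))" by (simp add: norm_triangle_ineq4)
    also have "norm (P (pull (\<Phi>' x - \<Phi>' p) Z)) \<le> KP * (?n\<^sup>2 * norm (\<Phi>' x - \<Phi>' p) * norm Z)"
      using KP norm_pull[of "\<Phi>' x - \<Phi>' p" Z] by (meson mult_left_mono less_imp_le order_trans)
    also have "\<dots> \<le> KP * (?n\<^sup>2 * \<eta>0 * norm Z)" using near[of x] x KP(1) unfolding K_def by (intro mult_left_mono mult_right_mono) auto
    also have "\<dots> = \<eta> * norm Z" unfolding \<eta>0_def using KP(1) by simp
    finally show ?thesis by simp
  qed
  obtain B0 where B0: "B0 > 0" "\<And>x. x \<in> K \<Longrightarrow> norm (\<Phi>' x) \<le> B0"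
    using compact_bound[OF K(1) continuous_on_subset[OF c\<Phi>'c Kd]] by blast
  have cJ: "continuous_on K (\<lambda>x. wo_jac (\<Phi>' x))" "continuous_on U' (\<lambda>x. wo_jac (\<Phi>' x))"
    using continuous_on_subset[OF c\<Phi>'c Kd] continuous_on_subset[OF c\<Phi>' U'(2)] by (intro continuous_on_wo_jac; simp)+
  have Jp: "wo_jac (\<Phi>' x) > 0" if "x \<in> cball p \<delta>" for x
    by (rule wo_jac_pos, rule inj_on_inverseI[of _ "flat_inv k (\<rho>' x)"]) (simp add: \<Phi>'_def flat_inv_left Rk[OF that])
  have "p \<in> K" unfolding K_def using r by simp
  then obtain x0 where x0: "x0 \<in> K" "\<And>x. x \<in> K \<Longrightarrow> wo_jac (\<Phi>' x0) \<le> wo_jac (\<Phi>' x)"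
    using continuous_attains_inf[OF K(1) _ cJ(1)] by blast
  define j0 where "j0 = wo_jac (\<Phi>' x0)"
  have j0: "j0 > 0" "\<And>x. x \<in> K \<Longrightarrow> j0 \<le> wo_jac (\<Phi>' x)" unfolding j0_def using x0 Jp Kd by auto
  obtain j1 where j1: "j1 > 0" "\<And>x. x \<in> K \<Longrightarrow> wo_jac (\<Phi>' x) \<le> j1"
    using compact_bound[OF K(1) cJ(1)] by (metis real_norm_def abs_le_D1)
  define T0 where "T0 = ?n\<^sup>2 * B0"
  \<comment> \<open>T0^2 / j0 leads from the weighted Y back to the Jacobian of w, j1 removes the
    weight on the other side, and 4 C1 is the Korn constant after absorption.\<close>
  define C where "C = T0\<^sup>2 / j0 * (4 * C1 * j1)"
  have C0: "C \<ge> 0" unfolding C_def using C1 j0 j1 by simp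
  show thesis
  proof (rule that[OF r(1) C0])
    fix w :: "real^'n \<Rightarrow> 'f" and Dw
    assume w: "C1_closure \<Omega> w Dw" and supp: "\<And>x. x \<in> closure \<Omega> \<Longrightarrow> x \<notin> cball p r \<Longrightarrow> w x = 0 \<and> Dw x = 0"
    have cw: "continuous_on (closure \<Omega>) w" "continuous_on (closure \<Omega>) Dw"
      and dw: "\<And>x. x \<in> \<Omega> \<Longrightarrow> (w has_derivative blinfun_apply (Dw x)) (at x)" using w unfolding C1_closure_def by auto
    have incl: "\<Omega> \<subseteq> closure \<Omega>" by (rule closure_subset)
    have supp': "w x = 0" "Dw x = 0" if "x \<in> \<Omega>" "x \<notin> K" for x using supp[of x] that incl unfolding K_def by blast+
    \<comment> \<open>The Jacobian of the transported field at \<Phi>(x), written as a function of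
      x.\<close>
    define Y where "Y x = (\<chi> i. Dw x (flat_inv k (\<rho>' x) (axis i 1)))" for x
    have jY: "jac_vec (Dw x) = pull (\<Phi>' x) (Y x)" if "x \<in> cball p \<delta>" for x
      unfolding \<Phi>'_def Y_def by (rule pull_flat_deriv[OF Rk[OF that]])
    have Y0: "Y x = 0" if "x \<in> \<Omega>" "x \<notin> K" for x unfolding Y_def using supp'[OF that] by (simp add: vec_eq_iff)
    have cfi: "continuous_on S (\<lambda>x. flat_inv k (\<rho>' x) a)" if "S \<subseteq> cball p \<delta>" for S a
    proof -
      have cr: "continuous_on S \<rho>'" using continuous_on_subset[OF c\<rho>'] that \<delta>(2) by blast
      show ?thesis unfolding flat_inv_def
        by (intro continuous_intros continuous_on_blinfun_eval cr) (use Rk that in blast)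
    qed
    have cY: "continuous_on S Y" if "S \<subseteq> cball p \<delta>" "S \<subseteq> closure \<Omega>" for S
      unfolding Y_def
      by (intro continuous_on_vec_lambda bounded_bilinear.continuous_on[OF bounded_bilinear_blinfun_apply] cfi that continuous_on_subset[OF cw(2)])
    have comK: "compact (closure \<Omega> \<inter> K)" using K(1) by (simp add: closed_Int_compact)
    obtain BY where BY: "BY > 0" "\<And>x. x \<in> closure \<Omega> \<inter> K \<Longrightarrow> norm (Y x) \<le> BY"
      using compact_bound[OF comK cY] Kd by blast
    obtain Bw where Bw: "Bw > 0" "\<And>x. x \<in> closure \<Omega> \<inter> K \<Longrightarrow> norm (w x) \<le> Bw"
      using compact_bound[OF comK continuous_on_subset[OF cw(1)]] by blast
    have YB: "norm (Y x) \<le> BY" "norm (w x) \<le> Bw" if "x \<in> \<Omega>" for x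
      using BY Bw Y0[of x] supp'[of x] that incl by (cases "x \<in> K"; force)+
    \<comment> \<open>The image of \<Omega> \<inter> U', since \<rho> is the k-th coordinate of
      \<Phi>.\<close>
    define W where "W = V \<inter> {y. y $ k < 0}"
    have W: "open W" unfolding W_def by (intro open_Int V open_Collect_less continuous_intros)
    have gW: "g y \<in> \<Omega>" "g y \<in> U'" "y \<in> V" if "y \<in> W" for y
    proof -
      show yV: "y \<in> V" using that unfolding W_def by simp
      show gU: "g y \<in> U'" by (rule gV[OF yV])
      have "\<rho> (g y) < 0" using that \<Phi>k[of "g y"] gV(2)[OF yV] unfolding W_def by simp
      then show "g y \<in> \<Omega>" using eq U'sub(2)[OF gU] by blast
    qed
    define E where "E = \<Omega> \<inter> U'"
    have E: "open E" unfolding E_def using Om U' by blast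
    have \<Phi>E: "\<Phi> x \<in> W" "g (\<Phi> x) = x" if "x \<in> E" for x
    proof -
      have "x \<in> {y\<in>U. \<rho> y < 0}" using that U'sub(2) unfolding E_def eq[symmetric] by blast
      then show "\<Phi> x \<in> W" "g (\<Phi> x) = x" using that \<Phi>U[of x] \<Phi>k[of x] unfolding E_def W_def by auto
    qed
    define v where "v = (\<lambda>y. indicator W y *\<^sub>R w (g y))"
    define X where "X = (\<lambda>y. indicator W y *\<^sub>R Y (g y))"
    have cg: "continuous_on W g" using hom unfolding homeomorphism_def W_def by (auto intro: continuous_on_subset)
    have gWs: "g ` W \<subseteq> \<Omega>" "g ` W \<subseteq> closure \<Omega>" "g ` W \<subseteq> cball p \<delta>" using gW incl U'sub by blast+
    have "compact (\<Phi> ` K)" using K hom unfolding homeomorphism_def by (intro compact_continuous_image) (auto intro: continuous_on_subset)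
    then have PK: "closed (\<Phi> ` K)" "\<exists>R. \<forall>y\<in>\<Phi> ` K. norm y \<le> R"
      using compact_imp_closed compact_imp_bounded bounded_iff by blast+
    then obtain R where R: "\<And>y. y \<in> \<Phi> ` K \<Longrightarrow> norm y \<le> R" by blast
    have outK: "g y \<notin> K" if "y \<in> W" "y \<notin> \<Phi> ` K" for y using that gV(2)[OF gW(3)[OF that(1)]] by force
    have far: "g y \<notin> K" if "y \<in> W" "R + 1 \<le> norm y" for y using outK[OF that(1)] R[of y] that(2) by fastforce
    have bv: "bdd_supp v" unfolding v_def
    proof (rule bdd_supp_open_cut[OF W, where B = Bw and R = "R + 1"])
      show "continuous_on W (\<lambda>y. w (g y))" by (rule continuous_on_compose2[OF cw(1) cg gWs(2)])
    qed (use YB gW far supp' in auto)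
    have bX: "bdd_supp X" unfolding X_def
    proof (rule bdd_supp_open_cut[OF W, where B = BY and R = "R + 1"])
      have "continuous_on (g ` W) Y" by (rule cY) (use gWs in auto)
      then show "continuous_on W (\<lambda>y. Y (g y))" by (rule continuous_on_compose2[OF _ cg]) simp
    qed (use YB gW far Y0 in auto)
    have \<Phi>KV: "\<Phi> ` K \<subseteq> V" using \<Phi>U K(2) by blast
    have dv: "dir_deriv v (axis j 1) y (X y $ j)" if yk: "y $ k < 0" for y j
    proof (cases "y \<in> W")
      case True
      have dgy: "(g has_derivative flat_inv k (\<rho>' (g y))) (at y)" using dg[OF gW(3)[OF True]] g'eq[OF gW(3)[OF True]] by simp
      have "((\<lambda>y. w (g y)) has_derivative (\<lambda>h. Dw (g y) (flat_inv k (\<rho>' (g y)) h))) (at y)"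
        by (rule has_derivative_compose[OF dgy dw[OF gW(1)[OF True]]])
      from has_derivative_imp_dir_deriv[OF this, of "axis j 1"]
      have "dir_deriv (\<lambda>y. w (g y)) (axis j 1) y (Y (g y) $ j)" unfolding Y_def by simp
      then have "dir_deriv v (axis j 1) y (Y (g y) $ j)" by (rule dir_deriv_local[OF _ W True]) (simp add: v_def)
      then show ?thesis using True unfolding X_def by simp
    next
      \<comment> \<open>With y_k < 0 and y outside W, the point y is outside V, hence off the
        compact image of K; there v vanishes in a neighbourhood.\<close>
      case y: False
      have "y \<notin> \<Phi> ` K" using y yk \<Phi>KV unfolding W_def by blast
      moreover have "v z = 0" if "z \<notin> \<Phi> ` K" for z
        using outK[OF _ that] supp' gW unfolding v_def by (cases "z \<in> W") auto
      ultimately have "dir_deriv v (axis j 1) y 0"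
        by (intro dir_deriv_local[OF dir_deriv_const[of 0], of "- \<Phi> ` K"]) (use PK(1) in auto)
      then show ?thesis using y unfolding X_def by simp
    qed
    have kv: "lint (\<lambda>y. (norm (X y))\<^sup>2) \<le> C1 * lint (\<lambda>y. (norm (P' (X y)))\<^sup>2)"
      by (rule korn[OF bv bX _ _ dv]) (auto simp: v_def X_def W_def)
    define J where "J x = wo_jac (\<Phi>' x)" for x
    obtain RK where RK: "\<And>x. x \<in> K \<Longrightarrow> norm x \<le> RK" using compact_imp_bounded[OF K(1)] unfolding bounded_iff by blast
    have EU: "E \<subseteq> \<Omega>" "E \<subseteq> U'" "E \<subseteq> U0" "E \<subseteq> cball p \<delta>" "E \<subseteq> closure \<Omega>" unfolding E_def using U' U'sub incl by blast+
    have bE: "bdd_supp (\<lambda>x. indicator E x * (J x * q x))"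
      if q: "continuous_on E q" "\<And>x. x \<in> E \<Longrightarrow> x \<notin> K \<Longrightarrow> q x = 0" "\<And>x. x \<in> E \<Longrightarrow> \<bar>q x\<bar> \<le> B" for q :: "_ \<Rightarrow> real" and B
    proof -
      have "bdd_supp (\<lambda>x. indicator E x *\<^sub>R (J x * q x))"
      proof (rule bdd_supp_open_cut[OF E, where B = "j1 * \<bar>B\<bar>" and R = "RK + 1"])
        show "continuous_on E (\<lambda>x. J x * q x)" unfolding J_def
          using continuous_on_subset[OF cJ(2) EU(2)] q(1) by (intro continuous_intros)
        show "norm (J x * q x) \<le> j1 * \<bar>B\<bar>" if x: "x \<in> E" for x
        proof (cases "x \<in> K")
          case True
          then have "\<bar>J x\<bar> \<le> j1" using j1(2)[OF True] j0 unfolding J_def by (metis abs_of_pos less_le_trans)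
          then show ?thesis using q(3)[OF x] j1(1) unfolding real_norm_def abs_mult by (intro mult_mono) auto
        qed (use q(2) x j1 in simp)
        show "J x * q x = 0" if "x \<in> E" "RK + 1 \<le> norm x" for x using q(2)[of x] RK[of x] that by fastforce
      qed
      then show ?thesis by simp
    qed
    have XP: "X (\<Phi> x) = Y x" if "x \<in> E" for x unfolding X_def using \<Phi>E[OF that] by simp
    have X0: "X y = 0" if "y \<notin> \<Phi> ` E" for y
    proof (cases "y \<in> W")
      case True
      have "g y \<in> E" using gW[OF True] unfolding E_def by blast
      then have "y \<in> \<Phi> ` E" using gV(2)[OF gW(3)[OF True]] by (metis imageI)
      then show ?thesis using that by blast
    qed (simp add: X_def)
    have injE: "inj_on \<Phi> E" by (rule inj_on_inverseI[of _ g]) (rule \<Phi>E(2))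
    have cYE: "continuous_on E Y" by (rule cY[OF EU(4,5)])
    have cP'E: "continuous_on E (\<lambda>x. P' (Y x))" using bounded_linear.continuous_on[OF linear_conv_bounded_linear[THEN iffD1, OF P'] cYE] .
    obtain KP' where KP': "KP' > 0" "\<And>x. norm (P' x) \<le> KP' * norm x" using bounded_linear_pos_bound[OF P'] by metis
    have cjac: "continuous_on S (\<lambda>x. jac_vec (Dw x))" if "S \<subseteq> closure \<Omega>" for S
      unfolding jac_vec_def by (intro continuous_on_vec_lambda continuous_on_blinfun_eval continuous_on_subset[OF cw(2) that])
    have cPj: "continuous_on S (\<lambda>x. P (jac_vec (Dw x)))" if "S \<subseteq> closure \<Omega>" for S
      using bounded_linear.continuous_on[OF linear_conv_bounded_linear[THEN iffD1, OF P] cjac[OF that]] .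
    have jac0: "jac_vec (Dw x) = 0" if "x \<in> \<Omega>" "x \<notin> K" for x
      using supp'[OF that] by (simp add: jac_vec_def vec_eq_iff)
    have jacT: "norm (jac_vec (Dw x)) \<le> T0 * norm (Y x)" if "x \<in> \<Omega>" for x
    proof (cases "x \<in> K")
      case True
      then have "norm (jac_vec (Dw x)) \<le> ?n\<^sup>2 * norm (\<Phi>' x) * norm (Y x)" using jY[of x] Kd norm_pull by force
      also have "\<dots> \<le> ?n\<^sup>2 * B0 * norm (Y x)" using B0(2)[OF True] by (intro mult_right_mono mult_left_mono) auto
      finally show ?thesis unfolding T0_def .
    qed (use jac0[OF that] Y0[OF that] in simp)
    have T00: "T0 > 0" unfolding T0_def using B0 by simp
    have b1: "bdd_supp (\<lambda>x. indicator E x * (J x * (norm (Y x))\<^sup>2))"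
    proof (rule bE[where B = "BY\<^sup>2"])
      show "\<bar>(norm (Y x))\<^sup>2\<bar> \<le> BY\<^sup>2" if "x \<in> E" for x using YB(1)[of x] that EU(1) by (auto intro!: power_mono)
    qed (use Y0 EU in \<open>auto intro!: continuous_intros cYE\<close>)
    have b2: "bdd_supp (\<lambda>x. indicator E x * (J x * (norm (P' (Y x)))\<^sup>2))"
    proof (rule bE[where B = "(KP' * BY)\<^sup>2"])
      show "\<bar>(norm (P' (Y x)))\<^sup>2\<bar> \<le> (KP' * BY)\<^sup>2" if "x \<in> E" for x
      proof -
        have "norm (P' (Y x)) \<le> KP' * norm (Y x)" by (rule KP')
        also have "\<dots> \<le> KP' * BY" using YB(1)[of x] that EU(1) KP'(1) by (intro mult_left_mono) auto
        finally show ?thesis by (simp add: power_mono)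
      qed
    qed (use Y0 EU linear_0[OF P'] in \<open>auto intro!: continuous_intros cP'E\<close>)
    have b3: "bdd_supp (\<lambda>x. indicator E x * (J x * (norm (P (jac_vec (Dw x))))\<^sup>2))"
    proof (rule bE[where B = "(KP * (T0 * BY))\<^sup>2"])
      show "\<bar>(norm (P (jac_vec (Dw x))))\<^sup>2\<bar> \<le> (KP * (T0 * BY))\<^sup>2" if "x \<in> E" for x
      proof -
        have x: "x \<in> \<Omega>" using that EU by blast
        have "norm (P (jac_vec (Dw x))) \<le> KP * norm (jac_vec (Dw x))" by (rule KP)
        also have "norm (jac_vec (Dw x)) \<le> T0 * norm (Y x)" by (rule jacT[OF x])
        also have "norm (Y x) \<le> BY" by (rule YB[OF x])
        finally show ?thesis using KP(1) T00 by (simp add: power_mono)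
      qed
    qed (use jac0 EU linear_0[OF P] in \<open>auto intro!: continuous_intros cPj\<close>)
    have cov: "lint (\<lambda>y. (norm (L (X y)))\<^sup>2) = lint (\<lambda>x. indicator E x * (J x * (norm (L (Y x)))\<^sup>2))"
      if L: "linear L" and b: "bdd_supp (\<lambda>x. indicator E x * (J x * (norm (L (Y x)))\<^sup>2))" for L :: "'f^'n \<Rightarrow> 'z::euclidean_space"
    proof -
      have e: "indicator E x * (wo_jac (\<Phi>' x) * (norm (L (X (\<Phi> x))))\<^sup>2) = indicator E x * (J x * (norm (L (Y x)))\<^sup>2)" for x
        using XP[of x] unfolding J_def by (cases "x \<in> E") auto
      have "lint (\<lambda>y. (norm (L (X y)))\<^sup>2) = lint (\<lambda>x. indicator E x * (wo_jac (\<Phi>' x) * (norm (L (X (\<Phi> x))))\<^sup>2))"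
      proof (rule integral_change_of_variables_lborel[OF E _ injE])
        show "(\<Phi> has_derivative blinfun_apply (\<Phi>' x)) (at x)" if "x \<in> E" for x using d\<Phi> that EU by blast
        show "integrable lborel (\<lambda>y. (norm (L (X y)))\<^sup>2)" by (rule bdd_supp_integrable[OF bdd_supp_norm2[OF bdd_supp_linear[OF bX L]]])
        show "(norm (L (X y)))\<^sup>2 = 0" if "y \<notin> \<Phi> ` E" for y using X0[OF that] by (simp add: linear_0[OF L])
        show "integrable lborel (\<lambda>x. indicator E x * (wo_jac (\<Phi>' x) * (norm (L (X (\<Phi> x))))\<^sup>2))" unfolding e by (rule bdd_supp_integrable[OF b])
      qed
      then show ?thesis unfolding e .
    qed
    define I1 where "I1 = lint (\<lambda>x. indicator E x * (J x * (norm (Y x))\<^sup>2))"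
    define I2 where "I2 = lint (\<lambda>x. indicator E x * (J x * (norm (P' (Y x)))\<^sup>2))"
    define I3 where "I3 = lint (\<lambda>x. indicator E x * (J x * (norm (P (jac_vec (Dw x))))\<^sup>2))"
    \<comment> \<open>The half-space inequality carried back to \<Omega>, with the Jacobian
      determinant as weight on both sides.\<close>
    have 1: "I1 \<le> C1 * I2" using kv cov[OF linear_id, unfolded id_apply, OF b1] cov[OF P' b2] unfolding I1_def I2_def by simp
    have J0: "0 \<le> J x" if "x \<in> E" for x using Jp[of x] EU that unfolding J_def by (auto intro: less_imp_le)
    have "I2 \<le> lint (\<lambda>x. 2 * (indicator E x * (J x * (norm (P (jac_vec (Dw x))))\<^sup>2)) + 2 * \<eta>\<^sup>2 * (indicator E x * (J x * (norm (Y x))\<^sup>2)))"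
      unfolding I2_def
    proof (intro integral_mono bdd_supp_integrable bdd_supp_add bdd_supp_cmult b1 b2 b3)
      fix x
      show "indicator E x * (J x * (norm (P' (Y x)))\<^sup>2) \<le> 2 * (indicator E x * (J x * (norm (P (jac_vec (Dw x))))\<^sup>2)) + 2 * \<eta>\<^sup>2 * (indicator E x * (J x * (norm (Y x))\<^sup>2))"
      proof (cases "x \<in> E")
        case True
        have "(norm (P' (Y x)))\<^sup>2 \<le> 2 * (norm (P (jac_vec (Dw x))))\<^sup>2 + 2 * \<eta>\<^sup>2 * (norm (Y x))\<^sup>2"
        proof (cases "x \<in> K")
          case xK: True
          have "norm (P' (Y x)) \<le> norm (P (jac_vec (Dw x))) + \<eta> * norm (Y x)"
            using pullerr[OF xK, of "Y x"] jY[of x] xK Kd by auto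
          then have "(norm (P' (Y x)))\<^sup>2 \<le> (norm (P (jac_vec (Dw x))) + \<eta> * norm (Y x))\<^sup>2" by (intro power_mono) auto
          also have "\<dots> \<le> 2 * (norm (P (jac_vec (Dw x))))\<^sup>2 + 2 * (\<eta> * norm (Y x))\<^sup>2"
            using sum_squares_bound[of "norm (P (jac_vec (Dw x)))" "\<eta> * norm (Y x)"] by (simp add: power2_sum)
          finally show ?thesis by (simp add: power_mult_distrib)
        next
          case False
          then show ?thesis using Y0[of x] True EU linear_0[OF P'] by auto
        qed
        from mult_left_mono[OF this J0[OF True]] show ?thesis using True by (simp add: algebra_simps)
      qed simp
    qed
    also have "\<dots> = 2 * I3 + 2 * \<eta>\<^sup>2 * I1" unfolding I1_def I3_def
      using bdd_supp_integrable[OF b1] bdd_supp_integrable[OF b3] by simp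
    finally have "C1 * I2 \<le> C1 * (2 * I3 + 2 * \<eta>\<^sup>2 * I1)" using C1 by (rule mult_left_mono)
    also have "\<dots> = 2 * C1 * I3 + (C1 * (2 * \<eta>\<^sup>2)) * I1" by (simp add: algebra_simps)
    also have "\<dots> \<le> 2 * C1 * I3 + 1 / 2 * I1"
    proof -
      have "0 \<le> I1" unfolding I1_def by (intro integral_nonneg_AE AE_I2) (use J0 in \<open>auto simp: indicator_def\<close>)
      then show ?thesis using mult_right_mono[OF C\<eta>, of I1] by simp
    qed
    finally have 2: "I1 \<le> 4 * C1 * I3" using 1 by linarith
    have "bdd_supp (\<lambda>x. indicator \<Omega> x *\<^sub>R (norm (jac_vec (Dw x)))\<^sup>2)" "bdd_supp (\<lambda>x. indicator \<Omega> x *\<^sub>R (norm (P (jac_vec (Dw x))))\<^sup>2)"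
      using supp by (intro bdd_supp_closure_cut[OF Om _ K(1)] continuous_intros cjac cPj; auto simp: K_def jac_vec_def linear_0[OF P] zero_vec_def[symmetric])+
    then have bj: "bdd_supp (\<lambda>x. indicator \<Omega> x * (norm (jac_vec (Dw x)))\<^sup>2)" "bdd_supp (\<lambda>x. indicator \<Omega> x * (norm (P (jac_vec (Dw x))))\<^sup>2)" by simp_all
    have "lint (\<lambda>x. indicator \<Omega> x * (norm (jac_vec (Dw x)))\<^sup>2) \<le> lint (\<lambda>x. T0\<^sup>2 / j0 * (indicator E x * (J x * (norm (Y x))\<^sup>2)))"
    proof (intro integral_mono bdd_supp_integrable bdd_supp_cmult b1 bj)
      fix x
      show "indicator \<Omega> x * (norm (jac_vec (Dw x)))\<^sup>2 \<le> T0\<^sup>2 / j0 * (indicator E x * (J x * (norm (Y x))\<^sup>2))"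
      proof (cases "x \<in> \<Omega> \<and> x \<in> K")
        case True
        then have xE: "x \<in> E" unfolding E_def using K by blast
        have "(norm (jac_vec (Dw x)))\<^sup>2 \<le> (T0 * norm (Y x))\<^sup>2" using jacT True by (intro power_mono) auto
        also have "\<dots> = T0\<^sup>2 / j0 * (j0 * (norm (Y x))\<^sup>2)" using j0(1) by (simp add: power_mult_distrib)
        also have "\<dots> \<le> T0\<^sup>2 / j0 * (J x * (norm (Y x))\<^sup>2)" using j0 True unfolding J_def by (intro mult_left_mono mult_right_mono) auto
        finally show ?thesis using True xE by simp
      next
        case False
        have "0 \<le> T0\<^sup>2 / j0 * (indicator E x * (J x * (norm (Y x))\<^sup>2))" using J0[of x] j0(1) by (cases "x \<in> E") auto
        moreover have "indicator \<Omega> x * (norm (jac_vec (Dw x)))\<^sup>2 = 0" using False jac0[of x] by (cases "x \<in> \<Omega>") auto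
        ultimately show ?thesis by linarith
      qed
    qed
    also have "\<dots> = T0\<^sup>2 / j0 * I1" unfolding I1_def by (rule integral_mult_right_zero)
    also have "\<dots> \<le> T0\<^sup>2 / j0 * (4 * C1 * I3)" using 2 j0(1) by (intro mult_left_mono) auto
    finally have 3: "lint (\<lambda>x. indicator \<Omega> x * (norm (jac_vec (Dw x)))\<^sup>2) \<le> T0\<^sup>2 / j0 * (4 * C1 * I3)" .
    have "I3 \<le> lint (\<lambda>x. j1 * (indicator \<Omega> x * (norm (P (jac_vec (Dw x))))\<^sup>2))"
      unfolding I3_def
    proof (intro integral_mono bdd_supp_integrable bdd_supp_cmult b3 bj)
      fix x
      show "indicator E x * (J x * (norm (P (jac_vec (Dw x))))\<^sup>2) \<le> j1 * (indicator \<Omega> x * (norm (P (jac_vec (Dw x))))\<^sup>2)"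
      proof (cases "x \<in> E \<and> x \<in> K")
        case True
        then have "x \<in> \<Omega>" using EU(1) by blast
        then show ?thesis using True j1(2)[of x] unfolding J_def by (simp add: mult_right_mono)
      next
        case False
        have "indicator E x * (J x * (norm (P (jac_vec (Dw x))))\<^sup>2) = 0"
          using False jac0[of x] EU linear_0[OF P] by (cases "x \<in> E") auto
        moreover have "0 \<le> j1 * (indicator \<Omega> x * (norm (P (jac_vec (Dw x))))\<^sup>2)" using j1(1) by simp
        ultimately show ?thesis by linarith
      qed
    qed
    then have "I3 \<le> j1 * lint (\<lambda>x. indicator \<Omega> x * (norm (P (jac_vec (Dw x))))\<^sup>2)" by simp
    then have "T0\<^sup>2 / j0 * (4 * C1 * I3) \<le> T0\<^sup>2 / j0 * (4 * C1 * (j1 * lint (\<lambda>x. indicator \<Omega> x * (norm (P (jac_vec (Dw x))))\<^sup>2)))"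
      using C1 j0(1) by (intro mult_left_mono) auto
    with 3 show "lint (\<lambda>x. indicator \<Omega> x * (norm (jac_vec (Dw x)))\<^sup>2)
       \<le> C * lint (\<lambda>x. indicator \<Omega> x * (norm (P (jac_vec (Dw x))))\<^sup>2)"
      unfolding C_def mult.assoc by linarith
  qed
qed

section \<open>Coercivity for fields satisfying the boundary condition\<close>

lemma norm_blinfun_le_jac_vec: "norm L \<le> real CARD('n) * norm (jac_vec L)"
  for L :: "(real^'n::finite) \<Rightarrow>\<^sub>L 'f::real_normed_vector"
proof -
  have "norm L \<le> (\<Sum>b\<in>Basis. norm (L b))" by (rule norm_blinfun_euclidean_le)
  also have "\<dots> = (\<Sum>j\<in>UNIV. norm (jac_vec L $ j))"
  proof -
    have B: "(Basis :: (real^'n) set) = range (\<lambda>i. axis i 1)" by (auto simp: Basis_vec_def)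
    have "inj (\<lambda>i::'n. axis i (1::real))" by (auto simp: inj_def axis_eq_axis)
    then show ?thesis unfolding B by (simp add: sum.reindex jac_vec_def)
  qed
  also have "\<dots> \<le> (\<Sum>j\<in>(UNIV::'n set). norm (jac_vec L))" by (intro sum_mono Finite_Cartesian_Product.norm_nth_le)
  finally show ?thesis by simp
qed

lemma norm_sq_jac_vec: "(norm (jac_vec L))\<^sup>2 = (\<Sum>j\<in>UNIV. (norm (L (axis j 1)))\<^sup>2)"
  for L :: "(real^'n::finite) \<Rightarrow>\<^sub>L 'f::real_inner"
  by (simp add: power2_norm_eq_inner inner_vec_def jac_vec_def)

lemma diffop_jac_vec: "diffop A L = (\<Sum>j\<in>UNIV. A j (jac_vec L $ j))"
  unfolding diffop_def jac_vec_def by simp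

text \<open>Its inner product with \<nu> is \<open>symb B \<nu> v \<bullet> c\<close>, which is how
  the boundary condition becomes tangency of vector fields.\<close>

definition comp_field :: "('n::finite \<Rightarrow> 'f \<Rightarrow> 'e::euclidean_space) \<Rightarrow> 'e \<Rightarrow> 'f::euclidean_space \<Rightarrow> real^'n" where
  "comp_field B c v = (\<chi> j. B j v \<bullet> c)"

lemma bounded_linear_comp_field: "(\<And>j. linear (B j)) \<Longrightarrow> bounded_linear (comp_field B c)"
  unfolding linear_conv_bounded_linear[symmetric]
  by (rule linearI) (simp_all add: comp_field_def vec_eq_iff linear_add linear_scale inner_add_left)

text \<open>The mixed terms B_j X_i . B_i X_j, expanded in an orthonormal basis of the target of B,
  are the traces of the squared Jacobians. The squared divergences add up to |B u|^2, which is
  therefore added and subtracted.\<close>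

lemma energy_decomposition:
  fixes A :: "'n::finite \<Rightarrow> 'f::euclidean_space \<Rightarrow> 'g::euclidean_space" and B :: "'n \<Rightarrow> 'f \<Rightarrow> 'e::euclidean_space"
  assumes lin: "\<And>j. linear (A j)" "\<And>j. linear (B j)"
  shows "jac_vec L \<bullet> Mmap A B (jac_vec L) = (norm (diffop A L))\<^sup>2 + (norm (diffop B L))\<^sup>2
     + (\<Sum>c\<in>Basis. null_lagrangian (Blinfun (comp_field B c) o\<^sub>L L))"
proof -
  define X where "X = jac_vec L"
  have n: "null_lagrangian (Blinfun (comp_field B c) o\<^sub>L L)
      = (\<Sum>i\<in>UNIV. \<Sum>j\<in>UNIV. (B j (X $ i) \<bullet> c) * (B i (X $ j) \<bullet> c)) - (diffop B L \<bullet> c) * (diffop B L \<bullet> c)" for c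
    unfolding null_lagrangian_def diffop_def X_def jac_vec_def
    by (simp add: bounded_linear_Blinfun_apply[OF bounded_linear_comp_field[OF lin(2)]] comp_field_def inner_sum_left power2_eq_square)
  have "(\<Sum>c\<in>Basis. \<Sum>i\<in>UNIV. \<Sum>j\<in>UNIV. (B j (X $ i) \<bullet> c) * (B i (X $ j) \<bullet> c))
      = (\<Sum>i\<in>UNIV. \<Sum>j\<in>UNIV. B j (X $ i) \<bullet> B i (X $ j))"
    by (subst sum.swap, intro sum.cong refl, subst sum.swap, intro sum.cong refl) (simp add: euclidean_inner[symmetric])
  then have "(\<Sum>c\<in>Basis. null_lagrangian (Blinfun (comp_field B c) o\<^sub>L L)) = (\<Sum>i\<in>UNIV. \<Sum>j\<in>UNIV. B j (X $ i) \<bullet> B i (X $ j)) - (norm (diffop B L))\<^sup>2"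
    unfolding n sum_subtractf power2_norm_eq_inner by (simp add: euclidean_inner[symmetric])
  moreover have "(\<Sum>i\<in>UNIV. \<Sum>j\<in>UNIV. A i (X $ i) \<bullet> A j (X $ j)) = (norm (diffop A L))\<^sup>2"
    unfolding power2_norm_eq_inner diffop_jac_vec X_def[symmetric] inner_sum_left unfolding inner_sum_right ..
  ultimately show ?thesis unfolding X_def[symmetric] inner_Mmap[OF lin] by (simp add: sum.distrib)
qed

text \<open>The Korn inequality bounds Du by the root of \<open>Mmap\<close>, whose square is the
  energy plus null Lagrangians. These contribute |w| |Dw| + |w|^2, and Young's inequality absorbs
  the product. The support condition is that of the two local ingredients, with the smaller
  radius.\<close>

lemma local_coercive:
  fixes A :: "'n::finite \<Rightarrow> 'f::euclidean_space \<Rightarrow> 'g::euclidean_space"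
    and B :: "'n \<Rightarrow> 'f \<Rightarrow> 'e::euclidean_space"
    and \<Omega> :: "(real^'n) set"
  assumes lin: "\<And>j. linear (A j)" "\<And>j. linear (B j)"
    and psd: "psd_map (Mmap A B)" and ell: "C_elliptic_DM A B"
    and Om: "open \<Omega>" and ldf: "local_defining_fun \<Omega> p U \<rho> \<rho>'"
  shows "\<exists>r C. r > 0 \<and> C \<ge> 0 \<and> (\<forall>w Dw. C1_closure \<Omega> w Dw \<longrightarrow> (\<forall>x\<in>closure \<Omega>. x \<notin> cball p r \<longrightarrow> w x = 0 \<and> Dw x = 0) \<longrightarrow>
      (\<forall>x \<nu>. outward_normal \<Omega> x \<nu> \<longrightarrow> symb B \<nu> (w x) = 0) \<longrightarrow>
      lint (\<lambda>x. indicator \<Omega> x * (norm (jac_vec (Dw x)))\<^sup>2)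
      \<le> C * lint (\<lambda>x. indicator \<Omega> x * ((norm (diffop A (Dw x)))\<^sup>2 + (norm (diffop B (Dw x)))\<^sup>2 + (norm (w x))\<^sup>2)))"
proof -
  define P where "P = psd_sqrt (Mmap A B)"
  have P: "linear P" and Psq: "(norm (P X))\<^sup>2 = X \<bullet> Mmap A B X" for X
    unfolding P_def using psd_sqrt_properties[OF linear_Mmap[OF lin] self_adjoint_Mmap[OF lin] psd] by auto
  have ellP: "C_elliptic_map P" using ell unfolding C_elliptic_DM_def C_elliptic_map_def P_def .
  obtain r1 C1 where r1: "r1 > 0" and C1: "C1 \<ge> 0" and korn: "\<And>(w :: real^'n \<Rightarrow> 'f) Dw. C1_closure \<Omega> w Dw \<Longrightarrow> (\<And>x. x \<in> closure \<Omega> \<Longrightarrow> x \<notin> cball p r1 \<Longrightarrow> w x = 0 \<and> Dw x = 0) \<Longrightarrow>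
      lint (\<lambda>x. indicator \<Omega> x * (norm (jac_vec (Dw x)))\<^sup>2)
       \<le> C1 * lint (\<lambda>x. indicator \<Omega> x * (norm (P (jac_vec (Dw x))))\<^sup>2)"
    by (fact local_korn[OF P ellP Om ldf])
  obtain r2 C2 where r2: "r2 > 0" and C2: "C2 \<ge> 0" and "cball p r2 \<subseteq> U" and nl: "\<And>V DV. C1_closure \<Omega> V DV \<Longrightarrow> (\<And>x. x \<in> closure \<Omega> \<Longrightarrow> x \<notin> cball p r2 \<Longrightarrow> V x = 0 \<and> DV x = 0) \<Longrightarrow>
      (\<And>q. q \<in> frontier \<Omega> \<inter> U \<Longrightarrow> V q \<bullet> grad (\<rho>' q) = 0) \<Longrightarrow>
      lint (\<lambda>x. indicator \<Omega> x * null_lagrangian (DV x))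
       \<le> C2 * lint (\<lambda>x. indicator \<Omega> x * (norm (V x) * norm (DV x) + (norm (V x))\<^sup>2))"
    by (fact null_lagrangian_boundary_bound[OF Om ldf])
  define r where "r = min r1 r2"
  let ?n = "real CARD('n)"
  define Lc where "Lc c = Blinfun (comp_field B c)" for c
  have Lca: "Lc c v = comp_field B c v" for c v
    unfolding Lc_def by (simp add: bounded_linear_Blinfun_apply[OF bounded_linear_comp_field[OF lin(2)]])
  define \<Lambda> where "\<Lambda> = 1 + (\<Sum>c\<in>Basis. norm (Lc c))"
  have \<Lambda>0: "\<Lambda> \<ge> 1" unfolding \<Lambda>_def by (simp add: sum_nonneg)
  have Lcn: "norm (Lc c) \<le> \<Lambda>" if "c \<in> Basis" for c
    unfolding \<Lambda>_def using member_le_sum[of c Basis "\<lambda>c. norm (Lc c)"] that by simp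
  define C3 where "C3 = real DIM('e) * (C2 * \<Lambda>\<^sup>2)"
  have C30: "C3 \<ge> 0" unfolding C3_def using C2 by simp
  \<comment> \<open>With a the norm of the Jacobian and d = C1 C3 n |w|, the bound d a \<le> a^2/2 +
    d^2/2 moves half of IJ to the left; multiplying by 2 yields these terms.\<close>
  define C where "C = 2 * C1 + (C1 * C3 * ?n)\<^sup>2 + 2 * C1 * C3"
  have C0: "C \<ge> 0" unfolding C_def using C1 C30 by simp
  show ?thesis
  proof (rule exI[of _ r], rule exI[of _ C], intro conjI allI impI)
    show "0 < r" unfolding r_def using r1 r2 by simp
    show "0 \<le> C" by (rule C0)
    fix w :: "real^'n \<Rightarrow> 'f" and Dw
    assume w: "C1_closure \<Omega> w Dw" and supp0: "\<forall>x\<in>closure \<Omega>. x \<notin> cball p r \<longrightarrow> w x = 0 \<and> Dw x = 0"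
      and bc: "\<forall>x \<nu>. outward_normal \<Omega> x \<nu> \<longrightarrow> symb B \<nu> (w x) = 0"
    have supp: "w x = 0 \<and> Dw x = 0" if "x \<in> closure \<Omega>" "x \<notin> cball p r1 \<or> x \<notin> cball p r2" for x
      using supp0 that unfolding r_def by auto
    have cw: "continuous_on (closure \<Omega>) w" "continuous_on (closure \<Omega>) Dw"
      and dw: "\<And>x. x \<in> \<Omega> \<Longrightarrow> (w has_derivative blinfun_apply (Dw x)) (at x)" using w unfolding C1_closure_def by auto
    have bdd_supp\<Omega>: "bdd_supp (\<lambda>x. indicator \<Omega> x * f x)" if "continuous_on (closure \<Omega>) f" "\<And>x. x \<in> closure \<Omega> \<Longrightarrow> w x = 0 \<Longrightarrow> Dw x = 0 \<Longrightarrow> f x = 0" for f :: "_ \<Rightarrow> real"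
    proof -
      have "bdd_supp (\<lambda>x. indicator \<Omega> x *\<^sub>R f x)"
        by (rule bdd_supp_closure_cut[OF Om that(1) compact_cball[of p r]]) (use supp0 that(2) in blast)
      then show ?thesis by simp
    qed
    have cj: "continuous_on (closure \<Omega>) (\<lambda>x. jac_vec (Dw x))"
      unfolding jac_vec_def by (intro continuous_on_vec_lambda continuous_on_blinfun_eval cw)
    have cA: "continuous_on (closure \<Omega>) (\<lambda>x. diffop A (Dw x))" "continuous_on (closure \<Omega>) (\<lambda>x. diffop B (Dw x))"
      unfolding diffop_def
      by (intro continuous_on_sum bounded_linear.continuous_on[OF linear_conv_bounded_linear[THEN iffD1, OF lin(1)]]
          bounded_linear.continuous_on[OF linear_conv_bounded_linear[THEN iffD1, OF lin(2)]] continuous_on_blinfun_eval cw)+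
    have d0: "diffop A 0 = 0" "diffop B 0 = 0" "jac_vec (0 :: (real^'n) \<Rightarrow>\<^sub>L 'f) = 0"
      unfolding diffop_def jac_vec_def by (simp_all add: linear_0[OF lin(1)] linear_0[OF lin(2)] vec_eq_iff)
    define IJ where "IJ = lint (\<lambda>x. indicator \<Omega> x * (norm (jac_vec (Dw x)))\<^sup>2)"
    define IA where "IA = lint (\<lambda>x. indicator \<Omega> x * ((norm (diffop A (Dw x)))\<^sup>2 + (norm (diffop B (Dw x)))\<^sup>2))"
    define Iw where "Iw = lint (\<lambda>x. indicator \<Omega> x * (norm (w x))\<^sup>2)"
    define Im where "Im = lint (\<lambda>x. indicator \<Omega> x * (?n * (norm (w x) * norm (jac_vec (Dw x))) + (norm (w x))\<^sup>2))"
    have bJ: "bdd_supp (\<lambda>x. indicator \<Omega> x * (norm (jac_vec (Dw x)))\<^sup>2)" by (rule bdd_supp\<Omega>) (auto intro!: continuous_intros cj simp: d0)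
    have bA: "bdd_supp (\<lambda>x. indicator \<Omega> x * ((norm (diffop A (Dw x)))\<^sup>2 + (norm (diffop B (Dw x)))\<^sup>2))" by (rule bdd_supp\<Omega>) (auto intro!: continuous_intros cA simp: d0)
    have bw: "bdd_supp (\<lambda>x. indicator \<Omega> x * (norm (w x))\<^sup>2)" by (rule bdd_supp\<Omega>) (auto intro!: continuous_intros cw)
    have bm: "bdd_supp (\<lambda>x. indicator \<Omega> x * (?n * (norm (w x) * norm (jac_vec (Dw x))) + (norm (w x))\<^sup>2))" by (rule bdd_supp\<Omega>) (auto intro!: continuous_intros cw cj)
    have nlc: "continuous_on (closure \<Omega>) (\<lambda>x. null_lagrangian (Lc c o\<^sub>L Dw x))" for c
      unfolding null_lagrangian_def by (intro continuous_intros continuous_on_vec_nth continuous_on_blinfun_eval cw)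
    have bn: "bdd_supp (\<lambda>x. indicator \<Omega> x * null_lagrangian (Lc c o\<^sub>L Dw x))" for c
      by (rule bdd_supp\<Omega>[OF nlc]) (simp add: null_lagrangian_def blinfun.zero_right)
    have nl1: "lint (\<lambda>x. indicator \<Omega> x * null_lagrangian (Lc c o\<^sub>L Dw x)) \<le> C2 * \<Lambda>\<^sup>2 * Im" if c: "c \<in> Basis" for c
    proof -
      have "lint (\<lambda>x. indicator \<Omega> x * null_lagrangian (Lc c o\<^sub>L Dw x))
         \<le> C2 * lint (\<lambda>x. indicator \<Omega> x * (norm (Lc c (w x)) * norm (Lc c o\<^sub>L Dw x) + (norm (Lc c (w x)))\<^sup>2))"
      proof (rule nl)
        show "C1_closure \<Omega> (\<lambda>x. Lc c (w x)) (\<lambda>x. Lc c o\<^sub>L Dw x)" unfolding C1_closure_def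
        proof (intro conjI ballI)
          show "continuous_on (closure \<Omega>) (\<lambda>x. Lc c (w x))" "continuous_on (closure \<Omega>) (\<lambda>x. Lc c o\<^sub>L Dw x)"
            by (intro continuous_intros cw bounded_linear.continuous_on[OF blinfun.bounded_linear_right])+
          show "((\<lambda>x. Lc c (w x)) has_derivative blinfun_apply (Lc c o\<^sub>L Dw x)) (at x)" if "x \<in> \<Omega>" for x
          proof -
            have e: "blinfun_apply (Lc c o\<^sub>L Dw x) = (\<lambda>h. Lc c (Dw x h))" by (simp add: fun_eq_iff)
            show ?thesis unfolding e by (rule bounded_linear.has_derivative[OF blinfun.bounded_linear_right dw[OF that]])
          qed
        qed
        show "Lc c (w x) = 0 \<and> Lc c o\<^sub>L Dw x = 0" if "x \<in> closure \<Omega>" "x \<notin> cball p r2" for x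
          using supp[OF that(1)] that(2) by (auto simp: blinfun.zero_right)
        \<comment> \<open>The hypothesis speaks of the unit normal; \<open>symb\<close> is linear in
          the covector, so the same holds for the gradient before normalisation. The function \<rho>
          on U is also a defining function at q.\<close>
        show "Lc c (w q) \<bullet> grad (\<rho>' q) = 0" if q: "q \<in> frontier \<Omega> \<inter> U" for q
        proof -
          have nz: "\<rho>' q \<noteq> 0" and ldq: "local_defining_fun \<Omega> q U \<rho> \<rho>'" using ldf q unfolding local_defining_fun_def by auto
          have g0: "norm (grad (\<rho>' q)) \<noteq> 0"
          proof
            assume "norm (grad (\<rho>' q)) = 0"
            then have "\<rho>' q (axis j 1) = 0" for j by (simp add: grad_def vec_eq_iff)
            then have "\<rho>' q = 0" by (intro blinfun_euclidean_eqI) (auto simp: Basis_vec_def)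
            then show False using nz by simp
          qed
          define \<nu> where "\<nu> = grad (\<rho>' q) /\<^sub>R norm (grad (\<rho>' q))"
          have "outward_normal \<Omega> q \<nu>" unfolding outward_normal_def \<nu>_def using q ldq by blast
          then have "symb B \<nu> (w q) = 0" using bc by blast
          moreover have "symb B \<nu> (w q) = symb B (grad (\<rho>' q)) (w q) /\<^sub>R norm (grad (\<rho>' q))"
            unfolding symb_def \<nu>_def by (simp add: scaleR_sum_right)
          ultimately have "symb B (grad (\<rho>' q)) (w q) = 0" using g0 by simp
          then have "symb B (grad (\<rho>' q)) (w q) \<bullet> c = 0" by simp
          then show ?thesis unfolding symb_def Lca comp_field_def inner_vec_def by (simp add: inner_sum_left mult.commute)
        qed
      qed
      also have "\<dots> \<le> C2 * lint (\<lambda>x. \<Lambda>\<^sup>2 * (indicator \<Omega> x * (?n * (norm (w x) * norm (jac_vec (Dw x))) + (norm (w x))\<^sup>2)))"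
      proof (intro mult_left_mono integral_mono bdd_supp_integrable bdd_supp_cmult bm C2)
        show "bdd_supp (\<lambda>x. indicator \<Omega> x * (norm (Lc c (w x)) * norm (Lc c o\<^sub>L Dw x) + (norm (Lc c (w x)))\<^sup>2))"
          by (rule bdd_supp\<Omega>) (auto intro!: continuous_intros cw bounded_linear.continuous_on[OF blinfun.bounded_linear_right] simp: blinfun.zero_right)
        fix x
        have 1: "norm (Lc c (w x)) \<le> \<Lambda> * norm (w x)"
          using norm_blinfun[of "Lc c" "w x"] mult_right_mono[OF Lcn[OF c], of "norm (w x)"] by simp
        have "norm (Lc c o\<^sub>L Dw x) \<le> \<Lambda> * norm (Dw x)"
          using norm_blinfun_compose[of "Lc c" "Dw x"] mult_right_mono[OF Lcn[OF c], of "norm (Dw x)"] by simp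
        also have "\<dots> \<le> \<Lambda> * (?n * norm (jac_vec (Dw x)))" using \<Lambda>0 by (intro mult_left_mono norm_blinfun_le_jac_vec) auto
        finally have 2: "norm (Lc c o\<^sub>L Dw x) \<le> \<Lambda> * (?n * norm (jac_vec (Dw x)))" .
        have "norm (Lc c (w x)) * norm (Lc c o\<^sub>L Dw x) \<le> (\<Lambda> * norm (w x)) * (\<Lambda> * (?n * norm (jac_vec (Dw x))))"
          using 1 2 \<Lambda>0 by (intro mult_mono) auto
        moreover have "(norm (Lc c (w x)))\<^sup>2 \<le> (\<Lambda> * norm (w x))\<^sup>2" using 1 by (intro power_mono) auto
        ultimately have "norm (Lc c (w x)) * norm (Lc c o\<^sub>L Dw x) + (norm (Lc c (w x)))\<^sup>2 \<le> \<Lambda>\<^sup>2 * (?n * (norm (w x) * norm (jac_vec (Dw x))) + (norm (w x))\<^sup>2)"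
          by (simp add: power2_eq_square algebra_simps)
        then show "indicator \<Omega> x * (norm (Lc c (w x)) * norm (Lc c o\<^sub>L Dw x) + (norm (Lc c (w x)))\<^sup>2) \<le> \<Lambda>\<^sup>2 * (indicator \<Omega> x * (?n * (norm (w x) * norm (jac_vec (Dw x))) + (norm (w x))\<^sup>2))"
          by (simp add: indicator_def)
      qed
      also have "\<dots> = C2 * \<Lambda>\<^sup>2 * Im" unfolding Im_def by simp
      finally show ?thesis .
    qed
    have PE: "indicator \<Omega> x * (norm (P (jac_vec (Dw x))))\<^sup>2 = indicator \<Omega> x * ((norm (diffop A (Dw x)))\<^sup>2 + (norm (diffop B (Dw x)))\<^sup>2)
       + (\<Sum>c\<in>Basis. indicator \<Omega> x * null_lagrangian (Lc c o\<^sub>L Dw x))" for x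
      unfolding Psq energy_decomposition[OF lin] Lc_def by (simp add: sum_distrib_left distrib_left)
    have "lint (\<lambda>x. indicator \<Omega> x * (norm (P (jac_vec (Dw x))))\<^sup>2)
      = IA + (\<Sum>c\<in>Basis. lint (\<lambda>x. indicator \<Omega> x * null_lagrangian (Lc c o\<^sub>L Dw x)))"
      unfolding PE IA_def
      by (subst Bochner_Integration.integral_add[OF bdd_supp_integrable[OF bA] bdd_supp_integrable[OF bdd_supp_sum[OF bn]]], subst Bochner_Integration.integral_sum[OF bdd_supp_integrable[OF bn]]) simp
    also have "\<dots> \<le> IA + (\<Sum>c\<in>(Basis::'e set). C2 * \<Lambda>\<^sup>2 * Im)" by (intro add_left_mono sum_mono nl1)
    also have "\<dots> = IA + C3 * Im" unfolding C3_def by simp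
    finally have "IJ \<le> C1 * (IA + C3 * Im)"
      using korn[OF w supp] mult_left_mono[OF _ C1] unfolding IJ_def by fastforce
    also have "\<dots> = C1 * IA + C1 * C3 * Im" by (simp add: algebra_simps)
    also have "C1 * C3 * Im \<le> 1 / 2 * IJ + (1 / 2 * (C1 * C3 * ?n)\<^sup>2 + C1 * C3) * Iw"
    proof -
      have "C1 * C3 * Im = lint (\<lambda>x. C1 * C3 * (indicator \<Omega> x * (?n * (norm (w x) * norm (jac_vec (Dw x))) + (norm (w x))\<^sup>2)))"
        unfolding Im_def by simp
      also have "\<dots> \<le> lint (\<lambda>x. 1 / 2 * (indicator \<Omega> x * (norm (jac_vec (Dw x)))\<^sup>2) + (1 / 2 * (C1 * C3 * ?n)\<^sup>2 + C1 * C3) * (indicator \<Omega> x * (norm (w x))\<^sup>2))"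
      proof (intro integral_mono bdd_supp_integrable bdd_supp_add bdd_supp_cmult bm bJ bw)
        fix x
        define a where "a = norm (jac_vec (Dw x))"
        define d where "d = C1 * C3 * ?n * norm (w x)"
        have "d * a \<le> 1 / 2 * a\<^sup>2 + 1 / 2 * d\<^sup>2" using sum_squares_bound[of d a] by simp
        then have "C1 * C3 * (?n * (norm (w x) * a) + (norm (w x))\<^sup>2) \<le> 1 / 2 * a\<^sup>2 + (1 / 2 * (C1 * C3 * ?n)\<^sup>2 + C1 * C3) * (norm (w x))\<^sup>2"
          unfolding d_def by (simp add: power_mult_distrib algebra_simps)
        then show "C1 * C3 * (indicator \<Omega> x * (?n * (norm (w x) * norm (jac_vec (Dw x))) + (norm (w x))\<^sup>2))
           \<le> 1 / 2 * (indicator \<Omega> x * (norm (jac_vec (Dw x)))\<^sup>2) + (1 / 2 * (C1 * C3 * ?n)\<^sup>2 + C1 * C3) * (indicator \<Omega> x * (norm (w x))\<^sup>2)"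
          unfolding a_def by (simp add: indicator_def)
      qed
      also have "\<dots> = 1 / 2 * IJ + (1 / 2 * (C1 * C3 * ?n)\<^sup>2 + C1 * C3) * Iw"
        unfolding IJ_def Iw_def using bdd_supp_integrable[OF bdd_supp_cmult[OF bJ, of "1/2"]] bdd_supp_integrable[OF bdd_supp_cmult[OF bw, of "1 / 2 * (C1 * C3 * ?n)\<^sup>2 + C1 * C3"]]
        by (subst Bochner_Integration.integral_add) (simp_all only: integral_mult_right_zero)
      finally show ?thesis .
    qed
    finally have main: "IJ \<le> 2 * C1 * IA + ((C1 * C3 * ?n)\<^sup>2 + 2 * C1 * C3) * Iw" by (simp add: algebra_simps)
    have IA0: "0 \<le> IA" "0 \<le> Iw" unfolding IA_def Iw_def by (auto intro!: integral_nonneg_AE AE_I2)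
    have "2 * C1 * IA \<le> C * IA" "((C1 * C3 * ?n)\<^sup>2 + 2 * C1 * C3) * Iw \<le> C * Iw"
      unfolding C_def using IA0 C1 C30 by (intro mult_right_mono; simp)+
    then have "IJ \<le> C * (IA + Iw)" using main by (simp add: algebra_simps)
    also have "IA + Iw = lint (\<lambda>x. indicator \<Omega> x * ((norm (diffop A (Dw x)))\<^sup>2 + (norm (diffop B (Dw x)))\<^sup>2 + (norm (w x))\<^sup>2))"
      unfolding IA_def Iw_def distrib_left[of "indicator \<Omega> _" "_ + _" "(norm (w _))\<^sup>2"]
      by (rule Bochner_Integration.integral_add[symmetric]) (intro bdd_supp_integrable bA bw)+
    finally show "lint (\<lambda>x. indicator \<Omega> x * (norm (jac_vec (Dw x)))\<^sup>2)
      \<le> C * lint (\<lambda>x. indicator \<Omega> x * ((norm (diffop A (Dw x)))\<^sup>2 + (norm (diffop B (Dw x)))\<^sup>2 + (norm (w x))\<^sup>2))"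
      unfolding IJ_def .
  qed
qed

section \<open>Cutoff functions and gluing of the local estimates\<close>

definition bump :: "real^'n::finite \<Rightarrow> real \<Rightarrow> real^'n \<Rightarrow> real" where
  "bump p r x = max 0 (r\<^sup>2 - (x - p) \<bullet> (x - p)) ^ Suc (Suc 0)"

definition bump_grad :: "real^'n::finite \<Rightarrow> real \<Rightarrow> real^'n \<Rightarrow> real^'n" where
  "bump_grad p r x = (- 4 * max 0 (r\<^sup>2 - (x - p) \<bullet> (x - p))) *\<^sub>R (x - p)"

lemma bump_deriv: "(bump p r has_derivative (\<lambda>h. bump_grad p r x \<bullet> h)) (at x)"
proof -
  have 1: "((\<lambda>x. r\<^sup>2 - (x - p) \<bullet> (x - p)) has_derivative (\<lambda>h. - 2 * ((x - p) \<bullet> h))) (at x)"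
    by (auto intro!: derivative_eq_intros simp: inner_commute algebra_simps)
  have 2: "((\<lambda>t::real. max 0 t ^ Suc (Suc 0)) has_derivative (\<lambda>h. h * (2 * max 0 (r\<^sup>2 - (x - p) \<bullet> (x - p))))) (at (r\<^sup>2 - (x - p) \<bullet> (x - p)))"
  proof -
    have e: "(\<lambda>h. h * (2 * max 0 (r\<^sup>2 - (x - p) \<bullet> (x - p)))) = (*) (2 * max 0 (r\<^sup>2 - (x - p) \<bullet> (x - p)))"
      by (auto simp: fun_eq_iff)
    show ?thesis unfolding e
      using DERIV_pos_part_power[of 0 "r\<^sup>2 - (x - p) \<bullet> (x - p)"] unfolding has_field_derivative_def by simp
  qed
  have "((\<lambda>x. max 0 (r\<^sup>2 - (x - p) \<bullet> (x - p)) ^ Suc (Suc 0)) has_derivative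
      (\<lambda>h. - 2 * ((x - p) \<bullet> h) * (2 * max 0 (r\<^sup>2 - (x - p) \<bullet> (x - p))))) (at x)"
    by (rule has_derivative_compose[OF 1 2])
  moreover have "(\<lambda>h. - 2 * ((x - p) \<bullet> h) * (2 * max 0 (r\<^sup>2 - (x - p) \<bullet> (x - p)))) = (\<lambda>h. bump_grad p r x \<bullet> h)"
    unfolding bump_grad_def by (auto simp: fun_eq_iff)
  ultimately show ?thesis unfolding bump_def[abs_def] by simp
qed

lemma continuous_on_bump: "continuous_on S (bump p r)" "continuous_on S (bump_grad p r)"
  unfolding bump_def[abs_def] bump_grad_def[abs_def] by (intro continuous_intros)+

lemma bump_outside: assumes "x \<notin> cball p r" "r > 0" shows "bump p r x = 0" "bump_grad p r x = 0"
proof -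
  have "r < norm (x - p)" using assms by (simp add: dist_norm norm_minus_commute)
  then have "r\<^sup>2 \<le> (norm (x - p))\<^sup>2" using assms(2) by (intro power_mono) auto
  then have "max 0 (r\<^sup>2 - (x - p) \<bullet> (x - p)) = 0" by (simp add: power2_norm_eq_inner)
  then show "bump p r x = 0" "bump_grad p r x = 0" unfolding bump_def bump_grad_def by simp_all
qed

lemma bump_pos: assumes "x \<in> ball p r" shows "bump p r x > 0"
proof -
  have "norm (x - p) < r" using assms by (simp add: dist_norm norm_minus_commute)
  then have "(norm (x - p))\<^sup>2 < r\<^sup>2" by (intro power_strict_mono) auto
  then have "max 0 (r\<^sup>2 - (x - p) \<bullet> (x - p)) > 0" by (simp add: power2_norm_eq_inner)
  then show ?thesis unfolding bump_def by simp
qed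

definition energy :: "('n::finite \<Rightarrow> 'f \<Rightarrow> 'g::real_normed_vector) \<Rightarrow> ('n \<Rightarrow> 'f \<Rightarrow> 'e::real_normed_vector)
    \<Rightarrow> 'f::real_normed_vector \<Rightarrow> ((real^'n) \<Rightarrow>\<^sub>L 'f) \<Rightarrow> real" where
  "energy A B v L = (norm (diffop A L))\<^sup>2 + (norm (diffop B L))\<^sup>2 + (norm v)\<^sup>2"

lemma bdd_supp_bounded_domain:
  fixes f :: "'a::euclidean_space \<Rightarrow> real"
  assumes "open \<Omega>" "bounded \<Omega>" "continuous_on (closure \<Omega>) f"
  shows "bdd_supp (\<lambda>x. indicator \<Omega> x * f x)"
  using bdd_supp_closure_cut[OF assms(1,3), of "closure \<Omega>"] assms(2) by (simp add: compact_closure)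

lemma integral_bounded_domain:
  fixes f :: "'a::euclidean_space \<Rightarrow> real"
  assumes "open \<Omega>" "bounded \<Omega>" "continuous_on (closure \<Omega>) f"
  shows "integral \<Omega> f = lint (\<lambda>x. indicator \<Omega> x * f x)"
proof -
  have "set_integrable lborel \<Omega> f" unfolding set_integrable_def using bdd_supp_integrable[OF bdd_supp_bounded_domain[OF assms]] by simp
  from set_borel_integral_eq_integral(2)[OF this] show ?thesis unfolding set_lebesgue_integral_def by simp
qed

lemma continuous_on_diffop:
  fixes A :: "'n::finite \<Rightarrow> 'f::euclidean_space \<Rightarrow> 'g::euclidean_space"
  assumes "\<And>j. linear (A j)" "continuous_on S D" shows "continuous_on S (\<lambda>x. diffop A (D x))"
  unfolding diffop_def
  by (intro continuous_on_sum bounded_linear.continuous_on[OF linear_conv_bounded_linear[THEN iffD1, OF assms(1)]] continuous_on_blinfun_eval assms(2))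

lemma bilinear_symb:
  fixes A :: "'n::finite \<Rightarrow> 'f::euclidean_space \<Rightarrow> 'g::euclidean_space"
  assumes "\<And>j. linear (A j)" shows "bilinear (symb A)"
  unfolding bilinear_def symb_def
  by (auto intro!: linearI simp: linear_add[OF assms] linear_scale[OF assms] scaleR_add_left scaleR_add_right sum.distrib scaleR_sum_right mult.commute)

lemma power2_add_le: "norm (a + b) ^ 2 \<le> 2 * norm a ^ 2 + 2 * norm b ^ 2" for a b :: "'a::real_normed_vector"
proof -
  have "norm (a + b) ^ 2 \<le> (norm a + norm b) ^ 2" by (intro power_mono norm_triangle_ineq) simp
  also have "\<dots> \<le> 2 * norm a ^ 2 + 2 * norm b ^ 2" using sum_squares_bound[of "norm a" "norm b"] by (simp add: power2_sum)
  finally show ?thesis .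
qed

lemma three_term_bound:
  fixes x y z a b c \<nu> \<alpha> \<beta> :: real
  assumes "x \<le> 2 * (\<nu> * a) + 2 * (\<alpha> * c)" "y \<le> 2 * (\<nu> * b) + 2 * (\<beta> * c)" "z \<le> \<nu> * c"
    and nn: "0 \<le> \<nu>" "0 \<le> \<alpha>" "0 \<le> \<beta>" "0 \<le> a" "0 \<le> b" "0 \<le> c"
  shows "x + y + z \<le> (2 * \<nu> + 2 * \<alpha> + 2 * \<beta>) * (a + b + c)"
proof -
  have "0 \<le> \<nu> * c" "0 \<le> \<alpha> * a" "0 \<le> \<alpha> * b" "0 \<le> \<beta> * a" "0 \<le> \<beta> * b" using nn by simp_all
  then show ?thesis using assms(1-3) unfolding distrib_left distrib_right by linarith
qed

text \<open>Multiplying u by the bump preserves the boundary condition, which is pointwise linear in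
  u, and changes each first-order expression by a zero-order term bounded by |u|. The local estimate
  for the product is thus an estimate for the Jacobian of u with the squared bump as weight.\<close>

lemma weighted_coercive:
  fixes A :: "'n::finite \<Rightarrow> 'f::euclidean_space \<Rightarrow> 'g::euclidean_space"
    and B :: "'n \<Rightarrow> 'f \<Rightarrow> 'e::euclidean_space"
    and \<Omega> :: "(real^'n) set"
  assumes lin: "\<And>j. linear (A j)" "\<And>j. linear (B j)"
    and psd: "psd_map (Mmap A B)" and ell: "C_elliptic_DM A B"
    and Om: "open \<Omega>" "bounded \<Omega>" and ldf: "local_defining_fun \<Omega> p U \<rho> \<rho>'"
  shows "\<exists>r G. r > 0 \<and> G \<ge> 0 \<and> (\<forall>u Du. C1_closure \<Omega> u Du \<longrightarrow>
      (\<forall>x \<nu>. outward_normal \<Omega> x \<nu> \<longrightarrow> symb B \<nu> (u x) = 0) \<longrightarrow>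
      lint (\<lambda>x. indicator \<Omega> x * ((bump p r x)\<^sup>2 * (norm (jac_vec (Du x)))\<^sup>2))
      \<le> G * lint (\<lambda>x. indicator \<Omega> x * energy A B (u x) (Du x)))"
proof -
  obtain r C where rC: "r > 0 \<and> C \<ge> 0 \<and> (\<forall>w Dw. C1_closure \<Omega> w Dw \<longrightarrow> (\<forall>x\<in>closure \<Omega>. x \<notin> cball p r \<longrightarrow> w x = 0 \<and> Dw x = 0) \<longrightarrow>
      (\<forall>x \<nu>. outward_normal \<Omega> x \<nu> \<longrightarrow> symb B \<nu> (w x) = 0) \<longrightarrow>
      lint (\<lambda>x. indicator \<Omega> x * (norm (jac_vec (Dw x)))\<^sup>2)
      \<le> C * lint (\<lambda>x. indicator \<Omega> x * energy A B (w x) (Dw x)))"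
    using local_coercive[OF lin psd ell Om(1) ldf, folded energy_def] by - (erule exE, erule exE, rule that)
  then have r: "r > 0" and C: "C \<ge> 0" by simp_all
  note loc = rC[THEN conjunct2, THEN conjunct2, THEN spec, THEN spec, THEN mp, THEN mp, THEN mp]
  have com: "compact (closure \<Omega>)" using Om(2) by (simp add: compact_closure)
  define b where "b = bump p r"
  define \<beta> where "\<beta> = bump_grad p r"
  obtain N where N: "N > 0" "\<And>x. x \<in> closure \<Omega> \<Longrightarrow> norm (b x) \<le> N" unfolding b_def
    using compact_bound[OF com continuous_on_bump(1)] by blast
  obtain M where M: "M > 0" "\<And>x. x \<in> closure \<Omega> \<Longrightarrow> norm (\<beta> x) \<le> M" unfolding \<beta>_def
    using compact_bound[OF com continuous_on_bump(2)] by blast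
  obtain KA where KA: "KA > 0" "\<And>\<xi> v. norm (symb A \<xi> v) \<le> KA * norm \<xi> * norm v" by (fact bilinear_pos_bound[OF bilinear_symb[OF lin(1)]])
  obtain KB where KB: "KB > 0" "\<And>\<xi> v. norm (symb B \<xi> v) \<le> KB * norm \<xi> * norm v" by (fact bilinear_pos_bound[OF bilinear_symb[OF lin(2)]])
  \<comment> \<open>The product rule and |a + b|^2 \<le> 2 |a|^2 + 2 |b|^2, with N and M bounding
    the bump and its gradient. In G the same splitting of the Jacobian gives the factor 2 and the
    term 2 M^2.\<close>
  define H where "H = 2 * N\<^sup>2 + 2 * (KA * M)\<^sup>2 + 2 * (KB * M)\<^sup>2"
  define G where "G = 2 * (C * H) + 2 * M\<^sup>2"
  have H0: "H \<ge> 0" unfolding H_def by simp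
  have G0: "G \<ge> 0" unfolding G_def using C H0 by simp
  show ?thesis
  proof (rule exI[of _ r], rule exI[of _ G], intro conjI allI impI)
    show "0 < r" "0 \<le> G" by (rule r, rule G0)
    fix u :: "real^'n \<Rightarrow> 'f" and Du
    assume u: "C1_closure \<Omega> u Du" and bc: "\<forall>x \<nu>. outward_normal \<Omega> x \<nu> \<longrightarrow> symb B \<nu> (u x) = 0"
    have cu: "continuous_on (closure \<Omega>) u" "continuous_on (closure \<Omega>) Du"
      and du: "\<And>x. x \<in> \<Omega> \<Longrightarrow> (u has_derivative blinfun_apply (Du x)) (at x)" using u unfolding C1_closure_def by auto
    have incl: "\<Omega> \<subseteq> closure \<Omega>" by (rule closure_subset)
    define w where "w x = b x *\<^sub>R u x" for x
    define Dw where "Dw x = b x *\<^sub>R Du x + (blinfun_scaleR_left (u x) o\<^sub>L blinfun_inner_right (\<beta> x))" for x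
    have Dwa: "Dw x h = b x *\<^sub>R Du x h + (\<beta> x \<bullet> h) *\<^sub>R u x" for x h
      unfolding Dw_def by (simp add: blinfun.add_left blinfun.scaleR_left)
    have cb: "continuous_on (closure \<Omega>) b" "continuous_on (closure \<Omega>) \<beta>" unfolding b_def \<beta>_def by (rule continuous_on_bump)+
    have cw: "continuous_on (closure \<Omega>) w" "continuous_on (closure \<Omega>) Dw"
      unfolding w_def Dw_def
      by (intro continuous_intros cb cu bounded_linear.continuous_on[OF bounded_linear_blinfun_scaleR_left] bounded_linear.continuous_on[OF bounded_linear_blinfun_inner_right])+
    have w: "C1_closure \<Omega> w Dw" unfolding C1_closure_def
    proof (intro conjI ballI cw)
      fix x assume x: "x \<in> \<Omega>"
      have "blinfun_apply (Dw x) = (\<lambda>h. b x *\<^sub>R Du x h + (\<beta> x \<bullet> h) *\<^sub>R u x)" by (simp add: fun_eq_iff Dwa)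
      then show "(w has_derivative blinfun_apply (Dw x)) (at x)"
        unfolding w_def b_def \<beta>_def using has_derivative_scaleR[OF bump_deriv du[OF x], of p r] by simp
    qed
    have wsupp: "\<forall>x\<in>closure \<Omega>. x \<notin> cball p r \<longrightarrow> w x = 0 \<and> Dw x = 0"
    proof (intro ballI impI)
      fix x assume "x \<notin> cball p r"
      then have "b x = 0" "\<beta> x = 0" unfolding b_def \<beta>_def using bump_outside[OF _ r] by auto
      then show "w x = 0 \<and> Dw x = 0" by (auto simp: w_def intro: blinfun_eqI simp: Dwa)
    qed
    have wbc: "\<forall>x \<nu>. outward_normal \<Omega> x \<nu> \<longrightarrow> symb B \<nu> (w x) = 0"
    proof (intro allI impI)
      fix x \<nu> assume "outward_normal \<Omega> x \<nu>"
      then have "symb B \<nu> (u x) = 0" using bc by blast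
      moreover have "linear (symb B \<nu>)" using bilinear_symb[of B, OF lin(2)] unfolding bilinear_def by blast
      ultimately show "symb B \<nu> (w x) = 0" unfolding w_def by (simp add: linear_scale)
    qed
    have jw: "b x *\<^sub>R jac_vec (Du x) = jac_vec (Dw x) + (- tensor (u x) (\<beta> x))" for x
      by (simp add: jac_vec_def tensor_def vec_eq_iff Dwa inner_axis)
    have nt: "(norm (tensor (u x) (\<beta> x)))\<^sup>2 = (norm (u x))\<^sup>2 * (norm (\<beta> x))\<^sup>2" for x
      unfolding power2_norm_eq_inner inner_tensor ..
    have dA: "diffop A (Dw x) = b x *\<^sub>R diffop A (Du x) + symb A (\<beta> x) (u x)" for x
      unfolding diffop_def symb_def Dwa by (simp add: linear_add[OF lin(1)] linear_scale[OF lin(1)] sum.distrib scaleR_sum_right inner_axis)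
    have dB: "diffop B (Dw x) = b x *\<^sub>R diffop B (Du x) + symb B (\<beta> x) (u x)" for x
      unfolding diffop_def symb_def Dwa by (simp add: linear_add[OF lin(2)] linear_scale[OF lin(2)] sum.distrib scaleR_sum_right inner_axis)
    note bd = bdd_supp_bounded_domain[OF Om]
    have cj: "continuous_on (closure \<Omega>) (\<lambda>x. jac_vec (D x))" if "continuous_on (closure \<Omega>) D" for D :: "real^'n \<Rightarrow> (real^'n) \<Rightarrow>\<^sub>L 'f"
      unfolding jac_vec_def by (intro continuous_on_vec_lambda continuous_on_blinfun_eval that)
    have ce: "continuous_on (closure \<Omega>) (\<lambda>x. energy A B (v x) (D x))" if "continuous_on (closure \<Omega>) v" "continuous_on (closure \<Omega>) D"
      for v and D :: "real^'n \<Rightarrow> (real^'n) \<Rightarrow>\<^sub>L 'f"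
      unfolding energy_def by (intro continuous_intros continuous_on_diffop lin that)
    have be: "bdd_supp (\<lambda>x. indicator \<Omega> x * energy A B (u x) (Du x))" by (rule bd[OF ce[OF cu]])
    have bew: "bdd_supp (\<lambda>x. indicator \<Omega> x * energy A B (w x) (Dw x))" by (rule bd[OF ce[OF cw]])
    have bjw: "bdd_supp (\<lambda>x. indicator \<Omega> x * (norm (jac_vec (Dw x)))\<^sup>2)" by (rule bd) (intro continuous_intros cj cw)
    have bju: "bdd_supp (\<lambda>x. indicator \<Omega> x * ((b x)\<^sup>2 * (norm (jac_vec (Du x)))\<^sup>2))" by (rule bd) (intro continuous_intros cj cu cb)
    define I where "I = lint (\<lambda>x. indicator \<Omega> x * energy A B (u x) (Du x))"
    define Jw where "Jw = lint (\<lambda>x. indicator \<Omega> x * (norm (jac_vec (Dw x)))\<^sup>2)"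
    have "lint (\<lambda>x. indicator \<Omega> x * energy A B (w x) (Dw x)) \<le> lint (\<lambda>x. H * (indicator \<Omega> x * energy A B (u x) (Du x)))"
    proof (intro integral_mono bdd_supp_integrable bdd_supp_cmult be bew)
      fix x
      show "indicator \<Omega> x * energy A B (w x) (Dw x) \<le> H * (indicator \<Omega> x * energy A B (u x) (Du x))"
      proof (cases "x \<in> \<Omega>")
        case True
        then have xc: "x \<in> closure \<Omega>" using incl by blast
        have b2: "(b x)\<^sup>2 \<le> N\<^sup>2" using power_mono[OF N(2)[OF xc], of 2] by simp
        have sA: "(norm (symb A (\<beta> x) (u x)))\<^sup>2 \<le> (KA * M)\<^sup>2 * (norm (u x))\<^sup>2"
        proof -
          have "norm (symb A (\<beta> x) (u x)) \<le> KA * M * norm (u x)"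
            using KA(2)[of "\<beta> x" "u x"] M(2)[OF xc] KA(1) by (meson mult_left_mono mult_right_mono norm_ge_zero less_imp_le order_trans)
          then have "(norm (symb A (\<beta> x) (u x)))\<^sup>2 \<le> (KA * M * norm (u x))\<^sup>2" by (rule power_mono) simp
          then show ?thesis by (simp add: power_mult_distrib)
        qed
        have sB: "(norm (symb B (\<beta> x) (u x)))\<^sup>2 \<le> (KB * M)\<^sup>2 * (norm (u x))\<^sup>2"
        proof -
          have "norm (symb B (\<beta> x) (u x)) \<le> KB * M * norm (u x)"
            using KB(2)[of "\<beta> x" "u x"] M(2)[OF xc] KB(1) by (meson mult_left_mono mult_right_mono norm_ge_zero less_imp_le order_trans)
          then have "(norm (symb B (\<beta> x) (u x)))\<^sup>2 \<le> (KB * M * norm (u x))\<^sup>2" by (rule power_mono) simp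
          then show ?thesis by (simp add: power_mult_distrib)
        qed
        have 1: "(norm (diffop A (Dw x)))\<^sup>2 \<le> 2 * (N\<^sup>2 * (norm (diffop A (Du x)))\<^sup>2) + 2 * ((KA * M)\<^sup>2 * (norm (u x))\<^sup>2)"
          unfolding dA using power2_add_le[of "b x *\<^sub>R diffop A (Du x)" "symb A (\<beta> x) (u x)"] sA mult_right_mono[OF b2, of "(norm (diffop A (Du x)))\<^sup>2"]
          by (simp add: power_mult_distrib)
        have 2: "(norm (diffop B (Dw x)))\<^sup>2 \<le> 2 * (N\<^sup>2 * (norm (diffop B (Du x)))\<^sup>2) + 2 * ((KB * M)\<^sup>2 * (norm (u x))\<^sup>2)"
          unfolding dB using power2_add_le[of "b x *\<^sub>R diffop B (Du x)" "symb B (\<beta> x) (u x)"] sB mult_right_mono[OF b2, of "(norm (diffop B (Du x)))\<^sup>2"]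
          by (simp add: power_mult_distrib)
        have 3: "(norm (w x))\<^sup>2 \<le> N\<^sup>2 * (norm (u x))\<^sup>2"
          unfolding w_def using mult_right_mono[OF b2, of "(norm (u x))\<^sup>2"] by (simp add: power_mult_distrib)
        have "energy A B (w x) (Dw x) \<le> H * energy A B (u x) (Du x)"
          unfolding energy_def H_def by (rule three_term_bound[OF 1 2 3]) simp_all
        then show ?thesis using True by simp
      qed simp
    qed
    then have "lint (\<lambda>x. indicator \<Omega> x * energy A B (w x) (Dw x)) \<le> H * I" unfolding I_def by simp
    from mult_left_mono[OF this C] loc[OF w wsupp wbc] have Jw: "Jw \<le> C * (H * I)" unfolding Jw_def by linarith
    have "lint (\<lambda>x. indicator \<Omega> x * ((b x)\<^sup>2 * (norm (jac_vec (Du x)))\<^sup>2))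
       \<le> lint (\<lambda>x. 2 * (indicator \<Omega> x * (norm (jac_vec (Dw x)))\<^sup>2) + 2 * M\<^sup>2 * (indicator \<Omega> x * energy A B (u x) (Du x)))"
    proof (intro integral_mono bdd_supp_integrable bdd_supp_add bdd_supp_cmult be bjw bju)
      fix x
      show "indicator \<Omega> x * ((b x)\<^sup>2 * (norm (jac_vec (Du x)))\<^sup>2) \<le> 2 * (indicator \<Omega> x * (norm (jac_vec (Dw x)))\<^sup>2) + 2 * M\<^sup>2 * (indicator \<Omega> x * energy A B (u x) (Du x))"
      proof (cases "x \<in> \<Omega>")
        case True
        then have xc: "x \<in> closure \<Omega>" using incl by blast
        have "(b x)\<^sup>2 * (norm (jac_vec (Du x)))\<^sup>2 = (norm (b x *\<^sub>R jac_vec (Du x)))\<^sup>2" by (simp add: power_mult_distrib)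
        also have "\<dots> \<le> 2 * (norm (jac_vec (Dw x)))\<^sup>2 + 2 * ((norm (u x))\<^sup>2 * (norm (\<beta> x))\<^sup>2)"
          unfolding jw using power2_add_le[of "jac_vec (Dw x)" "- tensor (u x) (\<beta> x)"] by (simp add: nt)
        also have "(norm (u x))\<^sup>2 * (norm (\<beta> x))\<^sup>2 \<le> energy A B (u x) (Du x) * M\<^sup>2"
          using power_mono[OF M(2)[OF xc], of 2] unfolding energy_def by (intro mult_mono) auto
        finally show ?thesis using True by (simp add: ac_simps)
      qed simp
    qed
    also have "\<dots> = 2 * Jw + 2 * M\<^sup>2 * I" unfolding Jw_def I_def using bdd_supp_integrable[OF be] bdd_supp_integrable[OF bjw] by simp
    also have "\<dots> \<le> G * I" using Jw unfolding G_def by (simp add: algebra_simps)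
    finally show "lint (\<lambda>x. indicator \<Omega> x * ((bump p r x)\<^sup>2 * (norm (jac_vec (Du x)))\<^sup>2))
      \<le> G * lint (\<lambda>x. indicator \<Omega> x * energy A B (u x) (Du x))" unfolding I_def b_def .
  qed
qed

text \<open>The half-space beyond a hyperplane touching a small ball inside \<Omega> does not meet
  that ball, so an affine function serves as \<rho>. This lets one local estimate cover interior and
  boundary points alike.\<close>

lemma interior_defining_fun:
  fixes \<Omega> :: "(real^'n::finite) set"
  assumes "open \<Omega>" "p \<in> \<Omega>"
  shows "\<exists>U \<rho> \<rho>'. local_defining_fun \<Omega> p U \<rho> \<rho>'"
proof -
  obtain e where e: "e > 0" "ball p e \<subseteq> \<Omega>" using assms open_contains_ball by blast
  define k :: 'n where "k = undefined"
  define L where "L = blinfun_inner_right (axis k 1 :: real^'n)"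
  define \<rho> where "\<rho> x = x $ k - p $ k - e" for x :: "real^'n"
  have La: "L h = h $ k" for h unfolding L_def by (simp add: inner_axis')
  have "C2_on (ball p e) \<rho> (\<lambda>x. L) (\<lambda>x. 0)" unfolding C2_on_def
  proof (intro conjI ballI)
    fix y
    have "blinfun_apply L = (\<lambda>h. h $ k)" by (simp add: fun_eq_iff La)
    then show "(\<rho> has_derivative blinfun_apply L) (at y)" unfolding \<rho>_def
      by (auto intro!: derivative_eq_intros bounded_linear.has_derivative[OF bounded_linear_vec_nth])
    show "((\<lambda>x. L) has_derivative blinfun_apply 0) (at y)" by (simp add: zero_blinfun.rep_eq)
  qed simp
  moreover have "L \<noteq> 0"
  proof
    assume "L = 0"
    then have "L (axis k 1) = 0" by simp
    then show False by (simp add: La)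
  qed
  moreover have "\<Omega> \<inter> ball p e = {y\<in>ball p e. \<rho> y < 0}"
  proof -
    have "\<rho> y < 0" if "y \<in> ball p e" for y
      using component_le_norm_cart[of "y - p" k] that unfolding \<rho>_def by (simp add: dist_norm norm_minus_commute)
    then show ?thesis using e(2) by blast
  qed
  ultimately have "local_defining_fun \<Omega> p (ball p e) \<rho> (\<lambda>x. L)" unfolding local_defining_fun_def using e(1) by auto
  then show ?thesis by blast
qed

text \<open>Finitely many balls cover the compact closure, so the sum of the squared bumps has a
  positive minimum m there. Summing the weighted estimates and dividing by m takes the place of a
  partition of unity.\<close>

theorem theorem1:
  fixes A :: "'n::finite \<Rightarrow> 'f::euclidean_space \<Rightarrow> 'g::euclidean_space"
    and B :: "'n \<Rightarrow> 'f \<Rightarrow> 'e::euclidean_space"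
    and \<Omega> :: "(real^'n) set"
  assumes "\<And>j. linear (A j)" and "\<And>j. linear (B j)"
    and "psd_map (Mmap A B)"
    and "C_elliptic_DM A B"
    and "bounded \<Omega>" and "C2_domain \<Omega>"
  shows "\<exists>C. \<forall>u Du. C1_closure \<Omega> u Du \<longrightarrow>
           (\<forall>x \<nu>. outward_normal \<Omega> x \<nu> \<longrightarrow> symb B \<nu> (u x) = 0) \<longrightarrow>
           W12_norm_sq \<Omega> u Du \<le> C * integral \<Omega> (\<lambda>x. (norm (diffop A (Du x)))\<^sup>2
               + (norm (diffop B (Du x)))\<^sup>2 + (norm (u x))\<^sup>2)"
proof (cases "\<Omega> = {}")
  \<comment> \<open>The empty domain is treated apart because a minimum over the closure is taken in
    the other case.\<close>
  case True
  then show ?thesis by (simp add: W12_norm_sq_def)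
next
  case ne: False
  have Om: "open \<Omega>" using assms(6) unfolding C2_domain_def by blast
  have com: "compact (closure \<Omega>)" using assms(5) by (simp add: compact_closure)
  define good where "good p r G \<longleftrightarrow> r > 0 \<and> G \<ge> 0 \<and> (\<forall>u Du. C1_closure \<Omega> u Du \<longrightarrow>
      (\<forall>x \<nu>. outward_normal \<Omega> x \<nu> \<longrightarrow> symb B \<nu> (u x) = 0) \<longrightarrow>
      lint (\<lambda>x. indicator \<Omega> x * ((bump p r x)\<^sup>2 * (norm (jac_vec (Du x)))\<^sup>2))
      \<le> G * lint (\<lambda>x. indicator \<Omega> x * energy A B (u x) (Du x)))" for p r G
  have "\<exists>r G. good p r G" if p: "p \<in> closure \<Omega>" for p
  proof -
    have "\<exists>U \<rho> \<rho>'. local_defining_fun \<Omega> p U \<rho> \<rho>'"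
    proof (cases "p \<in> \<Omega>")
      case True then show ?thesis by (rule interior_defining_fun[OF Om])
    next
      case False
      then have "p \<in> frontier \<Omega>" using p Om by (simp add: frontier_def interior_open)
      then show ?thesis using assms(6) unfolding C2_domain_def by blast
    qed
    then show ?thesis unfolding good_def using weighted_coercive[OF assms(1-4) Om assms(5)] by blast
  qed
  then obtain r G where rG: "\<And>p. p \<in> closure \<Omega> \<Longrightarrow> good p (r p) (G p)" by metis
  have "closure \<Omega> \<subseteq> (\<Union>p\<in>closure \<Omega>. ball p (r p))"
    using rG unfolding good_def by fastforce
  then obtain F where F: "F \<subseteq> closure \<Omega>" "finite F" "closure \<Omega> \<subseteq> (\<Union>p\<in>F. ball p (r p))"
    using compactE_image[OF com, of "closure \<Omega>" "\<lambda>p. ball p (r p)"] by blast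
  define s where "s x = (\<Sum>p\<in>F. (bump p (r p) x)\<^sup>2)" for x
  have cs: "continuous_on (closure \<Omega>) s" unfolding s_def by (intro continuous_intros continuous_on_bump)
  have "closure \<Omega> \<noteq> {}" using ne by simp
  then obtain x0 where x0: "x0 \<in> closure \<Omega>" "\<And>x. x \<in> closure \<Omega> \<Longrightarrow> s x0 \<le> s x"
    using continuous_attains_inf[OF com _ cs] by blast
  define m where "m = s x0"
  have m: "m > 0"
  proof -
    obtain q where q: "q \<in> F" "x0 \<in> ball q (r q)" using F(3) x0(1) by blast
    have "0 < (bump q (r q) x0)\<^sup>2" using bump_pos[OF q(2)] by simp
    then show ?thesis unfolding m_def s_def using F(2) q(1) by (intro sum_pos2[of F q]) auto
  qed
  \<comment> \<open>The added 1 pays for the |u|^2 part of the Sobolev norm.\<close>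
  define C where "C = (\<Sum>p\<in>F. G p) / m + 1"
  show ?thesis
  proof (rule exI[of _ C], intro allI impI)
    fix u :: "real^'n \<Rightarrow> 'f" and Du
    assume u: "C1_closure \<Omega> u Du" and bc: "\<forall>x \<nu>. outward_normal \<Omega> x \<nu> \<longrightarrow> symb B \<nu> (u x) = 0"
    have cu: "continuous_on (closure \<Omega>) u" "continuous_on (closure \<Omega>) Du" using u unfolding C1_closure_def by auto
    have cj: "continuous_on (closure \<Omega>) (\<lambda>x. jac_vec (Du x))"
      unfolding jac_vec_def by (intro continuous_on_vec_lambda continuous_on_blinfun_eval cu)
    have ce: "continuous_on (closure \<Omega>) (\<lambda>x. energy A B (u x) (Du x))"
      unfolding energy_def by (intro continuous_intros continuous_on_diffop assms(1,2) cu)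
    note bd = bdd_supp_bounded_domain[OF Om assms(5)]
    define I where "I = lint (\<lambda>x. indicator \<Omega> x * energy A B (u x) (Du x))"
    define J where "J = lint (\<lambda>x. indicator \<Omega> x * (norm (jac_vec (Du x)))\<^sup>2)"
    have be: "bdd_supp (\<lambda>x. indicator \<Omega> x * energy A B (u x) (Du x))" by (rule bd[OF ce])
    have bj: "bdd_supp (\<lambda>x. indicator \<Omega> x * (norm (jac_vec (Du x)))\<^sup>2)" by (rule bd) (intro continuous_intros cj)
    have bu: "bdd_supp (\<lambda>x. indicator \<Omega> x * (norm (u x))\<^sup>2)" by (rule bd) (intro continuous_intros cu)
    have bb: "bdd_supp (\<lambda>x. indicator \<Omega> x * ((bump p (r p) x)\<^sup>2 * (norm (jac_vec (Du x)))\<^sup>2))" for p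
      by (rule bd) (intro continuous_intros continuous_on_bump cj)
    have "m * J = lint (\<lambda>x. m * (indicator \<Omega> x * (norm (jac_vec (Du x)))\<^sup>2))" unfolding J_def by simp
    also have "\<dots> \<le> lint (\<lambda>x. \<Sum>p\<in>F. indicator \<Omega> x * ((bump p (r p) x)\<^sup>2 * (norm (jac_vec (Du x)))\<^sup>2))"
    proof (intro integral_mono bdd_supp_integrable bdd_supp_cmult bdd_supp_sum bj bb)
      fix x
      show "m * (indicator \<Omega> x * (norm (jac_vec (Du x)))\<^sup>2) \<le> (\<Sum>p\<in>F. indicator \<Omega> x * ((bump p (r p) x)\<^sup>2 * (norm (jac_vec (Du x)))\<^sup>2))"
      proof (cases "x \<in> \<Omega>")
        case True
        then have "m \<le> s x" unfolding m_def using x0(2) closure_subset by blast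
        from mult_right_mono[OF this, of "(norm (jac_vec (Du x)))\<^sup>2"] show ?thesis using True unfolding s_def by (simp add: sum_distrib_right)
      qed simp
    qed
    also have "\<dots> = (\<Sum>p\<in>F. lint (\<lambda>x. indicator \<Omega> x * ((bump p (r p) x)\<^sup>2 * (norm (jac_vec (Du x)))\<^sup>2)))"
      by (rule Bochner_Integration.integral_sum) (rule bdd_supp_integrable[OF bb])
    also have "\<dots> \<le> (\<Sum>p\<in>F. G p * I)"
    proof (rule sum_mono)
      fix p assume "p \<in> F"
      then have "good p (r p) (G p)" using rG F(1) by blast
      then show "lint (\<lambda>x. indicator \<Omega> x * ((bump p (r p) x)\<^sup>2 * (norm (jac_vec (Du x)))\<^sup>2)) \<le> G p * I"
        using u bc unfolding good_def I_def by blast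
    qed
    finally have J: "J \<le> (\<Sum>p\<in>F. G p) / m * I"
      unfolding sum_distrib_right[symmetric] using m by (simp add: field_simps)
    have "W12_norm_sq \<Omega> u Du = integral \<Omega> (\<lambda>x. (norm (u x))\<^sup>2 + (norm (jac_vec (Du x)))\<^sup>2)"
      unfolding W12_norm_sq_def norm_sq_jac_vec ..
    also have "\<dots> = lint (\<lambda>x. indicator \<Omega> x * ((norm (u x))\<^sup>2 + (norm (jac_vec (Du x)))\<^sup>2))"
      by (rule integral_bounded_domain[OF Om assms(5)]) (intro continuous_intros cu cj)
    also have "\<dots> = lint (\<lambda>x. indicator \<Omega> x * (norm (u x))\<^sup>2) + J"
      unfolding J_def distrib_left by (rule Bochner_Integration.integral_add) (intro bdd_supp_integrable bu bj)+
    also have "lint (\<lambda>x. indicator \<Omega> x * (norm (u x))\<^sup>2) \<le> I" unfolding I_def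
      by (intro integral_mono bdd_supp_integrable bu be mult_left_mono) (auto simp: energy_def)
    also have "I + J \<le> C * I" using J unfolding C_def by (simp add: algebra_simps)
    also have "I = integral \<Omega> (\<lambda>x. (norm (diffop A (Du x)))\<^sup>2 + (norm (diffop B (Du x)))\<^sup>2 + (norm (u x))\<^sup>2)"
      using integral_bounded_domain[OF Om assms(5) ce] unfolding I_def energy_def by simp
    finally show "W12_norm_sq \<Omega> u Du \<le> C * integral \<Omega> (\<lambda>x. (norm (diffop A (Du x)))\<^sup>2
               + (norm (diffop B (Du x)))\<^sup>2 + (norm (u x))\<^sup>2)" by simp
  qed
qed

end
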